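(* Let $C$ be a complete integral curve of arithmetic genus $g\ge2$ over an algebraically closed field $k$; let $C'\subset\mathbb P^{g-1}$ be its canonical model, $d'$ the degree of $C'$, and $g'$ the arithmetic genus of $C'$. (1) The model $C'$ is linearly normal iff it is projectively normal. (2) If $C$ is Gorenstein, then $C'$ is linearly normal. (3) If $C$ is not Gorenstein, then $h^1(\mathcal O_{C'}(l))=0$ for $l\ge1$; furthermore, then $C'$ is linearly normal iff $d'=g+g'-1$.
   Context: The field $k$ has arbitrary characteristic. $\omega$ is the dualizing sheaf of $C$; $C$ is Gorenstein iff $\omega$ is invertible. $h^i:=\dim_kH^i$. Canonical model: let $\nu\colon\bar C\to C$ be the normalization and $\mathcal O_{\bar C}\omega:=\nu^*\omega/\mathrm{Torsion}(\nu^*\omega)$. The $g$-dimensional space $H^0(\omega)$ generates $\omega$, so $\mathcal O_{\bar C}\omega$ is invertible and generated by $H^0(\omega)$; this defines a nondegenerate map $\bar\kappa\colon\bar C\to\mathbb P^{g-1}$, whose image is the canonical model $C'$. Linearly normal: $C'$ is linearly normal if the linear series of hyperplane sections is complete; in other words, $h^0(\mathcal O_{C'}(1))=g$. Projectively normal: the linear series of hypersurface sections of degree $n$ is complete for every $n\ge1$; in other words, the natural map $\mathrm{Sym}^nH^0(\omega)\to H^0(\mathcal O_{C'}(n))$ is surjective for every $n\ge1$. *)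

theory Defs
  imports
    Complex_Main
    "HOL-Library.Function_Algebras"
    "HOL-Library.Extended_Nat"
    "HOL-Computational_Algebra.Polynomial"
begin

text \<open>
  Integral schemes are presented in the manner of Zariski and Chevalley (EGA I, section 8): an
  integral separated scheme \<open>X\<close> of finite type over \<open>k\<close> with function field \<open>K\<close> is the set of its
  local rings, viewed as subrings of \<open>K\<close>. A point of \<open>X\<close> is its local ring, the generic point is
  \<open>K\<close> itself, and \<open>Q \<subseteq> P\<close> means that \<open>Q\<close> is a specialization of \<open>P\<close>.

  The ground field is the type \<open>'k\<close>, embedded in the field \<open>'K\<close> by \<open>\<iota>\<close>. A torsion-free sheaf
  is embedded in the constant sheaf of its generic stalk, and is presented as the family
  \<open>F\<close> of its stalks inside the generic stalk; its sections over \<open>U\<close> are the intersection of the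
  \<open>F P\<close> for \<open>P\<close> in \<open>U\<close>. In particular the structure sheaf is the family \<open>\<lambda>P. P\<close>.
\<close>

definition field_embedding :: "('k::field \<Rightarrow> 'K::field) \<Rightarrow> bool" where
  "field_embedding \<iota> \<longleftrightarrow>
     \<iota> 1 = 1 \<and> (\<forall>a b. \<iota> (a + b) = \<iota> a + \<iota> b) \<and> (\<forall>a b. \<iota> (a * b) = \<iota> a * \<iota> b)"


subsection \<open>Linear algebra\<close>

text \<open>\<open>quot_dim s U W\<close> is the dimension, possibly infinite, of \<open>U / W\<close> for subspaces \<open>W \<subseteq> U\<close> and
  scalar multiplication \<open>s\<close>: the supremum of the sizes of finite families in \<open>U\<close> that are
  linearly independent modulo \<open>W\<close>.\<close>

definition quot_dim ::
  "('k::field \<Rightarrow> 'v::ab_group_add \<Rightarrow> 'v) \<Rightarrow> 'v set \<Rightarrow> 'v set \<Rightarrow> enat" where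
  "quot_dim s U W =
     (SUP B \<in> {B. finite B \<and> B \<subseteq> U \<and>
                 (\<forall>a. (\<Sum>b\<in>B. s (a b) b) \<in> W \<longrightarrow> (\<forall>b\<in>B. a b = 0))}. enat (card B))"

definition lin_span :: "('K::field \<Rightarrow> 'v::ab_group_add \<Rightarrow> 'v) \<Rightarrow> 'K set \<Rightarrow> 'v set \<Rightarrow> 'v set" where
  "lin_span s R S = {\<Sum>x\<in>T. s (a x) x | T a. finite T \<and> T \<subseteq> S \<and> (\<forall>x\<in>T. a x \<in> R)}"

definition vec_scale :: "'K::field \<Rightarrow> (nat \<Rightarrow> 'K) \<Rightarrow> nat \<Rightarrow> 'K" where
  "vec_scale c x = (\<lambda>i. c * x i)"

definition vec_space :: "nat \<Rightarrow> (nat \<Rightarrow> 'K::field) set" where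
  "vec_space n = {x. \<forall>i\<ge>n. x i = 0}"


subsection \<open>Subrings of the function field\<close>

definition is_subring :: "'K::field set \<Rightarrow> bool" where
  "is_subring A \<longleftrightarrow> 1 \<in> A \<and> (\<forall>x\<in>A. \<forall>y\<in>A. x - y \<in> A \<and> x * y \<in> A)"

definition alg_gen :: "('k::field \<Rightarrow> 'K::field) \<Rightarrow> 'K set \<Rightarrow> 'K set" where
  "alg_gen \<iota> S = \<Inter>{A. is_subring A \<and> range \<iota> \<subseteq> A \<and> S \<subseteq> A}"

definition frac_field :: "'K::field set \<Rightarrow> 'K set" where
  "frac_field A = {a / b | a b. a \<in> A \<and> b \<in> A \<and> b \<noteq> 0}"

definition prime_ideal :: "'K::field set \<Rightarrow> 'K set \<Rightarrow> bool" where
  "prime_ideal A p \<longleftrightarrow>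
     p \<subseteq> A \<and> 0 \<in> p \<and> 1 \<notin> p \<and> (\<forall>x\<in>p. \<forall>y\<in>p. x + y \<in> p) \<and> (\<forall>a\<in>A. \<forall>x\<in>p. a * x \<in> p) \<and>
     (\<forall>a\<in>A. \<forall>b\<in>A. a * b \<in> p \<longrightarrow> a \<in> p \<or> b \<in> p)"

definition localization :: "'K::field set \<Rightarrow> 'K set \<Rightarrow> 'K set" where
  "localization A p = {a / b | a b. a \<in> A \<and> b \<in> A \<and> b \<notin> p}"

definition Spec :: "'K::field set \<Rightarrow> 'K set set" where
  "Spec A = {localization A p | p. prime_ideal A p}"

definition integral_closure :: "'K::field set \<Rightarrow> 'K set" where
  "integral_closure A = {x. \<exists>p. lead_coeff p = 1 \<and> (\<forall>i. coeff p i \<in> A) \<and> poly p x = 0}"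

text \<open>The set of nonunits, which is the maximal ideal when the ring is local.\<close>

definition nonunits :: "'K::field set \<Rightarrow> 'K set" where
  "nonunits R = {x \<in> R. x = 0 \<or> inverse x \<notin> R}"

definition dominates :: "'K::field set \<Rightarrow> 'K set \<Rightarrow> bool" where
  "dominates V P \<longleftrightarrow> P \<subseteq> V \<and> nonunits P = nonunits V \<inter> P"

definition valuation_ring :: "'K::field set \<Rightarrow> bool" where
  "valuation_ring V \<longleftrightarrow> is_subring V \<and> (\<forall>x. x \<in> V \<or> inverse x \<in> V)"


subsection \<open>Complete integral curves\<close>

text \<open>The first condition gives a finite cover by affine charts, spectra of finitely generated
  \<open>k\<close>-algebras with fraction field \<open>K\<close>. The second is the valuative criterion, uniqueness
  giving separatedness and existence giving completeness; the trivial valuation ring \<open>K\<close> is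
  allowed, and dominates only the generic point.\<close>

definition complete_integral_scheme :: "('k::field \<Rightarrow> 'K::field) \<Rightarrow> 'K set set \<Rightarrow> bool" where
  "complete_integral_scheme \<iota> X \<longleftrightarrow>
     (\<exists>\<T>. finite \<T> \<and> \<T> \<noteq> {} \<and>
        (\<forall>T\<in>\<T>. finite T \<and> frac_field (alg_gen \<iota> T) = UNIV) \<and>
        X = (\<Union>T\<in>\<T>. Spec (alg_gen \<iota> T))) \<and>
     (\<forall>V. valuation_ring V \<and> range \<iota> \<subseteq> V \<longrightarrow> (\<exists>!P. P \<in> X \<and> dominates V P))"

definition complete_integral_curve :: "('k::field \<Rightarrow> 'K::field) \<Rightarrow> 'K set set \<Rightarrow> bool" where
  "complete_integral_curve \<iota> X \<longleftrightarrow>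
     complete_integral_scheme \<iota> X \<and>
     (\<exists>P\<in>X. P \<noteq> UNIV) \<and> (\<forall>P\<in>X. \<forall>Q\<in>X. Q \<subset> P \<longrightarrow> P = UNIV)"

definition closed_points :: "'K::field set set \<Rightarrow> 'K set set" where
  "closed_points X = {P \<in> X. \<forall>Q\<in>X. \<not> Q \<subset> P}"

text \<open>The largest local ring, which is the function field.\<close>

definition generic_point :: "'K::field set set \<Rightarrow> 'K set" where
  "generic_point X = \<Union>X"


subsection \<open>Torsion-free sheaves and their cohomology\<close>

text \<open>The sets \<open>{Q \<in> X. T \<subseteq> Q}\<close> with \<open>T\<close> finite form a base of the Zariski topology. So a
  coherent family is one that is generated by finitely many sections near every point, and an
  invertible one is free of rank one near every point.\<close>

definition coherent ::
  "('K::field \<Rightarrow> 'v::ab_group_add \<Rightarrow> 'v) \<Rightarrow> 'K set set \<Rightarrow> ('K set \<Rightarrow> 'v set) \<Rightarrow> bool" where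
  "coherent s X F \<longleftrightarrow>
     (\<forall>P\<in>X. \<exists>T S. finite T \<and> T \<subseteq> P \<and> finite S \<and> (\<forall>Q\<in>X. T \<subseteq> Q \<longrightarrow> F Q = lin_span s Q S))"

definition invertible :: "'K::field set set \<Rightarrow> ('K set \<Rightarrow> 'K set) \<Rightarrow> bool" where
  "invertible X F \<longleftrightarrow>
     (\<forall>P\<in>X. \<exists>T w. finite T \<and> T \<subseteq> P \<and> w \<noteq> 0 \<and> (\<forall>Q\<in>X. T \<subseteq> Q \<longrightarrow> F Q = (\<lambda>x. x * w) ` Q))"

definition H0 :: "'K::field set set \<Rightarrow> ('K set \<Rightarrow> 'v::ab_group_add set) \<Rightarrow> 'v set" where
  "H0 X F = (\<Inter>P\<in>X. F P)"

text \<open>On a curve, a coherent \<open>F\<close> with generic stalk \<open>M\<close> has the flasque resolution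
  \<open>0 \<rightarrow> F \<rightarrow> M \<rightarrow> \<Oplus>\<^sub>P M / F P \<rightarrow> 0\<close>, where \<open>P\<close> runs over the closed points and the summands are
  skyscraper sheaves. So \<open>H\<^sup>1(F)\<close> is the cokernel of \<open>M \<rightarrow> \<Oplus>\<^sub>P M / F P\<close>, namely
  \<open>adeles X F / coboundaries X F\<close>.\<close>

definition adeles ::
  "'K::field set set \<Rightarrow> ('K set \<Rightarrow> 'v::ab_group_add set) \<Rightarrow> ('K set \<Rightarrow> 'v) set" where
  "adeles X F =
     {r. (\<forall>P. P \<notin> closed_points X \<longrightarrow> r P = 0) \<and>
         (\<forall>P\<in>closed_points X. r P \<in> F (generic_point X)) \<and>
         finite {P \<in> closed_points X. r P \<notin> F P}}"

definition coboundaries ::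
  "'K::field set set \<Rightarrow> ('K set \<Rightarrow> 'v::ab_group_add set) \<Rightarrow> ('K set \<Rightarrow> 'v) set" where
  "coboundaries X F =
     {r \<in> adeles X F. \<exists>m\<in>F (generic_point X). \<forall>P\<in>closed_points X. r P - m \<in> F P}"

definition h0 ::
  "('k::field \<Rightarrow> 'K::field) \<Rightarrow> 'K set set \<Rightarrow> ('K set \<Rightarrow> 'K set) \<Rightarrow> enat" where
  "h0 \<iota> X F = quot_dim (\<lambda>c x. \<iota> c * x) (H0 X F) {0}"

definition h1 ::
  "('k::field \<Rightarrow> 'K::field) \<Rightarrow> 'K set set \<Rightarrow> ('K set \<Rightarrow> 'K set) \<Rightarrow> enat" where
  "h1 \<iota> X F = quot_dim (\<lambda>c r P. \<iota> c * r P) (adeles X F) (coboundaries X F)"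

text \<open>This is \<open>h\<^sup>1(O\<^sub>X)\<close>.\<close>

definition arithmetic_genus :: "('k::field \<Rightarrow> 'K::field) \<Rightarrow> 'K set set \<Rightarrow> enat" where
  "arithmetic_genus \<iota> X = h1 \<iota> X (\<lambda>P. P)"


subsection \<open>The dualizing sheaf\<close>

text \<open>Linear functionals on \<open>H\<^sup>1(F)\<close>, lifted to the adeles.\<close>

definition H1_functional ::
  "('k::field \<Rightarrow> 'v::ab_group_add \<Rightarrow> 'v) \<Rightarrow> 'K::field set set \<Rightarrow> ('K set \<Rightarrow> 'v set) \<Rightarrow>
   (('K set \<Rightarrow> 'v) \<Rightarrow> 'k) \<Rightarrow> bool" where
  "H1_functional s X F \<phi> \<longleftrightarrow>
     (\<forall>r\<in>adeles X F. \<forall>r'\<in>adeles X F. \<phi> (\<lambda>P. r P + r' P) = \<phi> r + \<phi> r') \<and>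
     (\<forall>c. \<forall>r\<in>adeles X F. \<phi> (\<lambda>P. s c (r P)) = c * \<phi> r) \<and>
     (\<forall>r\<in>coboundaries X F. \<phi> r = 0)"

text \<open>The \<open>K\<close>-linear map \<open>K\<^sup>n \<rightarrow> K\<close> with coefficients \<open>c\<close>.\<close>

definition lin_form :: "nat \<Rightarrow> (nat \<Rightarrow> 'K::field) \<Rightarrow> (nat \<Rightarrow> 'K) \<Rightarrow> 'K" where
  "lin_form n c x = (\<Sum>i<n. c i * x i)"

definition sheaf_Hom ::
  "'K::field set set \<Rightarrow> nat \<Rightarrow> ('K set \<Rightarrow> (nat \<Rightarrow> 'K) set) \<Rightarrow> ('K set \<Rightarrow> 'K set) \<Rightarrow>
   (nat \<Rightarrow> 'K) set" where
  "sheaf_Hom X n F G = {c \<in> vec_space n. \<forall>P\<in>X. lin_form n c ` F P \<subseteq> G P}"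

text \<open>A dualizing sheaf on an integral curve is torsion-free of rank one, so it may be embedded
  in \<open>K\<close> with generic stalk \<open>K\<close>. It is defined by the requirement that it has a trace
  \<open>t : H\<^sup>1(\<omega>) \<rightarrow> k\<close> such that the induced map \<open>Hom(F, \<omega>) \<rightarrow> H\<^sup>1(F)\<^sup>*\<close> is bijective for every
  coherent \<open>F\<close>. It suffices to let \<open>F\<close> run over the torsion-free sheaves, of all ranks \<open>n\<close>,
  embedded in \<open>K\<^sup>n\<close>, because both sides do not change when the torsion of \<open>F\<close> is divided out.\<close>

definition dualizing_sheaf ::
  "('k::field \<Rightarrow> 'K::field) \<Rightarrow> 'K set set \<Rightarrow> ('K set \<Rightarrow> 'K set) \<Rightarrow> bool" where
  "dualizing_sheaf \<iota> X \<omega> \<longleftrightarrow>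
     coherent (*) X \<omega> \<and> \<omega> (generic_point X) = UNIV \<and>
     (\<exists>t. H1_functional (\<lambda>c x. \<iota> c * x) X \<omega> t \<and>
        (\<forall>n F \<phi>. coherent vec_scale X F \<and> F (generic_point X) = vec_space n \<and>
            H1_functional (\<lambda>c. vec_scale (\<iota> c)) X F \<phi> \<longrightarrow>
            (\<exists>!c. c \<in> sheaf_Hom X n F \<omega> \<and>
                  (\<forall>r\<in>adeles X F. \<phi> r = t (\<lambda>P. lin_form n c (r P))))))"

definition gorenstein :: "'K::field set set \<Rightarrow> ('K set \<Rightarrow> 'K set) \<Rightarrow> bool" where
  "gorenstein X \<omega> \<longleftrightarrow> invertible X \<omega>"


subsection \<open>The canonical model\<close>

definition normalization :: "'K::field set set \<Rightarrow> 'K set set" where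
  "normalization X = (\<Union>P\<in>X. Spec (integral_closure P))"

definition normalization_map :: "'K::field set set \<Rightarrow> 'K set \<Rightarrow> 'K set" where
  "normalization_map X Q = (THE P. P \<in> X \<and> dominates Q P)"

text \<open>The pullback of \<open>F\<close> to the normalization, modulo torsion.\<close>

definition normalization_pullback ::
  "'K::field set set \<Rightarrow> ('K set \<Rightarrow> 'K set) \<Rightarrow> 'K set \<Rightarrow> 'K set" where
  "normalization_pullback X F Q = lin_span (*) Q (F (normalization_map X Q))"

text \<open>Write \<open>V = H\<^sup>0(\<omega>)\<close>, a space of dimension \<open>g\<close>. The image in \<open>\<P>\<^sup>g\<^sup>-\<^sup>1\<close> of a point \<open>Q\<close> of the
  normalization lies in the affine chart of \<open>v \<in> V\<close> exactly when \<open>v\<close> generates the pullback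
  of \<open>\<omega>\<close> at \<open>Q\<close>. The coordinate ring of this chart of the image curve is the algebra
  generated by the ratios \<open>w / v\<close> with \<open>w \<in> V\<close>, and the image of \<open>Q\<close> is the prime ideal of
  functions in it that vanish at \<open>Q\<close>. The local rings obtained lie in the function field of the
  image, which may be a proper subfield of \<open>K\<close> (as when \<open>C\<close> is hyperelliptic).\<close>

definition canonical_model ::
  "('k::field \<Rightarrow> 'K::field) \<Rightarrow> 'K set set \<Rightarrow> ('K set \<Rightarrow> 'K set) \<Rightarrow> 'K set set" where
  "canonical_model \<iota> X \<omega> =
     {localization A (A \<inter> nonunits Q) | A Q v.
        Q \<in> normalization X \<and> v \<in> H0 X \<omega> \<and> v \<noteq> 0 \<and>
        normalization_pullback X \<omega> Q = (\<lambda>x. x * v) ` Q \<and>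
        A = alg_gen \<iota> ((\<lambda>w. w / v) ` H0 X \<omega>)}"

definition power_products :: "'K::field set \<Rightarrow> nat \<Rightarrow> 'K set" where
  "power_products V n = {\<Prod>i<n. f i | f. \<forall>i<n. f i \<in> V}"

text \<open>The image of \<open>Sym\<^sup>n V\<close> in \<open>K\<close> (with \<open>V \<subseteq> K\<close>, products of \<open>n\<close> factors from \<open>V\<close> are
  formed in \<open>K\<close>). As the forms that vanish on the image curve are the kernel, this is also the
  degree \<open>n\<close> part of its homogeneous coordinate ring.\<close>

definition coord_ring_part :: "('k::field \<Rightarrow> 'K::field) \<Rightarrow> 'K set \<Rightarrow> nat \<Rightarrow> 'K set" where
  "coord_ring_part \<iota> V n = lin_span (*) (range \<iota>) (power_products V n)"

text \<open>The sheaf \<open>O(n)\<close> on a curve in the projective space with space of linear forms \<open>V\<close>: its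
  stalks are generated by the forms of degree \<open>n\<close>.\<close>

definition twisting_sheaf :: "'K::field set \<Rightarrow> nat \<Rightarrow> 'K set \<Rightarrow> 'K set" where
  "twisting_sheaf V n R = lin_span (*) R (power_products V n)"

text \<open>The degree of a curve in projective space is the leading coefficient of its Hilbert
  polynomial.\<close>

definition projective_degree :: "('k::field \<Rightarrow> 'K::field) \<Rightarrow> 'K set \<Rightarrow> nat" where
  "projective_degree \<iota> V =
     (THE d. \<exists>c::int. eventually
        (\<lambda>n. \<exists>m. quot_dim (\<lambda>a x. \<iota> a * x) (coord_ring_part \<iota> V n) {0} = enat m \<and>
                 int m = int d * int n + c) sequentially)"

definition linearly_normal ::
  "('k::field \<Rightarrow> 'K::field) \<Rightarrow> 'K set set \<Rightarrow> ('K set \<Rightarrow> 'K set) \<Rightarrow> bool" where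
  "linearly_normal \<iota> X \<omega> \<longleftrightarrow>
     h0 \<iota> (canonical_model \<iota> X \<omega>) (twisting_sheaf (H0 X \<omega>) 1) = arithmetic_genus \<iota> X"

definition projectively_normal ::
  "('k::field \<Rightarrow> 'K::field) \<Rightarrow> 'K set set \<Rightarrow> ('K set \<Rightarrow> 'K set) \<Rightarrow> bool" where
  "projectively_normal \<iota> X \<omega> \<longleftrightarrow>
     (\<forall>n\<ge>1. coord_ring_part \<iota> (H0 X \<omega>) n =
             H0 (canonical_model \<iota> X \<omega>) (twisting_sheaf (H0 X \<omega>) n))"

end

theory Submission
 imports Defs "HOL-Library.FuncSet" "HOL-Library.Product_Plus"
begin

text \<open>Write k for the ground field, V for H0(C, \<omega>), C' for the canonical model, d' and g' for its degree and
genus. Cohomology is computed with adeles: for families F \<subseteq> G of stalks that differ at finitely many points,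
Euler characteristics differ by the sum of the local dimensions of G P / F P. The other tool is the set of valuation
rings of K over k, the points of the normalization.

Duality on C, applied to lattices of rank one, gives dim V = g and degree 2 g - 2 for \<omega>, and shows that V generates
\<omega> at every point. Hence C' consists of the local rings \<open>RW W\<close> that V defines below the valuation rings W. This
construction makes sense for every finite-dimensional V \<subseteq> K of dimension at least two (locale \<open>linsys\<close>), and for
it we have the Riemann-Roch formula h0(O(n)) + g' = 1 + n d' + h1(O(n)) and Clifford's inequality h0 + h1 \<le> g' + 1
for special families containing the structure sheaf. The latter combines the fact that the functionals on H1 form, in
the limit, a space of dimension one over the function field of C' with Hopf's inequality dim AB \<ge> dim A + dim B - 1.

Suppose that C is not Gorenstein. Comparing \<omega> with a principal module over a finite extension of the local ring at a
point where \<omega> is not principal gives d' \<le> 2 g - 3. As h0(O(1)) \<ge> g, Clifford's inequality and Riemann-Roch exclude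
h1(O(1)) \<noteq> 0. So h1(O(l)) = 0 for l \<ge> 1, and h0(O(1)) = 1 + d' - g', which is the last equivalence. If C' is linearly
normal, then g' + 2 \<le> g, and V V fills H0(C', O(2)): a missing section would define a quadratic form on adeles for which V
is too large an isotropic subspace (\<open>quadratic_normality\<close>); the vanishing of
h1 carries this on to higher degrees.

Suppose that C is Gorenstein. Then H0(C', O(n)) \<subseteq> H0(C, \<omega>^n), and it is enough that V^n fills H0(C, \<omega>^n). If
H0(C, \<omega>^(n+1)) \<noteq> V H0(C, \<omega>^n), then duality yields an adele \<eta>, no coboundary, that all of V multiplies into
coboundaries. Degrees exclude n \<ge> 3 and leave only g = 2 for n = 2; for n = 1, multiplication by \<eta> on V attains
equality in Hopf's inequality. Either way V is spanned by a geometric progression and C' is a rational normal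
curve, for which dimensions can be counted (\<open>rational_normal\<close>). So C' is projectively normal in either case.\<close>

section \<open>Dimensions of quotients\<close>

abbreviation "cpts == closed_points"
abbreviation "nu == nonunits"
abbreviation "cob == coboundaries"
abbreviation "lspan == lin_span (*)"
abbreviation smul :: "'a::times => 'a set => 'a set" (infixr "**" 90) where "c ** N == (%x. c*x) ` N"

definition ecard :: "'a set => enat" where
 "ecard S = (if finite S then enat (card S) else \<infinity>)"

lemma ecard_eqI_subsets:
 assumes "!!B. finite B ==> B <= S ==> enat (card B) <= n"
 shows "ecard S <= n"
proof(cases "finite S")
 case True thus ?thesis using assms by(simp add: ecard_def)
next
 case False
 have "enat m <= n" for m
  using infinite_arbitrarily_large[OF False, of m] assms by metis
 hence "n = \<infinity>" by(metis enat_ord_simps(1) not_less_eq_eq not_infinity_eq order_refl)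
 thus ?thesis by simp
qed

lemma ecard_disjoint_union:
 "A Int B = {} ==> ecard (A Un B) = ecard A + ecard B"
 by(auto simp: ecard_def card_Un_disjoint)

locale vspace = vector_space scale
 for scale :: "'a::field => 'b::ab_group_add => 'b"
begin

abbreviation "qd == quot_dim scale"

definition indep_mod :: "'b set => 'b set => bool" where
 "indep_mod W B \<longleftrightarrow> (ALL a. (SUM b:B. scale (a b) b):W --> (ALL b:B. a b = 0))"

lemma qd_alt: "qd U W = (SUP B\<in>{B. finite B & B <= U & indep_mod W B}. enat (card B))"
 unfolding quot_dim_def indep_mod_def ..

lemma qd_geI: "finite B ==> B <= U ==> indep_mod W B ==> enat (card B) <= qd U W"
 unfolding qd_alt by(rule SUP_upper) auto

lemma qd_leI: "(!!B. finite B ==> B <= U ==> indep_mod W B ==> enat (card B) <= n) ==> qd U W <= n"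
 unfolding qd_alt by(rule SUP_least) auto

lemma qd_mono: "U <= U' ==> W' <= W ==> qd U W <= qd U' W'"
 by(rule qd_leI, rule qd_geI) (auto simp: indep_mod_def)

lemma indep_mod_basis_diff:
 assumes ind: "independent BU" and sub: "BW <= BU" and B: "finite B" "B <= BU - BW"
 shows "indep_mod (span BW) B"
 unfolding indep_mod_def
proof(intro allI impI ballI, rule ccontr)
 fix a b assume s: "(SUM b:B. scale (a b) b):span BW" and b: "b:B" and nz: "a b ~= 0"
 have eq: "(SUM b:B. scale (a b) b) = scale (a b) b + (SUM x:B - {b}. scale (a x) x)"
  using B(1) b by(simp add: sum.remove)
 have 1: "(SUM x:B - {b}. scale (a x) x):span (BU - {b})"
  by(intro span_sum span_scale span_base) (use B in auto)
 have 2: "(SUM b:B. scale (a b) b):span (BU - {b})"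
  using s span_mono[of BW "BU - {b}"] B b sub by blast
 have "scale (a b) b:span (BU - {b})"
  using span_diff[OF 2 1] eq by simp
 hence "b:span (BU - {b})"
  using nz span_scale[of "scale (a b) b" "BU - {b}" "inverse (a b)"] by simp
 thus False using ind b B by(auto simp: dependent_def)
qed

lemma indep_mod_single:
 assumes "subspace W" "x ~: W" shows "indep_mod W {x}"
 unfolding indep_mod_def
proof(intro allI impI ballI, rule ccontr)
 fix a b assume a: "(SUM b:{x}. scale (a b) b):W" "b:{x}" "a b ~= 0"
 hence "scale (inverse (a x)) (scale (a x) x):W" using subspace_scale[OF assms(1), of "scale (a x) x" "inverse (a x)"] by auto
 thus False using a assms by simp
qed

lemma subspace_ker_on:
 assumes "subspace U" "!!x y. x:U ==> y:U ==> f (x + y) = f x + (f y :: 'a)"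
  "!!c x. x:U ==> f (scale c x) = c*f x"
 shows "subspace {u:U. f u = 0}"
proof(rule subspaceI)
 have "f (scale 0 0) = 0*f 0" using assms subspace_0 by blast
 thus "0:{u:U. f u = 0}" using assms subspace_0 by simp
qed (use assms in "auto intro: subspace_add subspace_scale")

lemma basis_extension:
 assumes "subspace U" "independent BW" "BW <= U"
 obtains BU where "BW <= BU" "independent BU" "span BU = U"
proof -
 obtain B where B: "BW <= B" "B <= U" "independent B" "U <= span B"
  using maximal_independent_subset_extend assms by metis
 hence "span B = U" using assms by(simp add: span_subspace)
 with B that show ?thesis by blast
qed

lemma independent_Un:
 "finite B ==> indep_mod (span A) B ==> independent A ==> independent (A Un B) & A Int B = {}"
proof(induction B rule: finite_induct)
 case (insert b B)
 have "b ~: span (A Un B)"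
 proof
  assume "b:span (A Un B)"
  then obtain w y where wy: "w:span A" "y:span B" "b = w + y" unfolding span_Un by blast
  obtain a where a: "y = (SUM x:B. scale (a x) x)" using wy(2) span_finite[OF insert(1)] by auto
  have "(SUM x:insert b B. scale (if x = b then 1 else - a x) x) = b + (SUM x:B. scale (- a x) x)"
   using insert(1,2) by(auto intro!: sum.cong)
  also have "... = w" using wy(3) by(simp add: a sum_negf)
  finally show False using insert.prems(1)[unfolded indep_mod_def, THEN spec, of "%x. if x = b then 1 else - a x"] wy(1) by simp
 qed
 moreover have "indep_mod (span A) B" unfolding indep_mod_def
 proof(intro allI impI)
  fix a assume "(SUM x:B. scale (a x) x):span A"
  moreover have "(SUM x:insert b B. scale ((a(b := 0)) x) x) = (SUM x:B. scale (a x) x)"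
   using insert(1,2) by(auto intro!: sum.cong)
  ultimately have "ALL x:insert b B. (a(b := 0)) x = 0"
   using insert.prems(1)[unfolded indep_mod_def, THEN spec, of "a(b := 0)"] by simp
  thus "ALL x:B. a x = 0" using insert(2) by(auto split: if_splits)
 qed
 ultimately show ?case using insert.IH insert.prems span_base[of b "A Un B"] by(auto simp: independent_insert)
qed simp

lemma finite_support: "finite B ==> B <= span A ==> EX F. finite F & F <= A & B <= span F"
proof(induction B rule: finite_induct)
 case (insert b B)
 then obtain F where F: "finite F" "F <= A" "B <= span F" by blast
 from insert.prems obtain t a where t: "b = (SUM x:t. scale (a x) x)" "finite t" "t <= A" unfolding span_explicit[of A] by blast
 have "b:span t" unfolding t(1) by(intro span_sum span_scale span_base)
 with F t(2,3) show ?case using span_mono[of F "F Un t"] span_mono[of t "F Un t"] by(intro exI[of _ "F Un t"]) auto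
qed auto

lemma qd_basis:
 assumes ind: "independent BU" and sub: "BW <= BU"
 shows "qd (span BU) (span BW) = ecard (BU - BW)"
proof(rule antisym)
 show "ecard (BU - BW) <= qd (span BU) (span BW)"
 proof(rule ecard_eqI_subsets)
  fix B assume B: "finite B" "B <= BU - BW"
  show "enat (card B) <= qd (span BU) (span BW)"
   by(rule qd_geI[OF B(1) _ indep_mod_basis_diff[OF ind sub B]]) (use B(2) span_superset in blast)
 qed
 show "qd (span BU) (span BW) <= ecard (BU - BW)"
 proof(cases "finite (BU - BW)")
  case False thus ?thesis by(simp add: ecard_def)
 next
  case True
  show ?thesis
  proof(rule qd_leI)
   fix B assume B: "finite B" "B <= span BU" "indep_mod (span BW) B"
   obtain F where F: "finite F" "F <= BU" "B <= span F" using finite_support[OF B(1,2)] by blast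
   let ?W = "F Int BW" and ?N = "BU - BW"
   have "span ?W <= span BW" by(rule span_mono) blast
   hence im: "indep_mod (span ?W) B" using B(3) by(auto simp: indep_mod_def)
   have iW: "independent ?W" by(rule independent_mono[OF ind]) (use F(2) in blast)
   note iu = independent_Un[OF B(1) im iW, THEN conjunct1] independent_Un[OF B(1) im iW, THEN conjunct2]
   have "F <= ?W Un ?N" using F(2) by blast
   hence "?W Un B <= span (?W Un ?N)" using F(3) span_mono[of F "?W Un ?N"] span_superset[of "?W Un ?N"] by blast
   hence "card (?W Un B) <= card (?W Un ?N)" using independent_span_bound[OF _ iu(1), of "?W Un ?N"] F(1) True by simp
   also have "... <= card ?W + card ?N" by(rule card_Un_le)
   finally show "enat (card B) <= ecard ?N" using card_Un_disjoint[of ?W B] F(1) B(1) iu(2) True by(simp add: ecard_def)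
  qed
 qed
qed

lemma qd_add:
 assumes "subspace W" "subspace U" "subspace T" "W <= U" "U <= T"
 shows "qd T W = qd T U + qd U W"
proof -
 obtain BW where BW: "independent BW" "span BW = W"
  using basis_extension[OF assms(1) independent_empty] by auto
 obtain BU where BU: "BW <= BU" "independent BU" "span BU = U"
  using basis_extension[OF assms(2) BW(1)] BW assms(4) span_superset by(metis subset_trans)
 obtain BT where BT: "BU <= BT" "independent BT" "span BT = T"
  using basis_extension[OF assms(3) BU(2)] BU assms(5) span_superset by(metis subset_trans)
 have "qd T W = ecard (BT - BW)" "qd T U = ecard (BT - BU)" "qd U W = ecard (BU - BW)"
  using qd_basis[OF BT(2), of BW] qd_basis[OF BT(2), of BU] qd_basis[OF BU(2), of BW] BW BU BT by auto
 moreover have "BT - BW = (BT - BU) Un (BU - BW)" "(BT - BU) Int (BU - BW) = {}"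
  using BU BT by auto
 ultimately show ?thesis by(simp add: ecard_disjoint_union)
qed

lemma qd_fin_spanning:
 assumes "subspace W" "subspace U" "W <= U" "qd U W = enat n"
 obtains B where "finite B" "card B = n" "B <= U" "indep_mod W B"
  "!!x. x:U ==> EX a. x - (SUM b:B. scale (a b) b):W"
proof -
 obtain BW where BW: "independent BW" "span BW = W"
  using basis_extension[OF assms(1) independent_empty] by auto
 obtain BU where BU: "BW <= BU" "independent BU" "span BU = U"
  using basis_extension[OF assms(2) BW(1)] BW assms(3) span_superset by(metis subset_trans)
 let ?B = "BU - BW"
 have e: "ecard ?B = enat n" using qd_basis[OF BU(2,1)] BW BU assms by simp
 hence f: "finite ?B" and c: "card ?B = n" by(auto simp: ecard_def split: if_splits)
 have 1: "?B <= U" using BU span_superset by blast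
 have 2: "indep_mod W ?B" using indep_mod_basis_diff[OF BU(2,1) f] BW by simp
 have 3: "EX a. x - (SUM b:?B. scale (a b) b):W" if xU: "x:U" for x
 proof -
  have "U = span (BW Un ?B)" using BU by(simp add: Un_absorb1)
  hence "U = {x + y |x y. x:span BW & y:span ?B}" using span_Un[of BW ?B] by(simp only:)
  then obtain w y where wy: "w:span BW" "y:span ?B" "x = w + y"
   using xU by auto
  from wy(2) obtain a where "y = (SUM b:?B. scale (a b) b)"
   using span_finite[OF f] by auto
  thus ?thesis using wy BW by(intro exI[of _ a]) auto
 qed
 show ?thesis using that[OF f c 1 2 3] .
qed

lemma qd_eq_0:
 assumes "subspace W" shows "qd U W = 0 \<longleftrightarrow> U <= W"
proof
 assume z: "qd U W = 0"
 show "U <= W"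
 proof(rule ccontr)
  assume "~ U <= W"
  then obtain x where x: "x:U" "x ~: W" by blast
  have "indep_mod W {x}" by(rule indep_mod_single[OF assms x(2)])
  from qd_geI[OF _ _ this, of U] x z show False by(auto simp: zero_enat_def)
 qed
next
 assume s: "U <= W"
 have "qd U W <= 0"
 proof(rule qd_leI)
  fix B assume B: "finite B" "B <= U" "indep_mod W B"
  have "(SUM b:B. scale 1 b):W"
   by(rule subspace_sum[OF assms]) (use B s in auto)
  hence "ALL b:B. (1::'a) = 0" using B(3) unfolding indep_mod_def by(elim allE[of _ "%_. 1"]) blast
  hence "B = {}" by auto
  thus "enat (card B) <= 0" by(simp add: zero_enat_def)
 qed
 thus "qd U W = 0" by simp
qed

lemma qd_self [simp]: "subspace W ==> qd W W = 0" by(simp add: qd_eq_0)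

text \<open>A linear functional on a subspace, as a function on the whole type.\<close>

definition lin_on :: "'b set => ('b => 'a) => bool" where
 "lin_on U f \<longleftrightarrow> (ALL x:U. ALL y:U. f (x + y) = f x + f y) & (ALL c. ALL x:U. f (scale c x) = c*f x)"

lemma lin_on_sum:
 assumes "lin_on U f" "subspace U" "finite B" "!!b. b:B ==> x b:U"
 shows "f (SUM b:B. scale (a b) (x b)) = (SUM b:B. a b*f (x b))"
 using assms(3,4)
proof(induction B rule: finite_induct)
 case empty
 have "f (scale 0 0) = 0*f 0" using assms subspace_0 unfolding lin_on_def by blast
 thus ?case by simp
next
 case (insert b B)
 have "(SUM b:B. scale (a b) (x b)):U" using insert assms(2) by(intro subspace_sum subspace_scale) auto
 moreover have "scale (a b) (x b):U" using insert assms(2) by(auto intro: subspace_scale)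
 ultimately show ?case using insert assms(1) unfolding lin_on_def by simp
qed

lemma functional_extend:
 assumes "subspace W" "finite B" "indep_mod W B"
 obtains f where "lin_on UNIV f" "!!w. w:W ==> f w = 0" "!!b. b:B ==> f b = c b"
proof -
 obtain BW where BW: "independent BW" "span BW = W"
  using basis_extension[OF assms(1) independent_empty] by auto
 have ind: "independent (BW Un B)" "BW Int B = {}" using independent_Un[OF assms(2) _ BW(1)] assms(3) BW(2) by auto
 interpret vp: vector_space_pair scale "(*) :: 'a => 'a => 'a"
  by unfold_locales (auto simp: algebra_simps)
 obtain g where g: "Vector_Spaces.linear scale (*) g" "!!x. x:BW Un B ==> g x = (if x:BW then 0 else c x)"
  using vp.linear_independent_extend[OF ind(1), of "%x. if x:BW then 0 else c x"] by blast
 have 1: "lin_on UNIV g" using g(1) unfolding lin_on_def Vector_Spaces.linear_iff by blast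
 have 2: "g w = 0" if "w:W" for w
  using vp.linear_eq_0_on_span[OF g(1), of BW w] g(2) that BW by auto
 have 3: "g b = c b" if "b:B" for b using g(2)[of b] that ind(2) by(auto simp: disjoint_iff)
 show ?thesis by(rule that[OF 1 2 3])
qed

lemma functional_separate:
 assumes "subspace W" "x ~: W"
 obtains f where "lin_on UNIV f" "!!w. w:W ==> f w = 0" "f x = 1"
proof -
 have "indep_mod W {x}" by(rule indep_mod_single[OF assms])
 from functional_extend[OF assms(1) _ this, of "%_. 1"] that show ?thesis by auto
qed

lemma qd_ge_family:
 assumes B: "finite B" "!!b. b:B ==> f b:U" "0:W"
  and ind: "!!a. (SUM b:B. scale (a b) (f b)):W ==> ALL b:B. a b = 0"
 shows "enat (card B) <= qd U W"
proof -
 have inj: "inj_on f B"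
 proof(rule inj_onI, rule ccontr)
  fix x y assume xy: "x:B" "y:B" "f x = f y" "x ~= y"
  define a where "a b = (if b = x then 1 else if b = y then -1 else 0 :: 'a)" for b
  have "(SUM b:B. scale (a b) (f b)) = (SUM b:{x,y}. scale (a b) (f b))"
   by(rule sum.mono_neutral_right) (use B xy in "auto simp: a_def")
  also have "... = 0" using xy by(simp add: a_def)
  finally have "a x = 0" using ind[of a] B(3) xy by simp
  thus False by(simp add: a_def)
 qed
 have "indep_mod W (f ` B)" unfolding indep_mod_def
 proof(intro allI impI ballI)
  fix a x assume "(SUM b:f ` B. scale (a b) b):W" "x:f ` B"
  hence "(SUM b:B. scale (a (f b)) (f b)):W" by(simp add: sum.reindex[OF inj])
  from ind[OF this] \<open>x : f ` B\<close> show "a x = 0" by auto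
 qed
 from qd_geI[OF _ _ this, of U] B(1,2) show ?thesis by(auto simp: card_image[OF inj])
qed

end

lemma qd_le_relation:
 fixes s1 :: "'k::field => 'v::ab_group_add => 'v" and s2 :: "'k => 'w::ab_group_add => 'w"
 assumes v1: "vspace s1" and v2: "vspace s2"
  and f: "!!x. x:U ==> f x:U'"
  and r: "!!B a. finite B ==> B <= U ==> (SUM b:B. s2 (a b) (f b)):W' ==> (SUM b:B. s1 (a b) b):W"
  and zero: "0:W'"
 shows "quot_dim s1 U W <= quot_dim s2 U' W'"
proof -
 interpret v1: vspace s1 by fact
 interpret v2: vspace s2 by fact
 show ?thesis
 proof(rule v1.qd_leI)
  fix B assume B: "finite B" "B <= U" "v1.indep_mod W B"
  show "enat (card B) <= quot_dim s2 U' W'"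
   by(rule v2.qd_ge_family[OF B(1), of f]) (use f zero B r[OF B(1,2)] in "auto simp: v1.indep_mod_def")
 qed
qed

context vspace begin

lemma qd_sum:
 assumes U: "subspace U" and W: "subspace W"
 shows "qd {x + y |x y. x:U & y:W} W = qd U (U Int W)"
proof(rule antisym)
 have v: "vspace scale" by unfold_locales
 define f where "f z = (SOME x. x:U & z - x:W)" for z
 have f: "f z:U & z - f z:W" if "z:{x + y |x y. x:U & y:W}" for z
  unfolding f_def by(rule someI_ex) (use that in auto)
 show "qd {x + y |x y. x:U & y:W} W <= qd U (U Int W)"
 proof(rule qd_le_relation[OF v v, where f=f])
  fix B a assume B: "finite B" "B <= {x + y |x y. x:U & y:W}" "(SUM b:B. scale (a b) (f b)):U Int W"
  have "(SUM b:B. scale (a b) (b - f b)):W" by(intro subspace_sum[OF W] subspace_scale[OF W] f[THEN conjunct2]) (use B(2) in blast)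
  hence "(SUM b:B. scale (a b) (b - f b)) + (SUM b:B. scale (a b) (f b)):W" using B(3) subspace_add[OF W] by blast
  thus "(SUM b:B. scale (a b) b):W" by(simp add: scale_right_diff_distrib sum_subtractf)
 qed (use f subspace_0[OF U] subspace_0[OF W] in auto)
 show "qd U (U Int W) <= qd {x + y |x y. x:U & y:W} W"
 proof(rule qd_le_relation[OF v v, where f="%x. x"])
  fix B a assume B: "finite B" "B <= U" "(SUM b:B. scale (a b) b):W"
  have "(SUM b:B. scale (a b) b):U" using B(2) by(intro subspace_sum[OF U] subspace_scale[OF U]) blast
  thus "(SUM b:B. scale (a b) b):U Int W" using B(3) by blast
 next
  show "x:{x + y |x y. x:U & y:W}" if "x:U" for x using that subspace_0[OF W] by force
 qed (rule subspace_0[OF W])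
qed

lemma qd_codim_functional:
 assumes U: "subspace U" and f: "lin_on U f"
 shows "qd U {u:U. f u = 0} <= 1"
proof(rule qd_leI, rule ccontr)
 fix B assume B: "finite B" "B <= U" and im: "indep_mod {u:U. f u = 0} B" and "~ enat (card B) <= 1"
 hence "~ card B <= Suc 0" by(simp add: one_enat_def)
 then obtain x y where xy: "x:B" "y:B" "x ~= y" unfolding card_le_Suc0_iff_eq[OF B(1)] by blast
 define a where "a b = (if b = x then f y else if b = y then - f x else 0)" for b
 have "(SUM b:B. scale (a b) b):U" using B by(intro subspace_sum[OF U] subspace_scale[OF U]) (use B in blast)
 moreover have "f (SUM b:B. scale (a b) b) = (SUM b:B. a b*f b)" by(rule lin_on_sum[OF f U B(1)]) (use B in blast)
 moreover have "(SUM b:B. a b*f b) = (SUM b:{x, y}. a b*f b)"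
  by(rule sum.mono_neutral_right) (use B xy in "auto simp: a_def")
 moreover have "... = 0" using xy by(simp add: a_def)
 ultimately have "(SUM b:B. scale (a b) b):{u:U. f u = 0}" by simp
 with im[unfolded indep_mod_def, THEN spec, of a] have "ALL b:B. a b = 0" by(rule mp)
 hence z: "f x = 0" "f y = 0" using xy by(auto simp: a_def split: if_splits)
 have "(SUM b:B. scale (if b = x then 1 else 0) b) = x" using B(1) xy(1) by(simp add: if_distrib[of "%c. scale c _"] cong: if_cong)
 hence "(SUM b:B. scale (if b = x then 1 else 0) b):{u:U. f u = 0}" using z(1) B(2) xy(1) by auto
 with im[unfolded indep_mod_def, THEN spec, of "%b. if b = x then 1 else 0"]
 have "ALL b:B. (if b = x then 1 else 0 :: 'a) = 0" by(rule mp)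
 thus False using xy(1) by auto
qed

lemma qd_codim_functionals:
 assumes "subspace U" "finite S" "!!s. s:S ==> lin_on U (b s)"
 shows "subspace {u:U. ALL s:S. b s u = 0} & qd U {u:U. ALL s:S. b s u = 0} <= enat (card S)"
 using assms(2,3)
proof(induction S rule: finite_induct)
 case empty
 thus ?case using assms(1) by simp
next
 case (insert x S)
 let ?N = "{u:U. ALL s:S. b s u = 0}"
 have N: "subspace ?N" "qd U ?N <= enat (card S)" using insert by auto
 have lx: "lin_on U (b x)" using insert by auto
 have l: "lin_on ?N (b x)" using lx unfolding lin_on_def by auto
 have e: "{u:U. ALL s:insert x S. b s u = 0} = {u:?N. b x u = 0}" by auto
 have sub: "subspace {u:?N. b x u = 0}"
  by(rule subspace_ker_on[OF N(1)]) (use l in "auto simp: lin_on_def")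
 have "qd U {u:?N. b x u = 0} = qd U ?N + qd ?N {u:?N. b x u = 0}"
  by(rule qd_add) (use sub N assms in auto)
 also have "... <= enat (card S) + 1"
  using N(2) qd_codim_functional[OF N(1) l] by(rule add_mono)
 also have "... = enat (card (insert x S))" using insert by(simp add: one_enat_def)
 finally show ?case using sub e by auto
qed

end

text \<open>If U/W is finite-dimensional, then N contains the common kernel of the functionals that a basis of U/W
  defines on S.\<close>
lemma qd_le_pairing:
 fixes s1 :: "'k::field => 'v::ab_group_add => 'v" and s2 :: "'k => 'w::ab_group_add => 'w"
 assumes v1: "vspace s1" and v2: "vspace s2"
  and S: "module.subspace s1 S" and U: "module.subspace s2 U" and W: "module.subspace s2 W" and WU: "W <= U"
  and lin1: "!!u. u:U ==> vspace.lin_on s1 S (%s. b s u)"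
  and lin2: "!!s. s:S ==> vspace.lin_on s2 U (b s)"
  and ann: "!!s w. s:S ==> w:W ==> b s w = 0"
  and inj: "!!s. s:S ==> (!!u. u:U ==> b s u = 0) ==> s:S0"
 shows "quot_dim s1 S S0 <= quot_dim s2 U W"
proof(cases "quot_dim s2 U W")
 case infinity thus ?thesis by simp
next
 case (enat n)
 interpret v1: vspace s1 by fact
 interpret v2: vspace s2 by fact
 obtain B where B: "finite B" "card B = n" "B <= U" "v2.indep_mod W B"
  "!!x. x:U ==> EX a. x - (SUM b:B. s2 (a b) b):W"
  by(rule v2.qd_fin_spanning[OF W U WU enat]) blast
 have "{s:S. ALL x:B. b s x = 0} <= S0"
 proof
  fix s assume s: "s:{s:S. ALL x:B. b s x = 0}"
  have "b s u = 0" if u: "u:U" for u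
  proof -
   obtain a where a: "u - (SUM x:B. s2 (a x) x):W" using B(5)[OF u] by blast
   have l: "v2.lin_on U (b s)" using lin2 s by auto
   have "b s (SUM x:B. s2 (a x) x) = (SUM x:B. a x*b s x)"
    by(rule v2.lin_on_sum[OF l U]) (use B in auto)
   also have "... = 0" using s by simp
   finally have 1: "b s (SUM x:B. s2 (a x) x) = 0" .
   have 2: "(SUM x:B. s2 (a x) x):U" using B U by(auto intro!: v2.subspace_sum v2.subspace_scale)
   have "b s ((u - (SUM x:B. s2 (a x) x)) + (SUM x:B. s2 (a x) x)) = b s (u - (SUM x:B. s2 (a x) x)) + b s (SUM x:B. s2 (a x) x)"
    using l 2 a WU unfolding v2.lin_on_def by blast
   thus ?thesis using 1 ann a s by simp
  qed
  thus "s:S0" using inj s by auto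
 qed
 hence "quot_dim s1 S S0 <= quot_dim s1 S {s:S. ALL x:B. b s x = 0}" by(intro v1.qd_mono) auto
 also have "... <= enat (card B)"
  using v1.qd_codim_functionals[OF S B(1), of "%x s. b s x"] lin1 B(3) by blast
 finally show ?thesis using B enat by simp
qed

locale pairing =
 v1: vspace s1 + v2: vspace s2
 for s1 :: "'k::field => 'v::ab_group_add => 'v" and s2 :: "'k => 'w::ab_group_add => 'w" +
 fixes S :: "'v set" and U W :: "'w set" and b :: "'v => 'w => 'k"
 assumes S: "v1.subspace S" and U: "v2.subspace U" and W: "v2.subspace W" and WU: "W <= U"
  and lin1: "u:U ==> v1.lin_on S (%s. b s u)"
  and lin2: "s:S ==> v2.lin_on U (b s)"
  and ann: "s:S ==> w:W ==> b s w = 0"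
  and inj: "s:S ==> (!!u. u:U ==> b s u = 0) ==> s = 0"
  and surj: "v2.lin_on U f ==> (!!w. w:W ==> f w = 0) ==> EX s:S. ALL u:U. b s u = f u"
begin

lemma dual_family:
 assumes "finite B" "B <= U" "v2.indep_mod W B"
 obtains d where "!!x. x:B ==> d x:S" "!!x y. x:B ==> y:B ==> b (d x) y = (if x = y then 1 else 0)"
proof -
 have "EX s:S. ALL y:B. b s y = (if x = y then 1 else 0)" for x
 proof -
  obtain f where "v2.lin_on UNIV f" "!!w. w:W ==> f w = 0" "!!y. y:B ==> f y = (if x = y then 1 else 0)"
   by(rule v2.functional_extend[OF W assms(1,3), of "%y. if x = y then 1 else 0"]) blast
  note f = this
  have "v2.lin_on U f" using f(1) unfolding v2.lin_on_def by blast
  from surj[OF this f(2)] obtain s where "s:S" "ALL u:U. b s u = f u" by blast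
  thus ?thesis using f(3) assms(2) by(intro bexI[of _ s]) auto
 qed
 hence "EX d. ALL x. d x:S & (ALL y:B. b (d x) y = (if x = y then 1 else 0))"
  by(intro choice) blast
 then obtain d where d: "ALL x. d x:S & (ALL y:B. b (d x) y = (if x = y then 1 else 0))" ..
 show ?thesis by(rule that[of d]) (use d in auto)
qed

lemma dim_eq: "quot_dim s2 U W = quot_dim s1 S {0}"
proof(rule antisym)
 show "quot_dim s2 U W <= quot_dim s1 S {0}"
 proof(rule v2.qd_leI)
  fix B assume B: "finite B" "B <= U" "v2.indep_mod W B"
  obtain d where d: "!!x. x:B ==> d x:S" "!!x y. x:B ==> y:B ==> b (d x) y = (if x = y then 1 else 0)"
   by(rule dual_family[OF B]) blast
  show "enat (card B) <= quot_dim s1 S {0}"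
  proof(rule v1.qd_ge_family[OF B(1) d(1)])
   fix a assume s: "(SUM x:B. s1 (a x) (d x)):{0}"
   show "ALL y:B. a y = 0"
   proof
    fix y assume y: "y:B"
    have lin: "v1.lin_on S (%s. b s y)" using lin1 y B by auto
    have "b (SUM x:B. s1 (a x) (d x)) y = (SUM x:B. a x*b (d x) y)"
     using v1.lin_on_sum[OF lin S B(1)] d by auto
    also have "... = (SUM x:B. if x = y then a x else 0)"
     by(rule sum.cong) (use d y in auto)
    also have "... = a y" using y B by simp
    finally show "a y = 0" using s v1.lin_on_sum[OF lin S finite.emptyI] by simp
   qed
  qed simp_all
 qed
next
 show "quot_dim s1 S {0} <= quot_dim s2 U W"
  by(rule qd_le_pairing[OF v1.vspace_axioms v2.vspace_axioms S U W WU lin1 lin2 ann]) (use inj in auto)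
qed

text \<open>The pairing is perfect and S is finite-dimensional, so the annihilator of a proper subspace is larger than
  W.\<close>
lemma proper_annihilated:
 assumes fin: "quot_dim s1 S {0} < \<infinity>" and S0: "v1.subspace S0" "S0 <= S" "S0 ~= S"
 shows "EX u:U. u ~: W & (ALL s:S0. b s u = 0)"
proof(rule ccontr)
 assume no: "~ ?thesis"
 have z: "v1.subspace {0}" by simp
 have "quot_dim s1 S0 {0} <= quot_dim s1 S {0}" using S0 by(intro v1.qd_mono) auto
 hence "quot_dim s1 S0 {0} < \<infinity>" using fin by(rule le_less_trans)
 then obtain m where m: "quot_dim s1 S0 {0} = enat m" by(rule less_infinityE)
 obtain B where B: "finite B" "card B = m" "B <= S0"
  "!!x. x:S0 ==> EX a. x - (SUM b:B. s1 (a b) b):{0}"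
  by(rule v1.qd_fin_spanning[OF z S0(1) _ m]) (use v1.subspace_0[OF S0(1)] in auto)
 have sub: "{u:U. ALL s:B. b s u = 0} <= W"
 proof
  fix u assume u: "u:{u:U. ALL s:B. b s u = 0}"
  have "b s u = 0" if s: "s:S0" for s
  proof -
   obtain a where "s - (SUM x:B. s1 (a x) x):{0}" using B(4)[OF s] by blast
   hence a: "s = (SUM x:B. s1 (a x) x)" by simp
   have "b s u = (SUM x:B. a x*b x u)" unfolding a
    by(rule v1.lin_on_sum[of S "%s. b s u"]) (use lin1 u S B(1,3) S0 in blast)+
   thus ?thesis using u by simp
  qed
  thus "u:W" using no u by blast
 qed
 have "quot_dim s1 S {0} = quot_dim s2 U W" by(simp add: dim_eq)
 also have "... <= quot_dim s2 U {u:U. ALL s:B. b s u = 0}" using sub by(intro v2.qd_mono) auto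
 also have "... <= enat m" using v2.qd_codim_functionals[OF U B(1), of b] lin2 B(2,3) S0 by blast
 finally have "quot_dim s1 S {0} <= quot_dim s1 S0 {0}" using m by simp
 moreover have "quot_dim s1 S {0} = quot_dim s1 S S0 + quot_dim s1 S0 {0}"
  by(rule v1.qd_add) (use S S0 v1.subspace_0 in auto)
 ultimately have "quot_dim s1 S S0 = 0" using m by(cases "quot_dim s1 S S0") (auto simp: zero_enat_def)
 thus False using v1.qd_eq_0[OF S0(1)] S0 by blast
qed

end

section \<open>Subrings and valuation rings of a field\<close>

lemma subring_0: "is_subring A ==> 0:A"
 unfolding is_subring_def by(metis diff_self)

lemma subring_1: "is_subring A ==> 1:A"
 unfolding is_subring_def by blast

lemma subring_diff: "is_subring A ==> x:A ==> y:A ==> x - y:A"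
 unfolding is_subring_def by blast

lemma subring_mult: "is_subring A ==> x:A ==> y:A ==> x*y:A"
 unfolding is_subring_def by blast

lemma subring_neg: "is_subring A ==> x:A ==> - x:A"
 using subring_diff[of A 0 x] subring_0[of A] by simp

lemma subring_add: "is_subring A ==> x:A ==> y:A ==> x + y:A"
 using subring_diff[of A x "- y"] subring_neg[of A y] by simp

lemma subring_power: "is_subring A ==> x:A ==> x^n:A"
 by(induction n) (auto intro: subring_1 subring_mult)

lemma subring_sum: "is_subring A ==> (!!i. i:I ==> f i:A) ==> sum f I:A"
 by(induction I rule: infinite_finite_induct) (auto intro: subring_0 subring_add)

lemma subring_prod: "is_subring A ==> (!!i. i:I ==> f i:A) ==> prod f I:A"
 by(induction I rule: infinite_finite_induct) (auto intro: subring_1 subring_mult)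

lemmas subring_intros = subring_0 subring_1 subring_diff subring_mult subring_neg subring_add
 subring_power subring_sum subring_prod

lemma subring_UNIV [simp]: "is_subring UNIV" by(simp add: is_subring_def)

definition adjoin :: "'K::field set => 'K => 'K set" where
 "adjoin S x = {poly p x |p. ALL i. coeff p i:S}"

lemma adjoin_subring: assumes "is_subring S" shows "is_subring (adjoin S x)"
 unfolding is_subring_def
proof(intro conjI ballI)
 show "1:adjoin S x" unfolding adjoin_def
  by(rule CollectI, rule exI[of _ "[:1:]"])
    (use assms in "auto simp: coeff_pCons intro: subring_intros split: nat.splits")
next
 fix y z assume "y:adjoin S x" "z:adjoin S x"
 then obtain p q where pq: "y = poly p x" "ALL i. coeff p i:S" "z = poly q x" "ALL i. coeff q i:S"
  unfolding adjoin_def by auto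
 show "y - z:adjoin S x" unfolding adjoin_def
  by(rule CollectI, rule exI[of _ "p - q"]) (use pq assms in "auto intro: subring_diff")
 show "y*z:adjoin S x" unfolding adjoin_def
  by(rule CollectI, rule exI[of _ "p*q"])
    (use pq assms in "auto simp: coeff_mult intro!: subring_sum subring_mult")
qed

lemma adjoin_superset: assumes "is_subring S" shows "S <= adjoin S x"
proof
 fix s assume s: "s:S"
 have "coeff [:s:] i:S" for i using s subring_0[OF assms] by(cases i) auto
 thus "s:adjoin S x" unfolding adjoin_def
  by(intro CollectI exI[of _ "[:s:]"]) auto
qed

lemma adjoin_elem: assumes "is_subring S" shows "x:adjoin S x"
proof -
 have "coeff [:0,1:] i:S" for i using subring_0[OF assms] subring_1[OF assms]
  by(auto simp: coeff_pCons split: nat.splits)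
 thus ?thesis unfolding adjoin_def
  by(intro CollectI exI[of _ "[:0,1:]"]) auto
qed

lemma adjoin_repr:
 assumes "y:adjoin S x"
 obtains n f where "!!i. f i:S" "y = (SUM i<=n. f i*x^i)"
proof -
 obtain p where p: "y = poly p x" "ALL i. coeff p i:S" using assms unfolding adjoin_def by auto
 thus ?thesis using that[of "coeff p" "degree p"] by(simp add: poly_altdef)
qed

lemma adjoin_least:
 assumes "is_subring R" "S <= R" "x:R" shows "adjoin S x <= R"
proof
 fix y assume "y:adjoin S x"
 then obtain n f where "!!i. f i:S" "y = (SUM i<=n. f i*x^i)" by(rule adjoin_repr) blast
 thus "y:R" using assms by(auto intro!: subring_sum subring_mult subring_power)
qed

text \<open>The first relation can be shortened when it is at least as long as the second: the second one, divided by
  1 - b g(0) and multiplied by x^n, expresses b x^n through lower powers.\<close>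
lemma reduce_relation:
 fixes x :: "'K::field"
 assumes S: "is_subring S" and b: "b:S" and v: "v:S" "v*(1 - b*g 0) = 1"
  and f: "!!i. f i:S" "b*(SUM i<=n. f i*x^i) = 1"
  and g: "!!i. g i:S" "b*(SUM j<=m. g j*inverse x^j) = 1"
  and mn: "m <= n" "0 < n" and x: "x ~= 0"
 shows "EX h. (ALL i. h i:S) & b*(SUM i<=n - 1. h i*x^i) = 1"
proof -
 define e where "e i = (if i < n & n - i <= m then v*b*g (n - i) else 0)" for i
 have eS: "e i:S" for i unfolding e_def using S b v g by(auto intro!: subring_intros)
 have "(SUM j<=m. g j*inverse x^j) = g 0 + (SUM j=1..m. g j*inverse x^j)"
  by(simp add: atMost_atLeast0 sum.atLeast_Suc_atMost)
 hence "(1 - b*g 0) = b*(SUM j=1..m. g j*inverse x^j)"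
  using g(2) by(simp add: algebra_simps)
 hence "1 = v*(b*(SUM j=1..m. g j*inverse x^j))" using v(2) by simp
 hence "x^n = x^n*(v*(b*(SUM j=1..m. g j*inverse x^j)))" by simp
 also have "... = v*b*(SUM j=1..m. g j*(x^n*inverse x^j))"
  by(simp add: sum_distrib_left mult_ac)
 also have "(SUM j=1..m. g j*(x^n*inverse x^j)) = (SUM j=1..m. g j*x^(n - j))"
  by(rule sum.cong) (use mn x in "auto simp: power_diff field_simps power_inverse")
 also have "... = (SUM i:{i. i < n & n - i <= m}. g (n - i)*x^i)"
  by(rule sum.reindex_bij_witness[of _ "%i. n - i" "%i. n - i"]) (use mn in auto)
 also have "v*b * ... = (SUM i:{i. i < n & n - i <= m}. e i*x^i)"
  unfolding sum_distrib_left by(rule sum.cong) (auto simp: e_def)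
 also have "... = (SUM i<=n - 1. e i*x^i)"
  by(rule sum.mono_neutral_left) (use mn in "auto simp: e_def")
 finally have xn: "x^n = (SUM i<=n - 1. e i*x^i)" .
 define h where "h i = f i + f n*e i" for i
 have "(SUM i<=n. f i*x^i) = (SUM i<=n - 1. f i*x^i) + f n*x^n"
  using mn by(cases n) auto
 also have "... = (SUM i<=n - 1. h i*x^i)"
  unfolding xn h_def by(simp add: sum_distrib_left sum.distrib algebra_simps)
 finally have "b*(SUM i<=n - 1. h i*x^i) = 1" using f(2) by simp
 moreover have "h i:S" for i unfolding h_def using f eS S by(auto intro: subring_intros)
 ultimately show ?thesis by blast
qed

text \<open>Zorn gives a maximal subring S above R in which b is not invertible. If neither x nor 1/x were in S, then
  b would be invertible after adjoining either of them. The two resulting relations, taken of minimal degree,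
  contradict \<open>reduce_relation\<close>.\<close>
lemma valuation_ring_extension:
 fixes b :: "'K::field"
 assumes R: "is_subring R" and b: "b:R" and nb: "inverse b ~: R"
 obtains W where "valuation_ring W" "R <= W" "b:nu W"
proof -
 have b0: "b ~= 0" using nb R subring_0 by fastforce
 define \<A> where "\<A> = {S. is_subring S & R <= S & inverse b ~: S}"
 have "EX M:\<A>. ALL X:\<A>. M <= X --> X = M"
 proof(rule subset_Zorn_nonempty)
  show "\<A> ~= {}" using R nb by(auto simp: \<A>_def)
  fix \<C> assume C: "\<C> ~= {}" "subset.chain \<A> \<C>"
  have sub: "\<C> <= \<A>" using C(2) by(simp add: subset_chain_def)
  have "is_subring (\<Union>\<C>)" unfolding is_subring_def
  proof(intro conjI ballI)
   show "1:\<Union>\<C>" using C(1) sub subring_1 by(force simp: \<A>_def)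
  next
   fix x y assume "x:\<Union>\<C>" "y:\<Union>\<C>"
   then obtain S T where ST: "S:\<C>" "T:\<C>" "x:S" "y:T" by blast
   hence "S <= T \<or> T <= S" using C(2) by(auto simp: subset_chain_def)
   then obtain Q where Q: "Q:\<C>" "x:Q" "y:Q" using ST by blast
   hence "is_subring Q" using sub by(auto simp: \<A>_def)
   thus "x - y:\<Union>\<C>" "x*y:\<Union>\<C>" using Q subring_diff subring_mult by blast+
  qed
  thus "\<Union>\<C> : \<A>" using C(1) sub by(auto simp: \<A>_def)
 qed
 then obtain S where SA: "S:\<A>" and max: "!!X. X:\<A> ==> S <= X ==> X = S" by blast
 have S: "is_subring S" "R <= S" "inverse b ~: S" using SA by(auto simp: \<A>_def)
 have bS: "b:S" using b S by blast
 have big: "inverse b:adjoin S x" if "x ~: S" for x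
 proof(rule ccontr)
  assume "inverse b ~: adjoin S x"
  hence "adjoin S x:\<A>" using S adjoin_subring adjoin_superset unfolding \<A>_def by blast
  hence "adjoin S x = S" using max adjoin_superset[OF S(1)] by blast
  thus False using that adjoin_elem[OF S(1)] by blast
 qed
 have unit: "EX v:S. v*(1 - b*c) = 1" if c: "c:S" for c
 proof -
  let ?u = "1 - b*c"
  have u0: "?u ~= 0"
  proof
   assume "?u = 0"
   hence "inverse b = c" using b0 by(simp add: inverse_unique)
   thus False using S c by simp
  qed
  have "inverse ?u:S"
  proof(rule ccontr)
   assume n: "inverse ?u ~: S"
   from big[OF this] obtain n f where f: "!!i. f i:S" "inverse b = (SUM i<=n. f i*inverse ?u^i)"
    by(rule adjoin_repr) blast
   have "inverse b*?u^n = (SUM i<=n. f i*?u^(n - i))"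
    unfolding f(2) sum_distrib_right
    by(rule sum.cong) (use u0 in "auto simp: power_diff field_simps power_inverse")
   also have "... : S" using f(1) S c bS by(auto intro!: subring_intros)
   finally have 1: "inverse b*?u^n:S" .
   have "inverse b - inverse b*?u^k:S" for k
   proof(induction k)
    case 0 thus ?case using S subring_0 by simp
   next
    case (Suc k)
    have "inverse b - inverse b*?u^Suc k = (inverse b - inverse b*?u^k) + c*?u^k"
     using b0 by(simp add: algebra_simps)
    moreover have "c*?u^k:S" using S c bS by(auto intro!: subring_intros)
    ultimately show ?case using Suc S subring_add by metis
   qed
   from subring_add[OF S(1) this[of n] 1] have "inverse b:S" by simp
   thus False using S by simp
  qed
  thus ?thesis using u0 by(intro bexI[of _ "inverse ?u"]) auto
 qed
 have no_red: False
  if x: "x ~= 0" and ex: "EX f. (ALL i. f i:S) & b*(SUM i<=n. f i*x^i) = 1"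
   and minn: "!!k. k < n ==> ~ (EX f. (ALL i. f i:S) & b*(SUM i<=k. f i*x^i) = 1)"
   and eg: "EX g. (ALL i. g i:S) & b*(SUM i<=m. g i*inverse x^i) = 1"
   and mn: "m <= n" for x n m
 proof -
  obtain f g where f: "!!i. f i:S" "b*(SUM i<=n. f i*x^i) = 1"
   and g: "!!i. g i:S" "b*(SUM j<=m. g j*inverse x^j) = 1" using ex eg by blast
  have n0: "0 < n"
  proof(rule ccontr)
   assume "~ 0 < n"
   hence "b*f 0 = 1" using f(2) by simp
   hence "inverse b = f 0" using b0 by(simp add: inverse_unique)
   thus False using f(1) S by metis
  qed
  obtain v where v: "v:S" "v*(1 - b*g 0) = 1" using unit g(1) by blast
  have "EX h. (ALL i. h i:S) & b*(SUM i<=n - 1. h i*x^i) = 1"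
   by(rule reduce_relation[OF S(1) bS v f g mn n0 x])
  thus False using minn[of "n - 1"] n0 by simp
 qed
 have "x:S \<or> inverse x:S" for x
 proof(rule ccontr)
  assume a: "~ (x:S \<or> inverse x:S)"
  hence x0: "x ~= 0" using S subring_0 by force
  define P where "P y n \<longleftrightarrow> (EX f. (ALL i. f i:S) & b*(SUM i<=n. f i*y^i) = 1)" for y n
  have ex: "EX n. P y n" if yS: "y ~: S" for y
  proof -
   obtain n f where f: "!!i. f i:S" "inverse b = (SUM i<=n. f i*y^i)"
    using big[OF yS] by(rule adjoin_repr) blast
   have "b*inverse b = 1" using b0 by simp
   thus ?thesis unfolding P_def using f by metis
  qed
  define n where "n = (LEAST n. P x n)"
  define m where "m = (LEAST n. P (inverse x) n)"
  have n: "P x n" "!!k. k < n ==> ~ P x k" unfolding n_def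
   using LeastI_ex[OF ex[of x]] not_less_Least a by auto
  have m: "P (inverse x) m" "!!k. k < m ==> ~ P (inverse x) k" unfolding m_def
   using LeastI_ex[OF ex[of "inverse x"]] not_less_Least a by auto
  show False
  proof(cases "m <= n")
   case True
   show False by(rule no_red[of x n m]) (use True n m x0 in "auto simp: P_def")
  next
   case False
   show False by(rule no_red[of "inverse x" m n]) (use False n m x0 in "auto simp: P_def")
  qed
 qed
 hence "valuation_ring S" using S by(simp add: valuation_ring_def)
 moreover have "b:nu S" using bS S by(simp add: nonunits_def)
 ultimately show ?thesis using that S by blast
qed

lemma valuation_subring: "valuation_ring W ==> is_subring W"
 by(simp add: valuation_ring_def)

lemma nonunits_sub: "x:nu W ==> x:W" by(simp add: nonunits_def)

lemma nonunits_0: "is_subring W ==> 0:nu W" by(simp add: nonunits_def subring_0)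

lemma nonunits_1: "is_subring W ==> 1 ~: nu W" by(simp add: nonunits_def subring_1)

lemma nonunits_mult:
 assumes "is_subring W" "x:nu W" "y:W" shows "y*x:nu W"
proof -
 have "inverse x:W" if "y*x ~= 0" "inverse (y*x):W"
 proof -
  have "y*inverse (y*x):W" using assms that subring_mult by blast
  thus ?thesis using that by(simp add: field_simps)
 qed
 thus ?thesis using assms by(auto simp: nonunits_def intro: subring_mult)
qed

lemma unit_inverse: "x:W ==> x ~: nu W ==> x ~= 0 & inverse x:W"
 by(auto simp: nonunits_def)

lemma val_nonunits_add:
 assumes "valuation_ring W" "x:nu W" "y:nu W" shows "x + y:nu W"
proof -
 have W: "is_subring W" using assms valuation_subring by blast
 show ?thesis
 proof(cases "x = 0 \<or> y = 0")
  case True thus ?thesis using assms by auto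
 next
  case False
  hence "y/x:W \<or> x/y:W" using assms(1)[unfolded valuation_ring_def]
   by(metis inverse_divide)
  hence "(EX z:W. x + y = z*x) \<or> (EX z:W. x + y = z*y)"
  proof
   assume "y/x:W"
   hence "1 + y/x:W" using W by(auto intro: subring_intros)
   moreover have "x + y = (1 + y/x)*x" using False by(simp add: field_simps)
   ultimately show ?thesis by blast
  next
   assume "x/y:W"
   hence "1 + x/y:W" using W by(auto intro: subring_intros)
   moreover have "x + y = (1 + x/y)*y" using False by(simp add: field_simps)
   ultimately show ?thesis by blast
  qed
  thus ?thesis using nonunits_mult[OF W] assms by auto
 qed
qed

lemma nonunits_neg: "is_subring W ==> x:nu W ==> - x:nu W"
 using nonunits_mult[of W x "-1"] subring_neg[of W 1] subring_1 by auto

lemma val_nonunits_diff: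
 "valuation_ring W ==> x:nu W ==> y:nu W ==> x - y:nu W"
 using val_nonunits_add[of W x "- y"] nonunits_neg valuation_subring by fastforce

lemma val_nonunits_prime:
 assumes "is_subring W" "x:W" "y:W" "x*y:nu W"
 shows "x:nu W \<or> y:nu W"
proof(rule ccontr)
 assume "~ ?thesis"
 hence "x ~= 0" "y ~= 0" "inverse x:W" "inverse y:W" using unit_inverse assms by auto
 hence "inverse (x*y):W" "x*y ~= 0" using assms subring_mult by auto
 thus False using assms by(simp add: nonunits_def)
qed

lemma val_not_in: "valuation_ring W ==> x ~: W ==> x ~= 0 & inverse x:nu W"
 using subring_0[OF valuation_subring, of W] unfolding valuation_ring_def nonunits_def by fastforce

text \<open>If x is not integral over A, then 1/x is not invertible in A[1/x], because inverting it there is an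
  integral equation for x. So some valuation ring above A[1/x] has 1/x as a nonunit, and it does not contain
  x.\<close>
lemma integral_closure_eq:
 assumes A: "is_subring A"
 shows "integral_closure A = \<Inter>{W. valuation_ring W & A <= W}"
proof(intro equalityI subsetI)
 fix x assume "x:integral_closure A"
 then obtain p where p: "lead_coeff p = 1" "!!i. coeff p i:A" "poly p x = 0"
  unfolding integral_closure_def by blast
 show "x:\<Inter>{W. valuation_ring W & A <= W}"
 proof(rule InterI, clarify)
  fix W assume W: "valuation_ring W" "A <= W"
  show "x:W"
  proof(rule ccontr)
   assume "x ~: W"
   from val_not_in[OF W(1) this] have x: "x ~= 0" "inverse x:nu W" by auto
   have sub: "is_subring W" using W valuation_subring by blast
   define n where "n = degree p"
   have "0 = inverse x^n*poly p x" using p by simp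
   also have "... = (SUM i<=n. coeff p i*inverse x^(n - i))"
    unfolding poly_altdef n_def sum_distrib_left
    by(rule sum.cong) (use x in "auto simp: power_diff field_simps power_inverse")
   also have "... = (SUM i<n. coeff p i*inverse x^(n - i)) + 1"
    using p(1) by(simp add: n_def lessThan_Suc_atMost[symmetric])
   finally have e: "1 = - (SUM i<n. coeff p i*inverse x^(n - i))"
    by(simp add: eq_neg_iff_add_eq_0 add.commute)
   have t: "coeff p i*inverse x^(n - i):nu W" if "i < n" for i
   proof -
    have e: "n - i = Suc (n - i - 1)" using that by simp
    have "coeff p i*inverse x^(n - i - 1):W"
     using p W sub x nonunits_sub by(intro subring_mult subring_power) auto
    from nonunits_mult[OF sub x(2) this] show ?thesis by(subst e) (simp add: mult_ac)
   qed
   have u: "(SUM i:I. coeff p i*inverse x^(n - i)):nu W" if "I <= {..<n}" "finite I" for I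
    using `finite I` `I <= {..<n}`
    by(induction I rule: finite_induct) (auto intro!: nonunits_0[OF sub] val_nonunits_add[OF W(1)] t)
   have "1:nu W" using e nonunits_neg[OF sub u[of "{..<n}"]] by simp
   thus False using nonunits_1[OF sub] by simp
  qed
 qed
next
 fix x assume x: "x:\<Inter>{W. valuation_ring W & A <= W}"
 show "x:integral_closure A"
 proof(rule ccontr)
  assume nx: "x ~: integral_closure A"
  have x0: "x ~= 0"
  proof
   assume "x = 0"
   have "coeff [:0, 1::'a:] i:A" for i using subring_0[OF A] subring_1[OF A]
    by(auto simp: coeff_pCons split: nat.splits)
   hence "x:integral_closure A" unfolding integral_closure_def `x = 0`
    by(intro CollectI exI[of _ "[:0, 1:]"]) auto
   thus False using nx by simp
  qed
  have "x ~: adjoin A (inverse x)"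
  proof
   assume "x:adjoin A (inverse x)"
   then obtain n f where f: "!!i. f i:A" "x = (SUM i<=n. f i*inverse x^i)" by(rule adjoin_repr) blast
   have "x^n*x = (SUM i<=n. f i*x^(n - i))"
    by(subst (2) f(2)) (use x0 in "auto simp: sum_distrib_left power_diff field_simps power_inverse intro!: sum.cong")
   hence e: "x^Suc n = (SUM i<=n. f i*x^(n - i))" by(simp only: power_Suc2)
   define q where "q = (SUM i<=n. monom (f i) (n - i))"
   define p where "p = monom 1 (Suc n) - q"
   have dq: "degree q <= n" unfolding q_def by(rule degree_sum_le) (auto intro: order.trans[OF degree_monom_le])
   have "degree p = Suc n" using degree_add_eq_left[of "- q" "monom 1 (Suc n)"] dq
    by(simp add: p_def degree_monom_eq)
   moreover have "coeff q (Suc n) = 0" using dq by(intro coeff_eq_0) simp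
   ultimately have 1: "lead_coeff p = 1" by(simp add: p_def)
   have "coeff q i:A" for i unfolding q_def using f A
    by(auto simp: coeff_sum intro!: subring_sum subring_0)
   hence 2: "coeff p i:A" for i unfolding p_def using A by(auto intro: subring_intros)
   have "poly p x = 0" unfolding p_def q_def using e by(simp add: poly_monom poly_sum)
   thus False using nx 1 2 unfolding integral_closure_def by blast
  qed
  hence "inverse (inverse x) ~: adjoin A (inverse x)" by simp
  then obtain W where W: "valuation_ring W" "adjoin A (inverse x) <= W" "inverse x:nu W"
   by(rule valuation_ring_extension[OF adjoin_subring[OF A] adjoin_elem[OF A]])
  hence "x:W" using x adjoin_superset[OF A] by blast
  moreover have "x ~: W" using W(3) x0 by(simp add: nonunits_def)
  ultimately show False by simp
 qed
qed

section \<open>Local rings inside valuation rings\<close>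

lemma lin_span_0: "0:lin_span s R S"
 unfolding lin_span_def by(intro CollectI exI[of _ "{}"]) auto

lemma lin_span_base:
 assumes "is_subring R" "x:S" shows "x:lspan R S"
 unfolding lin_span_def
 by(intro CollectI exI[of _ "{x}"] exI[of _ "%_. 1"]) (use assms subring_1 in auto)

lemma lin_span_add:
 assumes R: "is_subring R" and "x:lspan R S" "y:lspan R S"
 shows "x + y:lspan R S"
proof -
 obtain T a where T: "finite T" "T <= S" "ALL t:T. a t:R" "x = (SUM t:T. a t*t)"
  using assms(2) unfolding lin_span_def by blast
 obtain T' a' where T': "finite T'" "T' <= S" "ALL t:T'. a' t:R" "y = (SUM t:T'. a' t*t)"
  using assms(3) unfolding lin_span_def by blast
 have 1: "x = (SUM t:T Un T'. (if t:T then a t else 0)*t)"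
  unfolding T(4) by(rule sum.mono_neutral_cong_left) (use T T' in auto)
 have 2: "y = (SUM t:T Un T'. (if t:T' then a' t else 0)*t)"
  unfolding T'(4) by(rule sum.mono_neutral_cong_left) (use T T' in auto)
 have "x + y = (SUM t:T Un T'. ((if t:T then a t else 0) + (if t:T' then a' t else 0))*t)"
  unfolding distrib_right sum.distrib using 1 2 by simp
 moreover have "ALL t:T Un T'. (if t:T then a t else 0) + (if t:T' then a' t else 0):R"
  using T T' subring_0[OF R] subring_add[OF R] by auto
 ultimately show ?thesis unfolding lin_span_def
  using T T' by(intro CollectI exI[of _ "T Un T'"] exI[of _ "%t. (if t:T then a t else 0) + (if t:T' then a' t else 0)"]) auto
qed

lemma lin_span_scale:
 assumes R: "is_subring R" and "x:lspan R S" "r:R"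
 shows "r*x:lspan R S"
proof -
 obtain T a where T: "finite T" "T <= S" "ALL t:T. a t:R" "x = (SUM t:T. a t*t)"
  using assms(2) unfolding lin_span_def by blast
 hence "r*x = (SUM t:T. (r*a t)*t)" by(simp add: sum_distrib_left mult.assoc)
 thus ?thesis unfolding lin_span_def
  using T assms subring_mult[OF R] by(intro CollectI exI[of _ T] exI[of _ "%t. r*a t"]) auto
qed

lemma lin_span_sum:
 assumes R: "is_subring R" "!!i. i:I ==> f i:lspan R S"
 shows "sum f I:lspan R S"
 using assms(2) by(induction I rule: infinite_finite_induct) (auto intro: lin_span_0 lin_span_add[OF R(1)])

lemma lin_span_least:
 assumes "0:N" "!!x y. x:N ==> y:N ==> x + y:N" "!!r x. r:R ==> x:N ==> r*x:N" "S <= N"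
 shows "lspan R S <= N"
proof
 fix x assume "x:lspan R S"
 then obtain T a where T: "finite T" "T <= S" "ALL t:T. a t:R" "x = (SUM t:T. a t*t)"
  unfolding lin_span_def by blast
 have "(SUM t:T. a t*t):N" using T(1,2,3)
  by(induction T rule: finite_induct) (use assms in auto)
 thus "x:N" using T by simp
qed

lemma lin_span_mono: "R <= R' ==> S <= S' ==> lspan R S <= lspan R' S'"
 unfolding lin_span_def by blast

definition submod :: "'K::field set => 'K set => bool" where
 "submod R N \<longleftrightarrow> 0:N & (ALL x:N. ALL y:N. x + y:N) & (ALL r:R. ALL x:N. r*x:N)"

lemma submod_0: "submod R N ==> 0:N" and submod_add: "submod R N ==> x:N ==> y:N ==> x + y:N"
 and submod_scale: "submod R N ==> r:R ==> x:N ==> r*x:N"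
 unfolding submod_def by blast+

lemma submod_sum: "submod R N ==> (!!i. i:I ==> f i:N) ==> sum f I:N"
 by(induction I rule: infinite_finite_induct) (auto intro: submod_0 submod_add)

lemma submod_lin_span: "is_subring R ==> submod R (lspan R S)"
 unfolding submod_def using lin_span_0 lin_span_add lin_span_scale by blast

lemma lin_span_submod: "submod R N ==> S <= N ==> lspan R S <= N"
 by(rule lin_span_least) (auto intro: submod_0 submod_add submod_scale)

lemma submod_self: "is_subring R ==> submod R R"
 unfolding submod_def by(auto intro: subring_intros)

lemma submod_mono: "submod R N ==> R' <= R ==> submod R' N"
 unfolding submod_def by blast

lemma submod_image: assumes N: "submod R N" shows "submod R (c ** N)"
 unfolding submod_def
proof(intro conjI ballI)
 show "0:c ** N" using submod_0[OF N] by(intro image_eqI[of _ _ 0]) auto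
 fix x y assume "x:c ** N" "y:c ** N"
 then obtain u v where "u:N" "v:N" "x = c*u" "y = c*v" by blast
 thus "x + y:c ** N"
  using submod_add[OF N] by(intro image_eqI[of _ _ "u + v"]) (auto simp: distrib_left)
next
 fix r x assume "r:R" "x:c ** N"
 then obtain u where "u:N" "x = c*u" by blast
 thus "r*x:c ** N"
  using submod_scale[OF N `r : R`] by(intro image_eqI[of _ _ "r*u"]) auto
qed

lemma submod_diff: "is_subring R ==> submod R N ==> x:N ==> y:N ==> x - y:N"
 using submod_add[of R N x "-1*y"] submod_scale[of R N "-1" y] subring_neg[of R 1] subring_1[of R] by simp

text \<open>The local ring of the centre of W on Spec A.\<close>
definition loc :: "'K::field set => 'K set => 'K set" where
 "loc A W = localization A (A Int nu W)"

lemma loc_iff: "x:loc A W \<longleftrightarrow> (EX a b. x = a/b & a:A & b:A & b ~: nu W)"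
 unfolding loc_def localization_def by auto

context
 fixes A W :: "'K::field set"
 assumes A: "is_subring A" and W: "valuation_ring W" and AW: "A <= W"
begin

lemma loc_sub: "loc A W <= W"
proof
 fix x assume "x:loc A W"
 then obtain a b where "x = a/b" "a:A" "b:A" "b ~: nu W" unfolding loc_iff by blast
 thus "x:W" using AW unit_inverse[of b W] subring_mult[OF valuation_subring[OF W], of a "inverse b"]
  by(auto simp: divide_inverse)
qed

lemma loc_sup: "A <= loc A W"
proof
 fix x assume "x:A"
 thus "x:loc A W" unfolding loc_iff
  using A nonunits_1[OF valuation_subring[OF W]] subring_1 by(intro exI[of _ x] exI[of _ 1]) auto
qed

lemma loc_subring: "is_subring (loc A W)"
 unfolding is_subring_def
proof(intro conjI ballI)
 show "1:loc A W" using loc_sup subring_1[OF A] by blast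
next
 fix x y assume "x:loc A W" "y:loc A W"
 then obtain a b c d where x: "x = a/b" "a:A" "b:A" "b ~: nu W"
   and y: "y = c/d" "c:A" "d:A" "d ~: nu W" unfolding loc_iff by blast
 have nz: "b ~= 0" "d ~= 0" using x y nonunits_0[OF valuation_subring[OF W]] by auto
 have bd: "b*d:A" "b*d ~: nu W"
  using x y A AW val_nonunits_prime[OF valuation_subring[OF W]] subring_mult by blast+
 show "x - y:loc A W" unfolding loc_iff
  by(intro exI[of _ "a*d - c*b"] exI[of _ "b*d"])
    (use x y nz bd A in "auto simp: field_simps intro!: subring_intros")
 show "x*y:loc A W" unfolding loc_iff
  by(intro exI[of _ "a*c"] exI[of _ "b*d"])
    (use x y nz bd A in "auto simp: field_simps intro!: subring_intros")
qed

lemma loc_nonunits: "nu (loc A W) = nu W Int loc A W"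
proof(intro equalityI subsetI)
 fix x assume x: "x:nu (loc A W)"
 hence xl: "x:loc A W" by(simp add: nonunits_def)
 have "x:nu W"
 proof(rule ccontr)
  assume n: "x ~: nu W"
  obtain a b where ab: "x = a/b" "a:A" "b:A" "b ~: nu W" using xl unfolding loc_iff by blast
  have b0: "b ~= 0" using ab nonunits_0[OF valuation_subring[OF W]] by auto
  have "a ~: nu W"
  proof
   assume "a:nu W"
   moreover have "inverse b:W" using ab AW unit_inverse by blast
   ultimately have "inverse b*a:nu W" using nonunits_mult[OF valuation_subring[OF W]] by blast
   thus False using n ab by(simp add: field_simps)
  qed
  hence "b/a:loc A W" unfolding loc_iff using ab by blast
  moreover have "x ~= 0" using n nonunits_0[OF valuation_subring[OF W]] by auto
  ultimately show False using x ab by(auto simp: nonunits_def)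
 qed
 thus "x:nu W Int loc A W" using xl by simp
next
 fix x assume "x:nu W Int loc A W"
 thus "x:nu (loc A W)" using loc_sub by(auto simp: nonunits_def)
qed

lemma loc_dominates: "dominates W (loc A W)"
 using loc_sub loc_nonunits by(simp add: dominates_def)

lemma loc_in_Spec: "loc A W:Spec A"
 unfolding Spec_def
proof(rule CollectI, intro exI conjI)
 show "loc A W = localization A (A Int nu W)" by(simp add: loc_def)
 note Ws = valuation_subring[OF W]
 have "a*b:nu W ==> a:A ==> b:A ==> a:nu W \<or> b:nu W" for a b
  using val_nonunits_prime[OF Ws, of a b] AW by blast
 moreover have "a:A ==> x:nu W ==> a*x:nu W" for a x
  using nonunits_mult[OF Ws, of x a] AW by blast
 ultimately show "prime_ideal A (A Int nu W)"
  unfolding prime_ideal_def using nonunits_0[OF Ws] nonunits_1[OF Ws] subring_0[OF A]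
   val_nonunits_add[OF W] subring_add[OF A] subring_mult[OF A] by auto
qed

end

text \<open>Otherwise x is not invertible in R[1/y], and a valuation ring above R[1/y] in which x is a nonunit has y
  as a unit.\<close>
lemma nilpotent_mod:
 fixes R :: "'K::field set"
 assumes R: "is_subring R" and x: "x:R" "x ~= 0" and y: "y:R"
  and val: "!!W. valuation_ring W ==> R <= W ==> x:nu W ==> y:nu W"
 shows "EX N. y^N:x ** R"
proof(rule ccontr)
 assume n: "~ ?thesis"
 have y0: "y ~= 0"
 proof
  assume "y = 0"
  hence "y^1:x ** R" using subring_0[OF R] by(intro image_eqI[of _ _ 0]) auto
  thus False using n by blast
 qed
 let ?S = "adjoin R (inverse y)"
 have S: "is_subring ?S" "R <= ?S" "inverse y:?S" using adjoin_subring adjoin_superset adjoin_elem R by blast+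
 have "inverse x ~: ?S"
 proof
  assume "inverse x:?S"
  then obtain n f where f: "!!i. f i:R" "inverse x = (SUM i<=n. f i*inverse y^i)" by(rule adjoin_repr) blast
  have "y^n*inverse x = (SUM i<=n. f i*y^(n - i))"
   unfolding f(2) sum_distrib_left
   by(rule sum.cong) (use y0 in "auto simp: power_diff field_simps power_inverse")
  hence e: "y^n = x*(SUM i<=n. f i*y^(n - i))" using x by(simp add: field_simps)
  have "(SUM i<=n. f i*y^(n - i)):R" using f y R by(auto intro!: subring_intros)
  thus False using n e by blast
 qed
 then obtain W where W: "valuation_ring W" "?S <= W" "x:nu W"
  using valuation_ring_extension[OF S(1)] x S by blast
 hence "y:nu W" using val S by blast
 thus False using W S y0 by(auto simp: nonunits_def)
qed

lemma alg_gen_subring: "is_subring (alg_gen em S)"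
 unfolding alg_gen_def is_subring_def by auto

lemma alg_gen_base: "S <= alg_gen em S" "range em <= alg_gen em S"
 unfolding alg_gen_def by auto

lemma alg_gen_least: "is_subring A ==> range em <= A ==> S <= A ==> alg_gen em S <= A"
 unfolding alg_gen_def by auto

context vspace begin

lemma qd_dependent_seq:
 assumes "qd U W = enat e" "!!i. f i:U" "0:W"
 shows "EX a. (EX i<=e. a i ~= 0) & (SUM i<=e. scale (a i) (f i)):W"
proof(cases "inj_on f {..e}")
 case False
 then obtain i j where ij: "i <= e" "j <= e" "f i = f j" "i ~= j" unfolding inj_on_def by auto
 define a where "a l = (if l = i then 1 else if l = j then -1 else 0 :: 'a)" for l
 have "(SUM l<=e. scale (a l) (f l)) = (SUM l:{i,j}. scale (a l) (f l))"
  by(rule sum.mono_neutral_right) (use ij in "auto simp: a_def")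
 also have "... = 0" using ij by(simp add: a_def)
 finally show ?thesis using ij assms(3) by(intro exI[of _ a]) (auto simp: a_def)
next
 case True
 have "~ indep_mod W (f ` {..e})"
 proof
  assume "indep_mod W (f ` {..e})"
  from qd_geI[OF _ _ this, of U] assms show False by(auto simp: card_image[OF True])
 qed
 then obtain a b where ab: "(SUM b:f ` {..e}. scale (a b) b):W" "b:f ` {..e}" "a b ~= 0"
  unfolding indep_mod_def by blast
 thus ?thesis by(intro exI[of _ "%i. a (f i)"]) (auto simp: sum.reindex[OF True])
qed

lemma qd_image_le:
 assumes f: "Vector_Spaces.linear scale scale f" and W': "subspace W'"
  and c: "!!x. x:U' ==> EX u:U. x - f u:W'" and d: "!!w. w:W ==> f w:W'"
  and z: "0:W"
 shows "qd U' W' <= qd U W"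
proof -
 obtain h where h: "!!x. x:U' ==> h x:U & x - f (h x):W'" using c by metis
 have v: "vspace scale" by unfold_locales
 show ?thesis
 proof(rule qd_le_relation[OF v v, where f=h])
  fix B a assume B: "finite B" "B <= U'" and s: "(SUM b:B. scale (a b) (h b)):W"
  have "(SUM b:B. scale (a b) b) = (SUM b:B. scale (a b) (b - f (h b))) + (SUM b:B. scale (a b) (f (h b)))"
   by(simp add: sum.distrib[symmetric] scale_right_diff_distrib)
  also have "(SUM b:B. scale (a b) (f (h b))) = f (SUM b:B. scale (a b) (h b))"
  proof -
   interpret f: Vector_Spaces.linear scale scale f by fact
   show ?thesis by(simp add: f.sum f.scale)
  qed
  finally show "(SUM b:B. scale (a b) b):W'"
   using d[OF s] h B W' by(auto intro!: subspace_add subspace_sum subspace_scale)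
 qed (use h z in auto)
qed

end

section \<open>The ground field\<close>

locale ground =
 fixes em :: "'k::alg_closed_field => 'K::field"
 assumes emb: "field_embedding em"
begin

lemma i_1 [simp]: "em 1 = 1" and i_add: "em (a + b) = em a + em b" and i_mult: "em (a*b) = em a*em b"
 using emb unfolding field_embedding_def by blast+

lemma i_0 [simp]: "em 0 = 0"
proof -
 have "em 0 + em 0 = em 0 + 0" using i_add[of 0 0] by(simp del: add_cancel_left_left add_cancel_right_right)
 thus ?thesis by(rule add_left_imp_eq)
qed

lemma i_neg: "em (- a) = - em a"
proof -
 have "em a + em (- a) = 0" using i_add[of a "- a"] by simp
 thus ?thesis by(simp add: eq_neg_iff_add_eq_0 add.commute)
qed

lemma i_diff: "em (a - b) = em a - em b"
 using i_add[of a "- b"] by(simp add: i_neg)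

lemma i_eq_0 [simp]: "em a = 0 \<longleftrightarrow> a = 0"
proof
 assume z: "em a = 0"
 show "a = 0"
 proof(rule ccontr)
  assume "a ~= 0"
  hence "em a*em (inverse a) = 1" by(simp add: i_mult[symmetric])
  thus False using z by simp
 qed
qed simp

lemma i_inj: "em a = em b \<longleftrightarrow> a = b"
 using i_eq_0[of "a - b"] by(simp add: i_diff)

lemma i_inverse: "em (inverse a) = inverse (em a)"
proof(cases "a = 0")
 case False
 hence "em a*em (inverse a) = 1" by(simp add: i_mult[symmetric])
 thus ?thesis by(simp add: inverse_unique)
qed simp

lemma i_divide: "em (a/b) = em a/em b" by(simp add: divide_inverse i_mult i_inverse)

lemma range_subring: "is_subring (range em)"
 unfolding is_subring_def
 by(auto simp: i_diff[symmetric] i_mult[symmetric]) (metis i_1 rangeI)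

sublocale kv: vspace "%c x. em c*x"
 by unfold_locales (auto simp: i_add i_mult algebra_simps)

sublocale ka: vspace "%c (r :: 'K set => 'K) P. em c*r P"
 by unfold_locales (auto simp: i_add i_mult algebra_simps fun_eq_iff)

abbreviation "ag == alg_gen em"
abbreviation "ksub == kv.subspace"
lemmas ksub_0 = kv.subspace_0 and ksub_add = kv.subspace_add and ksub_scale = kv.subspace_scale and ksub_diff = kv.subspace_diff and ksub_sum = kv.subspace_sum
abbreviation "qdK == quot_dim (%c x. em c*x)"

lemma linear_mult: "Vector_Spaces.linear (%c x. em c*x) (%c x. em c*x) (%x. y*x)"
 by unfold_locales (auto simp: algebra_simps)

lemma subspace_iff: "ksub N \<longleftrightarrow> submod (range em) N"
 unfolding kv.subspace_def submod_def by auto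

lemma submod_subspace: "submod R N ==> range em <= R ==> ksub N"
 unfolding subspace_iff by(rule submod_mono)

lemma subring_subspace: "is_subring R ==> range em <= R ==> ksub R"
 using submod_subspace submod_self by blast

lemma ksub_image: "ksub N ==> ksub (c ** N)"
 unfolding subspace_iff by(rule submod_image)

lemma subspace_Int: "ksub M ==> ksub N ==> ksub (M Int N)"
 by(rule kv.subspace_inter)

lemma qd_mult_le: "qdK (y ** U) (y ** W) <= qdK U W" if "ksub W"
 by(rule kv.qd_image_le[OF linear_mult[of y] ksub_image[OF that]])
   (use ksub_0[OF that] ksub_0[OF ksub_image[OF that]] in "auto intro!: bexI")

lemma qd_mult:
 assumes "y ~= 0" "ksub W"
 shows "qdK (y ** U) (y ** W) = qdK U W"
proof(rule antisym)
 have e: "inverse y ** y ** U = U" for U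
  using assms(1) by(auto simp: image_image mult.assoc[symmetric])
 show "qdK U W <= qdK (y ** U) (y ** W)"
  using qd_mult_le[OF ksub_image[OF assms(2), of y], of "inverse y" "y ** U"]
  by(simp only: e)
qed (rule qd_mult_le[OF assms(2)])

definition ev :: "'k poly => 'K => 'K" where
 "ev p t = poly (map_poly em p) t"

lemma ev_0 [simp]: "ev 0 t = 0" by(simp add: ev_def)

lemma ev_pCons: "ev (pCons a p) t = em a + t*ev p t"
 by(simp add: ev_def map_poly_pCons)

lemma ev_add: "ev (p + q) t = ev p t + ev q t"
proof -
 have "map_poly em (p + q) = map_poly em p + map_poly em q"
  by(rule poly_eqI) (simp add: coeff_map_poly i_add)
 thus ?thesis by(simp add: ev_def)
qed

lemma ev_smult: "ev (smult a p) t = em a*ev p t"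
proof -
 have "map_poly em (smult a p) = smult (em a) (map_poly em p)"
  by(rule poly_eqI) (simp add: coeff_map_poly i_mult)
 thus ?thesis by(simp add: ev_def)
qed

lemma ev_mult: "ev (p*q) t = ev p t*ev q t"
 by(induction p) (auto simp: ev_pCons ev_add ev_smult algebra_simps)

lemma ev_sum: "ev (SUM i:I. f i) t = (SUM i:I. ev (f i) t)"
 by(induction I rule: infinite_finite_induct) (auto simp: ev_add)

lemma ev_monom: "ev (monom a n) t = em a*t^n"
 by(induction n) (auto simp: monom_0 monom_Suc ev_pCons)

lemma ev_sum_monom: "ev (SUM i<=n. monom (a i) i) t = (SUM i<=n. em (a i)*t^i)"
 by(simp add: ev_sum ev_monom)

lemma ev_subring: "is_subring R ==> range em <= R ==> t:R ==> ev p t:R"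
 by(induction p) (auto simp: ev_pCons intro!: subring_intros)

lemma ev_split:
 assumes M: "!!x y. x:M ==> y:M ==> x*y:M" "!!c. c ~= 0 ==> em c:M" "!!a. t - em a:M"
  and "p ~= 0"
 shows "ev p t:M"
 using `p ~= 0`
proof(induction "degree p" arbitrary: p rule: less_induct)
 case less
 show ?case
 proof(cases "degree p = 0")
  case True
  then obtain c where "p = [:c:]" using degree_eq_zeroE by blast
  thus ?thesis using less M(2) by(auto simp: ev_pCons)
 next
  case False
  then obtain a where "poly p a = 0" using alg_closed_imp_poly_has_root[of p] by auto
  then obtain q where q: "p = [:- a, 1:]*q" by(metis dvd_def poly_eq_0_iff_dvd)
  hence "q ~= 0" using less by auto
  moreover have "degree q < degree p" using q `q ~= 0` by(simp add: degree_mult_eq del: mult_pCons_left)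
  ultimately have "ev q t:M" using less by blast
  moreover have "ev p t = (t - em a)*ev q t"
   unfolding q ev_mult by(simp add: ev_pCons i_neg)
  ultimately show ?thesis using M by simp
 qed
qed

definition VR :: "'K set => bool" where
 "VR W \<longleftrightarrow> valuation_ring W & range em <= W"

lemma VR_subring: "VR W ==> is_subring W" by(simp add: VR_def valuation_subring)
lemma VR_val: "VR W ==> valuation_ring W" by(simp add: VR_def)
lemma VR_i: "VR W ==> em a:W" by(auto simp: VR_def)

lemma VR_UNIV: "VR UNIV" by(simp add: VR_def valuation_ring_def)

lemma i_nonunits: "is_subring W ==> range em <= W ==> em a:nu W \<longleftrightarrow> a = 0"
 by(auto simp: nonunits_def i_inverse[symmetric] subring_0)

lemma VR_extension:
 assumes "is_subring R" "range em <= R" "b:R" "inverse b ~: R"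
 obtains W where "VR W" "W ~= UNIV" "R <= W" "b:nu W"
proof -
 obtain W where W: "valuation_ring W" "R <= W" "b:nu W"
  using valuation_ring_extension[OF assms(1,3,4)] by blast
 have "b ~= 0" using assms(1,4) subring_0 by fastforce
 hence "W ~= UNIV" using W by(auto simp: nonunits_def)
 thus ?thesis using that W assms(2) by(auto simp: VR_def)
qed

lemma nonunits_nontrivial: "x:nu W ==> x ~= 0 ==> W ~= UNIV"
 by(auto simp: nonunits_def)

text \<open>As k is algebraically closed, an element c outside k is transcendental, so 1/c is not invertible in k[1/c]
  and some place has a pole of c.\<close>
lemma const_if_in_all_VR:
 assumes "!!W. VR W ==> W ~= UNIV ==> c:W"
 shows "c:range em"
proof(rule ccontr)
 assume n: "c ~: range em"
 hence c0: "c ~= 0" by(metis i_0 rangeI)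
 let ?S = "adjoin (range em) (inverse c)"
 have S: "is_subring ?S" "range em <= ?S" "inverse c:?S"
  using adjoin_subring adjoin_superset adjoin_elem range_subring by blast+
 have "c ~: ?S"
 proof
  assume "c:?S"
  then obtain m f where f: "!!i. f i:range em" "c = (SUM i<=m. f i*inverse c^i)" by(rule adjoin_repr) blast
  hence "EX a. f i = em a" for i by(metis imageE)
  then obtain a where a: "!!i. f i = em (a i)" by metis
  have "c^m*c = (SUM i<=m. f i*c^(m - i))"
   by(subst (2) f(2)) (use c0 in "auto simp: sum_distrib_left power_diff field_simps power_inverse intro!: sum.cong")
  hence e: "c^Suc m = (SUM i<=m. f i*c^(m - i))" by(simp only: power_Suc2)
  define q where "q = (SUM i<=m. monom (a i) (m - i))"
  define p where "p = monom 1 (Suc m) - q"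
  have dq: "degree q <= m" unfolding q_def by(rule degree_sum_le) (auto intro: order.trans[OF degree_monom_le])
  have "coeff q (Suc m) = 0" using dq by(intro coeff_eq_0) simp
  hence "coeff p (Suc m) = 1" by(simp add: p_def)
  hence "p ~= 0" by auto
  have "ev p c:{x. x ~= 0}"
   by(rule ev_split[OF _ _ _ `p ~= 0`]) (use n in auto)
  moreover have "ev p c = 0"
  proof -
   have "ev p c = ev (monom 1 (Suc m) + smult (-1) q) c" by(simp add: p_def)
   also have "... = 0" unfolding ev_add ev_smult q_def ev_sum ev_monom using e a by(simp add: i_neg)
   finally show ?thesis .
  qed
  ultimately show False by simp
 qed
 hence "inverse (inverse c) ~: ?S" by simp
 then obtain W where W: "VR W" "W ~= UNIV" "?S <= W" "inverse c:nu W"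
  by(rule VR_extension[OF S])
 hence "c:W" using assms by blast
 moreover have "c ~: W" using W(4) c0 by(simp add: nonunits_def)
 ultimately show False by simp
qed

lemma k_infinite: "infinite (UNIV :: 'k set)"
proof
 assume f: "finite (UNIV :: 'k set)"
 define p where "p = (PROD a:(UNIV :: 'k set). [:- a, 1:]) + 1"
 have "poly p a = 1" for a
  using f by(simp add: p_def poly_prod)
 moreover have "degree p > 0"
 proof -
  have "degree (PROD a:(UNIV :: 'k set). [:- a, 1:]) = (SUM a:(UNIV :: 'k set). 1)"
   by(subst degree_prod_eq_sum_degree) auto
  also have "... > 0" using f by(simp add: card_gt_0_iff)
  finally show ?thesis unfolding p_def by(subst degree_add_eq_left) auto
 qed
 ultimately show False using alg_closed_imp_poly_has_root[of p] by simp
qed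

text \<open>Local rings with residue field k.\<close>

definition rat_ring :: "'K set => bool" where
 "rat_ring R \<longleftrightarrow> is_subring R & range em <= R & (ALL x:R. EX a. x - em a:nu R) &
   (ALL x:nu R. ALL y:nu R. x + y:nu R)"

lemma rat_subring: "rat_ring R ==> is_subring R" and rat_i: "rat_ring R ==> em a:R"
 and rat_res: "rat_ring R ==> x:R ==> EX a. x - em a:nu R"
 and rat_add: "rat_ring R ==> x:nu R ==> y:nu R ==> x + y:nu R"
 and rat_range: "rat_ring R ==> range em <= R"
 unfolding rat_ring_def by blast+

lemma rat_nonunits_submod: "rat_ring R ==> submod R (nu R)"
 unfolding submod_def using nonunits_0 nonunits_mult rat_add rat_subring by blast

lemma rat_qd_nonunits:
 assumes R: "rat_ring R" shows "qdK R (nu R) <= 1"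
proof(rule kv.qd_leI)
 fix B assume B: "finite B" "B <= R" and ind: "kv.indep_mod (nu R) B"
 show "enat (card B) <= 1"
 proof(rule ccontr)
  assume "~ ?thesis"
  hence c: "card B > 1" by(simp add: one_enat_def)
  then obtain x y where xy: "x:B" "y:B" "x ~= y"
   by(metis card_le_Suc0_iff_eq B(1) not_less_eq One_nat_def linorder_not_le)
  obtain a b where ab: "x - em a:nu R" "y - em b:nu R" using rat_res[OF R] xy B by blast
  have key: "em c*x + em d*y:nu R ==> c = 0 & d = 0" for c d
  proof -
   assume s: "em c*x + em d*y:nu R"
   define e where "e z = (if z = x then c else if z = y then d else 0)" for z
   have "(SUM z:B. em (e z)*z) = (SUM z:{x,y}. em (e z)*z)"
    by(rule sum.mono_neutral_right) (use B xy in "auto simp: e_def")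
   hence "(SUM z:B. em (e z)*z):nu R" using s xy by(simp add: e_def)
   hence "ALL z:B. e z = 0" using ind unfolding kv.indep_mod_def by blast
   thus ?thesis using xy by(auto simp: e_def split: if_splits)
  qed
  have "em b*(x - em a) + em (- a)*(y - em b):nu R"
   using ab rat_add[OF R] nonunits_mult[OF rat_subring[OF R]] rat_i[OF R] by blast
  hence "em b*x + em (- a)*y:nu R" by(simp add: i_neg algebra_simps)
  from key[OF this] have "a = 0" by simp
  hence "em 1*x + em 0*y:nu R" using ab by simp
  from key[OF this] show False by simp
 qed
qed

text \<open>R/J is filtered by the images of the ideals J + s^i R with i \<le> N, and each quotient is an image of
  R/(J + sR).\<close>
lemma finite_colength_step:
 assumes R: "rat_ring R" and J: "submod R J" "J <= R" and s: "s:R" and sN: "s^N:J"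
  and fin: "qdK R {x + s*r |x r. x:J & r:R} < \<infinity>"
 shows "qdK R J < \<infinity>"
proof -
 note Rs = rat_subring[OF R]
 define F where "F i = {x + s^i*r |x r. x:J & r:R}" for i
 have Fsub: "ksub (F i)" for i
 proof -
  have "submod R (F i)" unfolding submod_def
  proof(intro conjI ballI)
   show "0:F i" unfolding F_def using submod_0[OF J(1)] subring_0[OF Rs] by force
   fix x y assume "x:F i" "y:F i"
   then obtain a b c d where "x = a + s^i*b" "y = c + s^i*d" "a:J" "b:R" "c:J" "d:R"
    unfolding F_def by blast
   hence "x + y = (a + c) + s^i*(b + d)" "a + c:J" "b + d:R"
    using submod_add[OF J(1)] subring_add[OF Rs] by(auto simp: algebra_simps)
   thus "x + y:F i" unfolding F_def by blast
  next
   fix r x assume "r:R" "x:F i"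
   then obtain a b where "x = a + s^i*b" "a:J" "b:R" unfolding F_def by blast
   hence "r*x = r*a + s^i*(r*b)" "r*a:J" "r*b:R"
    using submod_scale[OF J(1) `r : R` `a : J`] subring_mult[OF Rs `r : R` `b : R`] by(auto simp: algebra_simps)
   thus "r*x:F i" unfolding F_def by blast
  qed
  thus ?thesis using submod_subspace rat_range[OF R] by blast
 qed
 have dec: "F (Suc i) <= F i" for i
 proof
  fix x assume "x:F (Suc i)"
  then obtain a b where "x = a + s^Suc i*b" "a:J" "b:R" unfolding F_def by blast
  hence "x = a + s^i*(s*b)" "s*b:R" using subring_mult[OF Rs] s by auto
  thus "x:F i" unfolding F_def using `a : J` by blast
 qed
 have F0: "F 0 = R"
 proof
  show "F 0 <= R" unfolding F_def using J(2) subring_add[OF Rs] by auto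
  show "R <= F 0" unfolding F_def using submod_0[OF J(1)] by force
 qed
 have FN: "F N = J"
 proof
  show "F N <= J" unfolding F_def using submod_add[OF J(1)] submod_scale[OF J(1) _ sN] by(auto simp: mult.commute)
  show "J <= F N" unfolding F_def using subring_0[OF Rs] by force
 qed
 have F1: "F 1 = {x + s*r |x r. x:J & r:R}" by(simp add: F_def)
 have step: "qdK (F i) (F (Suc i)) <= qdK R (F 1)" for i
 proof(rule kv.qd_image_le[OF linear_mult[of "s^i"]])
  show "ksub (F (Suc i))" by(rule Fsub)
  show "EX u:R. x - s^i*u:F (Suc i)" if xF: "x:F i" for x
  proof -
   obtain a b where "x = a + s^i*b" "a:J" "b:R" using xF unfolding F_def by blast
   moreover have "a:F (Suc i)" unfolding F_def using `a : J` subring_0[OF Rs] by force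
   ultimately show ?thesis by(intro bexI[of _ b]) auto
  qed
  show "s^i*w:F (Suc i)" if wF: "w:F 1" for w
  proof -
   obtain a b where "w = a + s*b" "a:J" "b:R" using wF unfolding F_def by auto
   hence "s^i*w = s^i*a + s^Suc i*b" "s^i*a:J"
    using submod_scale[OF J(1) subring_power[OF Rs s]] by(auto simp: algebra_simps)
   thus ?thesis unfolding F_def using `b : R` by blast
  qed
  show "0:F 1" using ksub_0[OF Fsub] .
 qed
 have sub0: "F i <= R" for i
  by(induction i) (use F0 dec in auto)
 have "qdK R (F i) < \<infinity>" for i
 proof(induction i)
  case 0 thus ?case using F0 kv.qd_self[OF Fsub, of 0] by simp
 next
  case (Suc i)
  have "qdK R (F (Suc i)) = qdK R (F i) + qdK (F i) (F (Suc i))"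
   by(rule kv.qd_add) (use Fsub dec sub0 subring_subspace[OF Rs rat_range[OF R]] in auto)
  moreover have "qdK (F i) (F (Suc i)) < \<infinity>" by(rule le_less_trans[OF step]) (use fin F1 in simp)
  ultimately show ?case using Suc by(auto simp: plus_eq_infty_iff_enat)
 qed
 thus ?thesis using FN by metis
qed

text \<open>Some power of each generator of the maximal ideal lies in xR, so the generators can be removed one at a
  time from the ideal they generate with x, starting from the maximal ideal, which has codimension one.\<close>
lemma finite_colength:
 assumes R: "rat_ring R" and S: "finite S" "nu R = lspan R S" and x: "x:R"
  and nil: "!!y. y:nu R ==> EX N. y^N:x ** R"
 shows "qdK R (x ** R) < \<infinity>"
proof -
 note Rs = rat_subring[OF R]
 let ?I = "x ** R"
 define J where "J T = {a + b |a b. a:?I & b:lspan R T}" for T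
 have I: "submod R ?I" using submod_image[OF submod_self[OF Rs]] .
 have IR: "?I <= R" using subring_mult[OF Rs x] by auto
 have SR: "S <= R" using lin_span_base[OF Rs, of _ S] S(2) nonunits_sub by blast
 have LR: "lspan R T <= R" if "T <= S" for T
  using lin_span_submod[OF submod_self[OF Rs]] that SR by blast
 have Jsub: "submod R (J T)" for T unfolding submod_def
 proof(intro conjI ballI)
  show "0:J T" unfolding J_def using submod_0[OF I] lin_span_0 by force
  fix y z assume "y:J T" "z:J T"
  then obtain a b c d where "y = a + b" "z = c + d" "a:?I" "b:lspan R T" "c:?I" "d:lspan R T"
   unfolding J_def by blast
  hence "y + z = (a + c) + (b + d)" "a + c:?I" "b + d:lspan R T"
   using submod_add[OF I] lin_span_add[OF Rs] by(auto simp: algebra_simps simp del: image_iff)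
  thus "y + z:J T" unfolding J_def by blast
 next
  fix r y assume r: "r:R" "y:J T"
  then obtain a b where "y = a + b" "a:?I" "b:lspan R T" unfolding J_def by blast
  hence "r*y = r*a + r*b" "r*a:?I" "r*b:lspan R T"
   using submod_scale[OF I r(1)] lin_span_scale[OF Rs _ r(1)] by(auto simp: algebra_simps simp del: image_iff)
  thus "r*y:J T" unfolding J_def by blast
 qed
 have main: "qdK R (J (S - T)) < \<infinity>" if "finite T" "T <= S" for T
  using that
 proof(induction T rule: finite_induct)
  case empty
  have "nu R <= J S" unfolding J_def using S(2) submod_0[OF I] by force
  hence "qdK R (J S) <= qdK R (nu R)" by(intro kv.qd_mono) auto
  also have "... <= 1" by(rule rat_qd_nonunits[OF R])
  also have "1 < (\<infinity> :: enat)" by(simp add: one_enat_def)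
  finally show ?case by simp
 next
  case (insert s T)
  let ?J = "J (S - insert s T)"
  have s: "s:S" "s ~: T" using insert by auto
  have sn: "s:nu R" using lin_span_base[OF Rs s(1)] S by simp
  obtain N where N: "s^N:?I" using nil[OF sn] by blast
  have 1: "s^N:?J" unfolding J_def using N lin_span_0 by force
  have 2: "?J <= R" unfolding J_def using IR LR[of "S - insert s T"] subring_add[OF Rs] by blast
  have "J (S - T) <= {y + s*r |y r. y:?J & r:R}"
  proof
   fix y assume "y:J (S - T)"
   then obtain a b where ab: "y = a + b" "a:?I" "b:lspan R (S - T)" unfolding J_def by blast
   obtain U c where U: "finite U" "U <= S - T" "ALL t:U. c t:R" "b = (SUM t:U. c t*t)"
    using ab(3) unfolding lin_span_def by blast
   have "b = (SUM t:U - {s}. c t*t) + s*(if s:U then c s else 0)"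
    unfolding U(4) using U(1) by(auto simp: sum.remove[of U s] mult.commute)
   moreover have "(SUM t:U - {s}. c t*t):lspan R (S - insert s T)"
    unfolding lin_span_def using U by(intro CollectI exI[of _ "U - {s}"] exI[of _ c]) auto
   moreover have "(if s:U then c s else 0):R" using U subring_0[OF Rs] by auto
   ultimately have "y = (a + (SUM t:U - {s}. c t*t)) + s*(if s:U then c s else 0)"
     "a + (SUM t:U - {s}. c t*t):?J" "(if s:U then c s else 0):R"
    using ab unfolding J_def by auto
   thus "y:{y + s*r |y r. y:?J & r:R}" by blast
  qed
  hence "qdK R {y + s*r |y r. y:?J & r:R} <= qdK R (J (S - T))" by(intro kv.qd_mono) auto
  also have "... < \<infinity>" using insert by auto
  finally show ?case
   using finite_colength_step[OF R Jsub 2 _ 1] s SR by blast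
 qed
 have "J {} = ?I" unfolding J_def lin_span_def by auto
 thus ?thesis using main[of S] S(1) by simp
qed

end

section \<open>Places with residue field k\<close>

lemma finite_image_factor:
 assumes "finite (f ` S)" and det: "!!x y. x:S ==> y:S ==> f x = f y ==> g x = g y"
 shows "finite (g ` S)"
proof -
 have "g x:(%r. g (SOME y. y:S & f y = r)) ` f ` S" if x: "x:S" for x
 proof -
  let ?y = "SOME y. y:S & f y = f x"
  have "?y:S & f ?y = f x" by(rule someI[where x=x]) (use x in auto)
  hence "g x = g ?y" using det[of x ?y] x by simp
  thus ?thesis by(intro image_eqI[of _ _ "f x"] imageI x)
 qed
 hence "g ` S <= (%r. g (SOME y. y:S & f y = r)) ` f ` S" by blast
 thus ?thesis using assms(1) finite_subset by blast
qed

context ground begin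

lemma alg_gen_residues:
 assumes "!!t. t:T ==> EX c. t - em c:N"
  and N: "0:N" "!!x y. x:N ==> y:N ==> x - y:N" "!!x y. x:N ==> y:B ==> x*y:N"
  and B: "is_subring B" "range em <= B" "T <= B" and x: "x:ag T"
 shows "x:B & (EX c. x - em c:N)"
proof -
 let ?A = "{x:B. EX c. x - em c:N}"
 have "is_subring ?A" unfolding is_subring_def
 proof(intro conjI ballI)
  show "1:?A" using N(1) subring_1[OF B(1)] by(auto intro!: exI[of _ 1])
  fix x y assume "x:?A" "y:?A"
  then obtain c d where cd: "x:B" "y:B" "x - em c:N" "y - em d:N" by blast
  have e: "x - y - em (c - d) = (x - em c) - (y - em d)" by(simp add: i_diff)
  have "x - y - em (c - d):N" unfolding e by(rule N(2)) (use cd in auto)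
  thus "x - y:?A" using cd subring_diff[OF B(1)] by blast
  have e2: "x*y - em (c*d) = (x - em c)*y - (y - em d)*(- em c)" by(simp add: i_mult algebra_simps)
  have "(x - em c)*y:N" "(y - em d)*(- em c):N"
   using N(3) cd B subring_neg[OF B(1)] by blast+
  hence "x*y - em (c*d):N" unfolding e2 by(rule N(2))
  thus "x*y:?A" using cd subring_mult[OF B(1)] by blast
 qed
 moreover have "range em <= ?A" using B(2) N(1) by auto (metis diff_self)
 moreover have "T <= ?A" using B(3) assms(1) by auto
 ultimately have "ag T <= ?A" by(rule alg_gen_least)
 thus ?thesis using x by blast
qed

lemma nonunits_loc_generated:
 assumes T: "finite T" and W: "VR W" and TW: "ag T <= W"
  and rat: "!!t. t:T ==> EX a. t - em a:nu W"
 shows "EX S. finite S & nu (loc (ag T) W) = lspan (loc (ag T) W) S"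
proof -
 let ?A = "ag T" let ?P = "loc ?A W"
 note A = alg_gen_subring[of em T] and Wv = VR_val[OF W] and Ws = VR_subring[OF W]
 have P: "is_subring ?P" "?A <= ?P" "?P <= W" "nu ?P = nu W Int ?P"
  using loc_subring[OF A Wv TW] loc_sup[OF A Wv TW] loc_sub[OF A Wv TW] loc_nonunits[OF A Wv TW] by blast+
 obtain a where a: "!!t. t:T ==> t - em (a t):nu W" using rat by metis
 define S where "S = (%t. t - em (a t)) ` T"
 have SA: "S <= ?A" unfolding S_def using subring_diff[OF A] alg_gen_base by blast
 have SN: "S <= nu ?P" unfolding P(4) S_def using a SA[unfolded S_def] P(2) by blast
 have sub: "submod ?P (nu ?P)" unfolding submod_def P(4)
  using nonunits_0[OF Ws] subring_0[OF P(1)] val_nonunits_add[OF Wv] subring_add[OF P(1)] nonunits_mult[OF Ws] subring_mult[OF P(1)] P(3)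
  by(auto 0 3)
 have 1: "lspan ?P S <= nu ?P" by(rule lin_span_submod[OF sub SN])
 let ?N = "lspan ?P S"
 have res: "x:?P & (EX c. x - em c:?N)" if x: "x:?A" for x
 proof(rule alg_gen_residues[OF _ _ _ _ P(1) _ _ x])
  show "EX c. t - em c:?N" if "t:T" for t
   using lin_span_base[OF P(1), of "t - em (a t)" S] that unfolding S_def by blast
  show "0:?N" by(rule lin_span_0)
  show "x - y:?N" if "x:?N" "y:?N" for x y
   using submod_diff[OF P(1) submod_lin_span[OF P(1)]] that by blast
  show "x*y:?N" if "x:?N" "y:?P" for x y
   using lin_span_scale[OF P(1)] that by(metis mult.commute)
  show "range em <= ?P" "T <= ?P" using P(2) alg_gen_base by blast+
 qed
 have "nu ?P <= ?N"
 proof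
  fix x assume x: "x:nu ?P"
  then obtain u v where uv: "x = u/v" "u:?A" "v:?A" "v ~: nu W"
   using loc_iff nonunits_sub by metis
  have v0: "v ~= 0" using uv nonunits_0[OF Ws] by auto
  have vP: "v:?P" using uv P by blast
  have iv: "1/v:?P" unfolding loc_iff using uv subring_1[OF A] by blast
  have "v*x:nu W" using nonunits_mult[OF Ws] x P(3,4) vP by blast
  hence u: "u:nu W" using uv v0 by simp
  obtain c where c: "u - em c:?N" using res uv by blast
  hence "u - em c:nu W" using 1 P(4) by blast
  hence "u - (u - em c):nu W" using val_nonunits_diff[OF Wv u] by blast
  hence "c = 0" using i_nonunits[OF Ws] W by(simp add: VR_def)
  hence "u:?N" using c by simp
  hence "1/v*u:?N" by(rule lin_span_scale[OF P(1) _ iv])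
  thus "x:?N" using uv by simp
 qed
 thus ?thesis using 1 T S_def by(intro exI[of _ S]) auto
qed

end

text \<open>The assumption says that every place has residue field k. For a complete curve it follows from
  \<open>point_residue\<close>.\<close>
locale rplaces = ground em for em :: "'k::alg_closed_field => 'K::field" +
 assumes PR: "VR W ==> W ~= UNIV ==> t:W ==> EX a. t - em a:nu W"
begin

lemma VR_rat_ring: "VR W ==> W ~= UNIV ==> rat_ring W"
 unfolding rat_ring_def using VR_subring VR_val PR val_nonunits_add VR_i by blast

lemma residue_unique:
 assumes "VR W" "t - em a:nu W" "t - em b:nu W" shows "a = b"
proof -
 have "(t - em b) - (t - em a):nu W" using val_nonunits_diff VR_val assms by blast
 hence "em (a - b):nu W" by(simp add: i_diff)
 thus ?thesis using i_nonunits[OF VR_subring[OF assms(1)]] assms(1) by(auto simp: VR_def)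
qed

text \<open>If no nonzero polynomial in t were divisible by b, then inverting all of them would leave b a nonunit, and
  at a place that dominates this ring the residue of t would not be in k. So the residues of t at the zeros of b are
  among finitely many roots, and the residues of the generators determine the prime ideal.\<close>
lemma chart_finite:
 assumes T: "finite T" and b: "b:ag T" "b ~= 0"
 shows "finite {ag T Int nu W |W. VR W & ag T <= W & b:nu W}"
proof -
 let ?A = "ag T"
 note A = alg_gen_subring[of em T]
 have alg: "EX f. f ~= 0 & ev f t/b:?A" if t: "t:T" for t
 proof(rule ccontr)
  assume n: "~ ?thesis"
  have tA: "t:?A" using t alg_gen_base by blast
  have nz: "ev f t ~= 0" if "f ~= 0" for f
   using n that subring_0[OF A] by force
  have evA: "ev f t:?A" for f using ev_subring[OF A _ tA] alg_gen_base by blast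
  \<comment> \<open>The ring A with all nonzero polynomials in t inverted.\<close>
  define B where "B = {a/ev f t |a f. a:?A & f ~= 0}"
  have B: "is_subring B" unfolding is_subring_def
  proof(intro conjI ballI)
   show "1:B" unfolding B_def using subring_1[OF A] by(intro CollectI exI[of _ 1] exI[of _ "1 :: 'k poly"]) (auto simp: ev_def)
   fix x y assume "x:B" "y:B"
   then obtain a f c h where x: "x = a/ev f t" "a:?A" "f ~= 0" and y: "y = c/ev h t" "c:?A" "h ~= 0"
    unfolding B_def by blast
   have "x - y = (a*ev h t - c*ev f t)/ev (f*h) t"
    using x y nz by(simp add: ev_mult diff_frac_eq)
   moreover have "a*ev h t - c*ev f t:?A" using A x y evA by(auto intro!: subring_intros)
   ultimately show "x - y:B" unfolding B_def using x y no_zero_divisors by blast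
   have "x*y = (a*c)/ev (f*h) t" using x y by(simp add: ev_mult)
   moreover have "a*c:?A" using A x y by(auto intro!: subring_intros)
   ultimately show "x*y:B" unfolding B_def using x y no_zero_divisors by blast
  qed
  have AB: "?A <= B"
  proof
   fix a assume "a:?A"
   moreover have "a = a/ev 1 t" by(simp add: ev_def)
   ultimately show "a:B" unfolding B_def by(intro CollectI exI[of _ a] exI[of _ "1 :: 'k poly"]) auto
  qed
  have "inverse b ~: B"
  proof
   assume "inverse b:B"
   then obtain a f where "inverse b = a/ev f t" "a:?A" "f ~= 0" unfolding B_def by blast
   hence "ev f t/b = a" using nz by(simp add: field_simps)
   thus False using n `a : ?A` `f ~= 0` by blast
  qed
  then obtain W where W: "VR W" "W ~= UNIV" "B <= W" "b:nu W"
   using VR_extension[OF B _ _ `inverse b ~: B`] AB b alg_gen_base by(metis subset_trans subsetD)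
  obtain c where c: "t - em c:nu W" using PR[OF W(1,2), of t] tA AB W by blast
  have e: "ev [:- c, 1:] t = t - em c" by(simp add: ev_pCons i_neg)
  have "1/ev [:- c, 1:] t:B" unfolding B_def using subring_1[OF A] by(intro CollectI exI[of _ 1] exI[of _ "[:- c, 1:]"]) auto
  hence "inverse (t - em c):W" using W e by(auto simp: divide_inverse)
  moreover have "t - em c ~= 0" using nz[of "[:- c, 1:]"] e by simp
  ultimately show False using c by(simp add: nonunits_def)
 qed
 then obtain f where f: "!!t. t:T ==> f t ~= 0 & ev (f t) t/b:?A" by metis
 define Res where "Res W = (\<lambda>t\<in>T. (THE a. t - em a:nu W))" for W
 let ?Ws = "{W. VR W & ?A <= W & b:nu W}"
 have ntr: "W ~= UNIV" if "W:?Ws" for W using that b nonunits_nontrivial by blast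
 have res: "t - em (Res W t):nu W" if W: "W:?Ws" and t: "t:T" for W t
 proof -
  have "t:W" using W t alg_gen_base by blast
  then obtain a where a: "t - em a:nu W" using PR ntr[OF W] W by blast
  have WV: "VR W" using W by simp
  have "EX! a. t - em a:nu W"
   by(rule ex1I[of _ a]) (use a residue_unique[OF WV] in blast)+
  from theI'[OF this] have "t - em (THE a. t - em a:nu W):nu W" .
  thus ?thesis using t by(simp add: Res_def)
 qed
 have inR: "Res W:(\<Pi>\<^sub>E t\<in>T. {a. poly (f t) a = 0})" if W: "W:?Ws" for W
 proof(rule PiE_I)
  fix t assume t: "t:T"
  let ?c = "Res W t"
  have Ws: "is_subring W" using W VR_subring by blast
  have Wn: "rat_ring W" using VR_rat_ring W ntr by blast
  have "b*(ev (f t) t/b):nu W"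
   using nonunits_mult[OF Ws, of b "ev (f t) t/b"] f[OF t] W by(auto simp: mult.commute)
  hence e1: "ev (f t) t:nu W" using b by simp
  have "ev p t - em (poly p ?c):nu W" for p
  proof(induction p)
   case 0 thus ?case using nonunits_0[OF Ws] by simp
  next
   case (pCons a p)
   have tW: "t:W" using W t alg_gen_base by blast
   have "ev (pCons a p) t - em (poly (pCons a p) ?c) = t*(ev p t - em (poly p ?c)) + em (poly p ?c)*(t - em ?c)"
    by(simp add: ev_pCons i_add i_mult algebra_simps)
   also have "... : nu W"
    by(rule rat_add[OF Wn nonunits_mult[OF Ws pCons.IH tW] nonunits_mult[OF Ws res[OF W t] rat_i[OF Wn]]])
   finally show ?case .
  qed
  hence "ev (f t) t - (ev (f t) t - em (poly (f t) ?c)):nu W"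
   using val_nonunits_diff[OF VR_val e1] W by blast
  thus "?c:{a. poly (f t) a = 0}" using i_nonunits[OF Ws] W by(auto simp: VR_def)
 qed (simp add: Res_def)
 have fin: "finite (Res ` ?Ws)"
 proof(rule finite_subset)
  show "Res ` ?Ws <= (\<Pi>\<^sub>E t\<in>T. {a. poly (f t) a = 0})" using inR by blast
  show "finite (\<Pi>\<^sub>E t\<in>T. {a. poly (f t) a = 0})"
   using T f by(intro finite_PiE) (auto simp: poly_roots_finite)
 qed
 have det: "?A Int nu W <= nu W'" if W: "W:?Ws" "W':?Ws" "Res W = Res W'" for W W'
 proof
  fix x assume x: "x:?A Int nu W"
  have W1: "VR W" "VR W'" "?A <= W" "?A <= W'" using W by auto
  note s1 = VR_subring[OF W1(1)] and s2 = VR_subring[OF W1(2)]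
  have "x:W Int W' & (EX c. x - em c:nu W Int nu W')"
  proof(rule alg_gen_residues[of T])
   show "EX c. t - em c:nu W Int nu W'" if "t:T" for t
    using res[OF W(1) that] res[OF W(2) that] W(3) by auto
   show "0:nu W Int nu W'" using nonunits_0 s1 s2 by blast
   show "x - y:nu W Int nu W'" if "x:nu W Int nu W'" "y:nu W Int nu W'" for x y
    using that val_nonunits_diff VR_val W1 by blast
   show "x*y:nu W Int nu W'" if "x:nu W Int nu W'" "y:W Int W'" for x y
    using that nonunits_mult[OF s1, of x y] nonunits_mult[OF s2, of x y] by(auto simp: mult.commute)
   show "is_subring (W Int W')" using s1 s2 by(auto simp: is_subring_def)
   show "range em <= W Int W'" using W1 by(auto simp: VR_def)
   show "T <= W Int W'" using W1 alg_gen_base by blast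
   show "x:?A" using x by blast
  qed
  then obtain c where c: "x - em c:nu W" "x - em c:nu W'" by blast
  have "x - em 0:nu W" using x by simp
  hence "c = 0" using residue_unique[OF W1(1)] c by blast
  thus "x:nu W'" using c by simp
 qed
 have "{?A Int nu W |W. VR W & ?A <= W & b:nu W} = (%W. ?A Int nu W) ` ?Ws" by blast
 moreover have "finite ((%W. ?A Int nu W) ` ?Ws)"
 proof(rule finite_image_factor[OF fin])
  fix W W' assume a: "W:?Ws" "W':?Ws" "Res W = Res W'"
  show "?A Int nu W = ?A Int nu W'"
   using det[OF a] det[OF a(2,1) a(3)[symmetric]] by blast
 qed
 ultimately show ?thesis by simp
qed

end

lemma frac_field_common_denominator:
 assumes P: "is_subring P" and fr: "frac_field P = UNIV" and B: "finite B"
 shows "EX d:P. d ~= 0 & (ALL b:B. d*b:P)"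
 using B
proof(induction B rule: finite_induct)
 case empty thus ?case using subring_1[OF P] by(intro bexI[of _ 1]) auto
next
 case (insert b B)
 then obtain d where d: "d:P" "d ~= 0" "ALL b:B. d*b:P" by blast
 have "b:frac_field P" using fr by simp
 then obtain u v where uv: "b = u/v" "u:P" "v:P" "v ~= 0" unfolding frac_field_def by blast
 have "v*d*x:P" if "x:insert b B" for x
 proof(cases "x = b")
  case True
  hence e: "v*d*x = d*u" using uv by simp
  show ?thesis unfolding e by(rule subring_mult[OF P d(1) uv(2)])
 next
  case False
  hence "v*(d*x):P" using that d uv subring_mult[OF P] by blast
  thus ?thesis by(simp add: mult.assoc)
 qed
 thus ?case using d uv subring_mult[OF P] by(intro bexI[of _ "v*d"]) auto
qed

context ground begin

text \<open>A finite family in N generates a submodule isomorphic to an ideal U of P, and for U the dimension of U/xU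
  is that of P/xP because P/U is finite-dimensional: both complete the same chain from P down to xU.\<close>
lemma krull_akizuki:
 assumes P: "is_subring P" "range em <= P" and fr: "frac_field P = UNIV"
  and fin: "!!z. z:P ==> z ~= 0 ==> qdK P (z ** P) < \<infinity>"
  and x: "x:P" "x ~= 0" and N: "submod P N"
 shows "qdK N (x ** N) <= qdK P (x ** P)"
proof(rule kv.qd_leI)
 fix B assume B: "finite B" "B <= N" "kv.indep_mod (x ** N) B"
 show "enat (card B) <= qdK P (x ** P)"
 proof(cases "B <= {0}")
  case True
  have "B = {}"
  proof(rule ccontr)
   assume "B ~= {}"
   hence "B = {0}" using True by auto
   hence "(SUM b:B. em 1*b):x ** N" using submod_0[OF submod_image[OF N, of x]] by simp
   hence "ALL b:B. (1::'k) = 0"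
    using B(3)[unfolded kv.indep_mod_def, THEN spec, of "%_. 1"] by blast
   thus False using `B = {0}` by simp
  qed
  thus ?thesis by(simp add: zero_enat_def[symmetric])
 next
  case False
  then obtain b where b: "b:B" "b ~= 0" by blast
  obtain d where d: "d:P" "d ~= 0" "ALL b:B. d*b:P"
   using frac_field_common_denominator[OF P(1) fr B(1)] by blast
  define N0 where "N0 = lspan P B"
  define U where "U = d ** N0"
  have N0: "submod P N0" "N0 <= N" "B <= N0"
   unfolding N0_def using submod_lin_span[OF P(1)] lin_span_submod[OF N B(2)] lin_span_base[OF P(1)] by auto
  have U: "submod P U" unfolding U_def by(rule submod_image[OF N0(1)])
  have UP: "U <= P"
  proof -
   have "submod P {y. d*y:P}" unfolding submod_def
    using subring_0[OF P(1)] subring_add[OF P(1)] subring_mult[OF P(1)]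
    by(auto simp: distrib_left mult.left_commute)
   hence "N0 <= {y. d*y:P}" unfolding N0_def by(rule lin_span_submod) (use d in auto)
   thus ?thesis unfolding U_def by auto
  qed
  let ?x = "%S. x ** S"
  have sP: "ksub P" using subring_subspace P by blast
  have sU: "ksub U" using submod_subspace U P by blast
  have s0: "ksub N0" using submod_subspace N0 P by blast
  note sx = ksub_image
  have xU: "?x U <= U" using submod_scale[OF U x(1)] by auto
  have xP: "?x P <= P" using subring_mult[OF P(1) x(1)] by auto
  have "enat (card B) <= qdK N0 (?x N0)"
  proof(rule kv.qd_geI[OF B(1) N0(3)])
   show "kv.indep_mod (?x N0) B" using B(3) N0(2) unfolding kv.indep_mod_def by blast
  qed
  also have "... = qdK U (d ** ?x N0)"
   unfolding U_def by(rule qd_mult[OF d(2) sx[OF s0], symmetric])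
  also have "d ** ?x N0 = ?x U" unfolding U_def by(auto simp: image_image mult.left_commute)
  finally have c: "enat (card B) <= qdK U (?x U)" .
  have "d*b:U" "d*b ~= 0" using b d N0(3) unfolding U_def by auto
  hence "(d*b) ** P <= U" using submod_scale[OF U] by(auto simp: mult.commute)
  hence "qdK P U <= qdK P ((d*b) ** P)" by(intro kv.qd_mono) auto
  also have "... < \<infinity>" by(rule fin) (use `d * b : U` `d * b ~= 0` UP in auto)
  finally have f: "qdK P U < \<infinity>" .
  have 1: "qdK P (?x U) = qdK P U + qdK U (?x U)"
   by(rule kv.qd_add) (use sP sU sx xU UP in auto)
  have "?x U <= ?x P" using UP by auto
  hence 2: "qdK P (?x U) = qdK P (?x P) + qdK (?x P) (?x U)"
   using xP by(intro kv.qd_add sx sP sU) auto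
  have 3: "qdK (?x P) (?x U) = qdK P U" by(rule qd_mult[OF x(2) sU])
  obtain m where "qdK P U = enat m" using f by(rule less_infinityE)
  hence "qdK U (?x U) = qdK P (?x P)" using 1 2 3
   by(cases "qdK U (?x U)"; cases "qdK P (?x P)") auto
  thus ?thesis using c by simp
 qed
qed

lemma poly_relation_residue:
 assumes W: "VR W" and t: "t:W" and p: "p ~= 0" "ev p t:nu W"
 shows "EX a. t - em a:nu W"
proof(rule ccontr)
 assume n: "~ ?thesis"
 note Ws = VR_subring[OF W]
 have "ev p t:{x:W. x ~: nu W}"
 proof(rule ev_split[OF _ _ _ p(1)])
  show "x*y:{x:W. x ~: nu W}" if "x:{x:W. x ~: nu W}" "y:{x:W. x ~: nu W}" for x y
   using that val_nonunits_prime[OF Ws, of x y] subring_mult[OF Ws] by auto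
  show "em c:{x:W. x ~: nu W}" if "c ~= 0" for c
   using that i_nonunits[OF Ws] W VR_i by(auto simp: VR_def)
  show "t - em a:{x:W. x ~: nu W}" for a
   using n subring_diff[OF Ws t VR_i[OF W]] by auto
 qed
 thus False using p by simp
qed

end

section \<open>Complete integral curves\<close>

locale ccurve = ground em for em :: "'k::alg_closed_field => 'K::field" +
 fixes C :: "'K set set"
 assumes C: "complete_integral_curve em C"
begin

lemmas C_scheme = C[unfolded complete_integral_curve_def, THEN conjunct1, unfolded complete_integral_scheme_def]

lemma charts:
 obtains \<T> where "finite \<T>" "!!T. T:\<T> ==> finite T & frac_field (ag T) = UNIV"
  "C = (UN T:\<T>. Spec (ag T))"
 using C_scheme[THEN conjunct1] by(elim exE conjE) blast

lemma center_ex1: "VR W ==> EX! P. P:C & dominates W P"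
 using C_scheme[THEN conjunct2, rule_format, of W] unfolding VR_def .

lemma center_unique: "VR W ==> P:C ==> Q:C ==> dominates W P ==> dominates W Q ==> P = Q"
 using center_ex1 by blast

lemma C_sub: "P:C ==> Q:C ==> Q <= P ==> Q = P \<or> P = UNIV"
 using C[unfolded complete_integral_curve_def, THEN conjunct2, THEN conjunct2] by blast

lemma C_nontriv: "EX P:C. P ~= UNIV"
 using C[unfolded complete_integral_curve_def, THEN conjunct2, THEN conjunct1] .

lemma point_chart:
 assumes "P:C"
 obtains T p where "finite T" "frac_field (ag T) = UNIV" "prime_ideal (ag T) p"
  "P = localization (ag T) p"
  "!!W. VR W ==> ag T <= W ==> loc (ag T) W:C"
proof -
 obtain \<T> where \<T>: "finite \<T>" "!!T. T:\<T> ==> finite T & frac_field (ag T) = UNIV"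
  "C = (UN T:\<T>. Spec (ag T))" by(rule charts) blast
 then obtain T where T: "T:\<T>" "P:Spec (ag T)" using assms by blast
 then obtain p where p: "prime_ideal (ag T) p" "P = localization (ag T) p"
  unfolding Spec_def by blast
 show ?thesis
 proof(rule that[OF _ _ p])
  show "loc (ag T) W:C" if "VR W" "ag T <= W" for W
   using loc_in_Spec[OF alg_gen_subring VR_val[OF that(1)] that(2)] T \<T> by blast
 qed (use \<T> T in auto)
qed

lemma localization_subring:
 assumes A: "is_subring A" and p: "prime_ideal A p"
 shows "is_subring (localization A p)" and "A <= localization A p"
proof -
 have p0: "b ~= 0" if "b ~: p" for b using that p unfolding prime_ideal_def by blast
 have p1: "1 ~: p" using p unfolding prime_ideal_def by blast
 have pp: "b*d ~: p" if "b:A" "d:A" "b ~: p" "d ~: p" for b d using that p unfolding prime_ideal_def by blast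
 show 1: "A <= localization A p"
 proof
  fix x assume "x:A"
  thus "x:localization A p" unfolding localization_def
   using p1 subring_1[OF A] by(intro CollectI exI[of _ x] exI[of _ 1]) auto
 qed
 show "is_subring (localization A p)" unfolding is_subring_def
 proof(intro conjI ballI)
  show "1:localization A p" using 1 subring_1[OF A] by blast
  fix x y assume "x:localization A p" "y:localization A p"
  then obtain a b c d where x: "x = a/b" "a:A" "b:A" "b ~: p"
   and y: "y = c/d" "c:A" "d:A" "d ~: p" unfolding localization_def by blast
  have bd: "b*d:A" "b*d ~: p" using pp x y subring_mult[OF A] by auto
  have nz: "b ~= 0" "d ~= 0" using p0 x y by auto
  show "x - y:localization A p" unfolding localization_def
   by(intro CollectI exI[of _ "a*d - c*b"] exI[of _ "b*d"])
     (use x y nz bd A in "auto simp: field_simps intro!: subring_intros")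
  show "x*y:localization A p" unfolding localization_def
   by(intro CollectI exI[of _ "a*c"] exI[of _ "b*d"])
     (use x y nz bd A in "auto simp: field_simps intro!: subring_intros")
 qed
qed

lemma P_facts:
 assumes "P:C" shows "is_subring P" "range em <= P" "frac_field P = UNIV"
proof -
 obtain T p where T: "finite T" "frac_field (ag T) = UNIV" "prime_ideal (ag T) p"
  "P = localization (ag T) p" by(rule point_chart[OF assms]) blast
 have 1: "is_subring P" "ag T <= P"
  using localization_subring[OF alg_gen_subring T(3)] T(4) by auto
 thus "is_subring P" "range em <= P" using alg_gen_base by blast+
 show "frac_field P = UNIV" using T(2) 1(2) unfolding frac_field_def by fast
qed

lemma point_in_place:
 assumes P: "P:C" and W: "VR W" "W ~= UNIV" and PW: "P <= W"
 shows "dominates W P"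
  "EX T. finite T & frac_field (ag T) = UNIV & ag T <= W & P = loc (ag T) W"
proof -
 obtain T p where T: "finite T" "frac_field (ag T) = UNIV" "prime_ideal (ag T) p"
  "P = localization (ag T) p"
  "!!W. VR W ==> ag T <= W ==> loc (ag T) W:C" by(rule point_chart[OF P]) blast
 let ?A = "ag T"
 have AP: "?A <= P" using localization_subring[OF alg_gen_subring T(3)] T(4) by auto
 hence AW: "?A <= W" using PW by blast
 have in_C: "loc ?A W:C" using T(5) W AW by blast
 have "P <= loc ?A W"
 proof
  fix x assume "x:P"
  then obtain a b where ab: "x = a/b" "a:?A" "b:?A" "b ~: p"
   unfolding T(4) localization_def by blast
  have "1/b:P" unfolding T(4) localization_def using ab subring_1[OF alg_gen_subring] by blast
  hence "inverse b:W" using PW by(auto simp: divide_inverse)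
  moreover have "b ~= 0" using ab T(3) by(auto simp: prime_ideal_def)
  ultimately have "b ~: nu W" by(simp add: nonunits_def)
  thus "x:loc ?A W" unfolding loc_iff using ab by blast
 qed
 moreover have "loc ?A W ~= UNIV" using loc_sub[OF alg_gen_subring VR_val[OF W(1)] AW] W by blast
 ultimately have e: "P = loc ?A W" using C_sub[OF in_C P] by blast
 show "dominates W P" unfolding e by(rule loc_dominates[OF alg_gen_subring VR_val[OF W(1)] AW])
 show "EX T. finite T & frac_field (ag T) = UNIV & ag T <= W & P = loc (ag T) W"
  using T AW e by blast
qed

lemma UNIV_in_C: "UNIV:C"
proof -
 obtain P where P: "P:C" "dominates UNIV P" using center_ex1[OF VR_UNIV] by blast
 have inv: "inverse x:P" if x: "x:P" "x ~= 0" for x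
 proof(rule ccontr)
  assume "inverse x ~: P"
  hence "x:nu P" using x by(simp add: nonunits_def)
  hence "x:nu UNIV" using P by(simp add: dominates_def)
  thus False using x by(simp add: nonunits_def)
 qed
 have "x:P" for x
 proof -
  have "x:frac_field P" using P_facts(3)[OF P(1)] by simp
  then obtain a b where "x = a/b" "a:P" "b:P" "b ~= 0" unfolding frac_field_def by blast
  thus ?thesis using inv subring_mult[OF P_facts(1)[OF P(1)]] by(simp add: divide_inverse)
 qed
 thus ?thesis using P by(metis UNIV_eq_I)
qed

lemma closed_points_iff: "P:cpts C \<longleftrightarrow> P:C & P ~= UNIV"
proof
 assume P: "P:cpts C"
 thus "P:C & P ~= UNIV" using C_nontriv unfolding closed_points_def by blast
next
 assume "P:C & P ~= UNIV"
 thus "P:cpts C" unfolding closed_points_def using C_sub by blast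
qed

lemma generic_point: "generic_point C = UNIV"
 unfolding generic_point_def using UNIV_in_C by blast

lemma nonunit_exists:
 assumes "P:C" "P ~= UNIV" obtains x where "x:nu P" "x ~= 0"
proof -
 obtain y where y: "y ~: P" using assms by blast
 have "y:frac_field P" using P_facts(3)[OF assms(1)] by simp
 then obtain a b where ab: "y = a/b" "a:P" "b:P" "b ~= 0" unfolding frac_field_def by blast
 have "inverse b ~: P" using y ab subring_mult[OF P_facts(1)[OF assms(1)]] by(auto simp: divide_inverse)
 thus ?thesis using that[of b] ab by(simp add: nonunits_def)
qed

lemma dominating_place:
 assumes P: "P:C" "P ~= UNIV"
 obtains W where "VR W" "W ~= UNIV" "P <= W" "dominates W P"
proof -
 obtain x where x: "x:nu P" "x ~= 0" by(rule nonunit_exists[OF P])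
 obtain W where W: "VR W" "W ~= UNIV" "P <= W"
  by(rule VR_extension[OF P_facts(1,2)[OF P(1)], of x]) (use x in "auto simp: nonunits_def")
 show ?thesis using that[OF W point_in_place(1)[OF P(1) W]] .
qed

text \<open>Suppose that the residue of t at a place W over P were transcendental. Composing W with the place t =
  \<infinity> of the residue field gives a smaller valuation ring W' \<subset> W. It dominates a point, which W also
  dominates and which is therefore P. But t \<in> P is not in W'.\<close>
lemma point_residue:
 assumes P: "P:C" "P ~= UNIV" and t: "t:P"
 shows "EX a. t - em a:nu P"
proof(rule ccontr)
 assume n: "~ ?thesis"
 obtain W where W: "VR W" "W ~= UNIV" "P <= W" "dominates W P" by(rule dominating_place[OF P])
 note Ws = VR_subring[OF W(1)] and Wv = VR_val[OF W(1)] and Ps = P_facts(1)[OF P(1)]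
 have nW: "t - em a ~: nu W" for a
  using n W(4) subring_diff[OF Ps t] P_facts(2)[OF P(1)] unfolding dominates_def by blast
 have tW: "t:W" "t ~: nu W" using t W nW[of 0] by auto
 have t0: "t ~= 0" "inverse t:W" using unit_inverse[OF tW] by auto
 let ?S = "adjoin (range em) (inverse t)"
 have S: "is_subring ?S" "range em <= ?S" "inverse t:?S"
  using adjoin_subring adjoin_superset adjoin_elem range_subring by blast+
 have SW: "?S <= W" by(rule adjoin_least[OF Ws]) (use W t0 in "auto simp: VR_def")
 \<comment> \<open>The elements of W whose residue is a polynomial in 1/t.\<close>
 define R where "R = {x. EX y:?S. x - y:nu W}"
 have R: "is_subring R" unfolding is_subring_def
 proof(intro conjI ballI)
  show "1:R" unfolding R_def using subring_1[OF S(1)] nonunits_0[OF Ws] by(intro CollectI bexI[of _ 1]) auto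
  fix x y assume "x:R" "y:R"
  then obtain u v where uv: "u:?S" "v:?S" "x - u:nu W" "y - v:nu W" unfolding R_def by blast
  have e: "x - y - (u - v) = (x - u) - (y - v)" by simp
  have "x - y - (u - v):nu W" unfolding e by(rule val_nonunits_diff[OF Wv uv(3,4)])
  thus "x - y:R" unfolding R_def using subring_diff[OF S(1) uv(1,2)] by blast
  have y: "y:W" using subring_add[OF Ws, of "y - v" v] uv SW nonunits_sub by fastforce
  have "x*y - u*v = y*(x - u) + u*(y - v)" by(simp add: algebra_simps)
  moreover have "y*(x - u) + u*(y - v):nu W"
   using val_nonunits_add[OF Wv nonunits_mult[OF Ws uv(3) y] nonunits_mult[OF Ws uv(4), of u]] uv SW by blast
  ultimately have "x*y - u*v:nu W" by(simp only:)
  thus "x*y:R" unfolding R_def using subring_mult[OF S(1) uv(1,2)] by blast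
 qed
 have SR: "?S <= R"
 proof
  fix x assume "x:?S"
  thus "x:R" unfolding R_def using nonunits_0[OF Ws] by(intro CollectI bexI[of _ x]) auto
 qed
 have NR: "nu W <= R"
 proof
  fix x assume "x:nu W"
  thus "x:R" unfolding R_def using subring_0[OF S(1)] by(intro CollectI bexI[of _ 0]) auto
 qed
 have "t ~: R"
 proof
  assume "t:R"
  then obtain y where y: "y:?S" "t - y:nu W" unfolding R_def by blast
  obtain m f where f: "!!i. f i:range em" "y = (SUM i<=m. f i*inverse t^i)" using y(1) by(rule adjoin_repr) blast
  hence "EX a. f i = em a" for i by(metis imageE)
  then obtain a where a: "!!i. f i = em (a i)" by metis
  have e: "t^m*y = (SUM i<=m. f i*t^(m - i))"
   unfolding f(2) sum_distrib_left
   by(rule sum.cong) (use t0 in "auto simp: power_diff field_simps power_inverse")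
  define q where "q = (SUM i<=m. monom (a i) (m - i))"
  define p where "p = monom 1 (Suc m) - q"
  have dq: "degree q <= m" unfolding q_def by(rule degree_sum_le) (auto intro: order.trans[OF degree_monom_le])
  have "coeff q (Suc m) = 0" using dq by(intro coeff_eq_0) simp
  hence "coeff p (Suc m) = 1" by(simp add: p_def)
  hence p0: "p ~= 0" by auto
  have "ev p t = ev (monom 1 (Suc m) + smult (-1) q) t" by(simp add: p_def)
  also have "... = t^m*(t - y)" unfolding ev_add ev_smult q_def ev_sum ev_monom using e a
   by(simp add: i_neg algebra_simps)
  finally have "ev p t:nu W" using nonunits_mult[OF Ws y(2) subring_power[OF Ws tW(1), of m]] by simp
  thus False using poly_relation_residue[OF W(1) tW(1) p0] nW by blast
 qed
 hence "inverse (inverse t) ~: R" by simp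
 then obtain W' where W': "VR W'" "W' ~= UNIV" "R <= W'" "inverse t:nu W'"
  using VR_extension[OF R, of "inverse t"] SR S by blast
 have tW': "t ~: W'" using W'(4) t0 by(simp add: nonunits_def)
 have sub: "W' <= W"
 proof
  fix y assume y: "y:W'"
  show "y:W"
  proof(rule ccontr)
   assume "y ~: W"
   from val_not_in[OF Wv this] have y0: "y ~= 0" "inverse y:nu W" by auto
   have "t*inverse y:W'" using nonunits_mult[OF Ws y0(2) tW(1)] NR W'(3) by blast
   hence "y*(t*inverse y):W'" using subring_mult[OF VR_subring[OF W'(1)] y] by blast
   moreover have "y*(t*inverse y) = t" using y0 by(simp add: field_simps)
   ultimately show False using tW' by simp
  qed
 qed
 obtain Q where Q: "Q:C" "dominates W' Q" using center_ex1[OF W'(1)] by blast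
 hence "Q <= W'" by(simp add: dominates_def)
 hence "dominates W Q" using point_in_place(1)[OF Q(1) W(1,2)] sub by blast
 hence "P = Q" using center_unique[OF W(1) P(1) Q(1) W(4)] by blast
 thus False using t tW' `Q <= W'` by blast
qed

lemma point_rat_ring:
 assumes P: "P:C" "P ~= UNIV" shows "rat_ring P"
proof -
 obtain W where W: "VR W" "W ~= UNIV" "P <= W" "dominates W P" by(rule dominating_place[OF P])
 have e: "nu P = nu W Int P" using W by(simp add: dominates_def)
 show ?thesis unfolding rat_ring_def
 proof(intro conjI ballI)
  fix x y assume "x:nu P" "y:nu P"
  thus "x + y:nu P" unfolding e
   using val_nonunits_add[OF VR_val[OF W(1)]] subring_add[OF P_facts(1)[OF P(1)]] by blast
 qed (use P_facts[OF P(1)] point_residue[OF P] in auto)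
qed

lemma point_max_fg:
 assumes P: "P:C" "P ~= UNIV"
 obtains S where "finite S" "nu P = lspan P S"
proof -
 obtain W where W: "VR W" "W ~= UNIV" "P <= W" "dominates W P" by(rule dominating_place[OF P])
 obtain T where T: "finite T" "ag T <= W" "P = loc (ag T) W"
  using point_in_place(2)[OF P(1) W(1-3)] by blast
 have "EX a. t - em a:nu W" if "t:T" for t
 proof -
  have "t:P" using that alg_gen_base(1)[of T em] loc_sup[OF alg_gen_subring VR_val[OF W(1)] T(2)] T(3) by blast
  thus ?thesis using point_residue[OF P] W(4) unfolding dominates_def by blast
 qed
 from nonunits_loc_generated[OF T(1) W(1) T(2) this] T(3) that show ?thesis by blast
qed

lemma point_nilpotent:
 assumes P: "P:C" "P ~= UNIV" and x: "x:P" "x ~= 0" and y: "y:nu P"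
 shows "EX N. y^N:x ** P"
proof(rule nilpotent_mod[OF P_facts(1)[OF P(1)] x])
 show "y:P" using y nonunits_sub by blast
 fix W assume W: "valuation_ring W" "P <= W" "x:nu W"
 have VW: "VR W" using W P_facts(2)[OF P(1)] by(auto simp: VR_def)
 have "dominates W P" by(rule point_in_place(1)[OF P(1) VW nonunits_nontrivial[OF W(3) x(2)] W(2)])
 thus "y:nu W" using y by(simp add: dominates_def)
qed

lemma point_colength:
 assumes P: "P:C" "P ~= UNIV" and x: "x:P" "x ~= 0"
 shows "qdK P (x ** P) < \<infinity>"
proof -
 obtain S where "finite S" "nu P = lspan P S" by(rule point_max_fg[OF P])
 thus ?thesis using finite_colength[OF point_rat_ring[OF P] _ _ x(1)] point_nilpotent[OF P x] by blast
qed

lemma place_residue: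
 assumes W: "VR W" "W ~= UNIV" and t: "t:W"
 shows "EX a. t - em a:nu W"
proof -
 obtain P where P: "P:C" "dominates W P" using center_ex1[OF W(1)] by blast
 hence PW: "P <= W" by(simp add: dominates_def)
 hence P': "P ~= UNIV" using W by blast
 obtain x where x: "x:nu P" "x ~= 0" by(rule nonunit_exists[OF P(1) P'])
 have xP: "x:P" using x nonunits_sub by blast
 have xW: "x:nu W" using x P by(simp add: dominates_def)
 note Ws = VR_subring[OF W(1)]
 have "qdK W (x ** W) <= qdK P (x ** P)"
  by(rule krull_akizuki[OF P_facts[OF P(1)] point_colength[OF P(1) P'] xP x(2)])
    (auto intro: submod_mono[OF submod_self[OF Ws] PW])
 also have "... < \<infinity>" by(rule point_colength[OF P(1) P' xP x(2)])
 finally obtain e where e: "qdK W (x ** W) = enat e" by(rule less_infinityE)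
 have "0:x ** W" using subring_0[OF Ws] by force
 from kv.qd_dependent_seq[OF e _ this, of "%i. t^i"] subring_power[OF Ws t]
 obtain a i where a: "i <= e" "a i ~= 0" "(SUM i<=e. em (a i)*t^i):x ** W" by blast
 define p where "p = (SUM i<=e. monom (a i) i)"
 have "coeff p i = a i" unfolding p_def using a(1) by(simp add: coeff_sum)
 hence p0: "p ~= 0" using a(2) by auto
 obtain r where r: "r:W" "ev p t = x*r" using a(3) unfolding p_def ev_sum_monom by blast
 hence "ev p t:nu W" using nonunits_mult[OF Ws xW r(1)] by(simp add: mult.commute)
 thus ?thesis using poly_relation_residue[OF W(1) t p0] by blast
qed

sublocale rplaces em by unfold_locales (rule place_residue)

lemma almost_all_points:
 shows "finite {P:cpts C. x ~: P}"
proof -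
 obtain \<T> where \<T>: "finite \<T>" "!!T. T:\<T> ==> finite T & frac_field (ag T) = UNIV"
  "C = (UN T:\<T>. Spec (ag T))" by(rule charts) blast
 have "finite {P:cpts C. x ~: P & P:Spec (ag T)}" if T: "T:\<T>" for T
 proof -
  let ?A = "ag T"
  note A = alg_gen_subring[of em T]
  have "x:frac_field ?A" using \<T>(2)[OF T] by simp
  then obtain a b where ab: "x = a/b" "a:?A" "b:?A" "b ~= 0" unfolding frac_field_def by blast
  let ?F = "{?A Int nu W |W. VR W & ?A <= W & b:nu W}"
  have fin: "finite ?F" using chart_finite[OF _ ab(3,4)] \<T>(2)[OF T] by blast
  have "{P:cpts C. x ~: P & P:Spec ?A} <= (%p. localization ?A p) ` ?F"
  proof
   fix P assume "P:{P:cpts C. x ~: P & P:Spec ?A}"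
   hence P: "P:C" "P ~= UNIV" "x ~: P" "P:Spec ?A" by(auto simp: closed_points_iff)
   obtain W where W: "VR W" "W ~= UNIV" "P <= W" "dominates W P" by(rule dominating_place[OF P(1,2)])
   obtain p where p: "prime_ideal ?A p" "P = localization ?A p" using P(4) unfolding Spec_def by blast
   have AP: "?A <= P" using localization_subring(2)[OF A p(1)] p(2) by simp
   hence AW: "?A <= W" using W by blast
   have "loc ?A W:C" using loc_in_Spec[OF A VR_val[OF W(1)] AW] \<T> T by blast
   hence e: "P = loc ?A W"
    using center_unique[OF W(1) P(1) _ W(4) loc_dominates[OF A VR_val[OF W(1)] AW]] by blast
   have "b:nu W"
   proof(rule ccontr)
    assume "b ~: nu W"
    hence "x:loc ?A W" unfolding loc_iff using ab by blast
    thus False using P(3) e by simp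
   qed
   thus "P:(%p. localization ?A p) ` ?F" using e AW W(1) unfolding loc_def by blast
  qed
  thus ?thesis using fin finite_surj by blast
 qed
 hence "finite (UN T:\<T>. {P:cpts C. x ~: P & P:Spec (ag T)})" using \<T>(1) by blast
 moreover have "{P:cpts C. x ~: P} <= (UN T:\<T>. {P:cpts C. x ~: P & P:Spec (ag T)})"
  using \<T>(3) unfolding closed_points_def by blast
 ultimately show ?thesis using finite_subset by blast
qed

end

section \<open>Euler characteristics\<close>

context ground begin

abbreviation "qdA == quot_dim (%c (r :: 'K set => 'K) P. em c*r P)"

lemma vspK: "vspace (%c x. em c*x)" by unfold_locales
lemma vspA: "vspace (%c (r :: 'K set => 'K) P. em c*r P)" by unfold_locales

end

text \<open>The kernel of the map from the adeles to the sum of the M / F P.\<close>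
definition Lam :: "'K::field set set => ('K set => 'K set) => ('K set => 'K) set" where
 "Lam X F = {r:adeles X F. ALL P:cpts X. r P:F P}"

definition diag :: "'K::field set set => 'K => 'K set => 'K" where
 "diag X m = (%P. if P:cpts X then m else 0)"

locale ptset = ground em for em :: "'k::alg_closed_field => 'K::field" +
 fixes X :: "'K set set"
 assumes X: "X = insert (generic_point X) (cpts X)"
begin

abbreviation "cl == cpts X"
abbreviation "gp == generic_point X"

text \<open>Families for which adeles compute cohomology, with generic stalk M; the stalks are only required to be
  k-subspaces.\<close>
definition fam :: "'K set => ('K set => 'K set) => bool" where
 "fam M F \<longleftrightarrow> ksub M & F gp = M & (ALL P:cl. ksub (F P) & F P <= M) &
   (ALL m:M. finite {P:cl. m ~: F P})"

lemma fam_M: "fam M F ==> ksub M" and fam_gp: "fam M F ==> F gp = M"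
 and fam_sub: "fam M F ==> P:cl ==> ksub (F P)"
 and fam_le: "fam M F ==> P:cl ==> F P <= M"
 and fam_fin: "fam M F ==> m:M ==> finite {P:cl. m ~: F P}"
 unfolding fam_def by blast+

lemma H0_eq: "fam M F ==> H0 X F = {m:M. ALL P:cl. m:F P}"
 unfolding H0_def by(subst X) (auto simp: fam_gp)

lemma adeles_iff:
 "fam M F ==> r:adeles X F \<longleftrightarrow> (ALL P. P ~: cl --> r P = 0) & (ALL P:cl. r P:M) & finite {P:cl. r P ~: F P}"
 unfolding adeles_def by(simp add: fam_gp)

lemma adeles_eq:
 assumes "fam M F" "fam M G" "finite {P:cl. F P ~= G P}"
 shows "adeles X F = adeles X G"
proof -
 have "finite {P:cl. r P ~: F P} \<longleftrightarrow> finite {P:cl. r P ~: G P}" for r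
 proof
  assume "finite {P:cl. r P ~: F P}"
  hence "finite ({P:cl. r P ~: F P} Un {P:cl. F P ~= G P})" using assms by blast
  thus "finite {P:cl. r P ~: G P}" by(rule rev_finite_subset) auto
 next
  assume "finite {P:cl. r P ~: G P}"
  hence "finite ({P:cl. r P ~: G P} Un {P:cl. F P ~= G P})" using assms by blast
  thus "finite {P:cl. r P ~: F P}" by(rule rev_finite_subset) auto
 qed
 thus ?thesis by(auto simp: adeles_iff[OF assms(1)] adeles_iff[OF assms(2)])
qed

lemma adeles_subspace:
 assumes F: "fam M F" shows "ka.subspace (adeles X F)"
proof(rule ka.subspaceI)
 note s = ksub_0 ksub_add ksub_scale
 show "0:adeles X F" unfolding adeles_iff[OF F]
  using ksub_0[OF fam_M[OF F]] ksub_0[OF fam_sub[OF F]] by(auto cong: conj_cong)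
 show "x + y:adeles X F" if xy: "x:adeles X F" "y:adeles X F" for x y
 proof -
  have "finite ({P:cl. x P ~: F P} Un {P:cl. y P ~: F P})" using xy by(simp add: adeles_iff[OF F])
  hence "finite {P:cl. (x + y) P ~: F P}"
   by(rule rev_finite_subset) (use ksub_add[OF fam_sub[OF F]] in auto)
  thus ?thesis using xy ksub_add[OF fam_M[OF F]] by(simp add: adeles_iff[OF F])
 qed
 show "(%P. em c*x P):adeles X F" if x: "x:adeles X F" for c x
 proof -
  have "finite {P:cl. x P ~: F P}" using x by(simp add: adeles_iff[OF F])
  hence "finite {P:cl. em c*x P ~: F P}"
   by(rule rev_finite_subset) (use ksub_scale[OF fam_sub[OF F]] in auto)
  thus ?thesis using x ksub_scale[OF fam_M[OF F]] by(simp add: adeles_iff[OF F])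
 qed
qed

lemma Lam_iff: "fam M F ==> r:Lam X F \<longleftrightarrow> (ALL P. P ~: cl --> r P = 0) & (ALL P:cl. r P:F P)"
proof -
 assume F: "fam M F"
 have "finite {P:cl. r P ~: F P}" if "ALL P:cl. r P:F P"
  using that by(metis (mono_tags, lifting) empty_Collect_eq finite.emptyI)
 thus ?thesis unfolding Lam_def mem_Collect_eq adeles_iff[OF F, of r] using fam_le[OF F] by blast
qed

lemma Lam_mono_fam:
 assumes "fam M F" "fam M' G" "!!P. P:cl ==> F P <= G P" shows "Lam X F <= Lam X G"
 unfolding subset_iff Lam_iff[OF assms(1)] Lam_iff[OF assms(2)] using assms(3) by blast

lemma Lam_subspace:
 assumes F: "fam M F" shows "ka.subspace (Lam X F)"
 by(rule ka.subspaceI) (auto simp: Lam_iff[OF F] ksub_0[OF fam_sub[OF F]]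
   ksub_add[OF fam_sub[OF F]] ksub_scale[OF fam_sub[OF F]])

lemma diag_subspace: "ksub M ==> ka.subspace (diag X ` M)"
proof(rule ka.subspaceI)
 assume M: "ksub M"
 have d0: "diag X 0 = 0" by(simp add: diag_def fun_eq_iff)
 show "0:diag X ` M" using ksub_0[OF M] by(metis d0 imageI)
 show "x + y:diag X ` M" if xy: "x:diag X ` M" "y:diag X ` M" for x y
 proof -
  obtain a b where "x = diag X a" "y = diag X b" "a:M" "b:M" using xy by blast
  hence "x + y = diag X (a + b)" "a + b:M" using ksub_add[OF M] by(auto simp: diag_def fun_eq_iff)
  thus ?thesis by blast
 qed
 show "(%P. em c*x P):diag X ` M" if x: "x:diag X ` M" for c x
 proof -
  obtain a where "x = diag X a" "a:M" using x by blast
  hence "(%P. em c*x P) = diag X (em c*a)" "em c*a:M" using ksub_scale[OF M] by(auto simp: diag_def fun_eq_iff)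
  thus ?thesis by blast
 qed
qed

lemma diag_adele: "fam M F ==> m:M ==> diag X m:adeles X F"
 using fam_fin[of M F m] by(auto simp: adeles_iff diag_def cong: conj_cong)

lemma cob_eq:
 assumes F: "fam M F"
 shows "cob X F = {x + y |x y. x:Lam X F & y:diag X ` M}"
proof(intro equalityI subsetI)
 fix r assume "r:cob X F"
 then obtain m where m: "r:adeles X F" "m:M" "ALL P:cl. r P - m:F P"
  unfolding coboundaries_def by(auto simp: fam_gp[OF F])
 have "r = (%P. if P:cl then r P - m else 0) + diag X m"
  using m(1) by(auto simp: fun_eq_iff diag_def adeles_iff[OF F])
 moreover have "(%P. if P:cl then r P - m else 0):Lam X F" using m by(simp add: Lam_iff[OF F])
 ultimately show "r:{x + y |x y. x:Lam X F & y:diag X ` M}" using m(2) by blast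
next
 fix r assume "r:{x + y |x y. x:Lam X F & y:diag X ` M}"
 then obtain x m where r: "r = x + diag X m" "x:Lam X F" "m:M" by blast
 have "x:adeles X F" using r by(simp add: Lam_def)
 hence "r:adeles X F" unfolding r(1)
  using ka.subspace_add[OF adeles_subspace[OF F]] diag_adele[OF F r(3)] by blast
 moreover have "ALL P:cl. r P - m:F P" using r by(simp add: diag_def Lam_iff[OF F])
 ultimately show "r:cob X F"
  unfolding coboundaries_def using r(3) by(auto simp: fam_gp[OF F])
qed

lemma cob_subspace:
 assumes F: "fam M F" shows "ka.subspace (cob X F)"
 unfolding cob_eq[OF F] by(rule ka.subspace_sums[OF Lam_subspace[OF F] diag_subspace[OF fam_M[OF F]]])

lemma cob_adeles: "cob X F <= adeles X F" unfolding coboundaries_def by blast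

lemma Lam_cob: "fam M F ==> Lam X F <= cob X F"
proof
 fix r assume F: "fam M F" and r: "r:Lam X F"
 have "r = r + diag X 0" by(simp add: diag_def fun_eq_iff)
 thus "r:cob X F" unfolding cob_eq[OF F] using r ksub_0[OF fam_M[OF F]] by blast
qed

lemma diag_cob: "fam M F ==> m:M ==> diag X m:cob X F"
proof -
 assume F: "fam M F" and m: "m:M"
 have "diag X m = 0 + diag X m" by simp
 thus ?thesis unfolding cob_eq[OF F] using ka.subspace_0[OF Lam_subspace[OF F]] m by blast
qed

lemma cob_mono:
 assumes "fam M F" "fam M G" "!!P. P:cl ==> F P <= G P"
 shows "cob X F <= cob X G"
proof -
 have "Lam X F <= Lam X G" by(rule Lam_mono_fam[OF assms])
 thus ?thesis unfolding cob_eq[OF assms(1)] cob_eq[OF assms(2)] by blast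
qed

lemma H0_subspace: "fam M F ==> ksub (H0 X F)"
 by(rule kv.subspaceI) (auto simp: H0_eq ksub_0[OF fam_M] ksub_0[OF fam_sub]
   ksub_add[OF fam_M] ksub_add[OF fam_sub] ksub_scale[OF fam_M] ksub_scale[OF fam_sub])

end

locale fam_pair = ptset +
 fixes M F G
 assumes F: "fam M F" and G: "fam M G" and FG: "P:cpts X ==> F P <= G P"
  and ae: "finite {P:cpts X. F P ~= G P}" and ne: "cpts X ~= {}"
begin

lemma Lam_mono: "Lam X F <= Lam X G" by(rule Lam_mono_fam[OF F G FG])

lemma H0_mono: "H0 X F <= H0 X G" using FG by(auto simp: H0_eq[OF F] H0_eq[OF G])

lemma ad_eq: "adeles X F = adeles X G" by(rule adeles_eq[OF F G ae])

lemma h1_add: "h1 em X F = h1 em X G + qdA (cob X G) (cob X F)"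
 unfolding h1_def ad_eq[symmetric]
 by(rule ka.qd_add)
   (use cob_subspace[OF F] cob_subspace[OF G] adeles_subspace[OF F] cob_mono[OF F G FG] cob_adeles[of G] ad_eq in auto)

text \<open>Additivity of the Euler characteristic: Lam G / Lam F has the sections of G modulo those of F as kernel of
  its map onto the quotient of the coboundaries.\<close>
lemma Lam_add: "qdA (Lam X G) (Lam X F) = qdK (H0 X G) (H0 X F) + qdA (cob X G) (cob X F)"
proof -
 let ?D = "diag X ` M"
 note D = diag_subspace[OF fam_M[OF F]] and LF = Lam_subspace[OF F] and LG = Lam_subspace[OF G]
 let ?I = "Lam X G Int ?D"
 have I: "ka.subspace ?I" by(rule ka.subspace_inter[OF LG D])
 let ?S = "{x + y |x y. x:?I & y:Lam X F}"
 have S: "ka.subspace ?S" by(rule ka.subspace_sums[OF I LF])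
 have SG: "?S <= Lam X G" using Lam_mono ka.subspace_add[OF LG] by blast
 have FS: "Lam X F <= ?S"
 proof
  fix r assume "r:Lam X F"
  moreover have "r = 0 + r" by simp
  ultimately show "r:?S" using ka.subspace_0[OF I] by blast
 qed
 have "qdA (Lam X G) (Lam X F) = qdA (Lam X G) ?S + qdA ?S (Lam X F)"
  by(rule ka.qd_add[OF LF S LG FS SG])
 also have "qdA ?S (Lam X F) = qdA ?I (?I Int Lam X F)" by(rule ka.qd_sum[OF I LF])
 also have "... = qdK (H0 X G) (H0 X F)"
 proof(rule antisym)
  obtain P0 where P0: "P0:cl" using ne by blast
  have inv: "r = diag X (r P0)" if "r:?D" for r using that P0 by(auto simp: diag_def)
  show "qdA ?I (?I Int Lam X F) <= qdK (H0 X G) (H0 X F)"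
  proof(rule qd_le_relation[OF vspA vspK, where f="%r. r P0"])
   show "0:H0 X F" by(rule ksub_0[OF H0_subspace[OF F]])
   show "r P0:H0 X G" if r: "r:?I" for r
   proof -
    obtain m where "m:M" "r = diag X m" "r:Lam X G" using r by blast
    thus ?thesis using P0 by(auto simp: H0_eq[OF G] diag_def Lam_iff[OF G])
   qed
   fix B a assume B: "finite B" "B <= ?I" and s: "(SUM b:B. em (a b)*b P0):H0 X F"
   let ?s = "SUM b:B. (%P. em (a b)*b P)"
   have sI: "?s:?I" using B(2) by(intro ka.subspace_sum[OF I] ka.subspace_scale[OF I]) auto
   have e: "?s P0 = (SUM b:B. em (a b)*b P0)" using B(1) by(induction B rule: finite_induct) auto
   have "?s = diag X (?s P0)" using inv sI by blast
   moreover have "diag X (?s P0):Lam X F" using s e by(simp add: H0_eq[OF F] Lam_iff[OF F] diag_def)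
   ultimately show "?s:?I Int Lam X F" using sI by auto
  qed
  show "qdK (H0 X G) (H0 X F) <= qdA ?I (?I Int Lam X F)"
  proof(rule qd_le_relation[OF vspK vspA, where f="diag X"])
   show "0:?I Int Lam X F" using ka.subspace_0[OF I] ka.subspace_0[OF LF] by blast
   show "diag X m:?I" if "m:H0 X G" for m
    using that by(auto simp: H0_eq[OF G] Lam_iff[OF G] diag_def)
   fix B a assume B: "finite B" "B <= H0 X G" and s: "(SUM b:B. (%P. em (a b)*diag X b P)):?I Int Lam X F"
   have e: "(SUM b:B. (%P. em (a b)*diag X b P)) = diag X (SUM b:B. em (a b)*b)"
    using B(1) by(induction B rule: finite_induct) (auto simp: diag_def fun_eq_iff)
   have "(SUM b:B. em (a b)*b):M" using B(2) by(intro ksub_sum[OF fam_M[OF F]] ksub_scale[OF fam_M[OF F]]) (auto simp: H0_eq[OF G])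
   thus "(SUM b:B. em (a b)*b):H0 X F" using s unfolding e by(simp add: H0_eq[OF F] Lam_iff[OF F] diag_def)
  qed
 qed
 finally have 1: "qdA (Lam X G) (Lam X F) = qdA (Lam X G) ?S + qdK (H0 X G) (H0 X F)" .
 have mod: "?S = Lam X G Int cob X F"
 proof
  show "?S <= Lam X G Int cob X F"
  proof
   fix r assume r: "r:?S"
   then obtain x y where "r = x + y" "x:?D" "y:Lam X F" by blast
   hence "r = y + x" by(simp add: add.commute)
   thus "r:Lam X G Int cob X F" using r SG `x : ?D` `y : Lam X F` unfolding cob_eq[OF F] by blast
  qed
  show "Lam X G Int cob X F <= ?S"
  proof
   fix r assume r: "r:Lam X G Int cob X F"
   then obtain x y where xy: "r = x + y" "x:Lam X F" "y:?D" unfolding cob_eq[OF F] by blast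
   have "y = r - x" using xy by simp
   hence "y:Lam X G" using ka.subspace_diff[OF LG] r xy(2) Lam_mono by blast
   moreover have "r = y + x" using xy by(simp add: add.commute)
   ultimately show "r:?S" using xy by blast
  qed
 qed
 have cg: "{x + y |x y. x:Lam X G & y:cob X F} = cob X G"
 proof
  show "{x + y |x y. x:Lam X G & y:cob X F} <= cob X G"
   using Lam_cob[OF G] cob_mono[OF F G FG] ka.subspace_add[OF cob_subspace[OF G]] by blast
  show "cob X G <= {x + y |x y. x:Lam X G & y:cob X F}"
   unfolding cob_eq[OF G] using diag_cob[OF F] by blast
 qed
 have "qdA (cob X G) (cob X F) = qdA (Lam X G) (Lam X G Int cob X F)"
  using ka.qd_sum[OF LG cob_subspace[OF F]] unfolding cg .
 thus ?thesis using 1 mod by(simp add: add.commute)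
qed

lemma euler:
 "h0 em X F + qdA (Lam X G) (Lam X F) + h1 em X G = h0 em X G + h1 em X F"
proof -
 have "h0 em X G = qdK (H0 X G) (H0 X F) + h0 em X F" unfolding h0_def
  by(rule kv.qd_add) (use H0_subspace[OF F] H0_subspace[OF G] H0_mono ksub_0[OF H0_subspace[OF F]] in auto)
 thus ?thesis using h1_add Lam_add by(simp add: add_ac)
qed

lemma h0_le: "h0 em X G <= h0 em X F + qdA (Lam X G) (Lam X F)"
proof -
 have "h0 em X G = qdK (H0 X G) (H0 X F) + h0 em X F" unfolding h0_def
  by(rule kv.qd_add) (use H0_subspace[OF F] H0_subspace[OF G] H0_mono ksub_0[OF H0_subspace[OF F]] in auto)
 moreover have "qdK (H0 X G) (H0 X F) <= qdA (Lam X G) (Lam X F)" by(simp add: Lam_add)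
 ultimately show ?thesis by(simp add: add.commute)
qed

lemma h1_mono: "h1 em X G <= h1 em X F" by(simp add: h1_add)

end

context ptset begin

lemma Lam_single:
 assumes F: "fam M F" and G: "fam M G" and P0: "P0:cl"
  and eq: "!!P. P:cl ==> P ~= P0 ==> F P = G P"
 shows "qdA (Lam X G) (Lam X F) = qdK (G P0) (F P0)"
proof(rule antisym)
 show "qdA (Lam X G) (Lam X F) <= qdK (G P0) (F P0)"
 proof(rule qd_le_relation[OF vspA vspK, where f="%r. r P0"])
  show "0:F P0" using ksub_0[OF fam_sub[OF F P0]] .
  show "r P0:G P0" if "r:Lam X G" for r using that P0 by(simp add: Lam_iff[OF G])
  fix B a assume B: "finite B" "B <= Lam X G" and s: "(SUM b:B. em (a b)*b P0):F P0"
  let ?s = "SUM b:B. (%P. em (a b)*b P)"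
  have sG: "?s:Lam X G" using B(2) by(intro ka.subspace_sum[OF Lam_subspace[OF G]] ka.subspace_scale[OF Lam_subspace[OF G]]) auto
  have e: "?s P0 = (SUM b:B. em (a b)*b P0)" using B(1) by(induction B rule: finite_induct) auto
  show "?s:Lam X F" unfolding Lam_iff[OF F]
  proof(intro conjI allI impI ballI)
   show "?s P = 0" if "P ~: cl" for P using sG that by(simp add: Lam_iff[OF G])
   show "?s P:F P" if "P:cl" for P
    using sG that e s eq[OF that] by(cases "P = P0") (auto simp: Lam_iff[OF G])
  qed
 qed
 show "qdK (G P0) (F P0) <= qdA (Lam X G) (Lam X F)"
 proof(rule qd_le_relation[OF vspK vspA, where f="%x P. if P = P0 then x else 0"])
  show "0:Lam X F" by(rule ka.subspace_0[OF Lam_subspace[OF F]])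
  show "(%P. if P = P0 then x else 0):Lam X G" if "x:G P0" for x
   using that P0 ksub_0[OF fam_sub[OF G]] by(auto simp: Lam_iff[OF G])
  fix B a assume B: "finite B" "B <= G P0" and s: "(SUM b:B. (%P. em (a b)*(if P = P0 then b else 0))):Lam X F"
  have e: "(SUM b:B. (%P. em (a b)*(if P = P0 then b else 0))) P0 = (SUM b:B. em (a b)*b)"
   using B(1) by(induction B rule: finite_induct) auto
  show "(SUM b:B. em (a b)*b):F P0" using s P0 unfolding Lam_iff[OF F] e[symmetric] by blast
 qed
qed

lemma Lam_sum:
 assumes F: "fam M F" and G: "fam M G" and FG: "!!P. P:cl ==> F P <= G P"
  and S: "finite S" "S <= cl" and eq: "!!P. P:cl ==> P ~: S ==> F P = G P"
 shows "qdA (Lam X G) (Lam X F) = (SUM P:S. qdK (G P) (F P))"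
proof -
 define H where "H T = (%P. if P:T then G P else F P)" for T
 have gpc: "gp ~: T" if "T <= cl - {gp}" for T using that by blast
 have H: "fam M (H T)" if T: "T <= cl" for T
  unfolding fam_def
 proof(intro conjI ballI)
  show "ksub M" by(rule fam_M[OF F])
  show "H T gp = M" using fam_gp[OF F] fam_gp[OF G] by(simp add: H_def)
  fix P assume "P:cl"
  thus "ksub (H T P)" "H T P <= M" using fam_sub[OF F] fam_sub[OF G] fam_le[OF F] fam_le[OF G] by(auto simp: H_def)
 next
  fix m assume "m:M"
  have "{P:cl. m ~: H T P} <= {P:cl. m ~: F P}" using FG by(auto simp: H_def)
  thus "finite {P:cl. m ~: H T P}" using fam_fin[OF F `m : M`] finite_subset by blast
 qed
 have main: "qdA (Lam X (H T)) (Lam X F) = (SUM P:T. qdK (G P) (F P))" if "finite T" "T <= cl" for T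
  using that
 proof(induction T rule: finite_induct)
  case empty
  have "H {} = F" by(simp add: H_def)
  thus ?case using ka.qd_self[OF Lam_subspace[OF F]] by simp
 next
  case (insert P T)
  have T: "T <= cl" "insert P T <= cl" using insert by auto
  have "qdA (Lam X (H (insert P T))) (Lam X F) = qdA (Lam X (H (insert P T))) (Lam X (H T)) + qdA (Lam X (H T)) (Lam X F)"
  proof(rule ka.qd_add)
   show "Lam X F <= Lam X (H T)" using FG by(intro Lam_mono_fam[OF F H[OF T(1)]]) (auto simp: H_def)
   show "Lam X (H T) <= Lam X (H (insert P T))" using FG by(intro Lam_mono_fam[OF H[OF T(1)] H[OF T(2)]]) (auto simp: H_def)
  qed (use Lam_subspace[OF H[OF T(1)]] Lam_subspace[OF H[OF T(2)]] Lam_subspace[OF F] in auto)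
  also have "qdA (Lam X (H (insert P T))) (Lam X (H T)) = qdK (H (insert P T) P) (H T P)"
   by(rule Lam_single[OF H[OF T(1)] H[OF T(2)]]) (use insert in "auto simp: H_def")
  also have "... = qdK (G P) (F P)" using insert by(simp add: H_def)
  finally show ?case using insert T by simp
 qed
 have "Lam X (H S) = Lam X G"
  by(intro equalityI Lam_mono_fam[OF H[OF S(2)] G] Lam_mono_fam[OF G H[OF S(2)]]) (use eq in "auto simp: H_def")
 thus ?thesis using main[OF S] by simp
qed

lemma fam_scale:
 assumes F: "fam M F" and y: "y ~= 0"
 shows "fam (y ** M) (%P. y ** F P)"
 unfolding fam_def
proof(intro conjI ballI)
 show "ksub (y ** M)" by(rule ksub_image[OF fam_M[OF F]])
 show "y ** F gp = y ** M" by(simp add: fam_gp[OF F])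
 fix P assume P: "P:cl"
 show "ksub (y ** F P)" by(rule ksub_image[OF fam_sub[OF F P]])
 show "y ** F P <= y ** M" using fam_le[OF F P] by blast
next
 fix m assume "m:y ** M"
 then obtain x where x: "x:M" "m = y*x" by blast
 have "{P:cl. m ~: y ** F P} <= {P:cl. x ~: F P}" using x by blast
 thus "finite {P:cl. m ~: y ** F P}" using fam_fin[OF F x(1)] finite_subset by blast
qed

lemma H0_scale:
 assumes F: "fam M F" and y: "y ~= 0"
 shows "H0 X (%P. y ** F P) = y ** H0 X F"
proof(intro equalityI subsetI)
 fix z assume z: "z:H0 X (%P. y ** F P)"
 have "inverse y*z:F P" if "P:X" for P
 proof -
  have "z:y ** F P" using z that by(simp add: H0_def)
  thus ?thesis using y by(auto simp: field_simps)
 qed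
 hence "inverse y*z:H0 X F" by(simp add: H0_def)
 moreover have "z = y*(inverse y*z)" using y by(simp add: field_simps)
 ultimately show "z:y ** H0 X F" by blast
qed (auto simp: H0_def)

lemma h0_scale:
 assumes F: "fam M F" and y: "y ~= 0"
 shows "h0 em X (%P. y ** F P) = h0 em X F"
 using qd_mult[OF y kv.subspace_single_0, of "H0 X F"] unfolding h0_def H0_scale[OF F y] by simp

definition ascale :: "'K => ('K set => 'K) => 'K set => 'K" where
 "ascale y r = (%P. y*r P)"

lemma ascale_linear: "Vector_Spaces.linear (%c (r :: 'K set => 'K) P. em c*r P) (%c r P. em c*r P) (ascale y)"
 by unfold_locales (auto simp: algebra_simps ascale_def fun_eq_iff)

lemma Lam_scale:
 assumes F: "fam M F" and y: "y ~= 0"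
 shows "Lam X (%P. y ** F P) = ascale y ` Lam X F"
proof(intro equalityI subsetI)
 fix r assume r: "r:Lam X (%P. y ** F P)"
 hence "ascale (inverse y) r:Lam X F" using y
  by(auto simp: Lam_iff[OF F] Lam_iff[OF fam_scale[OF F y]] ascale_def) (force simp: field_simps)
 moreover have "r = ascale y (ascale (inverse y) r)" using y by(auto simp: ascale_def fun_eq_iff)
 ultimately show "r:ascale y ` Lam X F" by blast
qed (auto simp: Lam_iff[OF F] Lam_iff[OF fam_scale[OF F y]] ascale_def)

lemma adeles_scale:
 assumes F: "fam M F" and y: "y ~= 0"
 shows "adeles X (%P. y ** F P) = ascale y ` adeles X F"
proof -
 have e: "y*x:y ** S \<longleftrightarrow> x:S" for x S using y by auto
 have e2: "x:y ** S \<longleftrightarrow> inverse y*x:S" for x S using y e[of "inverse y*x" S] by(simp add: field_simps)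
 show ?thesis
 proof(intro equalityI subsetI)
  fix r assume r: "r:adeles X (%P. y ** F P)"
  hence "ascale (inverse y) r:adeles X F" using y
   by(simp add: adeles_iff[OF F] adeles_iff[OF fam_scale[OF F y]] ascale_def e2)
  moreover have "r = ascale y (ascale (inverse y) r)" using y by(auto simp: ascale_def fun_eq_iff)
  ultimately show "r:ascale y ` adeles X F" by blast
 next
  fix r assume "r:ascale y ` adeles X F"
  then obtain q where q: "q:adeles X F" "r = ascale y q" by blast
  thus "r:adeles X (%P. y ** F P)"
   by(simp add: adeles_iff[OF F] adeles_iff[OF fam_scale[OF F y]] ascale_def e)
 qed
qed

lemma cob_scale:
 assumes F: "fam M F" and y: "y ~= 0"
 shows "cob X (%P. y ** F P) = ascale y ` cob X F"
proof -
 have d: "diag X (y*m) = ascale y (diag X m)" for m by(auto simp: diag_def ascale_def)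
 have a: "ascale y (u + v) = ascale y u + ascale y v" for u v by(auto simp: ascale_def fun_eq_iff distrib_left)
 show ?thesis unfolding cob_eq[OF F] cob_eq[OF fam_scale[OF F y]] Lam_scale[OF F y]
 proof(intro equalityI subsetI)
  fix r assume "r:{x + z |x z. x:ascale y ` Lam X F & z:diag X ` (*) y ` M}"
  then obtain u m where "r = ascale y u + diag X (y*m)" "u:Lam X F" "m:M" by blast
  thus "r:ascale y ` {x + y |x y. x:Lam X F & y:diag X ` M}" unfolding d a[symmetric] by blast
 next
  fix r assume "r:ascale y ` {x + y |x y. x:Lam X F & y:diag X ` M}"
  then obtain u m where "r = ascale y (u + diag X m)" "u:Lam X F" "m:M" by blast
  thus "r:{x + z |x z. x:ascale y ` Lam X F & z:diag X ` (*) y ` M}" unfolding a d[symmetric] by blast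
 qed
qed

lemma qdA_scale:
 assumes y: "y ~= 0" and W: "ka.subspace W"
 shows "qdA (ascale y ` U) (ascale y ` W) = qdA U W"
proof -
 have le: "qdA (ascale y ` U) (ascale y ` W) <= qdA U W" if y: "y ~= 0" and W: "ka.subspace W" for y U W
 proof(rule ka.qd_image_le[OF ascale_linear[of y]])
  show sub: "ka.subspace (ascale y ` W)"
  proof(rule ka.subspaceI)
   have "ascale y 0 = 0" by(simp add: ascale_def fun_eq_iff)
   thus "0:ascale y ` W" using ka.subspace_0[OF W] by(metis imageI)
   show "a + b:ascale y ` W" if ab: "a:ascale y ` W" "b:ascale y ` W" for a b
   proof -
    obtain u v where "a = ascale y u" "b = ascale y v" "u:W" "v:W" using ab by blast
    hence "a + b = ascale y (u + v)" "u + v:W" using ka.subspace_add[OF W] by(auto simp: ascale_def fun_eq_iff distrib_left)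
    thus ?thesis by blast
   qed
   show "(%P. em c*a P):ascale y ` W" if a: "a:ascale y ` W" for a c
   proof -
    obtain u where "a = ascale y u" "u:W" using a by blast
    hence "(%P. em c*a P) = ascale y (%P. em c*u P)" "(%P. em c*u P):W" using ka.subspace_scale[OF W] by(auto simp: ascale_def fun_eq_iff)
    thus ?thesis by blast
   qed
  qed
  show "EX u:U. x - ascale y u:ascale y ` W" if "x:ascale y ` U" for x
  proof -
   obtain u where "u:U" "x = ascale y u" using \<open>x : ascale y ` U\<close> by blast
   thus ?thesis using ka.subspace_0[OF sub] by(intro bexI[of _ u]) auto
  qed
  show "ascale y w:ascale y ` W" if "w:W" for w using that by blast
  show "0:W" by(rule ka.subspace_0[OF W])
 qed
 have sub: "ka.subspace (ascale y ` W)"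
  using ka.subspace_0[OF W]
 proof -
  interpret l: Vector_Spaces.linear "%c (r :: 'K set => 'K) P. em c*r P" "%c r P. em c*r P" "ascale y" by(rule ascale_linear)
  show ?thesis by(rule l.subspace_image[OF W])
 qed
 have e0: "ascale (inverse y) (ascale y r) = r" for r
  using y by(simp add: ascale_def fun_eq_iff mult.assoc[symmetric])
 have e: "ascale (inverse y) ` ascale y ` U = U" for U
  by(simp add: image_image e0)
 show ?thesis using le[OF y W, of U] le[OF _ sub, of "inverse y" "ascale y ` U"] y e by(intro antisym) auto
qed

lemma h1_scale:
 assumes F: "fam M F" and y: "y ~= 0"
 shows "h1 em X (%P. y ** F P) = h1 em X F"
 unfolding h1_def adeles_scale[OF F y] cob_scale[OF F y] by(rule qdA_scale[OF y cob_subspace[OF F]])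

end

section \<open>Products of finite-dimensional subspaces\<close>

context vspace begin

lemma subspace_eq_of_qd:
 assumes "subspace U'" "subspace U" "U' <= U" "qd U {0} <= qd U' {0}" "qd U' {0} < \<infinity>"
 shows "U' = U"
proof -
 have "qd U {0} = qd U U' + qd U' {0}"
  by(rule qd_add) (use assms subspace_0 in auto)
 moreover obtain m where "qd U' {0} = enat m" using assms(5) by(rule less_infinityE)
 ultimately have "qd U U' = 0" using assms(4) by(cases "qd U U'") (auto simp: zero_enat_def)
 thus ?thesis using qd_eq_0[OF assms(1)] assms(3) by blast
qed

lemma qd_line:
 assumes "subspace U" "subspace W" "W <= U" "a:U" "a ~: W" "!!x. x:U ==> EX c. x - scale c a:W"
 shows "qd U W = 1"
proof(rule antisym)
 have "enat (card {a}) <= qd U W"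
  by(rule qd_geI) (use assms indep_mod_single in auto)
 thus "1 <= qd U W" by(simp add: one_enat_def)
 obtain c where c: "!!x. x:U ==> x - scale (c x) a:W" using assms(6) by metis
 interpret k: vspace "(*) :: 'a => 'a => 'a" by unfold_locales (auto simp: algebra_simps)
 have v: "vspace scale" "vspace ((*) :: 'a => 'a => 'a)" by unfold_locales
 have "qd U W <= quot_dim (*) (UNIV :: 'a set) {0}"
 proof(rule qd_le_relation[OF v, where f=c])
  fix B u assume B: "finite B" "B <= U" and s: "(SUM b:B. u b*c b):{0}"
  have "(SUM b:B. scale (u b) b) = (SUM b:B. scale (u b) (b - scale (c b) a)) + scale (SUM b:B. u b*c b) a"
   by(simp add: scale_right_diff_distrib sum_subtractf scale_sum_left)
  thus "(SUM b:B. scale (u b) b):W"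
   using s c B assms(2) by(auto intro!: subspace_sum subspace_scale)
 qed auto
 also have "... <= 1"
 proof -
  have "k.lin_on UNIV (%x. x)" by(simp add: k.lin_on_def)
  from k.qd_codim_functional[OF _ this] show ?thesis by simp
 qed
 finally show "qd U W <= 1" .
qed

lemma qd_span_finite: "finite S ==> qd (span S) {0} <= enat (card S)"
proof -
 assume S: "finite S"
 obtain B where B: "B <= S" "independent B" "S <= span B" using maximal_independent_subset[of S] by blast
 hence "span S = span B" by(metis span_mono span_span subset_antisym)
 moreover have "qd (span B) (span {}) = ecard (B - {})" using B by(intro qd_basis) auto
 ultimately have "qd (span S) {0} = enat (card B)" using B S by(auto simp: ecard_def dest: finite_subset)
 thus ?thesis using card_mono[OF S B(1)] by simp
qed

end

context ground begin

definition prods :: "'K set => 'K set => 'K set" where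
 "prods A B = kv.span {a*b |a b. a:A & b:B}"

lemma prods_subspace: "ksub (prods A B)" unfolding prods_def by simp

lemma prods_base: "a:A ==> b:B ==> a*b:prods A B"
 unfolding prods_def by(rule kv.span_base) blast

lemma prods_least: "ksub N ==> (!!a b. a:A ==> b:B ==> a*b:N) ==> prods A B <= N"
 unfolding prods_def by(rule kv.span_minimal) auto

lemma prods_commute: "prods A B = prods B A"
 unfolding prods_def by(rule arg_cong[of _ _ kv.span]) (auto, metis mult.commute, metis mult.commute)

definition pw :: "'K => 'K => nat => 'K set" where
 "pw x b n = kv.span ((%i. b*x^i) ` {..<n})"

lemma pw_subspace: "ksub (pw x b n)" unfolding pw_def by simp

lemma pw_base: "i < n ==> b*x^i:pw x b n" unfolding pw_def by(rule kv.span_base) auto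

lemma pw_least: "ksub N ==> (!!i. i < n ==> b*x^i:N) ==> pw x b n <= N"
 unfolding pw_def by(rule kv.span_minimal) auto

lemma transcendental:
 assumes x: "x ~: range em" and p: "p ~= 0" shows "ev p x ~= 0"
proof -
 have "ev p x:{x. x ~= 0}" by(rule ev_split[OF _ _ _ p]) (use x in auto)
 thus ?thesis by simp
qed

lemma power_relation:
 assumes x: "x ~: range em" and s: "(SUM i<=n. em (a i)*x^i) = 0" and i: "i <= n"
 shows "a i = 0"
proof -
 define p where "p = (SUM i<=n. monom (a i) i)"
 have "ev p x = 0" unfolding p_def ev_sum_monom by(rule s)
 hence "p = 0" using transcendental[OF x] by blast
 moreover have "coeff p i = a i" unfolding p_def using i by(simp add: coeff_sum)
 ultimately show ?thesis by simp
qed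

lemma pw_dim:
 assumes x: "x ~: range em" and b: "b ~= 0" shows "qdK (pw x b n) {0} = enat n"
proof(rule antisym)
 have "qdK (pw x b n) {0} <= enat (card ((%i. b*x^i) ` {..<n}))" unfolding pw_def by(rule kv.qd_span_finite) simp
 also have "... <= enat n" using card_image_le[of "{..<n}" "%i. b*x^i"] by simp
 finally show "qdK (pw x b n) {0} <= enat n" .
 show "enat n <= qdK (pw x b n) {0}"
 proof(rule ccontr)
  assume "~ ?thesis"
  then obtain e where e: "qdK (pw x b n) {0} = enat e" "e < n" by(cases "qdK (pw x b n) {0}") auto
  define f where "f i = (if i < n then b*x^i else 0)" for i
  have fp: "f i:pw x b n" for i unfolding f_def using pw_base ksub_0[OF pw_subspace] by auto
  from kv.qd_dependent_seq[where f=f, OF e(1) fp] obtain a i where a: "i <= e" "a i ~= 0" "(SUM i<=e. em (a i)*f i) = 0" by auto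
  have "(SUM i<=e. em (a i)*f i) = b*(SUM i<=e. em (a i)*x^i)"
   unfolding sum_distrib_left by(rule sum.cong) (use e in "auto simp: f_def")
  hence "(SUM i<=e. em (a i)*x^i) = 0" using a(3) b by simp
  from power_relation[OF x this a(1)] show False using a by simp
 qed
qed

lemma stable_finite_dim:
 assumes B: "ksub B" "qdK B {0} < \<infinity>" "b:B" "b ~= 0" and st: "!!b. b:B ==> x*b:B"
 shows "x:range em"
proof(rule ccontr)
 assume x: "x ~: range em"
 obtain e where e: "qdK B {0} = enat e" using B(2) by(rule less_infinityE)
 have "b*x^i:B" for i
 proof(induction i)
  case 0 thus ?case using B by simp
 next
  case (Suc i) thus ?case using st[of "b*x^i"] by(simp add: mult.left_commute)
 qed
 hence "pw x b (Suc e) <= B" by(intro pw_least B)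
 hence "qdK (pw x b (Suc e)) {0} <= enat e" using e kv.qd_mono[of "pw x b (Suc e)" B "{0}" "{0}"] by simp
 thus False using pw_dim[OF x B(4)] by simp
qed

text \<open>Elements b of B with x b \<in> B form a subspace of codimension one, to which induction applies; it is not
  of codimension zero because no nonzero finite-dimensional space is stable under x.\<close>
lemma geometric_progression:
 assumes x: "x ~: range em"
 shows "ksub B ==> qdK B {0} = enat (Suc q) ==>
  qdK {u + x*v |u v. u:B & v:B} {0} <= enat (Suc (Suc q)) ==> EX b. b ~= 0 & B = pw x b (Suc q)"
proof(induction q arbitrary: B)
 case 0
 hence "~ B <= {0}" using kv.qd_eq_0[of "{0}" B] by(auto simp: zero_enat_def)
 then obtain b where b: "b:B" "b ~= 0" by blast
 have "pw x b 1 <= B" using b 0 by(intro pw_least) auto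
 hence "pw x b 1 = B"
  by(rule kv.subspace_eq_of_qd[OF pw_subspace 0(1)]) (use 0 pw_dim[OF x b(2), of 1] in auto)
 thus ?case using b by auto
next
 case (Suc q)
 note B = Suc.prems(1)
 let ?S = "{u + x*v |u v. u:B & v:B}"
 have xB: "ksub (x ** B)" by(rule ksub_image[OF B])
 have "?S = {u + w |u w. u:B & w:x ** B}" by blast
 hence S: "ksub ?S" using kv.subspace_sums[OF B xB] by simp
 have BS: "B <= ?S" using ksub_0[OF B] by force
 have "qdK ?S {0} = qdK ?S B + qdK B {0}" by(rule kv.qd_add) (use S B BS ksub_0[OF B] in auto)
 hence S1: "qdK ?S B <= 1" using Suc.prems(2,3) by(cases "qdK ?S B") (auto simp: one_enat_def)
 define B1 where "B1 = {b:B. x*b:B}"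
 have B1: "ksub B1" unfolding B1_def
 proof(rule kv.subspaceI)
  show "em c*b:{b:B. x*b:B}" if "b:{b:B. x*b:B}" for c b
   using that ksub_scale[OF B, of b c] ksub_scale[OF B, of "x*b" c] by(simp add: mult.left_commute)
 qed (use ksub_0[OF B] ksub_add[OF B] in "auto simp: distrib_left")
 have B1B: "B1 <= B" unfolding B1_def by auto
 have "qdK B B1 <= qdK ?S B"
 proof(rule qd_le_relation[OF vspK vspK, where f="%v. x*v"])
  show "x*v:?S" if "v:B" for v using that ksub_0[OF B] by force
  show "0:B" by(rule ksub_0[OF B])
  fix U a assume U: "finite U" "U <= B" and s: "(SUM b:U. em (a b)*(x*b)):B"
  have "(SUM b:U. em (a b)*(x*b)) = x*(SUM b:U. em (a b)*b)" by(simp add: sum_distrib_left mult.left_commute)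
  thus "(SUM b:U. em (a b)*b):B1" unfolding B1_def
   using s U by(auto intro!: ksub_sum[OF B] ksub_scale[OF B])
 qed
 hence le1: "qdK B B1 <= 1" using S1 by simp
 have BB: "qdK B {0} = qdK B B1 + qdK B1 {0}" by(rule kv.qd_add) (use B B1 B1B ksub_0[OF B1] in auto)
 have ge1: "qdK B B1 ~= 0"
 proof
  assume "qdK B B1 = 0"
  hence st: "x*b:B" if "b:B" for b using kv.qd_eq_0[OF B1] that unfolding B1_def by blast
  have "~ B <= {0}" using Suc.prems(2) kv.qd_eq_0[of "{0}" B] by(auto simp: zero_enat_def)
  then obtain b where "b:B" "b ~= 0" by blast
  thus False using stable_finite_dim[OF B _ _ _ st] Suc.prems(2) x by auto
 qed
 hence "qdK B B1 = 1" using le1 by(cases "qdK B B1") (auto simp: one_enat_def zero_enat_def)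
 hence d1: "qdK B1 {0} = enat (Suc q)" using BB Suc.prems(2) by(cases "qdK B1 {0}") (auto simp: one_enat_def)
 have "{u + x*v |u v. u:B1 & v:B1} <= B" using B1_def ksub_add[OF B] by auto
 hence "qdK {u + x*v |u v. u:B1 & v:B1} {0} <= enat (Suc (Suc q))"
  using kv.qd_mono[of "{u + x*v |u v. u:B1 & v:B1}" B "{0}" "{0}"] Suc.prems(2) by simp
 from Suc.IH[OF B1 d1 this] obtain b where b: "b ~= 0" "B1 = pw x b (Suc q)" by blast
 have "b*x^i:B" if "i < Suc (Suc q)" for i
 proof(cases "i = Suc q")
  case True
  have "b*x^q:B1" unfolding b(2) by(rule pw_base) simp
  hence "x*(b*x^q):B" by(simp add: B1_def)
  thus ?thesis using True by(simp add: mult.left_commute)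
 next
  case False
  hence "b*x^i:B1" unfolding b(2) using that by(intro pw_base) simp
  thus ?thesis using B1B by blast
 qed
 hence "pw x b (Suc (Suc q)) <= B" by(intro pw_least B)
 hence "pw x b (Suc (Suc q)) = B"
  by(rule kv.subspace_eq_of_qd[OF pw_subspace B]) (use Suc.prems(2) pw_dim[OF x b(1)] in auto)
 thus ?case using b by auto
qed

lemma finite_span_set:
 assumes A: "ksub A" "qdK A {0} < \<infinity>"
 obtains B where "finite B" "B <= A" "A = kv.span B"
proof -
 obtain n where n: "qdK A {0} = enat n" using A(2) by(rule less_infinityE)
 obtain B where B: "finite B" "card B = n" "B <= A" "kv.indep_mod {0} B"
  "!!x. x:A ==> EX a. x - (SUM b:B. em (a b)*b):{0}"
  by(rule kv.qd_fin_spanning[OF kv.subspace_single_0 A(1) _ n]) (use ksub_0[OF A(1)] in auto)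
 have "A <= kv.span B"
 proof
  fix x assume "x:A"
  then obtain a where "x - (SUM b:B. em (a b)*b):{0}" using B(5) by blast
  hence "x = (SUM b:B. em (a b)*b)" by simp
  moreover have "(SUM b:B. em (a b)*b):kv.span B" by(intro kv.span_sum kv.span_scale kv.span_base)
  ultimately show "x:kv.span B" by simp
 qed
 moreover have "kv.span B <= A" by(rule kv.span_minimal[OF B(3) A(1)])
 ultimately show ?thesis using that[OF B(1,3)] by blast
qed

lemma val_min_finite:
 assumes W: "VR W" and B: "finite B" "B ~= {}" "0 ~: B"
 shows "EX b:B. ALL x:B. x/b:W"
 using B
proof(induction B rule: finite_ne_induct)
 case (singleton x)
 thus ?case using subring_1[OF VR_subring[OF W]] by simp
next
 case (insert y B)
 then obtain b where b: "b:B" "ALL x:B. x/b:W" by auto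
 have nz: "b ~= 0" "y ~= 0" using b insert by auto
 show ?case
 proof(cases "y/b:W")
  case True thus ?thesis using b by auto
 next
  case False
  hence "inverse (y/b):W" using VR_val[OF W] unfolding valuation_ring_def by blast
  hence by': "b/y:W" by(simp add: field_simps)
  have "x/y:W" if "x:B" for x
  proof -
   have "(x/b)*(b/y):W" using b that by' subring_mult[OF VR_subring[OF W]] by blast
   thus ?thesis using nz by simp
  qed
  thus ?thesis using nz subring_1[OF VR_subring[OF W]] by(intro bexI[of _ y]) auto
 qed
qed

lemma quotients_subspace:
 assumes "submod (range em) N" shows "ksub {x. x/a:N}"
 unfolding subspace_iff submod_def
 using submod_0[OF assms] submod_add[OF assms] submod_scale[OF assms]
 by(auto simp: add_divide_distrib times_divide_eq_right[symmetric] simp del: times_divide_eq_right)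

lemma val_min:
 assumes W: "VR W" and A: "ksub A" "qdK A {0} < \<infinity>" "A ~= {0}"
 obtains a where "a:A" "a ~= 0" "!!x. x:A ==> x/a:W"
proof -
 obtain B where B: "finite B" "B <= A" "A = kv.span B" by(rule finite_span_set[OF A(1,2)])
 have "B - {0} ~= {}" using B(3) A(3) by(metis kv.span_delete_0 kv.span_empty)
 then obtain b where b: "b:B - {0}" "ALL x:B - {0}. x/b:W" using val_min_finite[OF W, of "B - {0}"] B(1) by auto
 have s: "ksub {x. x/b:W}"
  by(rule quotients_subspace) (use W VR_subring submod_mono[OF submod_self] in "auto simp: VR_def")
 have "B <= {x. x/b:W}" using b(2) subring_0[OF VR_subring[OF W]] by auto
 hence "A <= {x. x/b:W}" unfolding B(3) by(rule kv.span_minimal[OF _ s])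
 thus ?thesis using that[of b] b(1) B(2) by blast
qed

end

context rplaces begin

lemma submod_nonunits: "VR W ==> submod (range em) (nu W)"
 unfolding submod_def using nonunits_0[OF VR_subring] val_nonunits_add[OF VR_val] nonunits_mult[OF VR_subring] VR_i by blast

lemma codim_positive_order:
 assumes W: "VR W" "W ~= UNIV" and A: "ksub A" and a: "a:A" "a ~= 0" and m: "!!x. x:A ==> x/a:W"
 shows "ksub {x:A. x/a:nu W}" "qdK A {x:A. x/a:nu W} = 1"
proof -
 have "ksub (A Int {x. x/a:nu W})"
  by(rule kv.subspace_inter[OF A quotients_subspace[OF submod_nonunits[OF W(1)]]])
 moreover have "A Int {x. x/a:nu W} = {x:A. x/a:nu W}" by auto
 ultimately show s: "ksub {x:A. x/a:nu W}" by simp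
 show "qdK A {x:A. x/a:nu W} = 1"
 proof(rule kv.qd_line[OF A s _ a(1)])
  show "a ~: {x:A. x/a:nu W}" using a nonunits_1[OF VR_subring[OF W(1)]] by simp
  show "EX c. x - em c*a:{x:A. x/a:nu W}" if x: "x:A" for x
  proof -
   obtain c where c: "x/a - em c:nu W" using PR[OF W m[OF x]] by blast
   have "(x - em c*a)/a = x/a - em c" using a by(simp add: field_simps)
   thus ?thesis using c ksub_diff[OF A x ksub_scale[OF A a(1)]] by(intro exI[of _ c]) auto
  qed
 qed auto
qed

lemma product_step:
 assumes W: "VR W" "W ~= UNIV" and a: "a:A" "a ~= 0" "!!x. x:A ==> x/a:W"
  and b: "b:B" "b ~= 0" "!!x. x:B ==> x/b:W"
  and B': "B' <= {y:B. y/b:nu W}"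
 shows "qdK (prods A B') {0} + 1 <= qdK (prods A B) {0}"
proof -
 note Ws = VR_subring[OF W(1)]
 let ?P = "prods A B" let ?Q = "{x:?P. x/(a*b):nu W}"
 have m: "?P <= {x. x/(a*b):W}"
 proof(rule prods_least)
  show "ksub {x. x/(a*b):W}"
   by(rule quotients_subspace) (use W VR_subring submod_mono[OF submod_self] in "auto simp: VR_def")
  show "x*y:{x. x/(a*b):W}" if "x:A" "y:B" for x y
  proof -
   have "(x/a)*(y/b):W" using a(3) b(3) that subring_mult[OF Ws] by blast
   thus ?thesis by simp
  qed
 qed
 have ab: "a*b:?P" "a*b ~= 0" using prods_base a b by auto
 have c: "ksub ?Q" "qdK ?P ?Q = 1"
  using codim_positive_order[OF W prods_subspace ab] m by blast+
 have "prods A B' <= ?Q"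
 proof(rule prods_least[OF c(1)])
  fix x y assume xy: "x:A" "y:B'"
  have "(x/a)*(y/b):nu W" using nonunits_mult[OF Ws, of "y/b" "x/a"] a(3) B' xy by blast
  moreover have "x*y:?P" using prods_base xy B' by blast
  ultimately show "x*y:?Q" by simp
 qed
 hence "qdK (prods A B') {0} <= qdK ?Q {0}" by(intro kv.qd_mono) auto
 moreover have "qdK ?P {0} = qdK ?P ?Q + qdK ?Q {0}"
  by(rule kv.qd_add) (use prods_subspace c ksub_0[OF c(1)] in auto)
 ultimately show ?thesis using c(2) by(simp add: add.commute)
qed

lemma place_avoiding:
 assumes "x ~: range em" obtains W where "VR W" "W ~= UNIV" "x ~: W"
proof -
 have "EX W. VR W & W ~= UNIV & x ~: W"
 proof(rule ccontr)
  assume "~ ?thesis"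
  hence "x:range em" by(intro const_if_in_all_VR) blast
  thus False using assms by simp
 qed
 thus ?thesis using that by blast
qed

lemma two_elements:
 assumes B: "ksub B" "qdK B {0} >= 2"
 obtains b c where "b:B" "c:B" "b ~= 0" "c/b ~: range em"
proof -
 have "~ B <= {0}" using B kv.qd_eq_0[of "{0}" B] by auto
 then obtain b where b: "b:B" "b ~= 0" by blast
 have "~ B <= kv.span {b}"
 proof
  assume "B <= kv.span {b}"
  hence "qdK B {0} <= qdK (kv.span {b}) {0}" by(intro kv.qd_mono) auto
  also have "... <= enat (card {b})" by(rule kv.qd_span_finite) simp
  finally have "(2 :: enat) <= enat 1" using B(2) order.trans by fastforce
  thus False by(simp add: numeral_eq_enat)
 qed
 then obtain c where c: "c:B" "c ~: kv.span {b}" by blast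
 have "c/b ~: range em"
 proof
  assume "c/b:range em"
  then obtain d where "c/b = em d" by blast
  hence "c = em d*b" using b by(simp add: field_simps)
  thus False using c kv.span_scale[OF kv.span_base[of b "{b}"], of d] by simp
 qed
 thus ?thesis using that b c by blast
qed

text \<open>Induction on dim B. At a place, the elements of B of minimal order form the complement of a hyperplane B1,
  and A B1 misses the products of minimal order in AB.\<close>
lemma hopf:
 assumes A: "ksub A" "qdK A {0} < \<infinity>" "A ~= {0}"
 shows "ksub B ==> qdK B {0} = enat (Suc q) ==> qdK A {0} + enat q <= qdK (prods A B) {0}"
proof(induction q arbitrary: B)
 case 0
 hence "~ B <= {0}" using kv.qd_eq_0[of "{0}" B] by(auto simp: zero_enat_def)
 then obtain b where b: "b:B" "b ~= 0" by blast
 have "b ** A <= prods A B" using prods_base[of _ A b B] b by(auto simp: mult.commute)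
 hence "qdK (b ** A) {0} <= qdK (prods A B) {0}" by(intro kv.qd_mono) auto
 moreover have "qdK (b ** A) {0} = qdK A {0}" using qd_mult[OF b(2) kv.subspace_single_0, of A] by simp
 ultimately show ?case by(simp add: zero_enat_def[symmetric])
next
 case (Suc q)
 have "qdK B {0} >= 2" using Suc.prems(2) by(simp add: numeral_eq_enat)
 then obtain b c where bc: "b:B" "c:B" "b ~= 0" "c/b ~: range em" by(rule two_elements[OF Suc.prems(1)])
 obtain W where W: "VR W" "W ~= UNIV" by(rule place_avoiding[OF bc(4)])
 obtain a where a: "a:A" "a ~= 0" "!!x. x:A ==> x/a:W" by(rule val_min[OF W(1) A]) blast
 obtain b where b: "b:B" "b ~= 0" "!!x. x:B ==> x/b:W"
  by(rule val_min[OF W(1) Suc.prems(1)]) (use Suc.prems(2) bc in auto)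
 let ?B' = "{y:B. y/b:nu W}"
 have B': "ksub ?B'" "qdK B ?B' = 1" using codim_positive_order[OF W Suc.prems(1) b] by auto
 have "qdK B {0} = qdK B ?B' + qdK ?B' {0}" by(rule kv.qd_add) (use Suc.prems B' ksub_0[OF B'(1)] in auto)
 hence "qdK ?B' {0} = enat (Suc q)" using B'(2) Suc.prems(2) by(cases "qdK ?B' {0}") (auto simp: one_enat_def)
 from Suc.IH[OF B'(1) this] have "qdK A {0} + enat q + 1 <= qdK (prods A ?B') {0} + 1" by(rule add_right_mono)
 also have "... <= qdK (prods A B) {0}" by(rule product_step[OF W a b]) auto
 finally show ?case by(simp add: one_enat_def add.assoc)
qed

text \<open>The same step as for Hopf keeps equality while it lowers dim B.\<close>
lemma reduce_to_pencil:
 assumes A: "ksub A" "qdK A {0} < \<infinity>" "A ~= {0}"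
 shows "ksub B ==> qdK B {0} = enat (Suc (Suc q)) ==> qdK (prods A B) {0} <= qdK A {0} + enat (Suc q) ==>
  EX b c. b:B & c:B & b ~= 0 & c/b ~: range em & qdK (prods A (kv.span {b, c})) {0} <= qdK A {0} + 1"
proof(induction q arbitrary: B)
 case 0
 have "qdK B {0} >= 2" using 0(2) by(simp add: numeral_eq_enat)
 then obtain b c where bc: "b:B" "c:B" "b ~= 0" "c/b ~: range em" by(rule two_elements[OF 0(1)])
 have "prods A (kv.span {b, c}) <= prods A B"
  using kv.span_minimal[of "{b, c}" B] bc 0(1) by(intro prods_least prods_subspace) (auto intro!: prods_base)
 hence "qdK (prods A (kv.span {b, c})) {0} <= qdK (prods A B) {0}" by(intro kv.qd_mono) auto
 thus ?case using bc 0(3) by(auto simp: one_enat_def intro: order.trans)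
next
 case (Suc q)
 have "qdK B {0} >= 2" using Suc.prems(2) by(simp add: numeral_eq_enat)
 then obtain b c where bc: "b:B" "c:B" "b ~= 0" "c/b ~: range em" by(rule two_elements[OF Suc.prems(1)])
 obtain W where W: "VR W" "W ~= UNIV" by(rule place_avoiding[OF bc(4)])
 obtain a where a: "a:A" "a ~= 0" "!!x. x:A ==> x/a:W" by(rule val_min[OF W(1) A]) blast
 obtain b where b: "b:B" "b ~= 0" "!!x. x:B ==> x/b:W"
  by(rule val_min[OF W(1) Suc.prems(1)]) (use Suc.prems(2) bc in auto)
 let ?B' = "{y:B. y/b:nu W}"
 have B': "ksub ?B'" "qdK B ?B' = 1" using codim_positive_order[OF W Suc.prems(1) b] by auto
 have "qdK B {0} = qdK B ?B' + qdK ?B' {0}" by(rule kv.qd_add) (use Suc.prems B' ksub_0[OF B'(1)] in auto)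
 hence d: "qdK ?B' {0} = enat (Suc (Suc q))" using B'(2) Suc.prems(2) by(cases "qdK ?B' {0}") (auto simp: one_enat_def)
 obtain m where m: "qdK A {0} = enat m" using A(2) by(rule less_infinityE)
 have "qdK (prods A ?B') {0} + 1 <= qdK (prods A B) {0}" by(rule product_step[OF W a b]) auto
 hence "qdK (prods A ?B') {0} <= qdK A {0} + enat (Suc q)"
  using Suc.prems(3) m by(cases "qdK (prods A ?B') {0}"; cases "qdK (prods A B) {0}") (auto simp: one_enat_def)
 from Suc.IH[OF B'(1) d this] show ?case by blast
qed

lemma pencil_progression:
 assumes A: "ksub A" "qdK A {0} = enat (Suc p)" and b: "b ~= 0" "c/b ~: range em"
  and le: "qdK (prods A (kv.span {b, c})) {0} <= enat (Suc (Suc p))"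
 shows "EX a. a ~= 0 & A = pw (c/b) a (Suc p)"
proof(rule geometric_progression[OF b(2) A])
 let ?S = "{u + c/b*v |u v. u:A & v:A}"
 have "b ** ?S <= prods A (kv.span {b, c})"
 proof
  fix y assume "y:b ** ?S"
  then obtain u v where uv: "u:A" "v:A" "y = b*(u + c/b*v)" by blast
  hence "y = u*b + v*(b*(c/b))" by(simp only: distrib_left mult_ac)
  hence "y = u*b + v*c" using b by simp
  moreover have "u*b:prods A (kv.span {b, c})" "v*c:prods A (kv.span {b, c})"
   using uv by(auto intro!: prods_base kv.span_base)
  ultimately show "y:prods A (kv.span {b, c})" using ksub_add[OF prods_subspace] by simp
 qed
 hence "qdK (b ** ?S) {0} <= qdK (prods A (kv.span {b, c})) {0}" by(intro kv.qd_mono) auto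
 moreover have "qdK (b ** ?S) {0} = qdK ?S {0}" using qd_mult[OF b(1) kv.subspace_single_0, of ?S] by simp
 ultimately show "qdK ?S {0} <= enat (Suc (Suc p))" using le by simp
qed

text \<open>Replacing B by a pencil <b, c> shows that A is a geometric progression in x = c/b. Removing its last
  terms, again without losing equality, leaves a pencil <a, ax>, and now B is a progression in the same x.\<close>
lemma equality_in_hopf:
 assumes A: "ksub A" "qdK A {0} = enat (Suc (Suc p))" and B: "ksub B" "qdK B {0} = enat (Suc (Suc q))"
  and le: "qdK (prods A B) {0} <= enat (p + q + 3)"
 shows "EX w x. w ~= 0 & x ~: range em & prods A B = pw x w (p + q + 3)"
proof -
 have nz: "A ~= {0}" "B ~= {0}" using A(2) B(2) by(auto simp: zero_enat_def)
 have "qdK (prods A B) {0} <= qdK A {0} + enat (Suc q)" using le A(2) by(simp add: eval_nat_numeral)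
 from reduce_to_pencil[OF A(1) _ nz(1) B this] A(2)
 obtain b c where bc: "b ~= 0" "c/b ~: range em" "qdK (prods A (kv.span {b, c})) {0} <= qdK A {0} + 1" by auto
 then obtain a where a: "a ~= 0" "A = pw (c/b) a (Suc (Suc p))"
  using pencil_progression[OF A bc(1,2)] A(2) by(auto simp: one_enat_def)
 obtain x where xd: "x = c/b" by blast
 note a = a[folded xd] and bc = bc[folded xd]
 obtain W where W: "VR W" "W ~= UNIV" "x ~: W" by(rule place_avoiding[OF bc(2)])
 have x0: "x ~= 0" "inverse x:nu W" using val_not_in[OF VR_val[OF W(1)] W(3)] by auto
 have small: "(inverse x)^Suc i:nu W" for i
  using nonunits_mult[OF VR_subring[OF W(1)] x0(2), of "inverse x^i"]
   subring_power[OF VR_subring[OF W(1)] nonunits_sub[OF x0(2)]] by(simp add: mult.commute)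
 obtain b0 where b0: "b0:B" "b0 ~= 0" "!!y. y:B ==> y/b0:W"
  by(rule val_min[OF W(1) B(1)]) (use B nz in auto)
 \<comment> \<open>shorten the progression of A at a pole of x\<close>
 have "qdK (prods B (pw x a (Suc (Suc m)))) {0} <= enat (m + q + 3)" if "m <= p" for m
  using that
 proof(induction "p - m" arbitrary: m)
  case 0
  thus ?case using le a(2) by(simp add: prods_commute)
 next
  case (Suc d)
  have ih: "qdK (prods B (pw x a (Suc (Suc (Suc m))))) {0} <= enat (Suc m + q + 3)" by(rule Suc.hyps(1)) (use Suc in auto)
  let ?top = "a*x^Suc (Suc m)"
  have sub1: "pw x a (Suc (Suc (Suc m))) <= {y. y/?top:W}"
  proof(rule pw_least)
   show "ksub {y. y/?top:W}"
    by(rule quotients_subspace) (use W VR_subring submod_mono[OF submod_self] in "auto simp: VR_def")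
   fix i assume i: "i < Suc (Suc (Suc m))"
   have "a*x^i/?top = inverse x^(Suc (Suc m) - i)"
    using i a x0 by(simp add: power_diff power_inverse field_simps del: power_Suc)
   thus "a*x^i:{y. y/?top:W}"
    using subring_power[OF VR_subring[OF W(1)] nonunits_sub[OF x0(2)]] by simp
  qed
  have sub2: "pw x a (Suc (Suc m)) <= {y:pw x a (Suc (Suc (Suc m))). y/?top:nu W}"
  proof -
   have "pw x a (Suc (Suc m)) <= pw x a (Suc (Suc (Suc m))) Int {y. y/?top:nu W}"
   proof(rule pw_least)
    show "ksub (pw x a (Suc (Suc (Suc m))) Int {y. y/?top:nu W})"
     by(rule kv.subspace_inter[OF pw_subspace quotients_subspace[OF submod_nonunits[OF W(1)]]])
    fix i assume i: "i < Suc (Suc m)"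
    have "a*x^i/?top = inverse x^(Suc (Suc m) - i)"
     using i a x0 by(simp add: power_diff power_inverse field_simps del: power_Suc)
    also have "... = inverse x^Suc (Suc m - i)" using i by(simp add: Suc_diff_le)
    finally show "a*x^i:pw x a (Suc (Suc (Suc m))) Int {y. y/?top:nu W}"
     using small pw_base[of i "Suc (Suc (Suc m))" a x] i by simp
   qed
   thus ?thesis by blast
  qed
  have "qdK (prods B (pw x a (Suc (Suc m)))) {0} + 1 <= qdK (prods B (pw x a (Suc (Suc (Suc m))))) {0}"
   by(rule product_step[OF W(1,2) b0, of ?top])
     (use sub1 sub2 a x0 pw_base[of "Suc (Suc m)" "Suc (Suc (Suc m))" a x] in auto)
  also note ih
  finally show ?case by(cases "qdK (prods B (pw x a (Suc (Suc m)))) {0}") (auto simp: one_enat_def)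
 qed
 from this[of 0] have le2: "qdK (prods B (pw x a (Suc (Suc 0)))) {0} <= enat (Suc (Suc (Suc q)))" by(simp add: eval_nat_numeral)
 have "pw x a (Suc (Suc 0)) = kv.span {a, a*x}"
  unfolding pw_def by(rule arg_cong[of _ _ kv.span]) (auto simp: lessThan_Suc)
 then obtain b1 where b1: "b1 ~= 0" "B = pw x b1 (Suc (Suc q))"
  using pencil_progression[OF B a(1), of "a*x"] le2 a bc by auto
 have "prods A B = pw x (a*b1) (p + q + 3)"
 proof
  show "prods A B <= pw x (a*b1) (p + q + 3)"
  proof -
   have "a*x^i*v:pw x (a*b1) (p + q + 3)" if i: "i < Suc (Suc p)" and v: "v:B" for i v
   proof -
    have "B <= {v. a*x^i*v:pw x (a*b1) (p + q + 3)}" unfolding b1(2)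
    proof(rule pw_least)
     show "ksub {v. a*x^i*v:pw x (a*b1) (p + q + 3)}"
      by(rule kv.subspaceI) (use ksub_0[OF pw_subspace] ksub_add[OF pw_subspace] ksub_scale[OF pw_subspace] in "auto simp: distrib_left mult.left_commute")
     fix j assume j: "j < Suc (Suc q)"
     have e: "a*x^i*(b1*x^j) = a*b1*x^(i + j)" by(simp only: power_add mult_ac)
     show "b1*x^j:{v. a*x^i*v:pw x (a*b1) (p + q + 3)}"
      unfolding mem_Collect_eq e by(rule pw_base) (use i j in simp)
    qed
    thus ?thesis using v by blast
   qed
   note key = this
   have "u*v:pw x (a*b1) (p + q + 3)" if u: "u:A" and v: "v:B" for u v
   proof -
    have "A <= {u. u*v:pw x (a*b1) (p + q + 3)}" unfolding a(2)
    proof(rule pw_least)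
     show "ksub {u. u*v:pw x (a*b1) (p + q + 3)}"
      by(rule kv.subspaceI) (use ksub_0[OF pw_subspace] ksub_add[OF pw_subspace] ksub_scale[OF pw_subspace] in "auto simp: distrib_right mult.assoc")
    qed (use key v in auto)
    thus ?thesis using u by blast
   qed
   thus ?thesis by(intro prods_least pw_subspace)
  qed
  show "pw x (a*b1) (p + q + 3) <= prods A B"
  proof(rule pw_least[OF prods_subspace])
   fix n assume n: "n < p + q + 3"
   define i where "i = min n (Suc p)"
   have i: "i < Suc (Suc p)" "n - i < Suc (Suc q)" "i <= n" using n by(auto simp: i_def)
   have "a*b1*x^n = (a*x^i)*(b1*x^(n - i))"
    using i(3) by(simp add: power_add[symmetric] mult_ac)
   moreover have "a*x^i:A" "b1*x^(n - i):B" unfolding a(2) b1(2) using i by(auto intro: pw_base)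
   ultimately show "a*b1*x^n:prods A B" using prods_base by metis
  qed
 qed
 thus ?thesis using a b1 bc(2) by(intro exI[of _ "a*b1"] exI[of _ x]) auto
qed

end

section \<open>The curve defined by a linear system\<close>

context ground begin

lemma lin_span_k: "lspan (range em) S = kv.span S"
proof(intro equalityI subsetI)
 fix x assume "x:lspan (range em) S"
 then obtain T a where T: "finite T" "T <= S" "ALL t:T. a t:range em" "x = (SUM t:T. a t*t)" unfolding lin_span_def by blast
 have "a t*t:kv.span S" if "t:T" for t
 proof -
  obtain c where "a t = em c" using T(3) `t : T` by blast
  thus ?thesis using kv.span_scale[OF kv.span_base, of t S c] T(2) `t : T` by auto
 qed
 thus "x:kv.span S" unfolding T(4) by(intro kv.span_sum)
next
 fix x assume "x:kv.span S"
 moreover have "kv.span S <= lspan (range em) S"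
  by(rule kv.span_minimal) (use lin_span_base[OF range_subring] submod_lin_span[OF range_subring] in "auto simp: subspace_iff")
 ultimately show "x:lspan (range em) S" by blast
qed

lemma coord_span: "coord_ring_part em V n = kv.span (power_products V n)"
 unfolding coord_ring_part_def lin_span_k ..

lemma coord_subspace: "ksub (coord_ring_part em V n)" unfolding coord_span by simp

lemma power_products_0: "power_products V 0 = {1}" unfolding power_products_def by auto

lemma power_products_Suc: "power_products V (Suc n) = {p*v |p v. p:power_products V n & v:V}"
proof(intro equalityI subsetI)
 fix x assume "x:power_products V (Suc n)"
 then obtain f where "x = (PROD i<Suc n. f i)" "ALL i<Suc n. f i:V" unfolding power_products_def by blast
 hence "x = (PROD i<n. f i)*f n" "(PROD i<n. f i):power_products V n" "f n:V"
  unfolding power_products_def by auto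
 thus "x:{p*v |p v. p:power_products V n & v:V}" by blast
next
 fix x assume "x:{p*v |p v. p:power_products V n & v:V}"
 then obtain f v where f: "x = (PROD i<n. f i)*v" "ALL i<n. f i:V" "v:V" unfolding power_products_def by blast
 hence "x = (PROD i<Suc n. (f(n := v)) i)" by simp
 moreover have "ALL i<Suc n. (f(n := v)) i:V" using f by(auto simp: less_Suc_eq)
 ultimately show "x:power_products V (Suc n)" unfolding power_products_def by blast
qed

lemma coord_0: "coord_ring_part em V 0 = range em"
proof -
 have "coord_ring_part em V 0 = lspan (range em) {1}" by(simp add: coord_ring_part_def power_products_0)
 also have "... = range em"
 proof
  show "lspan (range em) {1} <= range em"
   by(rule lin_span_submod[OF submod_self[OF range_subring]]) (use subring_1[OF range_subring] in auto)
  show "range em <= lspan (range em) {1}"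
   using lin_span_scale[OF range_subring lin_span_base[OF range_subring, of 1 "{1}"]] by fastforce
 qed
 finally show ?thesis .
qed

lemma subspace_preimage_mult:
 assumes N: "ksub N" shows "ksub {b. a*b:N}" "ksub {b. b*a:N}"
proof -
 show "ksub {b. a*b:N}"
 proof(rule kv.subspaceI)
  show "em c*x:{b. a*b:N}" if "x:{b. a*b:N}" for c x
   using that ksub_scale[OF N, of "a*x" c] by(simp add: mult.left_commute)
 qed (use ksub_0[OF N] ksub_add[OF N] in "auto simp: distrib_left")
 thus "ksub {b. b*a:N}" by(simp add: mult.commute)
qed

lemma coord_Suc: "coord_ring_part em V (Suc n) = prods (coord_ring_part em V n) V"
proof
 have pp: "power_products V n <= coord_ring_part em V n" for n unfolding coord_span by(rule kv.span_superset)
 show "coord_ring_part em V (Suc n) <= prods (coord_ring_part em V n) V"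
  unfolding coord_span[of V "Suc n"] power_products_Suc
  by(rule kv.span_minimal[OF _ prods_subspace]) (use pp in "auto intro!: prods_base")
 show "prods (coord_ring_part em V n) V <= coord_ring_part em V (Suc n)"
 proof(rule prods_least[OF coord_subspace])
  fix a b assume a: "a:coord_ring_part em V n" and b: "b:V"
  have "kv.span (power_products V n) <= {a. a*b:coord_ring_part em V (Suc n)}"
  proof(rule kv.span_minimal)
   show "ksub {a. a*b:coord_ring_part em V (Suc n)}"
    by(rule subspace_preimage_mult[OF coord_subspace])
   show "power_products V n <= {a. a*b:coord_ring_part em V (Suc n)}"
    using b pp[of "Suc n"] unfolding power_products_Suc by blast
  qed
  thus "a*b:coord_ring_part em V (Suc n)" using a unfolding coord_span[of V n] by blast
 qed
qed

lemma coord_mult: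
 assumes "a:coord_ring_part em V m" "b:coord_ring_part em V n"
 shows "a*b:coord_ring_part em V (m + n)"
 using assms(2)
proof(induction n arbitrary: b)
 case 0
 then obtain c where "b = em c" unfolding coord_0 by blast
 thus ?case using ksub_scale[OF coord_subspace, of a V m c] assms(1) by(simp add: mult.commute)
next
 case (Suc n)
 have "prods (coord_ring_part em V n) V <= {b. a*b:coord_ring_part em V (m + Suc n)}"
 proof(rule prods_least)
  show "ksub {b. a*b:coord_ring_part em V (m + Suc n)}"
   by(rule subspace_preimage_mult[OF coord_subspace])
  fix x v assume "x:coord_ring_part em V n" "v:V"
  hence "(a*x)*v:coord_ring_part em V (Suc (m + n))" unfolding coord_Suc using Suc.IH prods_base by blast
  thus "x*v:{b. a*b:coord_ring_part em V (m + Suc n)}" by(simp add: mult.assoc)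
 qed
 thus ?case using Suc.prems unfolding coord_Suc by blast
qed

lemma coord_1: "ksub V ==> coord_ring_part em V 1 = V"
proof -
 assume V: "ksub V"
 have "power_products V 1 = V" using power_products_Suc[of V 0] by(simp add: power_products_0)
 thus ?thesis unfolding coord_span by(simp add: kv.span_eq_iff[THEN iffD2, OF V])
qed

lemma coord_power: "v:coord_ring_part em V m ==> v^n:coord_ring_part em V (m*n)"
proof(induction n)
 case 0
 have "em 1:range em" by blast
 thus ?case by(simp add: coord_0)
next
 case (Suc n)
 hence "v*v^n:coord_ring_part em V (m + m*n)" by(intro coord_mult) auto
 thus ?case by simp
qed

end

context rplaces begin

lemma rat_ring_dominated:
 assumes R: "rat_ring R" and W: "VR W" "W ~= UNIV" "R <= W"
 shows "dominates W R"
proof -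
 note Ws = VR_subring[OF W(1)] and Rs = rat_subring[OF R]
 have "y:nu W" if y: "y:nu R" for y
 proof -
  have yR: "y:R" using y nonunits_sub by blast
  obtain c where c: "y - em c:nu W" using PR[OF W(1,2), of y] yR W by blast
  have "c = 0"
  proof(rule ccontr)
   assume c0: "c ~= 0"
   let ?n = "y - em c"
   have nR: "?n:R" using subring_diff[OF Rs yR rat_i[OF R]] .
   have "?n ~: nu R"
   proof
    assume "?n:nu R"
    hence "y + - ?n:nu R" using rat_add[OF R y nonunits_neg[OF Rs]] by blast
    hence "em c:nu R" by simp
    thus False using i_nonunits[OF Rs rat_range[OF R]] c0 by simp
   qed
   hence "?n ~= 0" "inverse ?n:W" using unit_inverse[OF nR] W(3) by auto
   thus False using c by(simp add: nonunits_def)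
  qed
  thus ?thesis using c by simp
 qed
 thus ?thesis unfolding dominates_def using W(3) nonunits_sub by(auto simp: nonunits_def)
qed

lemma rat_ring_colength:
 assumes A: "finite T" and W: "VR W" "W ~= UNIV" "ag T <= W" and x: "x:loc (ag T) W" "x ~= 0"
 shows "rat_ring (loc (ag T) W)" "qdK (loc (ag T) W) (x ** loc (ag T) W) < \<infinity>"
  "!!y. y:nu (loc (ag T) W) ==> EX N. y^N:x ** loc (ag T) W"
proof -
 let ?A = "ag T" let ?R = "loc ?A W"
 note As = alg_gen_subring[of em T] and Wv = VR_val[OF W(1)]
 have Rs: "is_subring ?R" "?A <= ?R" "?R <= W" "nu ?R = nu W Int ?R"
  using loc_subring[OF As Wv W(3)] loc_sup[OF As Wv W(3)] loc_sub[OF As Wv W(3)] loc_nonunits[OF As Wv W(3)] by blast+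
 have kR: "range em <= ?R" using alg_gen_base(2)[of em T] Rs(2) by blast
 show rat: "rat_ring ?R" unfolding rat_ring_def
 proof(intro conjI ballI)
  fix y assume y: "y:?R"
  then obtain a where "y - em a:nu W" using PR[OF W(1,2)] Rs(3) by blast
  moreover have "y - em a:?R" using subring_diff[OF Rs(1) y] kR by blast
  ultimately show "EX a. y - em a:nu ?R" unfolding Rs(4) by blast
 next
  fix y z assume "y:nu ?R" "z:nu ?R"
  thus "y + z:nu ?R" unfolding Rs(4) using val_nonunits_add[OF Wv] subring_add[OF Rs(1)] by blast
 qed (use Rs kR in auto)
 show nil: "EX N. y^N:x ** ?R" if y: "y:nu ?R" for y
 proof(rule nilpotent_mod[OF Rs(1) x])
  show "y:?R" using y nonunits_sub by blast
  fix W' assume W': "valuation_ring W'" "?R <= W'" "x:nu W'"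
  hence "VR W'" "W' ~= UNIV" using kR nonunits_nontrivial[OF W'(3) x(2)] by(auto simp: VR_def)
  thus "y:nu W'" using rat_ring_dominated[OF rat _ _ W'(2)] y by(simp add: dominates_def)
 qed
 obtain S where "finite S" "nu ?R = lspan ?R S"
  using nonunits_loc_generated[OF A W(1,3)] PR[OF W(1,2)] W(3) alg_gen_base(1)[of T em] by blast
 thus "qdK ?R (x ** ?R) < \<infinity>" using finite_colength[OF rat _ _ x(1) nil] by blast
qed

end

text \<open>A linear system V on the normalization; the last assumption says dim V \<ge> 2. Its image curve may have a
  function field smaller than K.\<close>
locale linsys = rplaces em for em :: "'k::alg_closed_field => 'K::field" +
 fixes V :: "'K set"
 assumes Vs: "ksub V" and Vf: "qdK V {0} < \<infinity>"
  and Vt: "EX u:V. EX v:V. v ~= 0 & u/v ~: range em"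
begin

abbreviation "Vn n == coord_ring_part em V n"
abbreviation "tw n == twisting_sheaf V n"

text \<open>v generates at the place W the invertible sheaf that V generates.\<close>
definition gen :: "'K set => 'K => bool" where
 "gen W v \<longleftrightarrow> v:V & v ~= 0 & (ALL w:V. w/v:W)"

definition Av :: "'K => 'K set" where "Av v = ag ((%w. w/v) ` V)"

text \<open>The local ring of the image curve below W, described by fractions of forms and so without the choice of a
  chart.\<close>
definition RW :: "'K set => 'K set" where
 "RW W = {a/b |n a b. a:Vn n & b:Vn n & b ~= 0 & (ALL c:Vn n. c/b:W)}"

lemma gen_UNIV: "v:V ==> v ~= 0 ==> gen UNIV v" by(simp add: gen_def)

lemma V_nonzero: "V ~= {0}" using Vt by auto

lemma nonzero_elem: obtains v where "v:V" "v ~= 0" using V_nonzero ksub_0[OF Vs] by blast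

lemma basis: obtains B where "finite B" "B <= V" "0 ~: B" "B ~= {}" "V = kv.span B"
proof -
 obtain B where B: "finite B" "B <= V" "V = kv.span B" by(rule finite_span_set[OF Vs Vf])
 have "V = kv.span (B - {0})" using B(3) by simp
 moreover hence "B - {0} ~= {}" using V_nonzero by(metis kv.span_empty)
 ultimately show ?thesis using that[of "B - {0}"] B by blast
qed

lemma gen_from_basis:
 assumes B: "finite B" "B <= V" "0 ~: B" "B ~= {}" "V = kv.span B" and W: "VR W"
 shows "EX v:B. gen W v"
proof -
 obtain b where b: "b:B" "ALL x:B. x/b:W" using val_min_finite[OF W B(1,4,3)] by blast
 have s: "ksub {x. x/b:W}"
  by(rule quotients_subspace) (use W VR_subring submod_mono[OF submod_self] in "auto simp: VR_def")
 have "V <= {x. x/b:W}" unfolding B(5) by(rule kv.span_minimal[OF _ s]) (use b in auto)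
 hence "gen W b" unfolding gen_def using b B(2,3) by blast
 thus ?thesis using b by blast
qed

lemma gen_exists: "VR W ==> EX v. gen W v"
 using gen_from_basis basis by metis

lemma V_coord: "v:V ==> v:Vn 1" using coord_1[OF Vs] by simp

lemma power_coord: "v:V ==> v^n:Vn n" using coord_power[OF V_coord, of v n] by simp

lemma gen_coord:
 assumes W: "VR W" and v: "gen W v" and a: "a:Vn n" shows "a/v^n:W"
proof -
 have Ws: "is_subring W" "range em <= W" using W VR_subring by(auto simp: VR_def)
 show ?thesis using a
 proof(induction n arbitrary: a)
  case 0 thus ?case using Ws by(auto simp: coord_0)
 next
  case (Suc n)
  have "prods (Vn n) V <= {a. a/v^Suc n:W}"
  proof(rule prods_least)
   show "ksub {a. a/v^Suc n:W}"
    by(rule quotients_subspace) (rule submod_mono[OF submod_self[OF Ws(1)] Ws(2)])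
   fix x y assume "x:Vn n" "y:V"
   hence "(x/v^n)*(y/v):W" using Suc.IH v subring_mult[OF Ws(1)] unfolding gen_def by blast
   thus "x*y:{a. a/v^Suc n:W}" by(simp add: mult.commute)
  qed
  thus ?case using Suc.prems unfolding coord_Suc by blast
 qed
qed

lemma Av_eq:
 assumes v: "v:V" "v ~= 0" shows "Av v = (\<Union>n. (%a. a/v^n) ` Vn n)"
proof
 let ?U = "\<Union>n. (%a. a/v^n) ` Vn n"
 have mem: "a/v^n:?U" if "a:Vn n" for a n using that by blast
 show "Av v <= ?U" unfolding Av_def
 proof(rule alg_gen_least)
  show "is_subring ?U" unfolding is_subring_def
  proof(intro conjI ballI)
   show "1:?U" using mem[of 1 0] unfolding coord_0 by(simp add: subring_1[OF range_subring])
   fix x y assume "x:?U" "y:?U"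
   then obtain a b n m where ab: "x = a/v^n" "a:Vn n" "y = b/v^m" "b:Vn m" by blast
   have "a*b:Vn (n + m)" using coord_mult ab by blast
   from mem[OF this] show "x*y:?U" using ab by(simp add: power_add)
   have "a*v^m - v^n*b:Vn (n + m)"
    using coord_mult[OF ab(2) power_coord[OF v(1)]] coord_mult[OF power_coord[OF v(1)] ab(4)]
    by(rule ksub_diff[OF coord_subspace])
   from mem[OF this] have "(a*v^m - v^n*b)/v^(n + m):?U" .
   moreover have "(a*v^m - v^n*b)/v^(n + m) = x - y"
    using v by(simp add: ab(1,3) power_add diff_divide_distrib)
   ultimately show "x - y:?U" by simp
  qed
  show "range em <= ?U" using mem[of _ 0] unfolding coord_0 by auto
  show "(%w. w/v) ` V <= ?U" using mem[of _ 1] V_coord by auto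
 qed
 have A: "is_subring (Av v)" "range em <= Av v" unfolding Av_def using alg_gen_subring alg_gen_base by blast+
 have "Vn n <= {a. a/v^n:Av v}" for n
 proof(induction n)
  case 0 thus ?case using A by(auto simp: coord_0)
 next
  case (Suc n)
  show ?case unfolding coord_Suc
  proof(rule prods_least)
   show "ksub {a. a/v^Suc n:Av v}"
    by(rule quotients_subspace) (rule submod_mono[OF submod_self[OF A(1)] A(2)])
   fix x y assume xy: "x:Vn n" "y:V"
   have "y/v:Av v" unfolding Av_def using xy alg_gen_base(1)[of "(%w. w/v) ` V" em] by blast
   hence "(x/v^n)*(y/v):Av v" using Suc xy subring_mult[OF A(1)] by blast
   thus "x*y:{a. a/v^Suc n:Av v}" by(simp add: mult.commute)
  qed
 qed
 thus "?U <= Av v" by blast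
qed

lemma Av_sub:
 assumes "VR W" "gen W v" shows "Av v <= W"
 unfolding Av_def by(rule alg_gen_least) (use assms VR_subring in "auto simp: gen_def VR_def")

lemma RW_eq_loc:
 assumes W: "VR W" and v: "gen W v" shows "RW W = loc (Av v) W"
proof(intro equalityI subsetI)
 have v': "v:V" "v ~= 0" using v by(auto simp: gen_def)
 note Ws = VR_subring[OF W]
 fix x assume "x:RW W"
 then obtain n a b where ab: "x = a/b" "a:Vn n" "b:Vn n" "b ~= 0" "ALL c:Vn n. c/b:W" unfolding RW_def by blast
 have "inverse (b/v^n):W" using ab(5) power_coord[OF v'(1), of n] by auto
 hence "b/v^n ~: nu W" using ab(4) v' by(auto simp: nonunits_def)
 moreover have "a/v^n:Av v" "b/v^n:Av v" unfolding Av_eq[OF v'] using ab by blast+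
 moreover have "x = (a/v^n)/(b/v^n)" using ab v' by simp
 ultimately show "x:loc (Av v) W" unfolding loc_iff by blast
next
 have v': "v:V" "v ~= 0" using v by(auto simp: gen_def)
 note Ws = VR_subring[OF W]
 fix x assume "x:loc (Av v) W"
 then obtain y z where yz: "x = y/z" "y:Av v" "z:Av v" "z ~: nu W" unfolding loc_iff by blast
 obtain a n where a: "y = a/v^n" "a:Vn n" using yz(2) unfolding Av_eq[OF v'] by blast
 obtain b m where b: "z = b/v^m" "b:Vn m" using yz(3) unfolding Av_eq[OF v'] by blast
 have zW: "z:W" using yz(3) Av_sub[OF W v] by blast
 hence z: "z ~= 0" "inverse z:W" using unit_inverse yz(4) by auto
 let ?a = "a*v^m" and ?b = "v^n*b"
 have b0: "b ~= 0" using z b by auto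
 have "x = ?a/?b" using yz a b v' b0 by(simp add: field_simps)
 moreover have "?a:Vn (n + m)" "?b:Vn (n + m)" using coord_mult a b power_coord[OF v'(1)] by blast+
 moreover have "?b ~= 0" using b0 v' by simp
 moreover have "c/?b:W" if c: "c:Vn (n + m)" for c
 proof -
  have "c/v^(n + m)*inverse z:W" using gen_coord[OF W v c] z subring_mult[OF Ws] by blast
  moreover have "c/v^(n + m)*inverse z = c/?b" using b b0 v' by(simp add: power_add field_simps)
  ultimately show ?thesis by simp
 qed
 ultimately show "x:RW W" unfolding RW_def by blast
qed

lemma Av_alg_gen_finite:
 assumes B: "finite B" "B <= V" "V = kv.span B" shows "Av v = ag ((%w. w/v) ` B)"
proof
 let ?A = "ag ((%w. w/v) ` B)"
 have A: "is_subring ?A" "range em <= ?A" using alg_gen_subring alg_gen_base by blast+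
 have "kv.span B <= {w. w/v:?A}"
 proof(rule kv.span_minimal)
  show "B <= {w. w/v:?A}" using alg_gen_base(1)[of "(%w. w/v) ` B" em] by blast
  show "ksub {w. w/v:?A}"
   by(rule quotients_subspace) (rule submod_mono[OF submod_self[OF A(1)] A(2)])
 qed
 thus "Av v <= ?A" unfolding Av_def by(intro alg_gen_least A) (use B in auto)
 show "?A <= Av v" unfolding Av_def
  by(intro alg_gen_least alg_gen_subring) (use B alg_gen_base(2)[of em] alg_gen_base(1)[of "(%w. w/v) ` V" em] in blast)+
qed

lemma RW_finite_chart:
 assumes W: "VR W" and v: "gen W v"
 obtains T where "finite T" "ag T = Av v" "ag T <= W" "RW W = loc (ag T) W"
proof -
 obtain B where B: "finite B" "B <= V" "0 ~: B" "B ~= {}" "V = kv.span B" by(rule basis)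
 have "ag ((%w. w/v) ` B) = Av v" using Av_alg_gen_finite[OF B(1,2,5)] by simp
 thus ?thesis using that[of "(%w. w/v) ` B"] B(1) RW_eq_loc[OF W v] Av_sub[OF W v] by simp
qed

lemma RW_facts:
 assumes W: "VR W"
 shows "is_subring (RW W)" "range em <= RW W" "RW W <= W" "nu (RW W) = nu W Int RW W"
proof -
 obtain v where v: "gen W v" using gen_exists[OF W] by blast
 obtain T where T: "finite T" "ag T <= W" "RW W = loc (ag T) W" by(rule RW_finite_chart[OF W v])
 note l = alg_gen_subring VR_val[OF W] T(2)
 show "is_subring (RW W)" "RW W <= W" "nu (RW W) = nu W Int RW W"
  unfolding T(3) by(rule loc_subring[OF l] loc_sub[OF l] loc_nonunits[OF l])+
 show "range em <= RW W" unfolding T(3) using loc_sup[OF l] alg_gen_base(2)[of em T] by blast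
qed

lemma RW_place:
 assumes W: "VR W" "W ~= UNIV"
 shows "rat_ring (RW W)" "x:RW W ==> x ~= 0 ==> qdK (RW W) (x ** RW W) < \<infinity>"
  "x:RW W ==> x ~= 0 ==> y:nu (RW W) ==> EX N. y^N:x ** RW W"
proof -
 obtain v where v: "gen W v" using gen_exists[OF W(1)] by blast
 obtain T where T: "finite T" "ag T = Av v" "ag T <= W" "RW W = loc (ag T) W" by(rule RW_finite_chart[OF W(1) v])
 show "x:RW W ==> x ~= 0 ==> qdK (RW W) (x ** RW W) < \<infinity>"
  using rat_ring_colength(2)[OF T(1) W T(3)] T(4) by simp
 show "x:RW W ==> x ~= 0 ==> y:nu (RW W) ==> EX N. y^N:x ** RW W"
  using rat_ring_colength(3)[OF T(1) W T(3)] T(4) by simp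
 have "1:RW W" using subring_1[OF RW_facts(1)[OF W(1)]] .
 thus "rat_ring (RW W)" using rat_ring_colength(1)[OF T(1) W T(3), of 1] T(4) by simp
qed

abbreviation "K' == RW UNIV"

lemma K'_iff: "x:K' \<longleftrightarrow> (EX n a b. x = a/b & a:Vn n & b:Vn n & b ~= 0)"
 unfolding RW_def by auto

lemma K'_subring: "is_subring K'" using RW_facts(1)[OF VR_UNIV] .
lemma K'_range: "range em <= K'" using RW_facts(2)[OF VR_UNIV] .
lemma K'_subspace: "ksub K'" by(rule subring_subspace[OF K'_subring K'_range])

lemma K'_inverse: "x:K' ==> inverse x:K'"
proof -
 assume "x:K'"
 then obtain n a b where ab: "x = a/b" "a:Vn n" "b:Vn n" "b ~= 0" unfolding K'_iff by blast
 show ?thesis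
 proof(cases "a = 0")
  case True thus ?thesis using ab subring_0[OF K'_subring] by simp
 next
  case False
  have "inverse x = b/a" using ab by simp
  thus ?thesis unfolding K'_iff using ab False by blast
 qed
qed

lemma K'_divide: "x:K' ==> y:K' ==> x/y:K'"
 using subring_mult[OF K'_subring _ K'_inverse] by(simp add: divide_inverse)

lemma RW_sub_K': "RW W <= K'" unfolding RW_def by blast

lemma coord_quot_K': "a:Vn n ==> b:Vn n ==> b ~= 0 ==> a/b:K'"
 unfolding K'_iff by blast

lemma V_quot_K': "u:V ==> v:V ==> v ~= 0 ==> u/v:K'"
 using coord_quot_K'[of u 1 v] V_coord by simp

lemma K'_not_sub:
 assumes W: "VR W" "W ~= UNIV" shows "~ K' <= W"
proof
 assume KW: "K' <= W"
 obtain u v where uv: "u:V" "v:V" "v ~= 0" "u/v ~: range em" using Vt by blast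
 have x: "u/v:K'" using V_quot_K' uv by blast
 then obtain a where a: "u/v - em a:nu W" using PR[OF W] KW by blast
 have nz: "u/v - em a ~= 0" using uv(4) by auto
 have "u/v - em a:K'" using subring_diff[OF K'_subring x] K'_range by blast
 hence "inverse (u/v - em a):W" using K'_inverse KW by blast
 thus False using a nz by(simp add: nonunits_def)
qed

definition CX :: "'K set set" where "CX = {RW W |W. VR W}"

lemma RW_inclusion:
 assumes W: "VR W" "W ~= UNIV" and W': "VR W'" "W' ~= UNIV" and sub: "RW W <= RW W'"
 shows "RW W = RW W'"
proof -
 obtain v where v: "gen W v" using gen_exists[OF W(1)] by blast
 have RW': "RW W <= W'" using sub RW_facts(3)[OF W'(1)] by blast
 have d: "nu (RW W) = nu W' Int RW W"
  using rat_ring_dominated[OF RW_place(1)[OF W] W' RW'] by(simp add: dominates_def)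
 have AR: "Av v <= RW W" using loc_sup[OF _ VR_val[OF W(1)] Av_sub[OF W(1) v]] RW_eq_loc[OF W(1) v]
  alg_gen_subring unfolding Av_def by blast
 have "w/v:Av v" if "w:V" for w unfolding Av_def using that alg_gen_base(1)[of "(%w. w/v) ` V" em] by blast
 hence v': "gen W' v" using v AR RW' unfolding gen_def by blast
 have "b:nu W \<longleftrightarrow> b:nu W'" if "b:Av v" for b
  using that d RW_facts(4)[OF W(1)] AR by blast
 thus ?thesis unfolding RW_eq_loc[OF W(1) v] RW_eq_loc[OF W'(1) v'] by(auto simp: loc_iff; blast)
qed

lemma RW_ne_K': "VR W ==> W ~= UNIV ==> RW W ~= K'"
 using K'_not_sub RW_facts(3) by blast

lemma CX_closed: "cpts CX = {RW W |W. VR W & W ~= UNIV}"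
proof(intro equalityI subsetI)
 fix P assume P: "P:cpts CX"
 then obtain W where W: "VR W" "P = RW W" unfolding closed_points_def CX_def by blast
 have "W ~= UNIV"
 proof
  assume WU: "W = UNIV"
  obtain u v where uv: "u:V" "v:V" "v ~= 0" "u/v ~: range em" using Vt by blast
  obtain W' where W': "VR W'" "W' ~= UNIV" by(rule place_avoiding[OF uv(4)])
  hence "RW W' \<subset> P" using RW_ne_K' RW_sub_K' W WU by blast
  thus False using P W' unfolding closed_points_def CX_def by blast
 qed
 thus "P:{RW W |W. VR W & W ~= UNIV}" using W by blast
next
 fix P assume "P:{RW W |W. VR W & W ~= UNIV}"
 then obtain W where W: "VR W" "W ~= UNIV" "P = RW W" by blast
 have "~ Q \<subset> P" if "Q:CX" for Q
 proof
  assume QP: "Q \<subset> P"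
  obtain W' where W': "VR W'" "Q = RW W'" using `Q : CX` unfolding CX_def by blast
  show False
  proof(cases "W' = UNIV")
   case True
   thus False using QP RW_sub_K'[of W] W' W by blast
  next
   case False
   thus False using RW_inclusion[OF W'(1) False W(1,2)] QP W W' by blast
  qed
 qed
 thus "P:cpts CX" unfolding closed_points_def CX_def using W by blast
qed

lemma CX_generic: "generic_point CX = K'"
 unfolding generic_point_def CX_def using RW_sub_K' VR_UNIV by blast

sublocale cx: ptset em CX
proof unfold_locales
 show "CX = insert (generic_point CX) (cpts CX)"
  unfolding CX_generic CX_closed unfolding CX_def using VR_UNIV by blast
qed

lemma CX_closed_ne: "cpts CX ~= {}"
proof -
 obtain u v where uv: "u:V" "v:V" "v ~= 0" "u/v ~: range em" using Vt by blast
 obtain W' where W': "VR W'" "W' ~= UNIV" by(rule place_avoiding[OF uv(4)])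
 thus ?thesis unfolding CX_closed by blast
qed

lemma closed_point:
 assumes "R:cpts CX"
 obtains W u where "VR W" "W ~= UNIV" "R = RW W" "gen W u"
 using assms gen_exists unfolding CX_closed by blast

lemma almost_all:
 assumes y: "y:K'" shows "finite {R:cpts CX. y ~: R}"
proof -
 obtain B where B: "finite B" "B <= V" "0 ~: B" "B ~= {}" "V = kv.span B" by(rule basis)
 have "finite {R. EX W. VR W & W ~= UNIV & R = RW W & y ~: R & gen W v}" if v: "v:B" for v
 proof -
  have vv: "v:V" "v ~= 0" using v B by auto
  have "y:loc (Av v) UNIV" using y RW_eq_loc[OF VR_UNIV gen_UNIV[OF vv]] by simp
  then obtain a b where ab: "y = a/b" "a:Av v" "b:Av v" "b ~: nu UNIV" unfolding loc_iff by blast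
  have b0: "b ~= 0" using ab(4) by(auto simp: nonunits_def)
  let ?T = "(%w. w/v) ` B"
  have A: "Av v = ag ?T" by(rule Av_alg_gen_finite[OF B(1,2,5)])
  let ?F = "{ag ?T Int nu W |W. VR W & ag ?T <= W & b:nu W}"
  have fin: "finite ?F" by(rule chart_finite) (use B ab A b0 in auto)
  have "{R. EX W. VR W & W ~= UNIV & R = RW W & y ~: R & gen W v} <= (%p. localization (Av v) p) ` ?F"
  proof
   fix R assume "R:{R. EX W. VR W & W ~= UNIV & R = RW W & y ~: R & gen W v}"
   then obtain W where W: "VR W" "R = RW W" "y ~: R" "gen W v" by blast
   have R: "R = loc (Av v) W" using RW_eq_loc[OF W(1,4)] W by simp
   have "b:nu W"
   proof(rule ccontr)
    assume "b ~: nu W"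
    hence "y:R" unfolding R loc_iff using ab by blast
    thus False using W by simp
   qed
   thus "R:(%p. localization (Av v) p) ` ?F" unfolding R loc_def using W(1) Av_sub[OF W(1,4)] A by blast
  qed
  thus ?thesis using fin finite_surj by blast
 qed
 hence "finite (UN v:B. {R. EX W. VR W & W ~= UNIV & R = RW W & y ~: R & gen W v})" using B(1) by blast
 moreover have "{R:cpts CX. y ~: R} <= (UN v:B. {R. EX W. VR W & W ~= UNIV & R = RW W & y ~: R & gen W v})"
  unfolding CX_closed using gen_from_basis[OF B] by blast
 ultimately show ?thesis using finite_subset by blast
qed

end

section \<open>Degree and Riemann--Roch on the curve of a linear system\<close>

context ground begin

lemma avoid_subspaces:
 assumes V: "ksub V" and S: "finite S" "!!s. s:S ==> ksub (N s)" "!!s. s:S ==> ~ V <= N s"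
 shows "EX x:V. ALL s:S. x ~: N s"
 using S
proof(induction S rule: finite_induct)
 case empty thus ?case using ksub_0[OF V] by blast
next
 case (insert s S)
 then obtain x where x: "x:V" "ALL s:S. x ~: N s" by auto
 show ?case
 proof(cases "x:N s")
  case False thus ?thesis using x by auto
 next
  case True
  have Ns: "ksub (N s)" using insert by auto
  obtain y where y: "y:V" "y ~: N s" using insert.prems(2)[of s] by blast
  define z where "z c = y + em c*x" for c
  have zV: "z c:V" for c unfolding z_def using x y ksub_add[OF V] ksub_scale[OF V] by blast
  have zs: "z c ~: N s" for c
  proof
   assume "z c:N s"
   from ksub_diff[OF Ns this ksub_scale[OF Ns True, of c]] show False using y by(simp add: z_def)
  qed
  have "finite {c. z c:N t}" if t: "t:S" for t
  proof(rule finite_subset)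
   have Nt: "ksub (N t)" using insert t by auto
   have "c = d" if cd: "z c:N t" "z d:N t" for c d
   proof(rule ccontr)
    assume "c ~= d"
    have "z c - z d:N t" by(rule ksub_diff[OF Nt cd])
    hence "em (inverse (c - d))*(z c - z d):N t" by(rule ksub_scale[OF Nt])
    moreover have "em (inverse (c - d))*(z c - z d) = em (inverse (c - d)*(c - d))*x"
     unfolding i_mult i_diff z_def by(simp add: algebra_simps)
    ultimately have "x:N t" using `c ~= d` by simp
    thus False using x t by blast
   qed
   thus "{c. z c:N t} <= {SOME c. z c:N t}"
    using someI[of "%c. z c:N t"] by blast
  qed simp
  hence "finite (UN t:S. {c. z c:N t})" using insert by blast
  then obtain c where "c ~: (UN t:S. {c. z c:N t})" using ex_new_if_finite[OF k_infinite] by blast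
  thus ?thesis using zV zs by(intro bexI[of _ "z c"]) auto
 qed
qed

end

lemma image_mult_assoc: "a ** b ** S = (a*b) ** (S :: 'a::field set)"
 by(simp add: image_image mult.assoc)

context linsys begin

lemma point_subring: "R:CX ==> is_subring R" and point_range: "R:CX ==> range em <= R"
 unfolding CX_def using RW_facts by blast+

lemma closed_in: "R:cpts CX ==> R:CX" unfolding closed_points_def by blast

lemma K'_in: "K':CX" unfolding CX_def using VR_UNIV by blast

lemma tw_submod: "R:CX ==> submod R (tw n R)"
 unfolding twisting_sheaf_def by(rule submod_lin_span[OF point_subring])

lemma tw_subspace: "R:CX ==> ksub (tw n R)"
 using submod_subspace[OF tw_submod point_range] .

lemma coord_tw: "R:CX ==> Vn n <= tw n R"
 unfolding twisting_sheaf_def coord_ring_part_def by(rule lin_span_mono[OF point_range order.refl])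

lemma gen_Av_RW:
 assumes W: "VR W" and u: "gen W u" shows "a:Vn n ==> a/u^n:RW W" "Av u <= RW W"
proof -
 have uv: "u:V" "u ~= 0" using u by(auto simp: gen_def)
 show s: "Av u <= RW W" unfolding RW_eq_loc[OF W u]
  using loc_sup[OF _ VR_val[OF W] Av_sub[OF W u]] alg_gen_subring unfolding Av_def by blast
 show "a:Vn n ==> a/u^n:RW W" using s unfolding Av_eq[OF uv] by blast
qed

lemma tw_gen:
 assumes W: "VR W" and u: "gen W u" shows "tw n (RW W) = (u^n) ** RW W"
proof
 have uv: "u:V" "u ~= 0" using u by(auto simp: gen_def)
 note Rs = RW_facts(1)[OF W]
 show "tw n (RW W) <= (u^n) ** RW W" unfolding twisting_sheaf_def
 proof(rule lin_span_submod[OF submod_image[OF submod_self[OF Rs]]])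
  show "power_products V n <= (u^n) ** RW W"
  proof
   fix p assume "p:power_products V n"
   hence "p:Vn n" unfolding coord_span using kv.span_base by blast
   hence "p/u^n:RW W" by(rule gen_Av_RW(1)[OF W u])
   moreover have "p = u^n*(p/u^n)" using uv by simp
   ultimately show "p:(u^n) ** RW W" by blast
  qed
 qed
 have "u^n:power_products V n" unfolding power_products_def
  using uv by(intro CollectI exI[of _ "%_. u"]) auto
 hence "r*u^n:tw n (RW W)" if "r:RW W" for r unfolding twisting_sheaf_def
  using lin_span_scale[OF Rs lin_span_base[OF Rs] that] by blast
 thus "(u^n) ** RW W <= tw n (RW W)" by(auto simp: mult.commute[of "u^n"])
qed

lemma tw_K': "v:V ==> v ~= 0 ==> tw n K' = (v^n) ** K'"
 by(rule tw_gen[OF VR_UNIV gen_UNIV])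

lemma tw_0: "R:CX ==> tw 0 R = R"
 unfolding CX_def using gen_exists tw_gen[of _ _ 0] by auto

lemma tw_mult: "R:CX ==> a:Vn m ==> x:tw n R ==> a*x:tw (m + n) R"
proof -
 assume R: "R:CX" and a: "a:Vn m" and x: "x:tw n R"
 obtain W where W: "VR W" "R = RW W" using R unfolding CX_def by blast
 obtain u where u: "gen W u" using gen_exists[OF W(1)] by blast
 have u0: "u ~= 0" using u by(simp add: gen_def)
 obtain y where y: "x = u^n*y" "y:RW W" using x unfolding W(2) tw_gen[OF W(1) u] by blast
 have "a/u^m*y:RW W" using gen_Av_RW(1)[OF W(1) u a] y subring_mult[OF RW_facts(1)[OF W(1)]] by blast
 moreover have "a*x = u^(m + n)*(a/u^m*y)" using y u0 by(simp add: power_add)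
 ultimately show ?thesis unfolding W(2) tw_gen[OF W(1) u] by blast
qed

text \<open>The zeros of the section v of O(1).\<close>
definition Z :: "'K => 'K set set" where
 "Z v = {R:cpts CX. EX w:V. w/v ~: R}"

lemma Z_finite:
 assumes v: "v:V" "v ~= 0" shows "finite (Z v)"
proof -
 obtain B where B: "finite B" "B <= V" "0 ~: B" "B ~= {}" "V = kv.span B" by(rule basis)
 have "Z v <= (UN w:B. {R:cpts CX. w/v ~: R})"
 proof
  fix R assume R: "R:Z v"
  hence Rc: "R:cpts CX" "R:CX" using closed_in by(auto simp: Z_def)
  have "EX w:B. w/v ~: R"
  proof(rule ccontr)
   assume "~ ?thesis"
   hence "B <= {w. w/v:R}" by blast
   moreover have "ksub {w. w/v:R}"
    by(rule quotients_subspace) (use Rc point_subring point_range submod_mono[OF submod_self] in blast)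
   ultimately have "V <= {w. w/v:R}" unfolding B(5) by(rule kv.span_minimal)
   thus False using R by(auto simp: Z_def)
  qed
  thus "R:(UN w:B. {R:cpts CX. w/v ~: R})" using Rc by blast
 qed
 moreover have "finite (UN w:B. {R:cpts CX. w/v ~: R})"
  using B almost_all V_quot_K' v by blast
 ultimately show ?thesis by(rule finite_subset)
qed

lemma not_Z:
 assumes "R:cpts CX" "R ~: Z v" "v:V" "v ~= 0" "VR W" "R = RW W"
 shows "gen W v"
 using assms RW_facts(3)[of W] unfolding Z_def gen_def by blast

lemma tw_not_Z:
 assumes "R:cpts CX" "R ~: Z v" "v:V" "v ~= 0"
 shows "tw n R = (v^n) ** R"
proof -
 obtain W where "VR W" "R = RW W" using assms(1) closed_in unfolding CX_def by blast
 thus ?thesis using tw_gen not_Z[OF assms] by blast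
qed

lemma fam_tw: "cx.fam (tw n K') (tw n)"
 unfolding cx.fam_def CX_generic
proof(intro conjI ballI)
 show "ksub (tw n K')" by(rule tw_subspace[OF K'_in])
 show "tw n K' = tw n K'" ..
 fix R assume R: "R:cpts CX"
 show "ksub (tw n R)" by(rule tw_subspace[OF closed_in[OF R]])
 show "tw n R <= tw n K'" unfolding twisting_sheaf_def
  using closed_in[OF R] RW_sub_K' unfolding CX_def by(intro lin_span_mono) auto
next
 fix m assume m: "m:tw n K'"
 obtain v where v: "v:V" "v ~= 0" by(rule nonzero_elem)
 obtain y where y: "y:K'" "m = v^n*y" using m unfolding tw_K'[OF v] by blast
 have "{R:cpts CX. m ~: tw n R} <= Z v Un {R:cpts CX. y ~: R}"
 proof
  fix R assume "R:{R:cpts CX. m ~: tw n R}"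
  hence R: "R:cpts CX" "m ~: tw n R" by auto
  show "R:Z v Un {R:cpts CX. y ~: R}"
  proof(cases "R:Z v")
   case False
   thus ?thesis using R tw_not_Z[OF R(1) False v, of n] y by blast
  qed simp
 qed
 thus "finite {R:cpts CX. m ~: tw n R}"
  using Z_finite[OF v] almost_all[OF y(1)] by(meson finite_Un finite_subset)
qed

abbreviation sc :: "'K => ('K set => 'K set) => 'K set => 'K set" where
 "sc y F == (%P. y ** F P)"

lemma K'_scale: "y:K' ==> y ~= 0 ==> y ** K' = K'"
proof
 assume y: "y:K'" "y ~= 0"
 show "y ** K' <= K'" using y subring_mult[OF K'_subring] by blast
 show "K' <= y ** K'"
 proof
  fix x assume "x:K'"
  hence "x/y:K'" "x = y*(x/y)" using K'_divide y by auto
  thus "x:y ** K'" by blast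
 qed
qed

lemma sc_tw_K':
 assumes a: "a:Vn m" "a ~= 0" shows "a ** tw n K' = tw (m + n) K'"
proof -
 obtain v where v: "v:V" "v ~= 0" by(rule nonzero_elem)
 have q: "a/v^m:K'" using coord_quot_K' a power_coord[OF v(1)] v by simp
 have "tw (m + n) K' = (v^(m + n)) ** (a/v^m) ** K'"
  unfolding tw_K'[OF v] using K'_scale[OF q] a v by simp
 also have "... = a ** tw n K'" unfolding tw_K'[OF v] image_mult_assoc
  using v by(simp add: power_add mult_ac)
 finally show ?thesis ..
qed

lemma fam_sc_tw:
 assumes a: "a:Vn m" "a ~= 0" shows "cx.fam (tw (m + n) K') (sc a (tw n))"
 using cx.fam_scale[OF fam_tw a(2), of n] sc_tw_K'[OF a, of n] by simp

lemma sc_tw_sub: "R:CX ==> a:Vn m ==> sc a (tw n) R <= tw (m + n) R"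
 using tw_mult by blast

lemma power_products_coord: "power_products V n <= Vn n"
 unfolding coord_span by(rule kv.span_superset)

lemma sc_tw_ae:
 assumes a: "a:power_products V m" "a ~= 0"
 shows "finite {R:cpts CX. sc a (tw n) R ~= tw (m + n) R}"
 using a
proof(induction m arbitrary: a)
 case 0
 hence "a = 1" by(simp add: power_products_0)
 thus ?case by simp
next
 case (Suc m)
 then obtain p v where pv: "a = p*v" "p:power_products V m" "v:V" unfolding power_products_Suc by blast
 hence nz: "p ~= 0" "v ~= 0" using Suc by auto
 have "{R:cpts CX. sc a (tw n) R ~= tw (Suc m + n) R} <= Z v Un {R:cpts CX. sc p (tw n) R ~= tw (m + n) R}"
 proof
  fix R assume "R:{R:cpts CX. sc a (tw n) R ~= tw (Suc m + n) R}"
  hence R: "R:cpts CX" "sc a (tw n) R ~= tw (Suc m + n) R" by auto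
  show "R:Z v Un {R:cpts CX. sc p (tw n) R ~= tw (m + n) R}"
  proof(rule ccontr)
   assume "~ ?thesis"
   hence n: "R ~: Z v" "sc p (tw n) R = tw (m + n) R" using R by auto
   have "sc a (tw n) R = v ** sc p (tw n) R" unfolding image_mult_assoc pv(1) by(simp add: mult.commute)
   also have "... = v ** tw (m + n) R" using n(2) by(simp only:)
   also have "... = tw (Suc m + n) R" unfolding tw_not_Z[OF R(1) n(1) pv(3) nz(2)] image_mult_assoc by simp
   finally show False using R by simp
  qed
 qed
 thus ?case using Z_finite[OF pv(3) nz(2)] Suc.IH[OF pv(2) nz(1)] by(meson finite_Un finite_subset)
qed

lemma pair_sc_tw:
 assumes a: "a:power_products V m" "a ~= 0"
 shows "fam_pair em CX (tw (m + n) K') (sc a (tw n)) (tw (m + n))"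
proof(unfold_locales)
 have aV: "a:Vn m" using a power_products_coord by blast
 show "cx.fam (tw (m + n) K') (sc a (tw n))" by(rule fam_sc_tw[OF aV a(2)])
 show "cx.fam (tw (m + n) K') (tw (m + n))" by(rule fam_tw)
 show "sc a (tw n) P <= tw (m + n) P" if "P:cpts CX" for P by(rule sc_tw_sub[OF closed_in[OF that] aV])
 show "finite {P:cpts CX. sc a (tw n) P ~= tw (m + n) P}" by(rule sc_tw_ae[OF a])
qed (rule CX_closed_ne)

lemma V_pp: "v:V ==> v:power_products V 1"
 using power_products_Suc[of V 0] by(simp add: power_products_0)

text \<open>The degree of the divisor of v; \<open>degree_eq\<close> identifies it with the projective degree, so it
  does not depend on v.\<close>
definition dg :: "'K => enat" where
 "dg v = qdA (Lam CX (tw 1)) (Lam CX (sc v (tw 0)))"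

lemma degree_step:
 assumes v: "v:V" "v ~= 0"
 shows "qdA (Lam CX (tw (1 + n))) (Lam CX (sc v (tw n))) = (SUM R:Z v. qdK (tw 1 R) (sc v (tw 0) R))"
  and "qdA (Lam CX (tw (1 + n))) (Lam CX (sc v (tw n))) = dg v" and "dg v < \<infinity>"
proof -
 have main: "qdA (Lam CX (tw (1 + n))) (Lam CX (sc v (tw n))) = (SUM R:Z v. qdK (tw 1 R) (sc v (tw 0) R))" for n
 proof -
  interpret p: fam_pair em CX "tw (1 + n) K'" "sc v (tw n)" "tw (1 + n)" by(rule pair_sc_tw[OF V_pp[OF v(1)] v(2)])
  have "qdA (Lam CX (tw (1 + n))) (Lam CX (sc v (tw n))) = (SUM R:Z v. qdK (tw (1 + n) R) (sc v (tw n) R))"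
  proof(rule cx.Lam_sum[OF p.F p.G p.FG Z_finite[OF v]])
   show "Z v <= cpts CX" unfolding Z_def by blast
   show "sc v (tw n) P = tw (1 + n) P" if "P:cpts CX" "P ~: Z v" for P
    unfolding tw_not_Z[OF that v] image_mult_assoc by simp
  qed
  also have "... = (SUM R:Z v. qdK (tw 1 R) (sc v (tw 0) R))"
  proof(rule sum.cong[OF refl])
   fix R assume "R:Z v"
   hence R: "R:cpts CX" unfolding Z_def by blast
   obtain W u where W: "VR W" "W ~= UNIV" "R = RW W" "gen W u" by(rule closed_point[OF R])
   have u0: "u^n ~= 0" using W(4) by(simp add: gen_def)
   have "tw (1 + n) R = (u^n) ** tw 1 R" "sc v (tw n) R = (u^n) ** sc v (tw 0) R"
    unfolding W(3) tw_gen[OF W(1,4)] image_mult_assoc by(simp_all add: mult_ac)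
   thus "qdK (tw (1 + n) R) (sc v (tw n) R) = qdK (tw 1 R) (sc v (tw 0) R)"
    using qd_mult[OF u0 ksub_image[OF tw_subspace[OF closed_in[OF R]]]] by simp
  qed
  finally show ?thesis .
 qed
 show "qdA (Lam CX (tw (1 + n))) (Lam CX (sc v (tw n))) = (SUM R:Z v. qdK (tw 1 R) (sc v (tw 0) R))" by(rule main)
 have d: "dg v = (SUM R:Z v. qdK (tw 1 R) (sc v (tw 0) R))" using main[of 0] by(simp add: dg_def)
 thus "qdA (Lam CX (tw (1 + n))) (Lam CX (sc v (tw n))) = dg v" using main[of n] by simp
 have fin1: "qdK (tw 1 R) (sc v (tw 0) R) < \<infinity>" if RZ: "R:Z v" for R
 proof -
  have R: "R:cpts CX" using RZ unfolding Z_def by blast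
  obtain W u where W: "VR W" "W ~= UNIV" "R = RW W" "gen W u" by(rule closed_point[OF R])
  have u0: "u ~= 0" using W(4) by(simp add: gen_def)
  have x: "v/u:RW W" "v/u ~= 0" using gen_Av_RW(1)[OF W(1,4) V_coord[OF v(1)]] v u0 by auto
  have e1: "tw 1 R = u ** RW W" and e2: "sc v (tw 0) R = u ** (v/u) ** RW W"
   unfolding W(3) tw_gen[OF W(1,4)] image_mult_assoc using u0 by simp_all
  have "qdK (tw 1 R) (sc v (tw 0) R) = qdK (RW W) ((v/u) ** RW W)"
   unfolding e1 e2 by(rule qd_mult[OF u0 ksub_image[OF subring_subspace[OF RW_facts(1,2)[OF W(1)]]]])
  thus ?thesis using RW_place(2)[OF W(1,2) x] by simp
 qed
 have "(SUM R:T. qdK (tw 1 R) (sc v (tw 0) R)) < \<infinity>" if T: "finite T" "T <= Z v" for T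
  using T
 proof(induction T rule: finite_induct)
  case (insert R T)
  thus ?case using fin1[of R] by(auto simp: plus_eq_infty_iff_enat)
 qed simp
 thus "dg v < \<infinity>" unfolding d using Z_finite[OF v] by blast
qed

lemma H0_tw_0: "H0 CX (tw 0) = range em"
proof
 show "range em <= H0 CX (tw 0)" unfolding H0_def using tw_0 point_range by auto
 show "H0 CX (tw 0) <= range em"
 proof
  fix x assume x: "x:H0 CX (tw 0)"
  show "x:range em"
  proof(rule const_if_in_all_VR)
   fix W assume W: "VR W" "W ~= UNIV"
   hence "RW W:CX" unfolding CX_def by blast
   hence "x:RW W" using x tw_0 unfolding H0_def by blast
   thus "x:W" using RW_facts(3)[OF W(1)] by blast
  qed
 qed
qed

lemma qd_range: "qdK (range em) {0} = 1"
proof(rule kv.qd_line[of _ _ 1])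
 show "ksub (range em)" by(rule subring_subspace[OF range_subring order.refl])
 show "{0} <= range em" using subring_0[OF range_subring] by simp
qed (auto intro: subring_1[OF range_subring])

lemma h0_tw_0: "h0 em CX (tw 0) = 1" unfolding h0_def H0_tw_0 by(rule qd_range)

lemma coord_H0: "Vn n <= H0 CX (tw n)" unfolding H0_def using coord_tw by blast

lemma h0_tw_step:
 assumes v: "v:V" "v ~= 0" shows "h0 em CX (tw (1 + n)) <= h0 em CX (tw n) + dg v"
proof -
 interpret p: fam_pair em CX "tw (1 + n) K'" "sc v (tw n)" "tw (1 + n)" by(rule pair_sc_tw[OF V_pp[OF v(1)] v(2)])
 show ?thesis using p.h0_le degree_step(2)[OF v, of n] cx.h0_scale[OF fam_tw v(2), of n] by simp
qed

lemma h0_tw_bound: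
 assumes v: "v:V" "v ~= 0" "dg v = enat e" shows "h0 em CX (tw n) <= enat (1 + n*e)"
proof(induction n)
 case 0 thus ?case by(simp add: h0_tw_0 one_enat_def)
next
 case (Suc n)
 have "h0 em CX (tw (Suc n)) <= h0 em CX (tw n) + enat e" using h0_tw_step[OF v(1,2), of n] v(3) by simp
 also have "... <= enat (1 + n*e) + enat e" using Suc by(rule add_right_mono)
 finally show ?case by(simp add: algebra_simps)
qed

lemma coord_le_h0: "qdK (Vn n) {0} <= h0 em CX (tw n)"
 unfolding h0_def by(rule kv.qd_mono[OF coord_H0]) auto

end

section \<open>The Hilbert function\<close>

text \<open>The defect 1 + n e - D n is nonnegative and eventually nonincreasing.\<close>
lemma eventually_linear:
 fixes D :: "nat => nat"
 assumes le: "!!n. D n <= 1 + n*e" and ge: "!!n. n0 <= n ==> D n + e <= D (Suc n)"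
 shows "EX (c::int) N. ALL n>=N. int (D n) = int e*int n + c"
proof -
 define f where "f n = int (D n) - int e*int n" for n
 have mono1: "f n <= f (Suc n)" if "n0 <= n" for n
 proof -
  have "int (D n + e) <= int (D (Suc n))" using ge[OF that] by(simp only: of_nat_le_iff)
  thus ?thesis by(simp add: f_def algebra_simps)
 qed
 have mono: "f n <= f m" if "n0 <= n" "n <= m" for n m
  using that(2,1) by(induction m rule: dec_induct) (auto intro: order.trans[OF _ mono1])
 have up: "f n <= 1" for n
 proof -
  have "int (D n) <= int (1 + n*e)" using le[of n] by(simp only: of_nat_le_iff)
  thus ?thesis by(simp add: f_def algebra_simps)
 qed
 have "f ` {n0..} <= {f n0..1}" using mono up by auto
 hence fin: "finite (f ` {n0..})" using finite_subset by blast
 have "Max (f ` {n0..}):f ` {n0..}" by(rule Max_in[OF fin]) auto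
 then obtain N where N: "n0 <= N" "f N = Max (f ` {n0..})" by auto
 have "f n = f N" if "N <= n" for n
  using mono[OF N(1) that] Max_ge[OF fin, of "f n"] N that by simp
 thus ?thesis by(intro exI[of _ "f N"] exI[of _ N]) (simp add: f_def algebra_simps)
qed

context linsys begin

lemma common_gen:
 assumes S: "finite S" "S <= cpts CX"
 obtains u where "u:V" "u ~= 0" "!!R. R:S ==> EX W. VR W & W ~= UNIV & R = RW W & gen W u"
proof -
 have "EX W w. VR W & W ~= UNIV & R = RW W & gen W w" if "R:S" for R
  using that S(2) closed_point by(metis subsetD)
 then obtain W w where Ww: "!!R. R:S ==> VR (W R) & W R ~= UNIV & R = RW (W R) & gen (W R) (w R)" by metis
 define N where "N R = (if R:S then {x. x/w R:nu (W R)} else {0})" for R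
 have KS: "K' ~: S" using S(2) RW_ne_K' unfolding CX_closed by blast
 have "EX x:V. ALL R:insert K' S. x ~: N R"
 proof(rule avoid_subspaces[OF Vs])
  show "finite (insert K' S)" using S by simp
  show "ksub (N R)" if "R:insert K' S" for R
   using quotients_subspace[OF submod_nonunits] Ww by(auto simp: N_def)
  show "~ V <= N R" if "R:insert K' S" for R
  proof(cases "R:S")
   case True
   hence "w R:V" "w R/w R ~: nu (W R)"
    using Ww[OF True] nonunits_1[OF VR_subring] by(auto simp: gen_def)
   thus ?thesis using True by(auto simp: N_def)
  next
   case False thus ?thesis using nonzero_elem by(auto simp: N_def)
  qed
 qed
 then obtain u where u: "u:V" "ALL R:insert K' S. u ~: N R" by blast
 have u0: "u ~= 0" using u(2) KS by(auto simp: N_def)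
 have gu: "gen (W R) u" if R: "R:S" for R
 proof -
  note W = Ww[OF R]
  have w: "w R:V" "w R ~= 0" "!!z. z:V ==> z/w R:W R" using W by(auto simp: gen_def)
  have "u/w R ~: nu (W R)" using u(2) R by(auto simp: N_def)
  hence "inverse (u/w R):W R" using unit_inverse w(3)[OF u(1)] by blast
  hence "z/w R*inverse (u/w R):W R" if "z:V" for z
   using w(3)[OF that] subring_mult[OF VR_subring] W by blast
  hence "z/u:W R" if "z:V" for z using that w u0 by(simp add: field_simps)
  thus ?thesis using u(1) u0 by(simp add: gen_def)
 qed
 show ?thesis
 proof(rule that[OF u(1) u0])
  fix R assume "R:S"
  with Ww[OF this] gu[OF this] show "EX W. VR W & W ~= UNIV & R = RW W & gen W u"
   by(intro exI[of _ "W R"]) simp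
 qed
qed

lemma Av_subring: "is_subring (Av u)" and Av_range: "range em <= Av u"
 unfolding Av_def using alg_gen_subring alg_gen_base by blast+

lemma Av_residue:
 assumes W: "VR W" "W ~= UNIV" and u: "gen W u" and a: "a:Av u"
 shows "EX c. a - em c:nu (RW W) & a - em c:Av u"
proof -
 obtain c where "a - em c:nu (RW W)"
  using rat_res[OF RW_place(1)[OF W], of a] a gen_Av_RW(2)[OF W(1) u] by blast
 moreover have "a - em c:Av u" using subring_diff[OF Av_subring a] Av_range by blast
 ultimately show ?thesis by blast
qed

lemma local_surj:
 assumes W: "VR W" "W ~= UNIV" and u: "gen W u" and x: "x:RW W" "x ~= 0" and r: "r:RW W"
 shows "EX a:Av u. a - r:x ** RW W"
proof -
 note Rs = RW_facts(1)[OF W(1)] and AR = gen_Av_RW(2)[OF W(1) u]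
 obtain y z where yz: "r = y/z" "y:Av u" "z:Av u" "z ~: nu W"
  using r unfolding RW_eq_loc[OF W(1) u] loc_iff by blast
 have z0: "z ~= 0" using yz(4) nonunits_0[OF VR_subring[OF W(1)]] by auto
 obtain c where c: "z - em c:nu (RW W)" "z - em c:Av u" using Av_residue[OF W u yz(3)] by blast
 have c0: "c ~= 0" using c yz RW_facts(4)[OF W(1)] by auto
 define s where "s = em (- inverse c)*(z - em c)"
 have sA: "s:Av u" unfolding s_def using c(2) Av_range subring_mult[OF Av_subring] by blast
 have sn: "s:nu (RW W)" unfolding s_def
  using nonunits_mult[OF Rs c(1)] RW_facts(2)[OF W(1)] by blast
 have "em c*em (- inverse c) = - 1" using c0 by(simp add: i_mult[symmetric] i_neg)
 moreover have "em c*(1 - s) = em c - (em c*em (- inverse c))*(z - em c)"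
  unfolding s_def by(simp add: right_diff_distrib mult.assoc)
 ultimately have zs: "z = em c*(1 - s)" by simp
 hence s1: "1 - s ~= 0" using z0 by auto
 obtain N where N: "s^N:x ** RW W" using RW_place(3)[OF W x sn] by blast
 define a where "a = em (inverse c)*y*(SUM j<N. s^j)"
 have "em (inverse c):Av u" using Av_range by blast
 hence aA: "a:Av u" unfolding a_def using yz(2) sA by(intro subring_intros[OF Av_subring])
 have geo: "(1 - s)*(SUM j<N. s^j) = 1 - s^N" by(rule one_diff_power_eq[symmetric])
 have "a = r*(1 - s^N)"
 proof -
  have "r*(1 - s^N) = y/(em c*(1 - s))*((1 - s)*(SUM j<N. s^j))" unfolding geo yz(1) zs ..
  also have "... = a" unfolding a_def using s1 c0 by(simp add: i_inverse field_simps)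
  finally show ?thesis ..
 qed
 hence "a - r = (- r)*s^N" by(simp add: algebra_simps)
 moreover have "(- r)*s^N:x ** RW W"
  by(rule submod_scale[OF submod_image[OF submod_self[OF Rs]] subring_neg[OF Rs r] N])
 ultimately have "a - r:x ** RW W" by(simp only:)
 thus ?thesis using aA by blast
qed

lemma separate_points:
 assumes W: "VR W" "W ~= UNIV" "gen W u" and W': "VR W'" "W' ~= UNIV" "gen W' u" and ne: "RW W ~= RW W'"
 shows "EX t:Av u. t:nu (RW W') & t ~: nu (RW W)"
proof(rule ccontr)
 assume n: "~ ?thesis"
 note AR = gen_Av_RW(2)[OF W(1,3)] and AR' = gen_Av_RW(2)[OF W'(1,3)]
 have 1: "t:nu (RW W)" if "t:Av u" "t:nu (RW W')" for t using n that by blast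
 have 2: "t:nu (RW W')" if t: "t:Av u" "t:nu (RW W)" for t
 proof -
  obtain c where c: "t - em c:nu (RW W')" "t - em c:Av u" using Av_residue[OF W' t(1)] by blast
  have "t - em c:nu (RW W)" using 1 c by blast
  hence "t + - (t - em c):nu (RW W)"
   using rat_add[OF RW_place(1)[OF W(1,2)] t(2) nonunits_neg[OF RW_facts(1)[OF W(1)]]] by blast
  hence "c = 0" using i_nonunits[OF RW_facts(1,2)[OF W(1)]] by simp
  thus ?thesis using c by simp
 qed
 have "b:nu W \<longleftrightarrow> b:nu W'" if b: "b:Av u" for b
  using 1[OF b] 2[OF b] RW_facts(4)[OF W(1)] RW_facts(4)[OF W'(1)] AR AR' b by blast
 thus False using ne unfolding RW_eq_loc[OF W(1,3)] RW_eq_loc[OF W'(1,3)] loc_iff set_eq_iff by blast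
qed

text \<open>A power of a function that vanishes at R but not at the other point lies in x R; as in a Dedekind ring,
  products of such functions isolate one point.\<close>
lemma chinese_remainder:
 assumes S: "finite S" and pts: "!!R. R:S ==> EX W. VR W & W ~= UNIV & R = RW W & gen W u"
  and x: "!!R. R:S ==> x:R" "x ~= 0" and r: "!!R. R:S ==> r R:R"
 shows "EX a:Av u. ALL R:S. a - r R:x ** R"
 using S pts x r
proof(induction S rule: finite_induct)
 case empty thus ?case using subring_1[OF Av_subring] by auto
next
 case (insert R0 S)
 then obtain a where a: "a:Av u" "ALL R:S. a - r R:x ** R" by auto
 obtain W0 where W0: "VR W0" "W0 ~= UNIV" "R0 = RW W0" "gen W0 u" using insert.prems(1)[of R0] by blast
 note Rs0 = RW_facts(1)[OF W0(1)]
 have "EX f:Av u. f ~: nu R0 & f:x ** R" if R: "R:S" for R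
 proof -
  obtain W where W: "VR W" "W ~= UNIV" "R = RW W" "gen W u" using insert.prems(1)[of R] R by blast
  have ne: "RW W0 ~= RW W" using insert.hyps(2) R W(3) W0(3) by auto
  obtain t where t: "t:Av u" "t:nu (RW W)" "t ~: nu (RW W0)"
   using separate_points[OF W0(1,2,4) W(1,2,4) ne] by blast
  obtain N where N: "t^N:x ** RW W"
   using RW_place(3)[OF W(1,2) _ _ t(2), of x] insert.prems(2)[of R] insert.prems(3) R W(3) by blast
  have tR: "t:RW W0" using t(1) gen_Av_RW(2)[OF W0(1,4)] by blast
  have "t^n ~: nu (RW W0)" for n
   by(induction n) (use nonunits_1[OF Rs0] val_nonunits_prime[OF Rs0 tR subring_power[OF Rs0 tR]] t(3) in auto)
  thus ?thesis using N subring_power[OF Av_subring t(1), of N] W(3) W0(3) by blast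
 qed
 then obtain f where f: "!!R. R:S ==> f R:Av u & f R ~: nu R0 & f R:x ** R" by metis
 define F where "F = (PROD R:S. f R)"
 have FA: "F:Av u" unfolding F_def using f Av_subring by(auto intro: subring_prod)
 have AR0: "Av u <= R0" using gen_Av_RW(2)[OF W0(1,4)] W0(3) by simp
 have F0: "F ~: nu R0"
 proof -
  have "(PROD R:T. f R) ~: nu R0 & (PROD R:T. f R):R0" if T: "finite T" "T <= S" for T
   using T
  proof(induction T rule: finite_induct)
   case empty thus ?case using nonunits_1[OF Rs0] subring_1[OF Rs0] W0(3) by simp
  next
   case (insert R T)
   hence "f R:R0" "f R ~: nu R0" using f AR0 by auto
   thus ?case using insert val_nonunits_prime[OF Rs0] subring_mult[OF Rs0] W0(3) by auto
  qed
  thus ?thesis unfolding F_def using insert.hyps by blast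
 qed
 have FR: "F:x ** R" if R: "R:S" for R
 proof -
  obtain W where W: "VR W" "R = RW W" "gen W u" using insert.prems(1)[of R] R by blast
  have "F = (PROD R:S - {R}. f R)*f R" unfolding F_def using insert.hyps R by(simp add: prod.remove mult.commute)
  moreover have "(PROD R:S - {R}. f R):R"
   using f gen_Av_RW(2)[OF W(1,3)] W(2) RW_facts(1)[OF W(1)] by(auto intro!: subring_prod)
  ultimately show ?thesis using submod_scale[OF submod_image[OF submod_self[OF RW_facts(1)[OF W(1)]]]] f R W(2) by auto
 qed
 have iF: "F ~= 0" "inverse F:R0" using unit_inverse[OF _ F0] FA AR0 by auto
 have "(r R0 - a)*inverse F:R0"
  using insert.prems(4)[of R0] a(1) AR0 iF Rs0 unfolding W0(3) by(auto intro!: subring_mult subring_diff)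
 then obtain b where b: "b:Av u" "b - (r R0 - a)*inverse F:x ** R0"
  using local_surj[OF W0(1,2,4), of x] insert.prems(2)[of R0] insert.prems(3) W0(3) by blast
 show ?case
 proof(intro bexI[of _ "a + b*F"] ballI)
  show "a + b*F:Av u" using a b FA Av_subring by(auto intro!: subring_intros)
  fix R assume "R:insert R0 S"
  then consider "R = R0" | "R:S" by blast
  thus "a + b*F - r R:x ** R"
  proof cases
   case 1
   have "a + b*F - r R0 = F*(b - (r R0 - a)*inverse F)" using iF by(simp add: field_simps)
   moreover have "F*(b - (r R0 - a)*inverse F):x ** R0"
    by(rule submod_scale[OF submod_image[OF submod_self] _ b(2)]) (use Rs0 W0(3) FA AR0 in auto)
   ultimately show ?thesis using 1 by simp
  next
   case 2
   obtain W where W: "VR W" "R = RW W" "gen W u" using insert.prems(1)[of R] 2 by blast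
   have bR: "b:R" using b(1) gen_Av_RW(2)[OF W(1,3)] W(2) by blast
   have sm: "submod R (x ** R)" using submod_image[OF submod_self] RW_facts(1)[OF W(1)] W(2) by blast
   have e: "a + b*F - r R = (a - r R) + b*F" by simp
   show ?thesis unfolding e
    using submod_add[OF sm _ submod_scale[OF sm bR FR[OF 2]]] a(2) 2 by blast
  qed
 qed
qed

lemma point_Z_gen:
 assumes v: "v:V" "v ~= 0"
 obtains u where "u:V" "u ~= 0" "!!R. R:Z v ==> EX W. VR W & W ~= UNIV & R = RW W & gen W u"
proof -
 have "Z v <= cpts CX" unfolding Z_def by blast
 thus ?thesis using common_gen[OF Z_finite[OF v]] that by blast
qed

text \<open>By the Chinese remainder theorem the stalks of O(1)/vO at the zeros of v are spanned by fractions a/u^n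
  with a form a. So for large n the forms of degree n + 1 map onto O(n+1)/vO(n).\<close>
lemma growth_ge:
 assumes v: "v:V" "v ~= 0"
 shows "EX n0. ALL n>=n0. dg v <= qdK (Vn (Suc n)) (v ** Vn n)"
proof -
 obtain u where u: "u:V" "u ~= 0" "!!R. R:Z v ==> EX W. VR W & W ~= UNIV & R = RW W & gen W u" by(rule point_Z_gen[OF v]) blast
 obtain e where e: "dg v = enat e" using degree_step(3)[OF v] by(rule less_infinityE)
 interpret p: fam_pair em CX "tw (1 + 0) K'" "sc v (tw 0)" "tw (1 + 0)" by(rule pair_sc_tw[OF V_pp[OF v(1)] v(2)])
 let ?L1 = "Lam CX (tw 1)" and ?L0 = "Lam CX (sc v (tw 0))"
 note F = p.F
 have G: "cx.fam (tw 1 K') (tw 1)" by(rule fam_tw)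
 obtain B where B: "finite B" "card B = e" "B <= ?L1" "ka.indep_mod ?L0 B"
  by(rule ka.qd_fin_spanning[OF cx.Lam_subspace[OF F] cx.Lam_subspace[OF G]]) (use p.Lam_mono e in "auto simp: dg_def")
 have twR: "tw n R = (u^n) ** R" if R: "R:Z v" for R n
  using u(3)[OF R] tw_gen by blast
 have approx: "EX n a. a:Vn n & (ALL R:Z v. u*(a/u^n) - b R:v ** R)" if b: "b:B" for b
 proof -
  have bR: "b R/u:R" if R: "R:Z v" for R
  proof -
   have "b:?L1" "R:cpts CX" using b B(3) R unfolding Z_def by blast+
   hence "b R:tw 1 R" using cx.Lam_iff[OF G] by blast
   thus ?thesis unfolding twR[OF R] using u(2) by auto
  qed
  have xR: "v/u:R" if R: "R:Z v" for R
  proof -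
   obtain W where "VR W" "R = RW W" "gen W u" using u(3)[OF R] by blast
   thus ?thesis using gen_Av_RW(1)[of W u v 1] V_coord[OF v(1)] by simp
  qed
  have "v/u ~= 0" using v u by simp
  then obtain a where a: "a:Av u" "ALL R:Z v. a - b R/u:(v/u) ** R"
   using chinese_remainder[OF Z_finite[OF v] u(3), of "v/u" "%R. b R/u"] xR bR by blast
  obtain n c where c: "a = c/u^n" "c:Vn n" using a(1) unfolding Av_eq[OF u(1,2)] by blast
  have "u*(c/u^n) - b R:v ** R" if R: "R:Z v" for R
  proof -
   obtain y where y: "y:R" "a - b R/u = v/u*y" using a(2) R by blast
   have "u*a - b R = u*(a - b R/u)" using u(2) by(simp add: field_simps)
   also have "... = v*y" unfolding y(2) using u(2) by simp
   finally have "u*a - b R = v*y" .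
   thus ?thesis using y(1) unfolding c(1) by blast
  qed
  thus ?thesis using c(2) by blast
 qed
 then obtain nn aa where na: "!!b. b:B ==> aa b:Vn (nn b)" "!!b R. b:B ==> R:Z v ==> u*(aa b/u^nn b) - b R:v ** R"
  by metis
 define n0 where "n0 = Max (insert 0 (nn ` B))"
 have n0: "nn b <= n0" if "b:B" for b unfolding n0_def using that B(1) by(intro Max_ge) auto
 have "dg v <= qdK (Vn (Suc n)) (v ** Vn n)" if n: "n0 <= n" for n
 proof -
  \<comment> \<open>Powers of u bring all the forms to degree n + 1.\<close>
  define f where "f b = u^(Suc n - nn b)*aa b" for b
  have f: "f b:Vn (Suc n)" if b: "b:B" for b
   unfolding f_def using coord_mult[OF power_coord[OF u(1), of "Suc n - nn b"] na(1)[OF b]] n0[OF b] n by simp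
  have fe: "f b = u^Suc n*(aa b/u^nn b)" if b: "b:B" for b
  proof -
   have "u^Suc n = u^(Suc n - nn b)*u^nn b" using n0[OF b] n by(simp add: power_add[symmetric])
   thus ?thesis unfolding f_def using u(2) by(simp only:) simp
  qed
  have "enat (card B) <= qdK (Vn (Suc n)) (v ** Vn n)"
  proof(rule kv.qd_ge_family[OF B(1) f])
   show "0:v ** Vn n" using ksub_0[OF coord_subspace, of V n] by force
   fix a assume s: "(SUM b:B. em (a b)*f b):v ** Vn n"
   let ?s = "SUM b:B. (%P. em (a b)*b P)"
   have ap: "?s P = (SUM b:B. em (a b)*b P)" for P using B(1) by(induction B rule: finite_induct) auto
   have sL: "?s:?L1" using B(3) by(intro ka.subspace_sum[OF cx.Lam_subspace[OF G]] ka.subspace_scale[OF cx.Lam_subspace[OF G]]) auto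
   have "?s:?L0" unfolding cx.Lam_iff[OF F]
   proof(intro conjI allI impI ballI)
    show "?s P = 0" if "P ~: cpts CX" for P using sL that cx.Lam_iff[OF G] by blast
    fix R assume R: "R:cpts CX"
    show "?s R:sc v (tw 0) R"
    proof(cases "R:Z v")
     case False
     have "?s R:tw 1 R" using sL R cx.Lam_iff[OF G] by blast
     thus ?thesis unfolding tw_not_Z[OF R False v] by simp
    next
     case RZ: True
     have Rs: "is_subring R" "range em <= R" using point_subring point_range closed_in[OF R] by blast+
     have sm: "submod R (v ** R)" by(rule submod_image[OF submod_self[OF Rs(1)]])
     have t0: "tw 0 R = R" by(rule tw_0[OF closed_in[OF R]])
     obtain c where c: "c:Vn n" "(SUM b:B. em (a b)*f b) = v*c" using s by blast
     have cu: "c/u^n:R" using coord_tw[OF closed_in[OF R], of n] c(1) unfolding twR[OF RZ] using u(2) by auto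
     have "(SUM b:B. em (a b)*(u*(aa b/u^nn b))) = (SUM b:B. em (a b)*f b)/u^n"
      unfolding sum_divide_distrib by(rule sum.cong) (use fe u(2) in auto)
     hence e1: "(SUM b:B. em (a b)*(u*(aa b/u^nn b))) = v*(c/u^n)" using c(2) by simp
     have "(SUM b:B. em (a b)*(u*(aa b/u^nn b) - b R)):v ** R"
      using na(2)[OF _ RZ] Rs(2) by(intro submod_sum[OF sm] submod_scale[OF sm]) auto
     moreover have "?s R = (SUM b:B. em (a b)*(u*(aa b/u^nn b))) - (SUM b:B. em (a b)*(u*(aa b/u^nn b) - b R))"
      unfolding ap by(simp add: right_diff_distrib sum_subtractf)
     moreover have "v*(c/u^n):v ** R" using cu by blast
     ultimately show ?thesis using submod_diff[OF Rs(1) sm] unfolding t0 e1 by simp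
    qed
   qed
   thus "ALL b:B. a b = 0" using B(4) unfolding ka.indep_mod_def by blast
  qed
  thus ?thesis using B(2) e by simp
 qed
 thus ?thesis by blast
qed

text \<open>The Hilbert function.\<close>
definition D :: "nat => nat" where "D n = the_enat (qdK (Vn n) {0})"

lemma D: "qdK (Vn n) {0} = enat (D n)"
proof -
 obtain v where v: "v:V" "v ~= 0" by(rule nonzero_elem)
 obtain e where e: "dg v = enat e" using degree_step(3)[OF v] by(rule less_infinityE)
 have "qdK (Vn n) {0} <= enat (1 + n*e)" using coord_le_h0 h0_tw_bound[OF v e] by(rule order.trans)
 thus ?thesis unfolding D_def by(metis enat_ord_code(5) the_enat.simps enat_ile)
qed

lemma D_linear_v:
 assumes v: "v:V" "v ~= 0" and e: "dg v = enat e"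
 shows "EX (c::int) N. ALL n>=N. int (D n) = int e*int n + c"
proof -
 obtain n0 where n0: "!!n. n0 <= n ==> dg v <= qdK (Vn (Suc n)) (v ** Vn n)" using growth_ge[OF v] by blast
 show ?thesis
 proof(rule eventually_linear)
  show "D n <= 1 + n*e" for n using order.trans[OF coord_le_h0[of n] h0_tw_bound[OF v e, of n]] D[of n] by simp
  show "D n + e <= D (Suc n)" if n: "n0 <= n" for n
  proof -
   have sub: "v ** Vn n <= Vn (Suc n)" using coord_mult[OF V_coord[OF v(1)]] by auto
   have "qdK (Vn (Suc n)) {0} = qdK (Vn (Suc n)) (v ** Vn n) + qdK (v ** Vn n) {0}"
    by(rule kv.qd_add) (use sub coord_subspace ksub_image[OF coord_subspace] ksub_0[OF ksub_image[OF coord_subspace]] in auto)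
   moreover have "qdK (v ** Vn n) {0} = enat (D n)"
    using qd_mult[OF v(2) kv.subspace_single_0, of "Vn n"] D by simp
   ultimately have "enat (D (Suc n)) = qdK (Vn (Suc n)) (v ** Vn n) + enat (D n)" using D by simp
   moreover have "enat e + enat (D n) <= qdK (Vn (Suc n)) (v ** Vn n) + enat (D n)"
    using n0[OF n] e by(intro add_right_mono) simp
   ultimately have "enat e + enat (D n) <= enat (D (Suc n))" by simp
   thus ?thesis by simp
  qed
 qed
qed

lemma linear_slope_unique:
 fixes d e :: nat and c c' :: int
 assumes "ALL n>=N. int (f n) = int d*int n + c" "ALL n>=N'. int (f n) = int e*int n + c'"
 shows "d = e"
proof -
 let ?n = "max N N'"
 have "int d*int ?n + c = int e*int ?n + c'" "int d*int (Suc ?n) + c = int e*int (Suc ?n) + c'"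
  using assms by(metis max.cobounded1 max.cobounded2 le_SucI)+
 hence "int d = int e" by(simp add: algebra_simps)
 thus ?thesis by simp
qed

definition deg :: nat where "deg = projective_degree em V"

lemma degree_eq:
 assumes v: "v:V" "v ~= 0" shows "dg v = enat deg"
proof -
 obtain e where e: "dg v = enat e" using degree_step(3)[OF v] by(rule less_infinityE)
 obtain c N where cN: "ALL n>=N. int (D n) = int e*int n + c" using D_linear_v[OF v e] by blast
 have "projective_degree em V = e" unfolding projective_degree_def
 proof(rule the_equality)
  show "EX c::int. \<forall>\<^sub>F n in sequentially. EX m. qdK (Vn n) {0} = enat m & int m = int e*int n + c"
   unfolding eventually_sequentially using cN D by blast
  fix d assume "EX c::int. \<forall>\<^sub>F n in sequentially. EX m. qdK (Vn n) {0} = enat m & int m = int d*int n + c"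
  then obtain c' N' where "ALL n>=N'. int (D n) = int d*int n + c'" unfolding eventually_sequentially D by auto
  thus "d = e" using linear_slope_unique cN by blast
 qed
 thus ?thesis using e by(simp add: deg_def)
qed

lemma D_linear: "EX (c::int) N. ALL n>=N. int (D n) = int deg*int n + c"
proof -
 obtain v where v: "v:V" "v ~= 0" by(rule nonzero_elem)
 show ?thesis by(rule D_linear_v[OF v degree_eq[OF v]])
qed

end

section \<open>Finiteness of the genus and Riemann-Roch\<close>

context ground begin

definition psc :: "'k => 'K \<times> 'K => 'K \<times> 'K" where
 "psc c p = (em c*fst p, em c*snd p)"

lemma vspP: "vspace psc"
 by unfold_locales (auto simp: psc_def i_add i_mult algebra_simps)

lemma psc_sum: "finite B ==> (SUM b:B. psc (a b) (f b)) = ((SUM b:B. em (a b)*fst (f b)), (SUM b:B. em (a b)*snd (f b)))"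
 by(induction B rule: finite_induct) (auto simp: psc_def zero_prod_def)

lemma qd_square:
 assumes X: "ksub X"
 shows "qdK X {0} + qdK X {0} <= quot_dim psc (X \<times> X) {0}"
proof -
 interpret p: vspace psc by(rule vspP)
 have s1: "p.subspace (X \<times> X)" "p.subspace (X \<times> {0})"
  by(rule p.subspaceI; use ksub_0[OF X] ksub_add[OF X] ksub_scale[OF X] in "auto simp: psc_def zero_prod_def")+
 have "quot_dim psc (X \<times> X) {0} = quot_dim psc (X \<times> X) (X \<times> {0}) + quot_dim psc (X \<times> {0}) {0}"
  by(rule p.qd_add) (use s1 ksub_0[OF X] p.subspace_0[OF s1(2)] p.subspace_single_0 in "auto simp: zero_prod_def[symmetric]")
 moreover have "qdK X {0} <= quot_dim psc (X \<times> X) (X \<times> {0})"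
  by(rule qd_le_relation[OF vspK vspP, where f="%x. (0, x)"]) (use ksub_0[OF X] in "auto simp: psc_sum zero_prod_def")
 moreover have "qdK X {0} <= quot_dim psc (X \<times> {0}) {0}"
  by(rule qd_le_relation[OF vspK vspP, where f="%x. (x, 0)"]) (auto simp: psc_sum zero_prod_def)
 ultimately show ?thesis by(simp add: add_mono)
qed

end

context linsys begin

text \<open>Some element of V vanishes at R, and a power of it cancels the denominator of y.\<close>
lemma pole_order:
 assumes R: "R:cpts CX" and y: "y:K'"
 shows "EX N a. a:power_products V N & a ~= 0 & a*y:tw N R"
proof -
 obtain W u where W: "VR W" "W ~= UNIV" "R = RW W" "gen W u" by(rule closed_point[OF R])
 have u: "u:V" "u ~= 0" using W(4) by(auto simp: gen_def)
 obtain w w' where ww: "w:V" "w':V" "w' ~= 0" "w/w' ~: range em" using Vt by blast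
 have "EX z:V. z/u ~: range em"
 proof(rule ccontr)
  assume "~ ?thesis"
  then obtain a b where ab: "w/u = em a" "w'/u = em b" using ww by blast
  hence "w/w' = em (a/b)" using u ww by(simp add: i_divide field_simps)
  thus False using ww by blast
 qed
 then obtain z where z: "z:V" "z/u ~: range em" by blast
 have "z/u:W" using W(4) z by(simp add: gen_def)
 then obtain c where c: "z/u - em c:nu W" using PR[OF W(1,2)] by blast
 define v where "v = z - em c*u"
 have v: "v:V" unfolding v_def using ksub_diff[OF Vs z(1) ksub_scale[OF Vs u(1)]] .
 have vu: "v/u = z/u - em c" unfolding v_def using u by(simp add: field_simps)
 have v0: "v ~= 0" using vu z by(metis diff_eq_diff_eq diff_self div_0 eq_iff_diff_eq_0 rangeI)
 have "v/u:RW W" using gen_Av_RW(1)[OF W(1,4) V_coord[OF v]] by simp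
 hence vn: "v/u:nu (RW W)" using c vu RW_facts(4)[OF W(1)] by auto
 have "y:loc (Av u) UNIV" using y RW_eq_loc[OF VR_UNIV gen_UNIV[OF u]] by simp
 then obtain p q where pq: "y = p/q" "p:Av u" "q:Av u" "q ~: nu UNIV" unfolding loc_iff by blast
 have q0: "q ~= 0" using pq(4) nonunits_0[OF subring_UNIV] by auto
 have pqR: "p:RW W" "q:RW W" using pq gen_Av_RW(2)[OF W(1,4)] by auto
 obtain N where N: "(v/u)^N:q ** RW W" using RW_place(3)[OF W(1,2) pqR(2) q0 vn] by blast
 then obtain r where r: "r:RW W" "(v/u)^N = q*r" by blast
 have "v^N*y = u^N*((v/u)^N*y)" using u by(simp add: power_divide)
 also have "... = u^N*(r*p)" unfolding r(2) pq(1) using q0 by simp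
 finally have "v^N*y:tw N R" unfolding W(3) tw_gen[OF W(1,4)] using subring_mult[OF RW_facts(1)[OF W(1)] r(1) pqR(1)] by blast
 moreover have "v^N:power_products V N" unfolding power_products_def
  using v by(intro CollectI exI[of _ "%_. v"]) auto
 ultimately show ?thesis using v0 by(intro exI[of _ N] exI[of _ "v^N"]) auto
qed

lemma power_products_mult:
 "a:power_products V m ==> b:power_products V n ==> a*b:power_products V (m + n)"
proof(induction n arbitrary: b)
 case 0 thus ?case by(simp add: power_products_0)
next
 case (Suc n)
 then obtain p v where pv: "b = p*v" "p:power_products V n" "v:V" unfolding power_products_Suc by blast
 hence "a*p:power_products V (m + n)" using Suc by blast
 hence "(a*p)*v:power_products V (Suc (m + n))" unfolding power_products_Suc using pv by blast
 thus ?case using pv by(simp add: mult.assoc)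
qed

lemma pole_orders:
 assumes Q: "finite Q" "!!R y. (R, y):Q ==> R:cpts CX & y:K'"
 shows "EX N a. N0 <= N & a:power_products V N & a ~= 0 & (ALL (R, y):Q. a*y:tw N R)"
 using Q
proof(induction Q rule: finite_induct)
 case empty
 obtain v where v: "v:V" "v ~= 0" by(rule nonzero_elem)
 hence "v^N0:power_products V N0" unfolding power_products_def by(intro CollectI exI[of _ "%_. v"]) auto
 thus ?case using v by(intro exI[of _ N0] exI[of _ "v^N0"]) auto
next
 case (insert q Q)
 then obtain N a where a: "N0 <= N" "a:power_products V N" "a ~= 0" "ALL (R, y):Q. a*y:tw N R" by blast
 obtain R y where q: "q = (R, y)" by(cases q)
 have Ry: "R:cpts CX" "y:K'" using insert.prems[of R y] q by auto
 obtain M b where b: "b:power_products V M" "b ~= 0" "b*y:tw M R" using pole_order[OF Ry] by blast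
 have ab: "a:Vn N" "b:Vn M" using a b power_products_coord by blast+
 show ?case
 proof(intro exI[of _ "N + M"] exI[of _ "a*b"] conjI ballI)
  show "N0 <= N + M" using a by simp
  show "a*b:power_products V (N + M)" by(rule power_products_mult[OF a(2) b(1)])
  show "a*b ~= 0" using a b by simp
  fix z assume "z:insert q Q"
  then consider "z = q" | "z:Q" by blast
  thus "case z of (R, y) => a*b*y:tw (N + M) R"
  proof cases
   case 1
   thus ?thesis using tw_mult[OF closed_in[OF Ry(1)] ab(1) b(3)] q by(simp add: mult.assoc)
  next
   case 2
   obtain R' y' where z: "z = (R', y')" by(cases z)
   hence "R':CX" "a*y':tw N R'" using 2 a(4) insert.prems[of R' y'] closed_in by auto
   from tw_mult[OF this(1) ab(2) this(2)] show ?thesis using z by(simp add: mult_ac add.commute)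
  qed
 qed
qed

lemma Lam_degree_product:
 "a:power_products V N ==> a ~= 0 ==> qdA (Lam CX (tw N)) (Lam CX (sc a (tw 0))) = enat (N*deg)"
proof(induction N arbitrary: a)
 case 0
 hence "a = 1" by(simp add: power_products_0)
 thus ?case using ka.qd_self[OF cx.Lam_subspace[OF fam_tw]] by(simp add: zero_enat_def)
next
 case (Suc N)
 then obtain p v where pv: "a = p*v" "p:power_products V N" "v:V" unfolding power_products_Suc by blast
 hence nz: "p ~= 0" "v ~= 0" using Suc by auto
 have pV: "p:Vn N" using pv power_products_coord by blast
 have a: "sc a (tw 0) = sc v (sc p (tw 0))" unfolding pv(1) mult.commute[of p v] image_mult_assoc ..
 note Fp = fam_sc_tw[OF pV nz(1), of 0]
 note Lp = cx.Lam_scale[OF Fp nz(2)] and LN = cx.Lam_scale[OF fam_tw nz(2), of N]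
 note Fs = cx.fam_scale[OF Fp nz(2)]
 have Fv: "cx.fam (tw (1 + N) K') (sc v (tw N))" by(rule fam_sc_tw[OF V_coord[OF pv(3)] nz(2)])
 have sub: "Lam CX (sc p (tw 0)) <= Lam CX (tw N)"
  by(rule cx.Lam_mono_fam[OF Fp fam_tw]) (use sc_tw_sub[OF closed_in pV, of _ 0] in simp)
 have sub2: "Lam CX (sc v (tw N)) <= Lam CX (tw (1 + N))"
  by(rule cx.Lam_mono_fam[OF Fv fam_tw]) (rule sc_tw_sub[OF closed_in V_coord[OF pv(3)]])
 have "qdA (Lam CX (tw (1 + N))) (Lam CX (sc a (tw 0))) = qdA (Lam CX (tw (1 + N))) (Lam CX (sc v (tw N))) + qdA (Lam CX (sc v (tw N))) (Lam CX (sc a (tw 0)))"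
 proof(rule ka.qd_add)
  show "ka.subspace (Lam CX (sc a (tw 0)))" unfolding a by(rule cx.Lam_subspace[OF Fs])
  show "ka.subspace (Lam CX (sc v (tw N)))" by(rule cx.Lam_subspace[OF Fv])
  show "ka.subspace (Lam CX (tw (1 + N)))" by(rule cx.Lam_subspace[OF fam_tw])
  show "Lam CX (sc a (tw 0)) <= Lam CX (sc v (tw N))" unfolding a Lp LN using sub by blast
 qed (rule sub2)
 also have "qdA (Lam CX (sc v (tw N))) (Lam CX (sc a (tw 0))) = enat (N*deg)"
  unfolding a Lp LN cx.qdA_scale[OF nz(2) cx.Lam_subspace[OF Fp]] by(rule Suc.IH[OF pv(2) nz(1)])
 finally show ?case using degree_step(2)[OF pv(3) nz(2), of N] degree_eq[OF pv(3) nz(2)] by simp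
qed

text \<open>Finitely many adeles lie in O(N)/a for a suitable form a. Their independence modulo coboundaries is
  bounded by the Euler characteristic, in which the unknown h0(O(N)) is at least the Hilbert function, so the bound 1
  - c does not depend on N.\<close>
lemma h1_finite: "h1 em CX (tw 0) < \<infinity>"
proof -
 obtain c :: int and N0 where cN: "ALL n>=N0. int (D n) = int deg*int n + c" using D_linear by blast
 have "h1 em CX (tw 0) <= enat (nat (1 - c))" unfolding h1_def
 proof(rule ka.qd_leI)
  fix B assume B: "finite B" "B <= adeles CX (tw 0)" "ka.indep_mod (cob CX (tw 0)) B"
  note FO = fam_tw[of 0]
  have tK: "tw 0 K' = K'" by(rule tw_0[OF K'_in])
  define Q where "Q = (UN b:B. (%R. (R, b R)) ` {R:cpts CX. b R ~: tw 0 R})"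
  have Qf: "finite Q" unfolding Q_def using B(1,2) cx.adeles_iff[OF FO] by(intro finite_UN_I finite_imageI) auto
  have Qm: "R:cpts CX & y:K'" if "(R, y):Q" for R y
   using that B(2) cx.adeles_iff[OF FO] unfolding Q_def tK by auto
  obtain N a where a: "N0 <= N" "a:power_products V N" "a ~= 0" "ALL (R, y):Q. a*y:tw N R"
   using pole_orders[OF Qf Qm, of N0] by blast
  have aV: "a:Vn N" using a power_products_coord by blast
  define G where "G = sc (inverse a) (tw N)"
  have aG: "sc a G = tw N" unfolding G_def image_mult_assoc using a(3) by simp
  have ia: "inverse a ~= 0" using a by simp
  have "inverse a ** tw N K' = inverse a ** a ** tw 0 K'"
   using sc_tw_K'[OF aV a(3), of 0] by simp
  also have "... = tw 0 K'" unfolding image_mult_assoc using a(3) by simp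
  finally have MK: "inverse a ** tw N K' = tw 0 K'" .
  have FG: "cx.fam (tw 0 K') G" unfolding G_def using cx.fam_scale[OF fam_tw ia, of N] MK by simp
  have inG: "x:G R \<longleftrightarrow> a*x:tw N R" for x R
  proof
   assume "x:G R"
   then obtain t where "t:tw N R" "x = inverse a*t" unfolding G_def by blast
   thus "a*x:tw N R" using a(3) by(simp add: mult.assoc[symmetric])
  next
   assume "a*x:tw N R"
   moreover have "x = inverse a*(a*x)" using a(3) by(simp add: mult.assoc[symmetric])
   ultimately show "x:G R" unfolding G_def by blast
  qed
  interpret p: fam_pair em CX "tw 0 K'" "tw 0" G
  proof(unfold_locales)
   show "tw 0 P <= G P" if "P:cpts CX" for P
    using tw_mult[OF closed_in[OF that] aV, of _ 0] inG by auto
   have "{P:cpts CX. tw 0 P ~= G P} <= {R:cpts CX. sc a (tw 0) R ~= tw (N + 0) R}"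
   proof clarify
    fix P assume P: "tw 0 P ~= G P" "P:cpts CX" "sc a (tw 0) P = tw (N + 0) P"
    have "x:G P \<longleftrightarrow> x:tw 0 P" for x
     unfolding inG P(3)[unfolded add_0_right, symmetric] using a(3) by auto
    thus False using P by blast
   qed
   thus "finite {P:cpts CX. tw 0 P ~= G P}" using sc_tw_ae[OF a(2,3), of 0] finite_subset by blast
  qed (use FO FG CX_closed_ne in auto)
  have "B <= Lam CX G"
  proof
   fix b assume b: "b:B"
   have bA: "b:adeles CX (tw 0)" using b B by blast
   show "b:Lam CX G" unfolding cx.Lam_iff[OF FG]
   proof(intro conjI allI impI ballI)
    show "b P = 0" if "P ~: cpts CX" for P using bA that cx.adeles_iff[OF FO] by blast
    fix R assume R: "R:cpts CX"
    show "b R:G R"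
    proof(cases "b R:tw 0 R")
     case True thus ?thesis using p.FG[OF R] by blast
    next
     case False
     hence "(R, b R):Q" unfolding Q_def using b R by blast
     thus ?thesis unfolding inG using a(4) by blast
    qed
   qed
  qed
  hence "B <= cob CX G" using cx.Lam_cob[OF FG] by blast
  hence c1: "enat (card B) <= qdA (cob CX G) (cob CX (tw 0))" by(rule ka.qd_geI[OF B(1) _ B(3)])
  have "qdA (Lam CX G) (Lam CX (tw 0)) = qdA (cx.ascale a ` Lam CX G) (cx.ascale a ` Lam CX (tw 0))"
   by(rule cx.qdA_scale[OF a(3) cx.Lam_subspace[OF FO], symmetric])
  also have "... = qdA (Lam CX (tw N)) (Lam CX (sc a (tw 0)))"
   unfolding cx.Lam_scale[OF FO a(3), symmetric] cx.Lam_scale[OF FG a(3), symmetric] aG ..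
  also have "... = enat (N*deg)" by(rule Lam_degree_product[OF a(2,3)])
  finally have c2: "enat (N*deg) = qdK (H0 CX G) (H0 CX (tw 0)) + qdA (cob CX G) (cob CX (tw 0))"
   using p.Lam_add by simp
  have "enat (D N) <= h0 em CX (tw N)" using coord_le_h0[of N] D by simp
  also have "... = h0 em CX G" unfolding G_def by(rule cx.h0_scale[OF fam_tw ia, symmetric])
  also have "... = qdK (H0 CX G) (H0 CX (tw 0)) + 1"
  proof -
   have "h0 em CX G = qdK (H0 CX G) (H0 CX (tw 0)) + qdK (H0 CX (tw 0)) {0}" unfolding h0_def
    by(rule kv.qd_add) (use cx.H0_subspace[OF FO] cx.H0_subspace[OF FG] p.H0_mono ksub_0[OF cx.H0_subspace[OF FO]] in auto)
   thus ?thesis using h0_tw_0 by(simp add: h0_def)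
  qed
  finally have c3: "enat (D N) <= qdK (H0 CX G) (H0 CX (tw 0)) + 1" .
  obtain h where h: "qdK (H0 CX G) (H0 CX (tw 0)) = enat h" using c2 by(cases "qdK (H0 CX G) (H0 CX (tw 0))") auto
  obtain y where y: "qdA (cob CX G) (cob CX (tw 0)) = enat y" using c2 by(cases "qdA (cob CX G) (cob CX (tw 0))") auto
  have "card B <= y" "N*deg = h + y" "D N <= h + 1" using c1 c2 c3 h y by(auto simp: one_enat_def)
  hence "int (card B) <= int (N*deg) - int (D N) + 1" by linarith
  also have "... = 1 - c" using cN a(1) by simp
  finally show "enat (card B) <= enat (nat (1 - c))" by simp
 qed
 also have "... < \<infinity>" by simp
 finally show ?thesis .
qed

definition g' :: nat where "g' = the_enat (h1 em CX (tw 0))"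

lemma g': "h1 em CX (tw 0) = enat g'"
 using h1_finite unfolding g'_def by(metis less_infinityE the_enat.simps)

lemma h1_cong:
 assumes "!!R. R:CX ==> F R = G R" shows "h1 em CX F = h1 em CX G"
proof -
 have "generic_point CX:CX" using K'_in CX_generic by simp
 hence 1: "F (generic_point CX) = G (generic_point CX)" by(rule assms)
 have 2: "F R = G R" if "R:cpts CX" for R using assms closed_in that by blast
 have "adeles CX F = adeles CX G" unfolding adeles_def 1 using 2 by(auto cong: conj_cong)
 moreover hence "cob CX F = cob CX G" unfolding coboundaries_def 1 using 2 by auto
 ultimately show ?thesis by(simp add: h1_def)
qed

lemma arithmetic_genus_CX: "arithmetic_genus em CX = enat g'"
 unfolding arithmetic_genus_def g'[symmetric] by(rule h1_cong) (simp add: tw_0)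

lemma h1_tw_mono: "h1 em CX (tw (Suc n)) <= h1 em CX (tw n)"
proof -
 obtain v where v: "v:V" "v ~= 0" by(rule nonzero_elem)
 interpret p: fam_pair em CX "tw (1 + n) K'" "sc v (tw n)" "tw (1 + n)" by(rule pair_sc_tw[OF V_pp[OF v(1)] v(2)])
 show ?thesis using p.h1_mono cx.h1_scale[OF fam_tw v(2), of n] by simp
qed

lemma h1_tw_le: "h1 em CX (tw n) <= enat g'"
 by(induction n) (use g' h1_tw_mono order.trans in "auto intro: order.trans")

lemma riemann_roch: "h0 em CX (tw n) + enat g' = enat (1 + n*deg) + h1 em CX (tw n)"
proof(induction n)
 case 0
 thus ?case by(simp add: h0_tw_0 g' one_enat_def)
next
 case (Suc n)
 obtain v where v: "v:V" "v ~= 0" by(rule nonzero_elem)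
 interpret p: fam_pair em CX "tw (1 + n) K'" "sc v (tw n)" "tw (1 + n)" by(rule pair_sc_tw[OF V_pp[OF v(1)] v(2)])
 have e: "h0 em CX (tw n) + enat deg + h1 em CX (tw (Suc n)) = h0 em CX (tw (Suc n)) + h1 em CX (tw n)"
  using p.euler degree_step(2)[OF v, of n] degree_eq[OF v] cx.h0_scale[OF fam_tw v(2), of n] cx.h1_scale[OF fam_tw v(2), of n] by simp
 obtain a where a: "h1 em CX (tw n) = enat a" using h1_tw_le[of n] by(cases "h1 em CX (tw n)") auto
 obtain b where b: "h1 em CX (tw (Suc n)) = enat b" using h1_tw_le[of "Suc n"] by(cases "h1 em CX (tw (Suc n))") auto
 obtain c where c: "h0 em CX (tw n) = enat c" using Suc a by(cases "h0 em CX (tw n)") auto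
 obtain d where d: "h0 em CX (tw (Suc n)) = enat d" using e a b c by(cases "h0 em CX (tw (Suc n))") auto
 show ?case using e Suc unfolding a b c d by(simp add: algebra_simps)
qed

end

section \<open>Differentials and Clifford's inequality\<close>

context ptset begin

lemma cob_scale_in:
 assumes F: "fam M F" and G: "fam M' G" and a: "!!y. y:M ==> a*y:M'" and m: "!!P y. P:cl ==> y:F P ==> a*y:G P"
  and r: "r:cob X F"
 shows "ascale a r:cob X G"
proof -
 obtain l x where lm: "r = l + diag X x" "l:Lam X F" "x:M" using r unfolding cob_eq[OF F] by blast
 have "ascale a l:Lam X G" using lm(2) m unfolding Lam_iff[OF F] Lam_iff[OF G] by(simp add: ascale_def)
 moreover have "ascale a (diag X x) = diag X (a*x)" by(auto simp: ascale_def diag_def)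
 moreover have "ascale a r = ascale a l + ascale a (diag X x)" unfolding lm(1) by(simp add: ascale_def fun_eq_iff algebra_simps)
 ultimately show ?thesis unfolding cob_eq[OF G] using a[OF lm(3)] by auto
qed

lemma ascale_ascale: "ascale x (ascale y r) = ascale (x*y) r" and ascale_1: "ascale 1 r = r" and ascale_0: "ascale 0 r = (%P. 0)"
 and ascale_add: "ascale (x + y) r = (%P. ascale x r P + ascale y r P)" and ascale_i: "ascale (em c*x) r = (%P. em c*ascale x r P)"
 and ascale_add2: "ascale x (r + r') = (%P. ascale x r P + ascale x r' P)" and ascale_i2: "ascale x (%P. em c*r P) = (%P. em c*ascale x r P)"
 by(simp_all add: ascale_def fun_eq_iff algebra_simps)

end

context linsys begin

abbreviation AD :: "('K set => 'K) set" where "AD == adeles CX (tw 0)"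
abbreviation "as == cx.ascale"

lemma AD_iff: "r:AD \<longleftrightarrow> (ALL P. P ~: cpts CX --> r P = 0) & (ALL P:cpts CX. r P:K') & finite {P:cpts CX. r P ~: P}"
 unfolding cx.adeles_iff[OF fam_tw] tw_0[OF K'_in] by(auto simp: tw_0 closed_in cong: conj_cong)

lemma AD_scale: assumes x: "x:K'" and r: "r:AD" shows "as x r:AD"
proof -
 have "{P:cpts CX. as x r P ~: P} <= {P:cpts CX. r P ~: P} Un {P:cpts CX. x ~: P}"
  unfolding cx.ascale_def using subring_mult[OF point_subring[OF closed_in]] by blast
 moreover have "finite ..." using r almost_all[OF x] unfolding AD_iff by blast
 ultimately have "finite {P:cpts CX. as x r P ~: P}" by(rule finite_subset)
 thus ?thesis using r subring_mult[OF K'_subring x] unfolding AD_iff by(simp add: cx.ascale_def)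
qed

lemma AD_subspace: "ka.subspace AD" by(rule cx.adeles_subspace[OF fam_tw])

lemmas as_as = cx.ascale_ascale and as_1 = cx.ascale_1 and as_0 = cx.ascale_0 and as_add = cx.ascale_add
 and as_i = cx.ascale_i and as_add2 = cx.ascale_add2 and as_i2 = cx.ascale_i2

text \<open>Fractional ideals that contain the structure sheaf.\<close>
definition over :: "('K set => 'K set) => bool" where
 "over F \<longleftrightarrow> cx.fam K' F & (ALL R:cpts CX. submod R (F R) & R <= F R) & finite {R:cpts CX. F R ~= R}"

lemma over_fam: "over F ==> cx.fam K' F" unfolding over_def by blast

lemma fam_O: "cx.fam K' (tw 0)" using fam_tw[of 0] unfolding tw_0[OF K'_in] .

lemma over_O: "over (tw 0)"
 unfolding over_def using fam_O submod_self[OF point_subring[OF closed_in]]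
 by(auto simp: tw_0 closed_in cong: conj_cong)

lemma over_pair: assumes F: "over F" shows "fam_pair em CX K' (tw 0) F"
proof(unfold_locales)
 show "finite {P:cpts CX. tw 0 P ~= F P}"
  using F[unfolded over_def] by(rule_tac finite_subset[of _ "{R:cpts CX. F R ~= R}"]) (auto simp: tw_0 closed_in)
qed (use F fam_O CX_closed_ne in "auto simp: over_def tw_0 closed_in")

lemma over_AD: "over F ==> adeles CX F = AD"
 using fam_pair.ad_eq[OF over_pair] by blast

lemma over_cob: "over F ==> cob CX (tw 0) <= cob CX F"
 using fam_pair.F[OF over_pair] fam_pair.G[OF over_pair] fam_pair.FG[OF over_pair] cx.cob_mono by metis

lemma deg_pos: "0 < deg"
proof(rule ccontr)
 assume "~ 0 < deg"
 obtain u v where uv: "u:V" "v:V" "v ~= 0" "u/v ~: range em" using Vt by blast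
 have "h0 em CX (tw 1) <= 1" using h0_tw_bound[OF uv(2,3) degree_eq[OF uv(2,3)], of 1] `~ 0 < deg` by(simp add: one_enat_def)
 hence le: "qdK V {0} <= 1" using coord_le_h0[of 1] coord_1[OF Vs] by simp
 have l: "ksub (v ** range em)" using ksub_image subring_subspace[OF range_subring] by blast
 have "qdK (v ** range em) {0} = 1"
  using qd_mult[OF uv(3) kv.subspace_single_0, of "range em"] qd_range by simp
 hence "v ** range em = V"
  by(intro kv.subspace_eq_of_qd[OF l Vs]) (use le uv ksub_scale[OF Vs] in "auto simp: mult.commute")
 thus False using uv by auto
qed

text \<open>E n is the inverse of the invertible family v^{-n} O(n), so its colength in O is the colength n d' of O in
  v^{-n} O(n).\<close>
lemma functional_growth:
 assumes v: "v:V" "v ~= 0"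
 defines "E == %n R. {y:K'. ALL a:Vn n. a/v^n*y:R}"
 shows "cx.fam K' (E n)" "adeles CX (E n) = AD" "h1 em CX (E n) <= enat (g' + n*deg)"
proof -
 have vn: "v^n:Vn n" "v^n ~= 0" using v power_coord by auto
 have ER: "E n R <= R" for R
 proof
  fix y assume "y:E n R"
  hence "v^n/v^n*y:R" using vn(1) unfolding E_def by blast
  thus "y:R" using v(2) by simp
 qed
 have out: "E n R = R" if Rv: "R:cpts CX" "R ~: Z v" for R
 proof
  show "R <= E n R"
  proof
   fix y assume y: "y:R"
   obtain W where W: "VR W" "W ~= UNIV" "R = RW W" using closed_point[OF Rv(1)] by blast
   have g: "gen W v" by(rule not_Z[OF Rv v W(1,3)])
   have "a/v^n*y:R" if "a:Vn n" for a
    using subring_mult[OF RW_facts(1)[OF W(1)] gen_Av_RW(1)[OF W(1) g that]] y W(3) by blast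
   thus "y:E n R" unfolding E_def using y W(3) RW_sub_K' by blast
  qed
 qed (rule ER)
 have ES: "ksub (E n R)" if R: "R:CX" for R
 proof -
  have s: "ksub R" using subring_subspace point_subring[OF R] point_range[OF R] by blast
  have "E n R = K' Int (INT a:Vn n. {y. a/v^n*y:R})" unfolding E_def by blast
  moreover have "ksub (INT a:Vn n. {y. a/v^n*y:R})"
   by(rule kv.subspace_Inter) (use subspace_preimage_mult(1)[OF s] in blast)
  ultimately show ?thesis using K'_subspace subspace_Int by simp
 qed
 show FE: "cx.fam K' (E n)" unfolding cx.fam_def
 proof(intro conjI ballI)
  have "a/v^n:K'" if "a:Vn n" for a using coord_quot_K'[OF that vn] .
  thus "E n (generic_point CX) = K'" unfolding CX_generic E_def using subring_mult[OF K'_subring] by blast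
  fix m assume m: "m:K'"
  have "{P:cpts CX. m ~: E n P} <= {P:cpts CX. m ~: P} Un Z v" using out by blast
  thus "finite {P:cpts CX. m ~: E n P}" using almost_all[OF m] Z_finite[OF v] finite_subset by blast
 qed (use K'_subspace ES[OF closed_in] in "auto simp: E_def")
 interpret p: fam_pair em CX K' "E n" "tw 0"
 proof(unfold_locales)
  show "finite {P:cpts CX. E n P ~= tw 0 P}"
   by(rule finite_subset[OF _ Z_finite[OF v]]) (use out tw_0[OF closed_in] in blast)
 qed (use FE fam_O CX_closed_ne ER in "auto simp: tw_0 closed_in")
 show "adeles CX (E n) = AD" by(rule p.ad_eq)
 define G where "G = sc (inverse (v^n)) (tw n)"
 have vi: "inverse (v^n) ~= 0" using vn by simp
 have "(inverse (v^n)) ** tw n K' = K'"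
  unfolding sc_tw_K'[OF vn, of 0, unfolded add_0_right tw_0[OF K'_in], symmetric] image_mult_assoc using vn(2) by simp
 note FG = cx.fam_scale[OF fam_tw vi, of n, folded G_def, unfolded this]
 have ZC: "Z v <= cpts CX" by(auto simp: Z_def)
 have loc: "qdK (tw 0 R) (E n R) = qdK (G R) (tw 0 R)" if R: "R:Z v" for R
 proof -
  obtain W u where W: "VR W" "W ~= UNIV" "R = RW W" "gen W u" using closed_point[OF subsetD[OF ZC R]] by blast
  have RC: "R:CX" using R ZC closed_in by blast
  have u: "u ~= 0" using W(4) by(simp add: gen_def)
  let ?t = "u^n/v^n"
  have t0: "?t ~= 0" using u v by simp
  have 1: "G R = ?t ** tw 0 R" unfolding G_def W(3) tw_gen[OF W(1,4)] image_mult_assoc tw_0[OF RC, unfolded W(3)]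
   by(simp add: field_simps)
  have 2: "tw 0 R = ?t ** E n R"
  proof
   have "u^n:Vn n" using W(4) power_coord by(simp add: gen_def)
   thus "?t ** E n R <= tw 0 R" unfolding tw_0[OF RC] E_def by blast
   show "tw 0 R <= ?t ** E n R"
   proof
    fix y assume "y:tw 0 R"
    hence y: "y:R" using tw_0[OF RC] by blast
    have "a/v^n*(y/?t):R" if a: "a:Vn n" for a
    proof -
     have e: "a/v^n*(y/?t) = a/u^n*y" using v u by(simp add: field_simps)
     show ?thesis unfolding e using subring_mult[OF point_subring[OF RC]] gen_Av_RW(1)[OF W(1,4) a] W(3) y by blast
    qed
    moreover have "?t:K'" using coord_quot_K' vn `u ^ n : Vn n` by blast
    hence "y/?t:K'" using y W(3) RW_sub_K' K'_divide by blast
    ultimately have "y/?t:E n R" unfolding E_def by blast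
    moreover have "y = ?t*(y/?t)" using u v(2) by(simp add: field_simps)
    ultimately show "y:?t ** E n R" by blast
   qed
  qed
  show ?thesis unfolding 1 using qd_mult[OF t0 ES[OF RC], of "tw 0 R"] 2 by simp
 qed
 have Gout: "tw 0 R = G R" if "R:cpts CX" "R ~: Z v" for R
  unfolding G_def tw_not_Z[OF that v] image_mult_assoc tw_0[OF closed_in[OF that(1)]] using vn by simp
 have Gsup: "tw 0 R <= G R" if R: "R:cpts CX" for R
 proof
  fix y assume "y:tw 0 R"
  hence "v^n*y:tw n R" using tw_mult[OF closed_in[OF R] vn(1), of y 0] by simp
  moreover have "y = inverse (v^n)*(v^n*y)" using vn by(simp add: mult.assoc[symmetric])
  ultimately show "y:G R" unfolding G_def by blast
 qed
 have vp: "v^n:power_products V n" unfolding power_products_def using v by(intro CollectI exI[of _ "%_. v"]) auto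
 have "qdA (Lam CX (tw 0)) (Lam CX (E n)) = (SUM R:Z v. qdK (tw 0 R) (E n R))"
  by(rule cx.Lam_sum[OF FE fam_O p.FG Z_finite[OF v] ZC]) (use out tw_0[OF closed_in] in auto)
 also have "... = (SUM R:Z v. qdK (G R) (tw 0 R))" using loc by simp
 also have "... = qdA (Lam CX G) (Lam CX (tw 0))"
  by(rule cx.Lam_sum[OF fam_O FG Gsup Z_finite[OF v] ZC Gout, symmetric])
 also have "... = qdA (as (v^n) ` Lam CX G) (as (v^n) ` Lam CX (tw 0))"
  by(rule cx.qdA_scale[OF vn(2) cx.Lam_subspace[OF fam_O], symmetric])
 also have "... = qdA (Lam CX (tw n)) (Lam CX (sc (v^n) (tw 0)))"
  unfolding cx.Lam_scale[OF fam_O vn(2), symmetric] cx.Lam_scale[OF FG vn(2), symmetric]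
  unfolding G_def image_mult_assoc using vn by simp
 also have "... = enat (n*deg)" by(rule Lam_degree_product[OF vp vn(2)])
 finally have "qdA (cob CX (tw 0)) (cob CX (E n)) <= enat (n*deg)"
  unfolding p.Lam_add by(metis add_increasing zero_le order_refl)
 thus "h1 em CX (E n) <= enat (g' + n*deg)" unfolding p.h1_add g' plus_enat_simps(1)[symmetric] by(rule add_left_mono)
qed

text \<open>Suppose that \<psi> is no multiple of \<phi>. For a, b in v^{-n} V^n the functionals a \<phi> + b \<psi>
  kill the coboundaries of E n, so they form a space of dimension 2 (n d' + c), whereas h1(E n) \<le> g' + n
  d'.\<close>
lemma weil_differentials:
 assumes l: "ka.lin_on UNIV \<phi>" "ka.lin_on AD \<psi>" and z: "!!r. r:cob CX (tw 0) ==> \<phi> r = 0" "!!r. r:cob CX (tw 0) ==> \<psi> r = 0"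
  and nz: "r0:AD" "\<phi> r0 ~= 0"
 shows "EX x:K'. ALL r:AD. \<psi> r = \<phi> (as x r)"
proof(rule ccontr)
 assume no: "~ ?thesis"
 obtain v where v: "v:V" "v ~= 0" by(rule nonzero_elem)
 note fg = functional_growth[OF v]
 have \<phi>add: "\<phi> (%P. r P + r' P) = \<phi> r + \<phi> r'" and \<phi>scl: "\<phi> (%P. em c*r P) = c*\<phi> r" for r r' c
  using l(1) unfolding ka.lin_on_def plus_fun_def by blast+
 have \<psi>add: "\<psi> (%P. r P + r' P) = \<psi> r + \<psi> r'" and \<psi>scl: "\<psi> (%P. em c*r P) = c*\<psi> r" if "r:AD" "r':AD" for r r' c
  using l(2) that unfolding ka.lin_on_def plus_fun_def by blast+
 define X where "X = (%n. (inverse (v^n)) ** Vn n)"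
 have XK: "X n <= K'" for n unfolding X_def using coord_quot_K'[OF _ power_coord[OF v(1)]] v by(auto simp: field_simps)
 have Xs: "ksub (X n)" for n unfolding X_def by(rule ksub_image[OF coord_subspace])
 have bound: "enat (2*D n) <= enat (g' + n*deg)" for n
 proof -
  define E where "E = (%R. {y:K'. ALL a:Vn n. a/v^n*y:R})"
  note FE = fg(1)[of n, folded E_def] and AE = fg(2)[of n, folded E_def] and hE = fg(3)[of n, folded E_def]
  have XE: "a*y:tw 0 R" if "R:cpts CX" "y:E R" "a:X n" for a y R
   using that tw_0[OF closed_in[OF that(1)]] unfolding E_def X_def by(auto simp: field_simps)
  let ?b = "%p r. \<phi> (as (fst p) r) + \<psi> (as (snd p) r)"
  have "qdK (Vn n) {0} = qdK (X n) {0}" unfolding X_def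
   using qd_mult[OF _ kv.subspace_single_0, of "inverse (v^n)" "Vn n"] v by simp
  hence "enat (2*D n) = qdK (X n) {0} + qdK (X n) {0}" using D[of n] by(simp add: mult_2 flip: plus_enat_simps(1))
  also have "... <= quot_dim psc (X n \<times> X n) {0}" by(rule qd_square[OF Xs])
  also have "... <= qdA AD (cob CX E)"
  proof(rule qd_le_pairing[OF vspP vspA, where b="?b"])
   interpret p: vspace psc by(rule vspP)
   show "p.subspace (X n \<times> X n)"
    by(rule p.subspaceI) (use ksub_0[OF Xs] ksub_add[OF Xs] ksub_scale[OF Xs] in "auto simp: psc_def zero_prod_def")
   show "ka.subspace AD" by(rule AD_subspace)
   show "ka.subspace (cob CX E)" by(rule cx.cob_subspace[OF FE])
   show "cob CX E <= AD" using cx.cob_adeles AE by blast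
  next
   fix u assume u: "u:AD"
   have a: "as x u:AD" if "x:X n" for x using AD_scale u XK that by blast
   have "\<psi> (%P. as x u P + as y u P) = \<psi> (as x u) + \<psi> (as y u)" "\<psi> (%P. em c*as x u P) = c*\<psi> (as x u)"
    if xy: "x:X n" "y:X n" for x y c
    by(rule \<psi>add[OF a[OF xy(1)] a[OF xy(2)]], rule \<psi>scl[OF a[OF xy(1)] a[OF xy(2)]])
   thus "vspace.lin_on psc (X n \<times> X n) (%p. ?b p u)" unfolding vspace.lin_on_def[OF vspP]
    by(simp add: psc_def as_add as_i \<phi>add \<phi>scl distrib_left add_ac mem_Times_iff)
  next
   fix p assume p: "p:X n \<times> X n"
   hence "fst p:K'" "snd p:K'" using XK[of n] by(auto simp: mem_Times_iff)
   hence d: "as (snd p) r:AD" if "r:AD" for r using AD_scale[OF _ that] by blast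
   have "\<psi> (%P. as (snd p) r P + as (snd p) r' P) = \<psi> (as (snd p) r) + \<psi> (as (snd p) r')"
    "\<psi> (%P. em c*as (snd p) r P) = c*\<psi> (as (snd p) r)" if rr: "r:AD" "r':AD" for r r' c
    by(rule \<psi>add[OF d[OF rr(1)] d[OF rr(2)]], rule \<psi>scl[OF d[OF rr(1)] d[OF rr(2)]])
   thus "ka.lin_on AD (?b p)" unfolding ka.lin_on_def
    by(simp add: as_add2 as_i2 \<phi>add \<phi>scl distrib_left add_ac)
  next
   fix p r assume p: "p:X n \<times> X n" and r: "r:cob CX E"
   have "as a r:cob CX (tw 0)" if "a:X n" for a
    by(rule cx.cob_scale_in[OF FE fam_O _ XE r]) (use that XK subring_mult[OF K'_subring] in auto)
   thus "?b p r = 0" using z p by auto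
  next
   fix p assume p: "p:X n \<times> X n" and zero: "!!u. u:AD ==> ?b p u = 0"
   obtain t s where ts: "p = (t, s)" by(cases p)
   have K: "t:K'" "s:K'" using p ts XK by auto
   have "p = 0"
   proof(cases "s = 0")
    case False
    have "\<psi> r = \<phi> (as (- (t/s)) r)" if r: "r:AD" for r
    proof -
     have r': "as (inverse s) r:AD" by(rule AD_scale[OF K'_inverse[OF K(2)] r])
     have 0: "\<phi> (as t (as (inverse s) r)) + \<psi> (as s (as (inverse s) r)) = 0" using zero[OF r'] ts by simp
     have n: "as (- (t/s)) r = (%P. em (- 1)*as (t/s) r P)" by(simp add: cx.ascale_def i_neg)
     have m: "\<phi> (as (- (t/s)) r) = - 1*\<phi> (as (t/s) r)" unfolding n using l(1) unfolding ka.lin_on_def by blast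
     have "\<psi> r = - \<phi> (as (t/s) r)" using 0 False unfolding as_as by(simp add: field_simps as_1 eq_neg_iff_add_eq_0)
     thus ?thesis unfolding m by simp
    qed
    moreover have "- (t/s):K'" using K'_divide[OF K] kv.subspace_neg[OF K'_subspace] by blast
    ultimately show ?thesis using no by blast
   next
    case True
    have \<psi>0: "\<psi> (%P. 0) = 0" using z(2) ka.subspace_0[OF cx.cob_subspace[OF fam_tw]] by(simp add: zero_fun_def)
    have "t = 0"
    proof(rule ccontr)
     assume t: "t ~= 0"
     have r': "as (inverse t) r0:AD" by(rule AD_scale[OF K'_inverse[OF K(1)] nz(1)])
     have "?b p (as (inverse t) r0) = \<phi> r0" using True ts t \<psi>0 by(simp add: as_as as_1 as_0)
     thus False using zero[OF r'] nz by simp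
    qed
    thus ?thesis using True ts by(simp add: zero_prod_def)
   qed
   thus "p:{0}" by simp
  qed
  also have "... <= enat (g' + n*deg)" using hE AE by(simp add: h1_def)
  finally show ?thesis .
 qed
 obtain c :: int and N where cN: "ALL n>=N. int (D n) = int deg*int n + c" using D_linear by blast
 \<comment> \<open>From this n on, 2 (n d' + c) exceeds n d' + g'.\<close>
 define n where "n = max N (g' + nat (- 2*c) + 1)"
 have "2*int (D n) <= int g' + int n*int deg" using bound[of n] by(simp add: of_nat_mult[symmetric] del: of_nat_mult)
 moreover have "int (D n) = int deg*int n + c" using cN by(simp add: n_def)
 ultimately have "int n*int deg + 2*c <= int g'" by(simp add: algebra_simps)
 moreover have "int n*1 <= int n*int deg" using deg_pos by(intro mult_left_mono) auto
 moreover have "int n >= int g' + - 2*c + 1" unfolding n_def by auto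
 ultimately show False by linarith
qed

text \<open>Fix \<phi> \<noteq> 0 on H1(F). By \<open>weil_differentials\<close> the dual of H1(G) is B G = {x. x
  \<phi> kills the coboundaries of G} for every G over O, so A (B F) \<subseteq> B O for A = H0(F), and Hopf's
  inequality gives h0 + h1 - 1 \<le> dim B O = g'.\<close>
lemma clifford:
 assumes F: "over F" and h: "h1 em CX F ~= 0"
 shows "h0 em CX F + h1 em CX F <= enat (g' + 1)"
proof -
 have "~ AD <= cob CX F" using h ka.qd_eq_0[OF cx.cob_subspace[OF over_fam[OF F]]] unfolding h1_def over_AD[OF F] by blast
 then obtain r0 where r0: "r0:AD" "r0 ~: cob CX F" by blast
 obtain \<phi> where \<phi>: "ka.lin_on UNIV \<phi>" "!!w. w:cob CX F ==> \<phi> w = 0" "\<phi> r0 = 1"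
  using ka.functional_separate[OF cx.cob_subspace[OF over_fam[OF F]] r0(2)] by metis
 have \<phi>O: "\<phi> w = 0" if "w:cob CX (tw 0)" for w using \<phi>(2) over_cob[OF F] that by blast
 define B where "B = (%G. {x:K'. ALL r:cob CX G. \<phi> (as x r) = 0})"
 have add: "\<phi> (%P. r P + r' P) = \<phi> r + \<phi> r'" and scl: "\<phi> (%P. em c*r P) = c*\<phi> r" for r r' c
  using \<phi>(1) unfolding ka.lin_on_def plus_fun_def by blast+
 have \<phi>0: "\<phi> (%P. 0) = 0" using scl[of 0] by simp
 have Bs: "ksub (B G)" for G
  by(rule kv.subspaceI) (use ksub_0[OF K'_subspace] ksub_add[OF K'_subspace] ksub_scale[OF K'_subspace] in "auto simp: B_def as_0 \<phi>0 as_add add as_i scl")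
 have dim: "h1 em CX G = qdK (B G) {0}" if G: "over G" for G
 proof -
  interpret pairing "%c x. em c*x" "%c r P. em c*r P" "B G" AD "cob CX G" "%x r. \<phi> (as x r)"
  proof(unfold_locales)
   show "ksub (B G)" by(rule Bs)
   show "ka.subspace AD" by(rule AD_subspace)
   show "ka.subspace (cob CX G)" by(rule cx.cob_subspace[OF over_fam[OF G]])
   show "cob CX G <= AD" using cx.cob_adeles over_AD[OF G] by blast
   show "kv.lin_on (B G) (%x. \<phi> (as x r))" for r unfolding kv.lin_on_def by(simp add: as_add add as_i scl)
   show "ka.lin_on AD (%r. \<phi> (as x r))" for x unfolding ka.lin_on_def by(simp add: as_add2 add as_i2 scl)
   show "\<phi> (as x w) = 0" if "x:B G" "w:cob CX G" for x w using that by(simp add: B_def)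
  next
   fix s assume s: "s:B G" and zz: "!!r. r:AD ==> \<phi> (as s r) = 0"
   show "s = 0"
   proof(rule ccontr)
    assume s0: "s ~= 0"
    have "as (inverse s) r0:AD" by(rule AD_scale[OF K'_inverse r0(1)]) (use s in "simp add: B_def")
    from zz[OF this] show False using s0 \<phi>(3) by(simp add: as_as as_1)
   qed
  next
   fix f assume f: "ka.lin_on AD f" "!!w. w:cob CX G ==> f w = 0"
   have "EX x:K'. ALL r:AD. f r = \<phi> (as x r)"
    by(rule weil_differentials[OF \<phi>(1) f(1) \<phi>O _ r0(1)]) (use f(2) over_cob[OF G] \<phi>(3) in auto)
   then obtain x where x: "x:K'" "!!r. r:AD ==> f r = \<phi> (as x r)" by blast
   have "\<phi> (as x r) = 0" if "r:cob CX G" for r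
    using x(2)[of r] f(2)[OF that] subsetD[OF cx.cob_adeles that] over_AD[OF G] by simp
   hence "x:B G" unfolding B_def using x(1) by blast
   thus "EX s:B G. ALL u:AD. \<phi> (as s u) = f u" using x by auto
  qed
  show ?thesis unfolding h1_def over_AD[OF G] by(rule dim_eq)
 qed
 have BO: "qdK (B (tw 0)) {0} = enat g'" using dim[OF over_O] g' by simp
 have prod_in: "a*x:B (tw 0)" if a: "a:H0 CX F" and x: "x:B F" for a x
 proof -
  have aK: "a:K'" "!!P. P:cpts CX ==> a:F P" using a unfolding cx.H0_eq[OF over_fam[OF F]] by auto
  have xK: "x:K'" using x by(simp add: B_def)
  have "\<phi> (as (a*x) r) = 0" if r: "r:cob CX (tw 0)" for r
  proof -
   have "as a r:cob CX F"
   proof(rule cx.cob_scale_in[OF fam_O over_fam[OF F] _ _ r])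
    show "a*y:K'" if "y:K'" for y by(rule subring_mult[OF K'_subring aK(1) that])
   next
    fix P y assume P: "P:cpts CX" "y:tw 0 P"
    have "submod P (F P)" "y:P" using F P tw_0[OF closed_in[OF P(1)]] unfolding over_def by auto
    from submod_scale[OF this aK(2)[OF P(1)]] show "a*y:F P" by(simp add: mult.commute)
   qed
   hence "\<phi> (as x (as a r)) = 0" using x unfolding B_def by blast
   thus ?thesis unfolding as_as by(simp add: mult.commute)
  qed
  thus ?thesis unfolding B_def using subring_mult[OF K'_subring aK(1) xK] by blast
 qed
 have Hs: "ksub (H0 CX F)" by(rule cx.H0_subspace[OF over_fam[OF F]])
 have "B F ~= {0}" using dim[OF F] h kv.qd_self[OF kv.subspace_single_0] by auto
 then obtain x where x: "x:B F" "x ~= 0" using ksub_0[OF Bs] by blast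
 have "h0 em CX F = qdK (x ** H0 CX F) {0}" unfolding h0_def using qd_mult[OF x(2) kv.subspace_single_0, of "H0 CX F"] by simp
 also have "... <= enat g'" unfolding BO[symmetric] by(rule kv.qd_mono) (use prod_in[OF _ x(1)] in "auto simp: mult.commute")
 finally obtain h where hh: "h0 em CX F = enat h" by(cases "h0 em CX F") auto
 have "1:H0 CX F" unfolding cx.H0_eq[OF over_fam[OF F]]
  using F subring_1[OF K'_subring] subring_1[OF point_subring[OF closed_in]] unfolding over_def by blast
 hence "h ~= 0" using hh kv.qd_eq_0[OF kv.subspace_single_0, of "H0 CX F"] unfolding h0_def by(auto simp: zero_enat_def[symmetric])
 then obtain q where q: "h = Suc q" using not0_implies_Suc by blast
 have "h1 em CX F <= enat g'" using fam_pair.h1_mono[OF over_pair[OF F]] g' by simp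
 hence Bf: "qdK (B F) {0} < \<infinity>" using dim[OF F] by(cases "qdK (B F) {0}") auto
 have "qdK (B F) {0} + enat q <= qdK (prods (B F) (H0 CX F)) {0}"
  by(rule hopf[OF Bs Bf `B F ~= {0}` Hs]) (use hh q in "simp add: h0_def")
 also have "... <= enat g'" unfolding BO[symmetric]
  unfolding prods_commute[of "B F"] by(rule kv.qd_mono[OF prods_least[OF Bs]]) (use prod_in in auto)
 finally have 1: "h1 em CX F + enat q <= enat g'" using dim[OF F] by simp
 obtain k where k: "h1 em CX F = enat k" using 1 by(cases "h1 em CX F") auto
 show ?thesis using 1 unfolding hh q k by simp
qed

lemma clifford_scaled:
 assumes v: "v:V" "v ~= 0" and F: "cx.fam (tw 1 K') F" and FR: "!!R. R:cpts CX ==> submod R (F R)" "!!R. R:cpts CX ==> v ** R <= F R"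
  and out: "!!R. R:cpts CX ==> R ~: Z v ==> F R = v ** R" and h: "h1 em CX F ~= 0"
 shows "h0 em CX F + h1 em CX F <= enat (g' + 1)"
proof -
 define G where "G = sc (inverse v) F"
 have vi: "inverse v ~= 0" using v by simp
 have MK: "inverse v ** tw 1 K' = K'" unfolding tw_K'[OF v] image_mult_assoc using v(2) by simp
 have "over G" unfolding over_def
 proof(intro conjI ballI)
  show "cx.fam K' G" using cx.fam_scale[OF F vi] unfolding MK G_def .
  fix R assume R: "R:cpts CX"
  show "submod R (G R)" unfolding G_def by(rule submod_image[OF FR(1)[OF R]])
  have "inverse v ** v ** R <= G R" unfolding G_def by(rule image_mono[OF FR(2)[OF R]])
  thus "R <= G R" unfolding image_mult_assoc using v(2) by simp
 next
  have "G R = R" if "R:cpts CX" "R ~: Z v" for R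
   unfolding G_def out[OF that] image_mult_assoc using v(2) by simp
  thus "finite {R:cpts CX. G R ~= R}" by(intro finite_subset[OF _ Z_finite[OF v]]) blast
 qed
 thus ?thesis using clifford[of G] h unfolding G_def cx.h0_scale[OF F vi] cx.h1_scale[OF F vi] by blast
qed

end

section \<open>Projective normality in the nonspecial case\<close>

lemma sum_fun_apply: "(SUM i:I. f i) x = (SUM i:I. f i x)"
 by(induction I rule: infinite_finite_induct) simp_all

context linsys begin

lemma point_gen:
 assumes "R:cpts CX"
 obtains u where "u:V" "u ~= 0" "!!n. tw n R = (u^n) ** R"
 using closed_point[OF assms] tw_gen by(metis gen_def)

text \<open>Let u, v \<in> V be without common zeros on Z v. The section z is divisible by u near Z v, and the
  vanishing of h1 lifts z/u modulo v to a global section m, so v divides z - u m.\<close>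
lemma sections_generated_step:
 assumes h: "h1 em CX (tw n) = 0"
 shows "H0 CX (tw (2 + n)) <= prods (H0 CX (tw (1 + n))) V"
proof
 fix z assume "z:H0 CX (tw (2 + n))"
 hence z: "z:tw (2 + n) K'" "!!P. P:cpts CX ==> z:tw (2 + n) P" unfolding cx.H0_eq[OF fam_tw] by auto
 obtain v where v: "v:V" "v ~= 0" by(rule nonzero_elem)
 obtain u where u: "u:V" "u ~= 0" "!!R. R:Z v ==> EX W. VR W & W ~= UNIV & R = RW W & gen W u"
  by(rule point_Z_gen[OF v]) blast
 define l where "l = (%P. if P:Z v then z/u else 0)"
 have ZC: "Z v <= cpts CX" by(auto simp: Z_def)
 note FT = fam_tw[of "1 + n"] and FS = fam_sc_tw[OF V_coord[OF v(1)] v(2), of n]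
 have divu: "z/u:tw (1 + n) P" if g: "tw (2 + n) P = (u^(2 + n)) ** P" "tw (1 + n) P = (u^(1 + n)) ** P" "z:tw (2 + n) P" for P
  using g(3) u(2) unfolding g(1,2) by auto
 have zK: "z/u:tw (1 + n) K'" by(rule divu[OF tw_K'[OF u(1,2)] tw_K'[OF u(1,2)] z(1)])
 have zP: "z/u:tw (1 + n) R" if R: "R:Z v" for R
 proof -
  obtain W where W: "VR W" "R = RW W" "gen W u" using u(3)[OF R] by blast
  show ?thesis unfolding W(2) by(rule divu[OF tw_gen[OF W(1,3)] tw_gen[OF W(1,3)]]) (use z(2) R ZC W(2) in blast)
 qed
 have l: "l:Lam CX (tw (1 + n))" unfolding cx.Lam_iff[OF FT] l_def
  using zP ZC submod_0[OF tw_submod[OF closed_in]] by auto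
 interpret p: fam_pair em CX "tw (1 + n) K'" "sc v (tw n)" "tw (1 + n)" by(rule pair_sc_tw[OF V_pp[OF v(1)] v(2)])
 have "h1 em CX (sc v (tw n)) = 0" using cx.h1_scale[OF fam_tw v(2), of n] h by simp
 hence "adeles CX (sc v (tw n)) <= cob CX (sc v (tw n))"
  unfolding h1_def using ka.qd_eq_0[OF cx.cob_subspace[OF FS]] by blast
 hence "l:cob CX (sc v (tw n))" using l p.ad_eq cx.Lam_cob[OF FT] cx.cob_adeles by blast
 then obtain k m where km: "l = k + diag CX m" "k:Lam CX (sc v (tw n))" "m:tw (1 + n) K'" unfolding cx.cob_eq[OF FS] by blast
 have kP: "k P:sc v (tw n) P" "k P = l P - m" if P: "P:cpts CX" for P
  using km P unfolding cx.Lam_iff[OF FS] by(auto simp: diag_def)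
 have "m:tw (1 + n) P" if P: "P:cpts CX" for P
 proof -
  have "l P - k P:tw (1 + n) P" using ksub_diff[OF tw_subspace[OF closed_in[OF P]]] kP(1)[OF P] p.FG[OF P] l P
   unfolding cx.Lam_iff[OF FT] by blast
  thus ?thesis using kP(2)[OF P] by simp
 qed
 hence mH: "m:H0 CX (tw (1 + n))" unfolding cx.H0_eq[OF FT] using km by blast
 have umP: "u*x:tw (2 + n) P" if "P:CX" "x:tw (1 + n) P" for P x using tw_mult[OF that(1) V_coord[OF u(1)] that(2)] by simp
 have dv: "z - u*m:v ** tw (1 + n) P" if P: "P:CX" "P:cpts CX ==> P:Z v \<or> tw (2 + n) P = v ** tw (1 + n) P"
   "P ~: cpts CX ==> P = K'" for P
 proof(cases "P:Z v")
  case True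
  obtain x where x: "k P = v*x" "x:tw n P" using kP(1) True ZC by blast
  have "k P = z/u - m" using kP(2) True ZC by(auto simp: l_def)
  hence "z = u*(m + v*x)" using u(2) x(1) by(simp add: field_simps)
  hence "z - u*m = v*(u*x)" by(simp add: algebra_simps)
  moreover have "u*x:tw (1 + n) P" using tw_mult[OF P(1) V_coord[OF u(1)] x(2)] .
  ultimately show ?thesis by blast
 next
  case False
  have "tw (2 + n) P = v ** tw (1 + n) P"
   using P False sc_tw_K'[OF V_coord[OF v(1)] v(2), of "1 + n"] by(cases "P:cpts CX") auto
  moreover have "z - u*m:tw (2 + n) P"
   using P(3) z km(3) mH umP[OF P(1)] ksub_diff[OF tw_subspace[OF P(1)]] unfolding cx.H0_eq[OF FT] by(cases "P:cpts CX") auto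
  ultimately show ?thesis by blast
 qed
 have "(z - u*m)/v:tw (1 + n) P" if "P:cpts CX \<or> P = K'" for P
 proof -
  have "z - u*m:v ** tw (1 + n) P"
  proof(rule dv)
   show "P:CX" using that closed_in K'_in by blast
   show "P:Z v \<or> tw (2 + n) P = v ** tw (1 + n) P" if "P:cpts CX"
    by(cases "P:Z v") (simp_all add: tw_not_Z[OF that _ v] image_mult_assoc)
  qed (use that in blast)
  thus ?thesis using v(2) by auto
 qed
 hence "(z - u*m)/v:H0 CX (tw (1 + n))" unfolding cx.H0_eq[OF FT] by blast
 hence "m*u + (z - u*m)/v*v:prods (H0 CX (tw (1 + n))) V"
  by(intro ksub_add[OF prods_subspace] prods_base mH u(1) v(1))
 moreover have "m*u + (z - u*m)/v*v = z" using v(2) by(simp add: mult.commute)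
 ultimately show "z:prods (H0 CX (tw (1 + n))) V" by simp
qed

text \<open>The adele supported at R.\<close>
definition sgl :: "'K set => 'K => 'K set => 'K" where "sgl R z = (%P. if P = R then z else 0)"

text \<open>A functional \<Psi> on adelic sections of O(2) kills v O(1) and the products of V, but not m0. So (x, y)
  \<mapsto> \<Psi>(x y) is a symmetric form on adelic sections of O(1) for which V is isotropic; let F be its radical.
  Isotropy gives 2 dim V/H0(F) \<le> dim Lam O(1)/Lam F, which the Euler characteristic turns into h0(F) + h1(F) \<ge>
  dim V \<ge> g' + 2. If h1(F) \<noteq> 0, this contradicts Clifford's inequality; if h1(F) = 0, the form is zero and
  \<Psi> vanishes on m0.\<close>
lemma quadratic_normality:
 assumes HV: "H0 CX (tw 1) = V" and h: "h1 em CX (tw 1) = 0" and big: "qdK V {0} >= enat (g' + 2)"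
 shows "H0 CX (tw 2) <= Vn 2"
proof(rule ccontr)
 assume "~ ?thesis"
 then obtain m0 where m0: "m0:H0 CX (tw 2)" "m0 ~: Vn 2" by blast
 obtain v where v: "v:V" "v ~= 0" by(rule nonzero_elem)
 note vv = V_coord[OF v(1)]
 have VV: "a*b:Vn 2" if "a:V" "b:V" for a b using coord_mult[OF V_coord V_coord, OF that] by(simp add: numeral_2_eq_2)
 note F1 = fam_tw[of 1] and F2 = fam_tw[of 2] and FS = fam_sc_tw[OF vv v(2), of 1, unfolded one_add_one]
 have m0P: "m0:tw 2 P" if "P:cpts CX" for P using m0(1) that unfolding cx.H0_eq[OF F2] by blast
 \<comment> \<open>Adelic sections of v O(1), together with V V.\<close>
 define W0 where "W0 = {x + y |x y. x:Lam CX (sc v (tw 1)) & y:diag CX ` Vn 2}"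
 have W0: "ka.subspace W0" unfolding W0_def by(rule ka.subspace_sums[OF cx.Lam_subspace[OF FS] cx.diag_subspace[OF coord_subspace]])
 have "diag CX m0 ~: W0"
 proof
  assume "diag CX m0:W0"
  then obtain l a where la: "diag CX m0 = l + diag CX a" "l:Lam CX (sc v (tw 1))" "a:Vn 2" unfolding W0_def by blast
  have "m0 - a:sc v (tw 1) P" if P: "P:cpts CX" for P
  proof -
   have "l P = m0 - a" using fun_cong[OF la(1), of P] P by(simp add: diag_def)
   moreover have "l P:sc v (tw 1) P" using la(2) P unfolding cx.Lam_iff[OF FS] by blast
   ultimately show ?thesis by(simp only:)
  qed
  moreover have "m0 - a:tw 2 K'" using m0(1) la(3) coord_tw[OF K'_in, of 2] ksub_diff[OF tw_subspace[OF K'_in]]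
   unfolding cx.H0_eq[OF F2] by blast
  ultimately have "m0 - a:H0 CX (sc v (tw 1))" unfolding cx.H0_eq[OF FS] by blast
  then obtain b where "b:V" "m0 - a = v*b" unfolding cx.H0_scale[OF F1 v(2)] HV by blast
  hence "m0 - a:Vn 2" using VV v by simp
  hence "(m0 - a) + a:Vn 2" using la(3) ksub_add[OF coord_subspace] by blast
  thus False using m0 by simp
 qed
 then obtain \<Psi> where \<Psi>: "ka.lin_on UNIV \<Psi>" "!!w. w:W0 ==> \<Psi> w = 0" "\<Psi> (diag CX m0) = 1"
  using ka.functional_separate[OF W0] by metis
 have add: "\<Psi> (r + r') = \<Psi> r + \<Psi> r'" and scl: "\<Psi> (%P. em c*r P) = c*\<Psi> r" for r r' c
  using \<Psi>(1) unfolding ka.lin_on_def by blast+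
 have \<Psi>0: "\<Psi> 0 = 0" using \<Psi>(2) ka.subspace_0[OF W0] by(simp add: zero_fun_def)
 have \<Psi>L: "\<Psi> l = 0" if "l:Lam CX (sc v (tw 1))" for l
 proof -
  have "l + diag CX 0:W0" unfolding W0_def using that ksub_0[OF coord_subspace] by blast
  moreover have "diag CX 0 = 0" by(simp add: diag_def fun_eq_iff)
  ultimately show ?thesis using \<Psi>(2) by simp
 qed
 have \<Psi>d: "\<Psi> (diag CX a) = 0" if "a:Vn 2" for a
 proof -
  have "0 + diag CX a:W0" unfolding W0_def using that ka.subspace_0[OF cx.Lam_subspace[OF FS], folded zero_fun_def] by blast
  thus ?thesis using \<Psi>(2) by simp
 qed
 have sglL: "\<Psi> (sgl R z) = 0" if R: "R:cpts CX" "z:sc v (tw 1) R" for R z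
 proof -
  have "0:sc v (tw 1) P" if "P:cpts CX" for P using submod_0[OF tw_submod[OF closed_in[OF that]], of 1] by force
  hence "sgl R z:Lam CX (sc v (tw 1))" unfolding cx.Lam_iff[OF FS] sgl_def using R by simp
  thus ?thesis by(rule \<Psi>L)
 qed
 have ZC: "Z v <= cpts CX" by(auto simp: Z_def)
 have out: "sc v (tw 1) R = tw 2 R" if "R:cpts CX" "R ~: Z v" for R
  unfolding tw_not_Z[OF that v] image_mult_assoc by(simp add: power2_eq_square)
 \<comment> \<open>only finitely many components matter\<close>
 have comp: "\<Psi> r = (SUM R:Z v. \<Psi> (sgl R (r R)))" if r: "r:Lam CX (tw 2)" for r
 proof -
  have sm: "\<Psi> (SUM R:S. sgl R (r R)) = (SUM R:S. \<Psi> (sgl R (r R)))" if "finite S" for S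
   using that by(induction S rule: finite_induct) (auto simp: \<Psi>0 \<Psi>0[unfolded zero_fun_def] add[unfolded plus_fun_def])
  define s where "s = (SUM R:Z v. sgl R (r R))"
  have s: "s P = (if P:Z v then r P else 0)" for P
   unfolding s_def sgl_def using Z_finite[OF v] by(simp add: sum_fun_apply sum.delta' cong: if_cong)
  have "r - s:Lam CX (sc v (tw 1))" unfolding cx.Lam_iff[OF FS]
  proof(intro conjI allI impI ballI)
   show "(r - s) P = 0" if "P ~: cpts CX" for P using r that ZC s unfolding cx.Lam_iff[OF F2] by auto
   fix P assume P: "P:cpts CX"
   have "0:sc v (tw 1) P" using submod_0[OF tw_submod[OF closed_in[OF P]], of 1] by force
   thus "(r - s) P:sc v (tw 1) P" using r P out[OF P] s unfolding cx.Lam_iff[OF F2] by auto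
  qed
  hence "\<Psi> ((r - s) + s) = \<Psi> s" unfolding add using \<Psi>L by simp
  thus ?thesis using sm[OF Z_finite[OF v]] unfolding s_def by simp
 qed
 have mul2: "x*y:tw 2 P" if xy: "P:cpts CX" "x:tw 1 P" "y:tw 1 P" for x y P
 proof -
  obtain u where u: "u:V" "u ~= 0" "!!n. tw n P = (u^n) ** P" by(rule point_gen[OF xy(1)]) blast
  obtain a b where ab: "x = u*a" "y = u*b" "a:P" "b:P" using xy(2,3) unfolding u(3) by auto
  have "x*y = u^2*(a*b)" unfolding ab by(simp add: power2_eq_square)
  thus ?thesis unfolding u(3) using subring_mult[OF point_subring[OF closed_in[OF xy(1)]] ab(3,4)] by blast
 qed
 define F where "F = (%R. if R:cpts CX then {x:tw 1 R. ALL y:tw 1 R. \<Psi> (sgl R (x*y)) = 0} else tw 1 R)"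
 have sgl_add: "sgl R (x + y) = sgl R x + sgl R y" and sgl_scl: "sgl R (em c*x) = (%P. em c*sgl R x P)" for R x y c
  by(auto simp: sgl_def fun_eq_iff)
 have FR: "submod R (F R)" "v ** R <= F R" "F R <= tw 1 R" if R: "R:cpts CX" for R
 proof -
  have RC: "R:CX" using closed_in[OF R] .
  have z0: "\<Psi> (sgl R 0) = 0" using sglL[OF R, of 0] submod_0[OF tw_submod[OF RC], of 1] by force
  show "submod R (F R)" unfolding submod_def
  proof(intro conjI ballI)
   show "0:F R" unfolding F_def using R submod_0[OF tw_submod[OF RC]] z0 by auto
   show "x + y:F R" if "x:F R" "y:F R" for x y
    using that R submod_add[OF tw_submod[OF RC]] unfolding F_def by(simp add: distrib_right sgl_add add)
   fix r x assume r: "r:R" and x: "x:F R"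
   have "\<Psi> (sgl R (r*x*y)) = 0" if "y:tw 1 R" for y
   proof -
    have e: "r*x*y = x*(r*y)" by(simp add: mult_ac)
    show ?thesis unfolding e using x submod_scale[OF tw_submod[OF RC] r that] R unfolding F_def by simp
   qed
   thus "r*x:F R" using x submod_scale[OF tw_submod[OF RC] r] R unfolding F_def by simp
  qed
  have "v*r:tw 1 R" if "r:R" for r using tw_mult[OF RC vv, of r 0] tw_0[OF RC] that by simp
  moreover have "\<Psi> (sgl R (v*r*y)) = 0" if "r:R" "y:tw 1 R" for r y
   by(rule sglL[OF R]) (use submod_scale[OF tw_submod[OF RC] that] in "auto simp: mult.assoc")
  ultimately show "v ** R <= F R" using R unfolding F_def by auto
  show "F R <= tw 1 R" using R by(auto simp: F_def)
 qed
 have Fout: "F R = v ** R" "F R = tw 1 R" if "R:cpts CX" "R ~: Z v" for R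
  using FR(2,3)[OF that(1)] tw_not_Z[OF that v, of 1] by auto
 have gpc: "generic_point CX ~: cpts CX" unfolding CX_generic CX_closed using RW_ne_K' by blast
 have FF: "cx.fam (tw 1 K') F" unfolding cx.fam_def
 proof(intro conjI ballI)
  show "F (generic_point CX) = tw 1 K'" using gpc CX_generic by(simp add: F_def)
  fix m assume m: "m:tw 1 K'"
  have "{P:cpts CX. m ~: F P} <= {P:cpts CX. m ~: tw 1 P} Un Z v" using Fout(2) by blast
  thus "finite {P:cpts CX. m ~: F P}" using cx.fam_fin[OF F1 m] Z_finite[OF v] finite_subset by blast
 next
  fix P assume P: "P:cpts CX"
  show "ksub (F P)" by(rule submod_subspace[OF FR(1)[OF P] point_range[OF closed_in[OF P]]])
  show "F P <= tw 1 K'" using FR(3)[OF P] cx.fam_le[OF F1 P] by blast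
 qed (use tw_subspace[OF K'_in] in blast)
 interpret p: fam_pair em CX "tw 1 K'" F "tw 1"
 proof(unfold_locales)
  show "finite {P:cpts CX. F P ~= tw 1 P}" by(rule finite_subset[OF _ Z_finite[OF v]]) (use Fout in blast)
 qed (use FF F1 FR(3) CX_closed_ne in auto)
 define pm where "pm = (%x y (P :: 'K set). x P*(y P :: 'K))"
 have pmL: "pm x y:Lam CX (tw 2)" if "x:Lam CX (tw 1)" "y:Lam CX (tw 1)" for x y
  using that mul2 unfolding cx.Lam_iff[OF F1] cx.Lam_iff[OF F2] pm_def by auto
 have F_pm: "\<Psi> (pm x y) = 0" if "x:Lam CX F" "y:Lam CX (tw 1)" for x y
 proof -
  have "x:Lam CX (tw 1)" using that p.Lam_mono by blast
  hence "\<Psi> (pm x y) = (SUM R:Z v. \<Psi> (sgl R (x R*y R)))" using comp[OF pmL[OF _ that(2)]] by(simp add: pm_def)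
  also have "... = 0" using that ZC unfolding cx.Lam_iff[OF FF] cx.Lam_iff[OF F1] by(intro sum.neutral) (auto simp: F_def)
  finally show ?thesis .
 qed
 have V1: "a:tw 1 P" if "a:V" "P:CX" for a P using coord_tw[OF that(2)] V_coord[OF that(1)] by blast
 have dV: "diag CX a:Lam CX (tw 1)" if "a:V" for a unfolding cx.Lam_iff[OF F1] diag_def using V1[OF that closed_in] by auto
 define I where "I = {x + y |x y. x:Lam CX F & y:diag CX ` V}"
 have Is: "ka.subspace I" unfolding I_def by(rule ka.subspace_sums[OF cx.Lam_subspace[OF FF] cx.diag_subspace[OF Vs]])
 have Lvs: "ka.subspace (Lam CX (tw 1))" by(rule cx.Lam_subspace[OF F1])
 have I1: "I <= Lam CX (tw 1)" unfolding I_def using p.Lam_mono dV ka.subspace_add[OF Lvs] by blast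
 have pm_add: "pm (x + x') y = pm x y + pm x' y" "pm x (y + y') = pm x y + pm x y'" for x x' y y'
  by(auto simp: pm_def fun_eq_iff algebra_simps)
 have half: "qdK V (H0 CX F) <= qdA (Lam CX (tw 1)) I"
 proof(rule qd_le_pairing[OF vspK vspA Vs Lvs Is I1, where b="%s u. \<Psi> (pm (diag CX s) u)"])
  have e: "pm (diag CX (s + t)) u = pm (diag CX s) u + pm (diag CX t) u" "pm (diag CX (em c*s)) u = (%P. em c*pm (diag CX s) u P)"
   "pm (diag CX s) (%P. em c*u P) = (%P. em c*pm (diag CX s) u P)" for s t u c
   by(auto simp: pm_def diag_def fun_eq_iff algebra_simps)
  show "kv.lin_on V (%s. \<Psi> (pm (diag CX s) u))" for u unfolding kv.lin_on_def e add scl by simp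
  show "ka.lin_on (Lam CX (tw 1)) (%u. \<Psi> (pm (diag CX s) u))" for s unfolding ka.lin_on_def e pm_add add scl by simp
  fix s assume s: "s:V"
  show "\<Psi> (pm (diag CX s) w) = 0" if wI: "w:I" for w
  proof -
   obtain l a where la: "w = l + diag CX a" "l:Lam CX F" "a:V" using wI unfolding I_def by blast
   have "pm (diag CX s) (diag CX a) = diag CX (s*a)" by(simp add: pm_def diag_def fun_eq_iff)
   moreover have "pm (diag CX s) l = pm l (diag CX s)" by(simp add: pm_def mult.commute)
   ultimately show ?thesis unfolding la(1) pm_add add using F_pm[OF la(2) dV[OF s]] \<Psi>d[OF VV[OF s la(3)]] by simp
  qed
  show "s:H0 CX F" if z: "!!u. u:Lam CX (tw 1) ==> \<Psi> (pm (diag CX s) u) = 0"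
  proof -
   have "s:F R" if R: "R:cpts CX" for R
   proof -
    have "\<Psi> (sgl R (s*y)) = 0" if y: "y:tw 1 R" for y
    proof -
     have "sgl R y:Lam CX (tw 1)" unfolding cx.Lam_iff[OF F1] sgl_def using y R submod_0[OF tw_submod[OF closed_in]] by auto
     moreover have "pm (diag CX s) (sgl R y) = sgl R (s*y)" using R by(auto simp: pm_def diag_def sgl_def fun_eq_iff)
     ultimately show ?thesis using z by metis
    qed
    thus ?thesis unfolding F_def using R V1[OF s closed_in[OF R]] by simp
   qed
   thus ?thesis unfolding cx.H0_eq[OF FF] using V1[OF s K'_in] by blast
  qed
 qed
 have diags: "(SUM b:B. (%P. em (c b)*diag CX b P)) = diag CX (SUM b:B. em (c b)*b)" for B c
  by(auto simp: fun_eq_iff sum_fun_apply diag_def)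
 have "qdK V (H0 CX F) <= qdA I (Lam CX F)"
 proof(rule qd_le_relation[OF vspK vspA, where f="diag CX"])
  show "diag CX x:I" if "x:V" for x
  proof -
   have "0 + diag CX x:I" unfolding I_def using that ka.subspace_0[OF cx.Lam_subspace[OF FF]] unfolding zero_fun_def[symmetric] by blast
   thus ?thesis by simp
  qed
  show "0:Lam CX F" using ka.subspace_0[OF cx.Lam_subspace[OF FF]] unfolding zero_fun_def[symmetric] .
  fix B c assume B: "finite B" "B <= V" "(SUM b:B. (%P. em (c b)*diag CX b P)):Lam CX F"
  have "(SUM b:B. em (c b)*b):V" using B by(intro ksub_sum[OF Vs] ksub_scale[OF Vs]) auto
  thus "(SUM b:B. em (c b)*b):H0 CX F"
   using B(3) V1[OF _ K'_in] unfolding diags cx.H0_eq[OF FF] cx.Lam_iff[OF FF] by(auto simp: diag_def)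
 qed
 moreover have "qdA (Lam CX (tw 1)) (Lam CX F) = qdA (Lam CX (tw 1)) I + qdA I (Lam CX F)"
  by(rule ka.qd_add[OF cx.Lam_subspace[OF FF] Is Lvs _ I1]) (use ksub_0[OF Vs] in "force simp: I_def diag_def zero_fun_def[symmetric]")
 ultimately have iso: "qdK V (H0 CX F) + qdK V (H0 CX F) <= qdA (Lam CX (tw 1)) (Lam CX F)" using half add_mono by simp
 have HFV: "H0 CX F <= V" using p.H0_mono HV by simp
 have gs: "qdK V {0} = qdK V (H0 CX F) + h0 em CX F" unfolding h0_def
  by(rule kv.qd_add) (use HFV Vs cx.H0_subspace[OF FF] ksub_0[OF cx.H0_subspace[OF FF]] in auto)
 have eul: "h0 em CX F + qdA (Lam CX (tw 1)) (Lam CX F) = qdK V {0} + h1 em CX F"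
  using p.euler h HV by(simp add: h0_def)
 note cl = clifford_scaled[OF v FF FR(1,2) Fout(1)]
 obtain g where g: "qdK V {0} = enat g" using Vf by auto
 obtain a where a: "h0 em CX F = enat a" using gs g by(cases "h0 em CX F") auto
 obtain b where b: "qdK V (H0 CX F) = enat b" using gs g by(cases "qdK V (H0 CX F)") auto
 have gab: "g = b + a" using gs g a b by simp
 show False
 proof(cases "h1 em CX F = 0")
  case False
  hence "enat a + h1 em CX F <= enat (g' + 1)" using cl a by simp
  moreover then obtain e where e: "h1 em CX F = enat e" by(cases "h1 em CX F") auto
  moreover obtain dl where "qdA (Lam CX (tw 1)) (Lam CX F) = enat dl" using eul a g e by(cases "qdA (Lam CX (tw 1)) (Lam CX F)") auto
  ultimately show False using iso eul big g a b gab by simp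
 next
  case True
  then obtain dl where dl: "qdA (Lam CX (tw 1)) (Lam CX F) = enat dl" using eul a g by(cases "qdA (Lam CX (tw 1)) (Lam CX F)") auto
  hence "dl = 0" using iso eul a b g gab True by simp
  hence LL: "Lam CX (tw 1) <= Lam CX F" using dl ka.qd_eq_0[OF cx.Lam_subspace[OF FF]] by(simp add: zero_enat_def)
  have "\<Psi> (sgl R (m0)) = 0" if R: "R:Z v" for R
  proof -
   have RC: "R:cpts CX" using R ZC by blast
   obtain u where u: "u:V" "u ~= 0" "!!n. tw n R = (u^n) ** R" by(rule point_gen[OF RC]) blast
   obtain r where r: "r:R" "m0 = u^2*r" using m0P[OF RC] unfolding u(3) by blast
   have "diag CX u:Lam CX F" using LL dV[OF u(1)] by blast
   hence "u:F R" using RC unfolding cx.Lam_iff[OF FF] by(auto simp: diag_def)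
   moreover have "u*r:tw 1 R" unfolding u(3) using r(1) by auto
   moreover have "m0 = u*(u*r)" using r by(simp add: power2_eq_square)
   ultimately show ?thesis unfolding F_def using RC by simp
  qed
  moreover have "diag CX m0:Lam CX (tw 2)" unfolding cx.Lam_iff[OF F2] using m0P by(simp add: diag_def)
  ultimately have "\<Psi> (diag CX m0) = 0" using comp ZC by(simp add: diag_def subset_iff)
  thus False using \<Psi>(3) by simp
 qed
qed

lemma h1_tw_0_later: "h1 em CX (tw 1) = 0 ==> 1 <= n ==> h1 em CX (tw n) = 0"
proof(induction n)
 case (Suc n)
 thus ?case using h1_tw_mono[of n] by(cases "n = 0") auto
qed simp

lemma normal_generation:
 assumes HV: "H0 CX (tw 1) = V" and h: "h1 em CX (tw 1) = 0" and big: "qdK V {0} >= enat (g' + 2)" and n: "1 <= n"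
 shows "H0 CX (tw n) = Vn n"
proof(rule antisym[OF _ coord_H0])
 have "H0 CX (tw (Suc n)) <= Vn (Suc n)" for n
 proof(induction n)
  case 0 thus ?case using HV coord_1[OF Vs] by simp
 next
  case (Suc n)
  show ?case
  proof(cases n)
   case 0 thus ?thesis using quadratic_normality[OF HV h big] by(simp add: numeral_2_eq_2)
  next
   case (Suc m)
   have "H0 CX (tw (2 + n)) <= prods (H0 CX (tw (1 + n))) V"
    by(rule sections_generated_step[OF h1_tw_0_later[OF h]]) (simp add: Suc)
   also have "... <= prods (Vn (Suc n)) V"
    by(rule prods_least[OF prods_subspace]) (use `H0 CX (tw (Suc n)) <= Vn (Suc n)` prods_base in auto)
   finally show ?thesis unfolding coord_Suc[of V "Suc n"] by simp
  qed
 qed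
 from this[of "n - 1"] n show "H0 CX (tw n) <= Vn n" by simp
qed

end

section \<open>Lattices on a curve\<close>

context ccurve begin

sublocale cc: ptset em C
 by unfold_locales (use closed_points_iff generic_point UNIV_in_C in auto)

lemma closed_pt: "P:cpts C ==> P:C & P ~= UNIV" using closed_points_iff by blast
lemma closed_ring: "P:cpts C ==> is_subring P" and closed_range: "P:cpts C ==> range em <= P"
 using closed_pt P_facts by blast+
lemma closed_ne: "cpts C ~= {}" using C_nontriv closed_points_iff by blast

text \<open>Coherent torsion-free sheaves of rank one, embedded in K; \<open>coherent_lat\<close> and
  \<open>lat_coherent\<close> give the equivalence with coherence.\<close>
definition lat :: "('K set => 'K set) => bool" where
 "lat F \<longleftrightarrow> F UNIV = UNIV & (ALL P:cpts C. EX S. finite S & (EX s:S. s ~= 0) & F P = lspan P S) &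
   finite {P:cpts C. F P ~= P}"

lemma lat_gen:
 assumes "lat F" "P:cpts C"
 obtains S s where "finite S" "s:S" "s ~= 0" "F P = lspan P S"
 using assms unfolding lat_def by blast

lemma lat_submod: assumes F: "lat F" and P: "P:cpts C" shows "submod P (F P)"
proof -
 obtain S where S: "F P = lspan P S" by(rule lat_gen[OF F P]) blast
 show ?thesis unfolding S by(rule submod_lin_span[OF closed_ring[OF P]])
qed

lemma lin_span_1: assumes R: "is_subring R" shows "lspan R {1} = R"
proof
 show "lspan R {1} <= R" by(rule lin_span_submod[OF submod_self[OF R]]) (simp add: subring_1[OF R])
 show "R <= lspan R {1}" using lin_span_scale[OF R lin_span_base[OF R, of 1 "{1}"]] by fastforce
qed

lemma lat_O: "lat (%P. P)" unfolding lat_def using lin_span_1[OF closed_ring]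
 by(auto intro!: exI[of _ "{1}"])

lemma lat_fam: assumes F: "lat F" shows "cc.fam UNIV F"
 unfolding cc.fam_def
proof(intro conjI ballI)
 show "F (generic_point C) = UNIV" using F by(simp add: lat_def generic_point)
 fix m :: 'K
 have "{P:cpts C. m ~: F P} <= {P:cpts C. F P ~= P} Un {P:cpts C. m ~: P}" by blast
 thus "finite {P:cpts C. m ~: F P}" using F almost_all_points[of m] finite_subset unfolding lat_def by blast
qed (use submod_subspace[OF lat_submod[OF F] closed_range] in auto)

lemma lat_bounds:
 assumes F: "lat F" and P: "P:cpts C"
 obtains z y where "z ~= 0" "y ~= 0" "z ** P <= F P" "F P <= y ** P"
proof -
 obtain S s where S: "finite S" "s:S" "s ~= 0" "F P = lspan P S" by(rule lat_gen[OF F P])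
 note R = closed_ring[OF P]
 obtain d where d: "d:P" "d ~= 0" "ALL b:S. d*b:P" using frac_field_common_denominator[OF R _ S(1)] P_facts(3) closed_pt[OF P] by blast
 have "S <= inverse d ** P"
 proof
  fix b assume "b:S"
  thus "b:inverse d ** P" using d by(intro image_eqI[of _ _ "d*b"]) auto
 qed
 hence "F P <= inverse d ** P" unfolding S(4) by(intro lin_span_submod submod_image submod_self R)
 moreover have "s ** P <= F P" unfolding S(4)
  using lin_span_scale[OF R lin_span_base[OF R S(2)]] by(auto simp: mult.commute)
 ultimately show thesis using that[of s "inverse d"] S(3) d(2) by simp
qed

lemma sandwich_finite:
 assumes P: "P:cpts C" and z: "z ~= 0" and zN: "z ** P <= N" and Ny: "N <= y ** P"
 shows "qdK N (z ** P) < \<infinity>"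
proof -
 note R = closed_ring[OF P]
 have s: "ksub P" using subring_subspace[OF R closed_range[OF P]] .
 have "z:z ** P" using subring_1[OF R] by(intro image_eqI[of _ _ 1]) auto
 then obtain p where p: "z = y*p" "p:P" using zN Ny by blast
 have nz: "y ~= 0" "p ~= 0" using p z by auto
 have "qdK N (z ** P) <= qdK (y ** P) (y ** p ** P)"
  unfolding image_mult_assoc p(1)[symmetric] by(rule kv.qd_mono[OF Ny order_refl])
 also have "... = qdK P (p ** P)" by(rule qd_mult[OF nz(1) ksub_image[OF s]])
 also have "... < \<infinity>" using point_colength closed_pt[OF P] p nz by blast
 finally show ?thesis .
qed

lemma lat_intro:
 assumes U: "F UNIV = UNIV" and ae: "finite {P:cpts C. F P ~= P}"
  and N: "!!P. P:cpts C ==> submod P (F P)"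
  and b: "!!P. P:cpts C ==> EX z y. z ~= 0 & z ** P <= F P & F P <= y ** P"
 shows "lat F"
proof -
 have "EX S. finite S & (EX s:S. s ~= 0) & F P = lspan P S" if P: "P:cpts C" for P
 proof -
  note R = closed_ring[OF P] and N = N[OF P]
  obtain z y where z: "z ~= 0" and zN: "z ** P <= F P" and Ny: "F P <= y ** P" using b[OF P] by blast
  let ?Z = "z ** P"
  have s: "ksub P" "ksub (F P)" using subring_subspace[OF R] submod_subspace[OF N] closed_range[OF P] by auto
  obtain n where n: "qdK (F P) ?Z = enat n" using sandwich_finite[OF P z zN Ny] by auto
  obtain B where B: "finite B" "B <= F P" "!!x. x:F P ==> EX a. x - (SUM b:B. em (a b)*b):?Z"
   by(rule kv.qd_fin_spanning[OF ksub_image[OF s(1)] s(2) zN n]) blast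
  have "F P = lspan P (insert z B)"
  proof
   have "z*1:F P" using subring_1[OF R] zN by blast
   thus "lspan P (insert z B) <= F P" using lin_span_submod[OF N] B(2) by simp
   show "F P <= lspan P (insert z B)"
   proof
    fix x assume "x:F P"
    then obtain a where a: "x - (SUM b:B. em (a b)*b):?Z" using B(3) by blast
    note b = lin_span_base[OF R]
    have 1: "x - (SUM b:B. em (a b)*b):lspan P (insert z B)"
     using a lin_span_scale[OF R b, of z "insert z B"] by(auto simp: mult.commute)
    have 2: "(SUM b:B. em (a b)*b):lspan P (insert z B)"
     by(rule lin_span_sum[OF R]) (use closed_range[OF P] lin_span_scale[OF R b] in blast)
    show "x:lspan P (insert z B)" using lin_span_add[OF R 1 2] by simp
   qed
  qed
  thus ?thesis using B(1) z by(intro exI[of _ "insert z B"]) simp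
 qed
 thus ?thesis using U ae unfolding lat_def by simp
qed

lemma lat_modify:
 assumes F: "lat F" and P: "P:cpts C" and N: "submod P N"
  and z: "z ~= 0" and zN: "z ** P <= N" and Ny: "N <= y ** P"
 shows "lat (F(P := N))"
proof(rule lat_intro)
 show "(F(P := N)) UNIV = UNIV" using F closed_pt[OF P] by(auto simp: lat_def)
 have "{Q:cpts C. (F(P := N)) Q ~= Q} <= insert P {Q:cpts C. F Q ~= Q}" by auto
 thus "finite {Q:cpts C. (F(P := N)) Q ~= Q}" using F finite_subset unfolding lat_def by blast
 fix Q assume Q: "Q:cpts C"
 show "submod Q ((F(P := N)) Q)" using lat_submod[OF F Q] N by simp
 show "EX z y. z ~= 0 & z ** Q <= (F(P := N)) Q & (F(P := N)) Q <= y ** Q"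
 proof(cases "Q = P")
  case True thus ?thesis using z zN Ny by auto
 next
  case False
  obtain z y where "z ~= 0" "z ** Q <= F Q" "F Q <= y ** Q" by(rule lat_bounds[OF F Q])
  moreover have "(F(P := N)) Q = F Q" using False by simp
  ultimately show ?thesis by(simp only:) blast
 qed
qed

lemma lat_ae:
 assumes F: "lat F" and G: "lat G" shows "finite {P:cpts C. F P ~= G P}"
proof -
 have "{P:cpts C. F P ~= G P} <= {P:cpts C. F P ~= P} Un {P:cpts C. G P ~= P}" by blast
 thus ?thesis using F G finite_subset unfolding lat_def by blast
qed

lemma lat_pair:
 assumes "lat F" "lat G" "!!P. P:cpts C ==> F P <= G P" shows "fam_pair em C UNIV F G"
 by unfold_locales (use assms lat_fam lat_ae closed_ne in auto)

abbreviation AC :: "('K set => 'K) set" where "AC == adeles C (%P. P)"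

lemma lat_adeles: "lat F ==> adeles C F = AC"
 using cc.adeles_eq lat_fam lat_O lat_ae by blast

lemma lat_Lam_sum:
 assumes F: "lat F" and G: "lat G" and FG: "!!P. P:cpts C ==> F P <= G P"
 shows "qdA (Lam C G) (Lam C F) = (\<Sum>P | P:cpts C & F P ~= G P. qdK (G P) (F P))"
 by(rule cc.Lam_sum[OF lat_fam[OF F] lat_fam[OF G] FG lat_ae[OF F G]]) auto

lemma lat_colength:
 assumes F: "lat F" and G: "lat G" and FG: "!!P. P:cpts C ==> F P <= G P"
 shows "qdA (Lam C G) (Lam C F) < \<infinity>"
proof -
 have "qdK (G P) (F P) < \<infinity>" if P: "P:cpts C" for P
 proof -
  obtain z where zy: "z ~= 0" "z ** P <= F P" by(rule lat_bounds[OF F P]) blast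
  obtain y where y: "G P <= y ** P" by(rule lat_bounds[OF G P]) blast
  have "qdK (G P) (F P) <= qdK (G P) (z ** P)" by(rule kv.qd_mono) (use zy in auto)
  also have "... < \<infinity>" by(rule sandwich_finite[OF P zy(1) _ y]) (use zy(2) FG[OF P] in blast)
  finally show ?thesis .
 qed
 hence nf: "qdK (G P) (F P) ~= \<infinity>" if "P:cpts C" for P using that by auto
 have "(SUM P:T. qdK (G P) (F P)) ~= \<infinity>" if T: "finite T" "T <= cpts C" for T
  using T by(induction T rule: finite_induct) (auto simp: plus_eq_infty_iff_enat nf simp del: not_infinity_eq)
 from this[OF lat_ae[OF F G]] have "(\<Sum>P | P:cpts C & F P ~= G P. qdK (G P) (F P)) < \<infinity>" by auto
 also have "(\<Sum>P | P:cpts C & F P ~= G P. qdK (G P) (F P)) = qdA (Lam C G) (Lam C F)"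
  by(rule lat_Lam_sum[OF F G FG, symmetric])
 finally show ?thesis .
qed

lemma H0_O: "H0 C (%P. P) = range em"
proof
 show "H0 C (%P. P) <= range em"
 proof
  fix c assume c: "c:H0 C (%P. P)"
  show "c:range em"
  proof(rule const_if_in_all_VR)
   fix W assume "VR W"
   then obtain P where "P:C" "dominates W P" using center_ex1 by blast
   thus "c:W" using c unfolding H0_def dominates_def by blast
  qed
 qed
 show "range em <= H0 C (%P. P)" using P_facts(2) unfolding H0_def by blast
qed

lemma qd_range_k: "qdK (range em) {0} = 1"
 by(rule kv.qd_line[of _ _ 1]) (use subring_subspace[OF range_subring] in "auto simp: subring_1[OF range_subring]")

lemma h0_O: "h0 em C (%P. P) = 1" unfolding h0_def H0_O by(rule qd_range_k)

lemma h0_finite: assumes F: "lat F" shows "h0 em C F < \<infinity>"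
proof -
 define G where "G = (%P. if P:cpts C then F P Int P else UNIV)"
 have G: "lat G"
 proof(rule lat_intro)
  show "G UNIV = UNIV" unfolding G_def using closed_pt by auto
  have "{P:cpts C. G P ~= P} <= {P:cpts C. F P ~= P}" by(auto simp: G_def)
  thus "finite {P:cpts C. G P ~= P}" using F finite_subset unfolding lat_def by blast
  fix P assume P: "P:cpts C"
  note R = closed_ring[OF P]
  obtain z where zy: "z ~= 0" "z ** P <= F P" by(rule lat_bounds[OF F P]) blast
  obtain b where b: "b:P" "b ~= 0" "z*b:P"
   using frac_field_common_denominator[OF R, of "{z}"] P_facts(3) closed_pt[OF P] by(auto simp: mult.commute)
  show "submod P (G P)" unfolding G_def submod_def using P lat_submod[OF F P] submod_self[OF R] unfolding submod_def by simp
  have "z*b*x = z*(b*x)" for x by(simp add: mult.assoc)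
  hence zb: "(z*b) ** P <= G P" unfolding G_def using P zy b subring_mult[OF R] by(auto simp: mult.assoc[symmetric])
  thus "EX z y. z ~= 0 & z ** P <= G P & G P <= y ** P"
   using zy b P by(intro exI[of _ "z*b"] exI[of _ "1::'K"]) (auto simp: G_def)
 qed
 have GF: "G P <= F P" "G P <= P" if "P:cpts C" for P using that by(auto simp: G_def)
 interpret p: fam_pair em C UNIV G F by(rule lat_pair[OF G F GF(1)])
 interpret q: fam_pair em C UNIV G "%P. P" by(rule lat_pair[OF G lat_O GF(2)])
 have "h0 em C G <= h0 em C (%P. P)" unfolding h0_def by(rule kv.qd_mono) (use q.H0_mono in auto)
 hence "h0 em C G + qdA (Lam C F) (Lam C G) ~= \<infinity>" using h0_O lat_colength[OF G F GF(1)] by(cases "h0 em C G") auto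
 thus ?thesis using p.h0_le by(cases "h0 em C F") auto
qed

text \<open>A nonzero s is a unit at almost all points.\<close>
lemma lat_bad_points:
 assumes F: "lat F" and S: "finite S" "s:S" "s ~= 0"
 shows "finite {Q:cpts C. F Q ~= lspan Q S}"
proof -
 have "{Q:cpts C. F Q ~= lspan Q S} <= {Q:cpts C. F Q ~= Q} Un {Q:cpts C. inverse s ~: Q} Un (UN x:S. {Q:cpts C. x ~: Q})"
 proof clarify
  fix Q assume Q: "Q:cpts C" "F Q ~= lspan Q S" "Q ~: (UN x:S. {Q:cpts C. x ~: Q})" "inverse s:Q" "F Q = Q"
  note R = closed_ring[OF Q(1)]
  have SQ: "S <= Q" using Q by blast
  have 1: "lspan Q S <= Q" by(rule lin_span_submod[OF submod_self[OF R] SQ])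
  have "Q <= lspan Q S"
  proof
   fix x assume x: "x:Q"
   have "x*inverse s*s:lspan Q S"
    by(rule lin_span_scale[OF R lin_span_base[OF R S(2)] subring_mult[OF R x Q(4)]])
   thus "x:lspan Q S" using S(3) by(simp add: mult.assoc)
  qed
  thus False using 1 Q by blast
 qed
 thus ?thesis by(rule finite_subset) (use F S(1) almost_all_points in "auto simp: lat_def")
qed

lemma avoid_points:
 assumes P: "P:C" and B: "finite Bd" "!!Q. Q:Bd ==> Q:cpts C & Q ~= P"
 shows "EX T. finite T & T <= P & (ALL Q:Bd. ~ T <= Q)"
proof -
 have "EX t. t:P & t ~: Q" if Q: "Q:Bd" for Q
 proof -
  have Qc: "Q:C" "Q ~= UNIV" "Q ~= P" using B(2)[OF Q] closed_pt by auto
  thus ?thesis using C_sub[OF Qc(1) P] by blast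
 qed
 then obtain t where t: "!!Q. Q:Bd ==> t Q:P & t Q ~: Q" by metis
 thus ?thesis using B(1) by(intro exI[of _ "t ` Bd"]) blast
qed

lemma lat_coherent:
 assumes F: "lat F" and P: "P:C"
 shows "EX T S. finite T & T <= P & finite S & (ALL Q:C. T <= Q --> F Q = lspan Q S)"
proof -
 have "EX S s. finite S & s:S & s ~= 0 & (P:cpts C --> F P = lspan P S)"
 proof(cases "P:cpts C")
  case True thus ?thesis using lat_gen[OF F True] by metis
 next
  case False thus ?thesis by(intro exI[of _ "{1}"] exI[of _ 1]) auto
 qed
 then obtain S s where S: "finite S" "s:S" "s ~= 0" "P:cpts C ==> F P = lspan P S" by metis
 define Bd where "Bd = {Q:cpts C. F Q ~= lspan Q S}"
 have "finite Bd" unfolding Bd_def by(rule lat_bad_points[OF F S(1-3)])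
 hence "EX T. finite T & T <= P & (ALL Q:Bd. ~ T <= Q)"
  by(rule avoid_points[OF P]) (use S(4) in "auto simp: Bd_def")
 then obtain T where T: "finite T" "T <= P" "!!Q. Q:Bd ==> ~ T <= Q" by blast
 have gn: "F Q = lspan Q S" if Q: "Q:C" "T <= Q" for Q
 proof(cases "Q = UNIV")
  case True
  have "x/s*s:lspan UNIV S" for x
   by(rule lin_span_scale[OF subring_UNIV lin_span_base[OF subring_UNIV S(2)] UNIV_I])
  hence "x:lspan UNIV S" for x using S(3) by simp
  thus ?thesis using F True unfolding lat_def by auto
 next
  case False
  thus ?thesis using Q T closed_points_iff unfolding Bd_def by blast
 qed
 show ?thesis
 proof(rule exI[of _ T], rule exI[of _ S], intro conjI ballI impI)
  show "F Q = lspan Q S" if "Q:C" "T <= Q" for Q by(rule gn[OF that])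
 qed (rule T(1), rule T(2), rule S(1))
qed

lemma coherent_lat:
 assumes co: "coherent (*) C F" and g: "F UNIV = UNIV" shows "lat F"
proof -
 have lc: "EX T S. finite T & T <= P & finite S & (ALL Q:C. T <= Q --> F Q = lspan Q S) & (EX s:S. s ~= 0)" if P: "P:C" for P
 proof -
  obtain T S where TS: "finite T" "T <= P" "finite S" "ALL Q:C. T <= Q --> F Q = lspan Q S"
   using bspec[OF co[unfolded coherent_def] P] by(elim exE conjE) (rule that)
  have "EX s:S. s ~= 0"
  proof(rule ccontr)
   assume "~ ?thesis"
   hence "lspan UNIV S <= {0}" by(rule_tac lin_span_least) auto
   moreover have "lspan UNIV S = UNIV" using bspec[OF TS(4) UNIV_in_C] g by simp
   ultimately have "(1 :: 'K):{0}" by(metis UNIV_I subsetD)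
   thus False by simp
  qed
  with TS show ?thesis by(intro exI conjI)
 qed
 obtain T S where TS: "finite T" "finite S" "ALL Q:C. T <= Q --> F Q = lspan Q S" "EX s:S. s ~= 0"
  using lc[OF UNIV_in_C] by(elim exE conjE) (rule that)
 then obtain s where s: "s:S" "s ~= 0" by blast
 have "{P:cpts C. F P ~= P} <= {Q:cpts C. Q ~= lspan Q S} Un (UN x:T. {Q:cpts C. x ~: Q})"
  using TS(3) closed_pt by blast
 hence "finite {P:cpts C. F P ~= P}"
  by(rule finite_subset) (use TS(1) almost_all_points lat_bad_points[OF lat_O TS(2) s] in auto)
 moreover have "EX S. finite S & (EX s:S. s ~= 0) & F P = lspan P S" if P: "P:cpts C" for P
 proof -
  obtain T S where "T <= P" "finite S" "ALL Q:C. T <= Q --> F Q = lspan Q S" "EX s:S. s ~= 0"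
   using lc[OF conjunct1[OF closed_pt[OF P]]] by(elim exE conjE) (rule that)
  thus ?thesis using closed_pt[OF P] by(intro exI[of _ S]) simp
 qed
 ultimately show ?thesis unfolding lat_def using g by simp
qed

end

section \<open>Duality for lattices\<close>

text \<open>Duality is stated for families in K^n; this is the case n = 1.\<close>
definition vemb :: "'K::field => nat => 'K" where "vemb x = (%i. if i = 0 then x else 0)"

lemma vemb_0 [simp]: "vemb x 0 = x" by(simp add: vemb_def)
lemma vemb_zero [simp]: "vemb 0 = 0" by(simp add: vemb_def fun_eq_iff)
lemma vemb_inj: "inj vemb" by(rule inj_on_inverseI[of _ "%f. f 0"]) simp
lemma vemb_sum: "vemb (SUM i:I. f i) = (SUM i:I. vemb (f i))"
 by(rule ext) (simp add: vemb_def sum_fun_apply)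
lemma vemb_mult: "vemb (c*x) = vec_scale c (vemb x)" by(auto simp: vemb_def vec_scale_def fun_eq_iff)
lemma vemb_range: "vec_space (Suc 0) = range vemb"
proof
 show "vec_space (Suc 0) <= range vemb"
 proof
  fix f assume "f:vec_space (Suc 0)"
  hence "f = vemb (f 0)" by(auto simp: vec_space_def vemb_def fun_eq_iff Suc_le_eq)
  thus "f:range vemb" by blast
 qed
qed (auto simp: vec_space_def vemb_def)
lemma vemb_mem: "r:vemb ` A \<longleftrightarrow> r = vemb (r 0) & r 0:A" by force
lemma lin_form_1: "lin_form (Suc 0) c x = c 0*x 0" by(simp add: lin_form_def)

lemma vemb_lin_span: "vemb ` lspan R S = lin_span vec_scale R (vemb ` S)"
proof
 have i: "inj_on vemb T" for T :: "'a set" using vemb_inj inj_on_subset by blast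
 show "vemb ` lspan R S <= lin_span vec_scale R (vemb ` S)"
 proof
  fix f assume "f:vemb ` lspan R S"
  then obtain T a where T: "f = vemb (SUM x:T. a x*x)" "finite T" "T <= S" "ALL x:T. a x:R" unfolding lin_span_def by blast
  have "f = (SUM y:vemb ` T. vec_scale (a (y 0)) y)" unfolding T(1) vemb_sum vemb_mult by(simp add: sum.reindex[OF i])
  thus "f:lin_span vec_scale R (vemb ` S)" unfolding lin_span_def using T
   by(intro CollectI exI[of _ "vemb ` T"] exI[of _ "%y. a (y 0)"]) auto
 qed
 show "lin_span vec_scale R (vemb ` S) <= vemb ` lspan R S"
 proof
  fix f assume "f:lin_span vec_scale R (vemb ` S)"
  then obtain T' a where T': "f = (SUM x:T'. vec_scale (a x) x)" "finite T'" "T' <= vemb ` S" "ALL x:T'. a x:R" unfolding lin_span_def by blast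
  obtain T where T: "T <= S" "T' = vemb ` T" using T'(3) by(auto simp: subset_image_iff)
  have "finite T" using T'(2) finite_imageD[OF _ i] T(2) by blast
  moreover have "f = vemb (SUM x:T. a (vemb x)*x)" unfolding T'(1) T(2) vemb_sum vemb_mult by(simp add: sum.reindex[OF i])
  ultimately show "f:vemb ` lspan R S" unfolding lin_span_def using T T'(4)
   by(intro image_eqI[of _ _ "SUM x:T. a (vemb x)*x"] CollectI exI[of _ T] exI[of _ "%x. a (vemb x)"]) auto
 qed
qed

locale dcurve = ccurve em C for em :: "'k::alg_closed_field => 'K::field" and C :: "'K set set" +
 fixes \<omega> :: "'K set => 'K set"
 assumes dual: "dualizing_sheaf em C \<omega>" and big: "2 <= arithmetic_genus em C"
begin

lemma lat_omega: "lat \<omega>" using dual coherent_lat generic_point unfolding dualizing_sheaf_def by metis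

definition tr :: "('K set => 'K) => 'k" where
 "tr = (SOME t. H1_functional (%c x. em c*x) C \<omega> t &
    (ALL n F \<phi>. coherent vec_scale C F & F (generic_point C) = vec_space n &
      H1_functional (%c. vec_scale (em c)) C F \<phi> -->
      (EX! c. c:sheaf_Hom C n F \<omega> & (ALL r:adeles C F. \<phi> r = t (%P. lin_form n c (r P))))))"

lemma tr: "H1_functional (%c x. em c*x) C \<omega> tr"
 "coherent vec_scale C F ==> F (generic_point C) = vec_space n ==> H1_functional (%c. vec_scale (em c)) C F \<phi> ==>
      (EX! c. c:sheaf_Hom C n F \<omega> & (ALL r:adeles C F. \<phi> r = tr (%P. lin_form n c (r P))))"
 using someI_ex[OF dual[unfolded dualizing_sheaf_def, THEN conjunct2, THEN conjunct2], folded tr_def] by blast+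

lemma tr_add: "r:AC ==> r':AC ==> tr (%P. r P + r' P) = tr r + tr r'" and tr_scl: "r:AC ==> tr (%P. em c*r P) = c*tr r"
 and tr_cob: "r:cob C \<omega> ==> tr r = 0"
 using tr(1) unfolding H1_functional_def lat_adeles[OF lat_omega] by blast+

text \<open>Hom(F, \<omega>).\<close>
definition Hm :: "('K set => 'K set) => 'K set" where
 "Hm F = {c. ALL P:cpts C. ALL x:F P. c*x:\<omega> P}"

lemma duality:
 assumes F: "lat F" and f: "ka.lin_on AC f" "!!r. r:cob C F ==> f r = 0"
 shows "EX! c. c:Hm F & (ALL r:AC. f r = tr (cc.ascale c r))"
proof -
 define G where "G = (%P. vemb ` F P)"
 define \<phi> where "\<phi> = (%r :: 'K set => nat => 'K. f (%P. r P 0))"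
 note AF = lat_adeles[OF F]
 have fa: "f (%P. r P + r' P) = f r + f r'" and fs: "f (%P. em c*r P) = c*f r" if "r:AC" "r':AC" for r r' c
  using f(1) that unfolding ka.lin_on_def plus_fun_def by blast+
 have FU: "F UNIV = UNIV" using F by(simp add: lat_def)
 have coh: "coherent vec_scale C G" unfolding coherent_def
 proof
  fix P assume "P:C"
  from lat_coherent[OF F this] obtain T S where TS: "finite T" "T <= P" "finite S" "ALL Q:C. T <= Q --> F Q = lspan Q S"
   by(elim exE conjE) (rule that)
  show "EX T S. finite T & T <= P & finite S & (ALL Q:C. T <= Q --> G Q = lin_span vec_scale Q S)"
   by(rule exI[of _ T], rule exI[of _ "vemb ` S"]) (use TS in "simp add: G_def vemb_lin_span")
 qed
 have gen: "G (generic_point C) = vec_space (Suc 0)" unfolding G_def generic_point FU vemb_range ..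
 have ad1: "(%P. r P 0):AC" if "r:adeles C G" for r
 proof -
  have "{P:cpts C. r P 0 ~: F P} <= {P:cpts C. r P ~: G P}" unfolding G_def vemb_mem by blast
  thus ?thesis using that finite_subset unfolding AF[symmetric] unfolding adeles_def generic_point FU by auto
 qed
 have ad2: "(%P. vemb (r P)):adeles C G" if "r:AC" for r
  using that unfolding AF[symmetric] unfolding adeles_def generic_point G_def FU by(auto simp: vemb_zero inj_image_mem_iff[OF vemb_inj])
 have "H1_functional (%c. vec_scale (em c)) C G \<phi>" unfolding H1_functional_def
 proof(intro conjI ballI allI)
  fix r r' c assume r: "r:adeles C G"
  show "\<phi> (%P. r P + r' P) = \<phi> r + \<phi> r'" if "r':adeles C G"
   using fa[OF ad1[OF r] ad1[OF that]] by(simp add: \<phi>_def)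
  show "\<phi> (%P. vec_scale (em c) (r P)) = c*\<phi> r"
   using fs[OF ad1[OF r] ad1[OF r]] by(simp add: \<phi>_def vec_scale_def)
 next
  fix r assume r: "r:cob C G"
  then obtain m where m: "m:G UNIV" "ALL P:cpts C. r P - m:G P" "r:adeles C G" unfolding coboundaries_def generic_point by blast
  have "r P 0 - m 0:F P" if "P:cpts C" for P using m(2) that unfolding G_def vemb_mem by force
  hence "(%P. r P 0):cob C F" unfolding coboundaries_def generic_point FU AF using ad1[OF m(3)] by blast
  thus "\<phi> r = 0" unfolding \<phi>_def by(rule f(2))
 qed
 note e = tr(2)[OF coh gen this]
 define Q where "Q = (%c. c:sheaf_Hom C (Suc 0) G \<omega> & (ALL r:adeles C G. \<phi> r = tr (%P. lin_form (Suc 0) c (r P))))"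
 have "EX! c. Q c" unfolding Q_def by(rule e)
 then obtain c where Qc: "Q c" "!!c'. Q c' ==> c' = c" by blast
 note c = Qc(1)[unfolded Q_def, THEN conjunct1] Qc(1)[unfolded Q_def, THEN conjunct2]
 have uniq: "c' = c" if "c':sheaf_Hom C (Suc 0) G \<omega>" "ALL r:adeles C G. \<phi> r = tr (%P. lin_form (Suc 0) c' (r P))" for c'
  by(rule Qc(2)) (unfold Q_def, rule conjI[OF that])
 show ?thesis
 proof(rule ex1I[of _ "c 0"], intro conjI ballI)
  show "c 0:Hm F" using c(1) closed_pt unfolding sheaf_Hom_def Hm_def G_def lin_form_1 by fastforce
  show "f r = tr (cc.ascale (c 0) r)" if "r:AC" for r using bspec[OF c(2) ad2[OF that]] by(simp add: \<phi>_def lin_form_1 cc.ascale_def)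
 next
  fix d assume d: "d:Hm F & (ALL r:AC. f r = tr (cc.ascale d r))"
  have "vemb d:sheaf_Hom C (Suc 0) G \<omega>" unfolding sheaf_Hom_def
  proof(intro CollectI conjI ballI)
   show "vemb d:vec_space (Suc 0)" unfolding vemb_range by blast
   fix P assume P: "P:C"
   have "\<omega> UNIV = UNIV" using lat_omega by(simp add: lat_def)
   thus "lin_form (Suc 0) (vemb d) ` G P <= \<omega> P" using d P closed_points_iff[of P] unfolding Hm_def G_def by(cases "P = UNIV") (auto simp: lin_form_1)
  qed
  moreover have "ALL r:adeles C G. \<phi> r = tr (%P. lin_form (Suc 0) (vemb d) (r P))"
   using d ad1 by(simp add: \<phi>_def lin_form_1 cc.ascale_def)
  ultimately have "vemb d = c" by(rule uniq)
  thus "d = c 0" by auto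
 qed
qed

lemma AC_scale: "r:AC ==> cc.ascale c r:AC"
proof -
 assume r: "r:AC"
 have "{P:cpts C. cc.ascale c r P ~: P} <= {P:cpts C. r P ~: P} Un {P:cpts C. c ~: P}"
  unfolding cc.ascale_def using subring_mult[OF closed_ring] by blast
 moreover have "finite ..." using r almost_all_points[of c] unfolding adeles_def by simp
 ultimately have "finite {P:cpts C. cc.ascale c r P ~: P}" by(rule finite_subset)
 thus ?thesis using r unfolding adeles_def generic_point by(simp add: cc.ascale_def)
qed

lemma Hm_subspace: "ksub (Hm F)"
proof -
 note s = submod_subspace[OF lat_submod[OF lat_omega] closed_range]
 show ?thesis unfolding Hm_def
  by(rule kv.subspaceI) (use ksub_0[OF s] ksub_add[OF s] ksub_scale[OF s] in "auto simp: distrib_right mult.assoc")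
qed

lemma Hm_pairing:
 assumes F: "lat F"
 shows "pairing (%c x. em c*x) (%c r P. em c*r P) (Hm F) AC (cob C F) (%c r. tr (cc.ascale c r))"
proof -
 have zero: "cc.ascale c r:cob C \<omega>" if c: "c:Hm F" and r: "r:cob C F" for c r
  by(rule cc.cob_scale_in[OF lat_fam[OF F] lat_fam[OF lat_omega] _ _ r]) (use c in "auto simp: Hm_def")
 have l2: "ka.lin_on AC (%r. tr (cc.ascale s r))" for s
  unfolding ka.lin_on_def cc.ascale_add2 cc.ascale_i2 using tr_add tr_scl AC_scale by simp
 show ?thesis
 proof(unfold_locales)
  show "ksub (Hm F)" by(rule Hm_subspace)
  show "ka.subspace AC" by(rule cc.adeles_subspace[OF lat_fam[OF lat_O]])
  show "ka.subspace (cob C F)" by(rule cc.cob_subspace[OF lat_fam[OF F]])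
  show "cob C F <= AC" using cc.cob_adeles lat_adeles[OF F] by blast
  show "kv.lin_on (Hm F) (%s. tr (cc.ascale s u))" if "u:AC" for u
   unfolding kv.lin_on_def cc.ascale_add cc.ascale_i using tr_add tr_scl AC_scale[OF that] by simp
  show "ka.lin_on AC (%r. tr (cc.ascale s r))" for s by(rule l2)
  show "tr (cc.ascale s w) = 0" if "s:Hm F" "w:cob C F" for s w by(rule tr_cob[OF zero[OF that]])
  show "s = 0" if s: "s:Hm F" "!!u. u:AC ==> tr (cc.ascale s u) = 0" for s
  proof -
   have e: "EX! c. c:Hm F & (ALL r:AC. tr (cc.ascale s r) = tr (cc.ascale c r))"
    by(rule duality[OF F l2]) (use tr_cob zero s(1) in blast)
   have "tr (%P. 0) = 0" using tr_cob ka.subspace_0[OF cc.cob_subspace[OF lat_fam[OF lat_omega]]] unfolding zero_fun_def by blast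
   hence "0:Hm F & (ALL r:AC. tr (cc.ascale s r) = tr (cc.ascale 0 r))" using ksub_0[OF Hm_subspace] s(2) by(simp add: cc.ascale_0)
   moreover have "s:Hm F & (ALL r:AC. tr (cc.ascale s r) = tr (cc.ascale s r))" using s by simp
   ultimately show ?thesis using ex1E[OF e] by metis
  qed
  show "EX s:Hm F. ALL u:AC. tr (cc.ascale s u) = f u" if f: "ka.lin_on AC f" "!!w. w:cob C F ==> f w = 0" for f
   using ex1_implies_ex[OF duality[OF F f]] by metis
 qed
qed

lemma h1_dual: assumes F: "lat F" shows "h1 em C F = qdK (Hm F) {0}"
 using pairing.dim_eq[OF Hm_pairing[OF F]] unfolding h1_def lat_adeles[OF F] .

end

section \<open>Generation of the dualizing sheaf\<close>

context ccurve begin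

lemma lat_scale:
 assumes F: "lat F" and y: "y ~= 0" shows "lat (%P. y ** F P)"
proof(rule lat_intro)
 have FU: "F UNIV = UNIV" using F by(simp add: lat_def)
 have "x:y ** UNIV" for x by(rule image_eqI[of _ _ "x/y"]) (use y in auto)
 thus "y ** F UNIV = UNIV" unfolding FU by blast
 have "{P:cpts C. y ** F P ~= P} <= {P:cpts C. F P ~= P} Un {P:cpts C. y ~: P} Un {P:cpts C. inverse y ~: P}"
 proof clarify
  fix P assume P: "P:cpts C" "y ** F P ~= P" "inverse y:P" "y:P" "F P = P"
  have "x = y*(inverse y*x)" for x using y by simp
  hence "P <= y ** P" using subring_mult[OF closed_ring[OF P(1)] P(3)] by blast
  moreover have "y ** P <= P" using subring_mult[OF closed_ring[OF P(1)] P(4)] by blast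
  ultimately show False using P by simp
 qed
 thus "finite {P:cpts C. y ** F P ~= P}"
  by(rule finite_subset) (use F almost_all_points in "auto simp: lat_def")
 fix P assume P: "P:cpts C"
 show "submod P (y ** F P)" by(rule submod_image[OF lat_submod[OF F P]])
 obtain z u where zu: "z ~= 0" "z ** P <= F P" "F P <= u ** P" by(rule lat_bounds[OF F P])
 have "(y*z) ** P <= y ** F P" "y ** F P <= (y*u) ** P"
  unfolding image_mult_assoc[symmetric] using zu by blast+
 thus "EX z u. z ~= 0 & z ** P <= y ** F P & y ** F P <= u ** P"
  using y zu(1) by(intro exI[of _ "y*z"] exI[of _ "y*u"]) auto
qed

end

context dcurve begin

abbreviation "VV == H0 C \<omega>"

lemma V_iff: "v:VV \<longleftrightarrow> (ALL P:cpts C. v:\<omega> P)" using cc.H0_eq[OF lat_fam[OF lat_omega]] by simp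

lemma V_subspace: "ksub VV" by(rule cc.H0_subspace[OF lat_fam[OF lat_omega]])

lemma V_finite: "qdK VV {0} < \<infinity>" using h0_finite[OF lat_omega] by(simp add: h0_def)

lemma Hm_O: "Hm (%P. P) = VV"
proof -
 have "(ALL x:P. c*x:\<omega> P) \<longleftrightarrow> c:\<omega> P" if P: "P:cpts C" for P c
  using submod_scale[OF lat_submod[OF lat_omega P]] subring_1[OF closed_ring[OF P]] by(auto simp: mult.commute)
 thus ?thesis unfolding Hm_def set_eq_iff V_iff by blast
qed

lemma genus: "arithmetic_genus em C = qdK VV {0}" unfolding arithmetic_genus_def h1_dual[OF lat_O] Hm_O ..

definition gC :: nat where "gC = the_enat (qdK VV {0})"

lemma gC: "qdK VV {0} = enat gC" "arithmetic_genus em C = enat gC" "2 <= gC"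
proof -
 show 1: "qdK VV {0} = enat gC" using V_finite unfolding gC_def by auto
 thus 2: "arithmetic_genus em C = enat gC" using genus by simp
 show "2 <= gC" using big unfolding 2 by(simp add: numeral_eq_enat)
qed

lemma h1_O: "h1 em C (%P. P) = enat gC" using gC(2) unfolding arithmetic_genus_def .

lemma V_ne: obtains v where "v:VV" "v ~= 0"
proof -
 have "VV ~= {0}"
 proof
  assume "VV = {0}"
  hence "enat gC = 0" using kv.qd_self[OF kv.subspace_single_0] gC(1) by simp
  thus False using gC(3) by(simp add: zero_enat_def)
 qed
 thus thesis using that ksub_0[OF V_subspace] by blast
qed

lemma omega_gen: assumes "P:cpts C"
 obtains S s where "finite S" "s:S" "s ~= 0" "\<omega> P = lspan P S" by(rule lat_gen[OF lat_omega assms])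

lemma stable_sections: assumes c: "!!v. v:VV ==> c*v:VV" shows "c:range em"
proof -
 obtain v where "v:VV" "v ~= 0" by(rule V_ne)
 thus ?thesis by(rule stable_finite_dim[OF V_subspace V_finite _ _ c])
qed

lemma Hm_omega: "Hm \<omega> = range em"
proof
 show "Hm \<omega> <= range em"
 proof
  fix c assume "c:Hm \<omega>"
  thus "c:range em" by(intro stable_sections) (auto simp: Hm_def V_iff)
 qed
 show "range em <= Hm \<omega>" unfolding Hm_def using submod_scale[OF lat_submod[OF lat_omega]] closed_range by blast
qed

lemma h1_omega: "h1 em C \<omega> = 1" unfolding h1_dual[OF lat_omega] Hm_omega by(rule qd_range_k)

text \<open>Otherwise replace \<omega> at P by the module that V generates. This does not change H0, so h1 goes up and
  dual to it there is a nonconstant c with c F \<subseteq> \<omega>. But then c V \<subseteq> V, which is impossible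
  for finite-dimensional V.\<close>
lemma omega_generated:
 assumes P: "P:cpts C" shows "lspan P VV = \<omega> P"
proof(rule ccontr)
 define N where "N = lspan P VV"
 assume "~ ?thesis"
 hence ne: "N ~= \<omega> P" by(simp add: N_def)
 note R = closed_ring[OF P] and M = lat_submod[OF lat_omega P]
 have N: "submod P N" "N <= \<omega> P" unfolding N_def using submod_lin_span[OF R] lin_span_submod[OF M] V_iff P by auto
 have VN: "v:N" if "v:VV" for v unfolding N_def by(rule lin_span_base[OF R that])
 obtain v where v: "v:VV" "v ~= 0" by(rule V_ne)
 have vP: "v ** P <= N" using submod_scale[OF N(1) _ VN[OF v(1)]] by(auto simp: mult.commute)
 obtain y where y: "\<omega> P <= y ** P" by(rule lat_bounds[OF lat_omega P]) blast
 define F where "F = \<omega>(P := N)"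
 have lF: "lat F" unfolding F_def by(rule lat_modify[OF lat_omega P N(1) v(2) vP]) (use N y in blast)
 have FW: "F Q <= \<omega> Q" for Q using N by(simp add: F_def)
 interpret p: fam_pair em C UNIV F \<omega> by(rule lat_pair[OF lF lat_omega FW])
 have HF: "H0 C F = VV"
 proof(rule antisym)
  show "VV <= H0 C F" unfolding cc.H0_eq[OF p.F] using VN by(auto simp: V_iff F_def)
  show "H0 C F <= VV" by(rule p.H0_mono)
 qed
 have "qdA (Lam C \<omega>) (Lam C F) = qdK (\<omega> P) (F P)" by(rule cc.Lam_single[OF p.F p.G P]) (simp add: F_def)
 hence "enat gC + qdK (\<omega> P) N + 1 = enat gC + h1 em C F" using p.euler h1_omega gC(1) HF by(simp add: h0_def F_def)
 moreover have "qdK (\<omega> P) N ~= 0" using N ne kv.qd_eq_0[OF submod_subspace[OF N(1) closed_range[OF P]]] by blast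
 ultimately have "~ qdK (Hm F) {0} <= 1" unfolding h1_dual[OF lF, symmetric]
  by(cases "h1 em C F"; cases "qdK (\<omega> P) N") (auto simp: one_enat_def zero_enat_def)
 hence "~ Hm F <= range em" using qd_range_k kv.qd_mono[of "Hm F" "range em" "{0}" "{0}"] by auto
 then obtain c where c: "c:Hm F" "c ~: range em" by blast
 have "c*v:VV" if "v:VV" for v
 proof -
  have "v:F Q" if "Q:cpts C" for Q using `v : VV` HF that unfolding cc.H0_eq[OF p.F] by blast
  thus ?thesis unfolding V_iff using c(1) by(simp add: Hm_def)
 qed
 thus False using stable_sections c(2) by blast
qed

lemma omega_degree:
 assumes v: "v:VV" "v ~= 0"
 shows "qdA (Lam C \<omega>) (Lam C (%P. v ** P)) = enat (2*gC - 2)"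
proof -
 have lF: "lat (%P. v ** P)" by(rule lat_scale[OF lat_O v(2)])
 interpret p: fam_pair em C UNIV "%P. v ** P" \<omega>
  by(rule lat_pair[OF lF lat_omega]) (use v submod_scale[OF lat_submod[OF lat_omega]] in "auto simp: V_iff mult.commute")
 have "1 + qdA (Lam C \<omega>) (Lam C (%P. v ** P)) + 1 = enat gC + enat gC"
  using p.euler cc.h0_scale[OF lat_fam[OF lat_O] v(2)] cc.h1_scale[OF lat_fam[OF lat_O] v(2)] h0_O h1_O h1_omega gC(1) by(simp add: h0_def)
 thus ?thesis by(cases "qdA (Lam C \<omega>) (Lam C (%P. v ** P))") (auto simp: one_enat_def)
qed

end

section \<open>The canonical model\<close>

context ccurve begin

text \<open>The places over P contain a common chart on which x is regular, and some nonzero function on it vanishes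
  at all of them.\<close>
lemma finite_residues:
 assumes P: "P:C"
 shows "finite {a. EX W. VR W & P <= W & x - em a:nu W}"
proof -
 have one: "finite {a. x - em a = 0}"
 proof(rule finite_subset)
  show "{a. x - em a = 0} <= {THE a. x = em a}" using i_inj by auto
 qed simp
 have "finite {a. EX W. VR W & W ~= UNIV & P <= W & x - em a:nu W}"
 proof(cases "P = UNIV")
  case True
  hence "{a. EX W. VR W & W ~= UNIV & P <= W & x - em a:nu W} = {}" by blast
  thus ?thesis by(simp only:) simp
 next
  case False
  obtain W0 where W0: "VR W0" "W0 ~= UNIV" "P <= W0" "dominates W0 P" by(rule dominating_place[OF P False])
  obtain T where T: "finite T" "ag T <= W0" "P = loc (ag T) W0" using point_in_place(2)[OF P W0(1-3)] by blast
  have AP: "ag T <= P" unfolding T(3) by(rule loc_sup[OF alg_gen_subring VR_val[OF W0(1)] T(2)])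
  obtain z where z: "z:nu P" "z ~= 0" by(rule nonunit_exists[OF P False])
  have "z:loc (ag T) W0" using z(1) T(3) by(simp add: nonunits_def)
  then obtain b c where bc: "z = b/c" "b:ag T" "c:ag T" unfolding loc_iff by blast
  have nz: "c ~= 0" "b ~= 0" using z bc by auto
  have "c*z:nu P" using submod_scale[OF rat_nonunits_submod[OF point_rat_ring[OF P False]] _ z(1)] bc(3) AP by blast
  hence bP: "b:nu P" using nz bc(1) by simp
  define A where "A = ag (insert x T)"
  have "ag T <= A" unfolding A_def by(rule alg_gen_least[OF alg_gen_subring alg_gen_base(2)]) (use alg_gen_base(1) in blast)
  hence bA: "b:A" using bc by blast
  have xA: "x:A" "range em <= A" "is_subring A" unfolding A_def using alg_gen_base alg_gen_subring by blast+
  have fin: "finite {A Int nu W |W. VR W & A <= W & b:nu W}"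
   unfolding A_def by(rule chart_finite) (use T(1) bA nz in "auto simp: A_def")
  have "{a. EX W. VR W & W ~= UNIV & P <= W & x - em a:nu W} <= (%I. THE a. x - em a:I) ` {A Int nu W |W. VR W & A <= W & b:nu W}"
  proof clarify
   fix a W assume W: "VR W" "W ~= UNIV" "P <= W" "x - em a:nu W"
   have "x - em a + em a:W"
    by(rule subring_add[OF VR_subring[OF W(1)] _ VR_i[OF W(1)]]) (use W(4) in "simp add: nonunits_def")
   hence "A <= W" unfolding A_def by(intro alg_gen_least[OF VR_subring[OF W(1)]]) (use W(1,3) AP alg_gen_base(1)[of T em] in "auto simp: VR_def")
   moreover have "b:nu W" using point_in_place(1)[OF P W(1-3)] bP unfolding dominates_def by blast
   moreover have "a = (THE a. x - em a:A Int nu W)"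
   proof(rule the_equality[symmetric])
    show "x - em a:A Int nu W" using W(4) subring_diff[OF xA(3,1)] xA(2) by blast
    show "a' = a" if "x - em a':A Int nu W" for a' by(rule residue_unique[OF W(1) _ W(4)]) (use that in blast)
   qed
   ultimately show "a:(%I. THE a. x - em a:I) ` {A Int nu W |W. VR W & A <= W & b:nu W}" using W(1) by blast
  qed
  thus ?thesis using fin finite_subset by blast
 qed
 moreover have "{a. EX W. VR W & P <= W & x - em a:nu W} <= {a. x - em a = 0} Un {a. EX W. VR W & W ~= UNIV & P <= W & x - em a:nu W}"
 proof clarify
  fix a W assume W: "VR W" "P <= W" "x - em a:nu W" and n: "~ (EX W. VR W & W ~= UNIV & P <= W & x - em a:nu W)"
  hence "W = UNIV" by blast
  thus "x - em a = 0" using W(3) by(simp add: nonunits_def)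
 qed
 ultimately show ?thesis using one finite_subset by blast
qed

text \<open>Choose a outside the finitely many residues of x at places over P. So every element of K is a quotient of
  elements of the integral closure, whose localizations are therefore valuation rings.\<close>
lemma separating_denominator:
 assumes P: "P:C"
 obtains a where "x - em a ~= 0" "inverse (x - em a):integral_closure P" "x*inverse (x - em a):integral_closure P"
  "x*inverse (x - em a) = 1 + em a*inverse (x - em a)"
proof -
 obtain a where a: "a ~: {a. EX W. VR W & P <= W & x - em a:nu W}" using ex_new_if_finite[OF k_infinite finite_residues[OF P, of x]] by blast
 have nz: "x - em a ~= 0" using a VR_UNIV nonunits_0[OF subring_UNIV] by force
 define y where "y = inverse (x - em a)"
 have e: "x*y = 1 + em a*y" using nz by(simp add: y_def field_simps)
 have yW: "y:W" if W: "valuation_ring W" "P <= W" for W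
 proof -
  have "VR W" using W P_facts(2)[OF P] unfolding VR_def by blast
  hence "x - em a ~: nu W" using a W by blast
  thus ?thesis using W(1) nz unfolding y_def nonunits_def valuation_ring_def by blast
 qed
 have "x*y:W" if W: "valuation_ring W" "P <= W" for W
 proof -
  have R: "is_subring W" using W(1) by(simp add: valuation_ring_def)
  have "em a:W" using W(2) P_facts(2)[OF P] by blast
  thus ?thesis unfolding e using subring_add[OF R subring_1[OF R]] subring_mult[OF R _ yW[OF W]] by blast
 qed
 thus thesis using that[of a] nz yW e unfolding integral_closure_eq[OF P_facts(1)[OF P]] y_def by blast
qed

lemma closure_facts:
 assumes P: "P:C"
 shows "is_subring (integral_closure P)" "range em <= integral_closure P" "VR W ==> P <= W ==> integral_closure P <= W"
 using P_facts(2)[OF P] unfolding integral_closure_eq[OF P_facts(1)[OF P]] VR_def valuation_ring_def is_subring_def by blast+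

lemma localization_VR:
 assumes P: "P:C" and p: "prime_ideal (integral_closure P) p"
 shows "VR (localization (integral_closure P) p)"
proof -
 let ?B = "integral_closure P"
 note B = closure_facts[OF P]
 note L = localization_subring[OF B(1) p]
 have "x:localization ?B p \<or> inverse x:localization ?B p" for x
 proof -
  obtain a where a: "x - em a ~= 0" "inverse (x - em a):?B" "x*inverse (x - em a):?B"
   "x*inverse (x - em a) = 1 + em a*inverse (x - em a)" by(rule separating_denominator[OF P])
  define y where "y = inverse (x - em a)"
  note a = a[folded y_def]
  have y0: "y ~= 0" using a(1) by(simp add: y_def)
  show ?thesis
  proof(cases "y:p")
   case False
   have "x = x*y/y" using y0 by simp
   thus ?thesis unfolding localization_def using a False by blast
  next
   case True
   have "x*y ~: p"
   proof
    assume xy: "x*y:p"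
    have "- em a:?B" using B(2) i_neg[of a] by(metis rangeI subsetD)
    hence "- em a*y:p" "x*y + - em a*y:p" using p True xy unfolding prime_ideal_def by blast+
    hence "1:p" using a(4) by simp
    thus False using p unfolding prime_ideal_def by blast
   qed
   moreover hence "x*y ~= 0" using p unfolding prime_ideal_def by auto
   hence "inverse x = y/(x*y)" by(simp add: field_simps)
   ultimately show ?thesis unfolding localization_def using a by blast
  qed
 qed
 thus ?thesis unfolding VR_def valuation_ring_def using L B(2) by blast
qed

lemma place_is_localization:
 assumes P: "P:C" and W: "VR W" "P <= W"
 shows "W = loc (integral_closure P) W"
proof
 note B = closure_facts[OF P]
 show "loc (integral_closure P) W <= W" by(rule loc_sub[OF B(1) VR_val[OF W(1)] B(3)[OF W]])
 show "W <= loc (integral_closure P) W"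
 proof
  fix x assume x: "x:W"
  obtain a where a: "x - em a ~= 0" "inverse (x - em a):integral_closure P" "x*inverse (x - em a):integral_closure P"
   by(rule separating_denominator[OF P, of x])
  have "x - em a:W" using x subring_diff[OF VR_subring[OF W(1)]] VR_i[OF W(1)] by blast
  hence "inverse (x - em a) ~: nu W" using a(1) by(simp add: nonunits_def)
  moreover have "x = x*inverse (x - em a)/inverse (x - em a)" using a(1) by simp
  ultimately show "x:loc (integral_closure P) W" unfolding loc_iff using a by blast
 qed
qed

lemma normalization_eq: "normalization C = {W. VR W}"
proof
 show "normalization C <= {W. VR W}" unfolding normalization_def Spec_def using localization_VR by blast
 show "{W. VR W} <= normalization C"
 proof clarify
  fix W assume W: "VR W"
  then obtain P where P: "P:C" "dominates W P" using center_ex1 by blast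
  hence PW: "P <= W" by(simp add: dominates_def)
  note B = closure_facts[OF P(1)]
  have "W:Spec (integral_closure P)"
   using loc_in_Spec[OF B(1) VR_val[OF W] B(3)[OF W PW]] place_is_localization[OF P(1) W PW] by simp
  thus "W:normalization C" unfolding normalization_def using P by blast
 qed
qed

lemma normalization_map_eq: "VR W ==> P:C ==> dominates W P ==> normalization_map C W = P"
 unfolding normalization_map_def using center_unique by(intro the_equality) blast+

end

context dcurve begin

sublocale ls: linsys em VV
proof unfold_locales
 show "ksub VV" by(rule V_subspace)
 show "qdK VV {0} < \<infinity>" by(rule V_finite)
 show "EX u:VV. EX v:VV. v ~= 0 & u/v ~: range em"
  using two_elements[OF V_subspace] gC(1,3) by(metis numeral_eq_enat enat_ord_simps(1))
qed

lemma pullback_eq: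
 assumes W: "VR W" shows "normalization_pullback C \<omega> W = lspan W VV"
proof -
 obtain P where P: "P:C" "dominates W P" using center_ex1[OF W] by blast
 have PW: "P <= W" using P by(simp add: dominates_def)
 note R = VR_subring[OF W]
 have wP: "\<omega> P <= lspan W VV"
 proof(cases "P = UNIV")
  case True
  hence WU: "W = UNIV" using PW by blast
  obtain v where v: "v:VV" "v ~= 0" by(rule V_ne)
  have "x/v*v:lspan UNIV VV" for x by(rule lin_span_scale[OF subring_UNIV lin_span_base[OF subring_UNIV v(1)] UNIV_I])
  thus ?thesis using v WU by auto
 next
  case False
  hence "\<omega> P = lspan P VV" using omega_generated P closed_points_iff by simp
  thus ?thesis using lin_span_mono[OF PW order_refl] by simp
 qed
 have Vw: "VV <= \<omega> P" using P(1) by(auto simp: H0_def)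
 show ?thesis unfolding normalization_pullback_def normalization_map_eq[OF W P]
  using lin_span_submod[OF submod_lin_span[OF R] wP] lin_span_mono[OF order_refl Vw, of W] by blast
qed

lemma pullback_gen:
 assumes W: "VR W" and v: "v:VV" "v ~= 0"
 shows "normalization_pullback C \<omega> W = (%x. x*v) ` W \<longleftrightarrow> ls.gen W v"
proof -
 note R = VR_subring[OF W]
 have s: "submod W ((%x. x*v) ` W)" using submod_image[OF submod_self[OF R], of v] by(simp add: mult.commute)
 have 1: "(%x. x*v) ` W <= lspan W VV" using lin_span_scale[OF R lin_span_base[OF R v(1)]] by auto
 have 2: "w:(%x. x*v) ` W \<longleftrightarrow> w/v:W" for w using v(2) by(auto intro!: image_eqI[of _ _ "w/v"])
 show ?thesis unfolding pullback_eq[OF W] ls.gen_def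
 proof
  assume "lspan W VV = (%x. x*v) ` W"
  thus "v:VV & v ~= 0 & (ALL w:VV. w/v:W)" using v 2 lin_span_base[OF R] by blast
 next
  assume "v:VV & v ~= 0 & (ALL w:VV. w/v:W)"
  hence "VV <= (%x. x*v) ` W" using 2 by blast
  thus "lspan W VV = (%x. x*v) ` W" using 1 lin_span_submod[OF s] by blast
 qed
qed

lemma canonical_model_eq: "canonical_model em C \<omega> = ls.CX"
proof
 show "canonical_model em C \<omega> <= ls.CX"
 proof
  fix R assume "R:canonical_model em C \<omega>"
  then obtain W v where W: "VR W" "v:VV" "v ~= 0" "normalization_pullback C \<omega> W = (%x. x*v) ` W" "R = loc (ls.Av v) W"
   unfolding canonical_model_def normalization_eq ls.Av_def loc_def by blast
  hence "R = ls.RW W" using ls.RW_eq_loc[OF W(1)] pullback_gen[OF W(1-3)] by simp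
  thus "R:ls.CX" unfolding ls.CX_def using W(1) by blast
 qed
 show "ls.CX <= canonical_model em C \<omega>"
 proof
  fix R assume "R:ls.CX"
  then obtain W where W: "VR W" "R = ls.RW W" unfolding ls.CX_def by blast
  obtain v where v: "ls.gen W v" using ls.gen_exists[OF W(1)] by blast
  hence v': "v:VV" "v ~= 0" by(auto simp: ls.gen_def)
  have "R = localization (ag ((%w. w/v) ` VV)) (ag ((%w. w/v) ` VV) Int nu W)"
   using ls.RW_eq_loc[OF W(1) v] W(2) by(simp add: loc_def ls.Av_def)
  moreover have "normalization_pullback C \<omega> W = (%x. x*v) ` W" using pullback_gen[OF W(1) v'] v by blast
  ultimately show "R:canonical_model em C \<omega>" unfolding canonical_model_def normalization_eq using W(1) v' by blast
 qed
qed

end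

section \<open>Curves that are not Gorenstein\<close>

context ground begin

lemma qd_power_ideal:
 assumes R: "is_subring R" "range em <= R" and x: "x:R" "x ~= 0" and e: "qdK R (x ** R) = enat e"
 shows "qdK R ((x^n) ** R) = enat (n*e)"
proof(induction n)
 case 0
 have "ksub R" using subring_subspace[OF R] .
 thus ?case by(simp add: zero_enat_def[symmetric])
next
 case (Suc n)
 let ?x = "%n. (x^n) ** R"
 have s: "ksub R" using subring_subspace[OF R] .
 have sub: "?x (Suc n) <= ?x n" "?x n <= R"
 proof -
  show "?x n <= R" using subring_mult[OF R(1) subring_power[OF R(1) x(1)]] by auto
  have "x^Suc n*r = x^n*(x*r)" for r by(simp add: mult_ac)
  thus "?x (Suc n) <= ?x n" using subring_mult[OF R(1) x(1)] by blast
 qed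
 have "qdK R (?x (Suc n)) = qdK R (?x n) + qdK (?x n) (?x (Suc n))"
  by(rule kv.qd_add) (use s ksub_image[OF s] sub in auto)
 also have "qdK (?x n) (?x (Suc n)) = enat e"
  unfolding power_Suc2 image_mult_assoc[symmetric] using qd_mult[OF _ ksub_image[OF s, of x], of "x^n" R] x e by simp
 finally show ?case using Suc by(simp add: algebra_simps)
qed

text \<open>N is the R-module generated by the powers of m below the degree of its equation; the ring of its
  multipliers contains R and m and is contained in N.\<close>
lemma adjoin_integral:
 assumes P: "is_subring P" and fr: "frac_field P = UNIV" and R: "is_subring R" "P <= R" and d: "d:P" "d ~= 0" "!!r. r:R ==> d*r:P"
  and m: "m:integral_closure P"
 shows "EX R' d. is_subring R' & R <= R' & m:R' & d:P & d ~= 0 & (ALL r:R'. d*r:P)"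
proof -
 obtain p where p: "lead_coeff p = 1" "!!i. coeff p i:P" "poly p m = 0" using m unfolding integral_closure_def by blast
 define n where "n = degree p"
 define N where "N = {SUM j<n. r j*m^j |r. ALL j<n. r j:R}"
 have Nj: "r*m^j:N" if "r:R" "j < n" for r j
 proof -
  have "r*m^j = (SUM i<n. (if i = j then r else 0)*m^i)" using that(2) by(simp add: if_distrib[of "%x. x*_"] cong: if_cong)
  thus ?thesis unfolding N_def using that(1) subring_0[OF R(1)] by(intro CollectI exI[of _ "%i. if i = j then r else 0"]) auto
 qed
 have n: "0 < n"
 proof(rule ccontr)
  assume "~ 0 < n"
  hence "p = 1" using p(1) unfolding n_def by(metis degree_0_id lead_coeff_pCons(1) monom_eq_1_iff neq0_conv one_pCons of_nat_eq_of_nat_power_cancel_iff)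
  thus False using p(3) by simp
 qed
 have Ns: "submod R N" unfolding submod_def
 proof(intro conjI ballI)
  have "0*m^0:N" using Nj[of 0 0] n subring_0[OF R(1)] by blast
  thus "0:N" by simp
  fix a assume "a:N"
  then obtain r where a: "a = (SUM j<n. r j*m^j)" "ALL j<n. r j:R" unfolding N_def by blast
  show "a + b:N" if "b:N" for b
  proof -
   obtain s where b: "b = (SUM j<n. s j*m^j)" "ALL j<n. s j:R" using `b : N` unfolding N_def by blast
   have "a + b = (SUM j<n. (r j + s j)*m^j)" unfolding a b by(simp add: distrib_right sum.distrib)
   thus ?thesis unfolding N_def using a b subring_add[OF R(1)] by(intro CollectI exI[of _ "%j. r j + s j"]) auto
  qed
  show "c*a:N" if "c:R" for c
  proof -
   have "c*a = (SUM j<n. (c*r j)*m^j)" unfolding a by(simp add: sum_distrib_left mult.assoc)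
   thus ?thesis unfolding N_def using a that subring_mult[OF R(1)] by(intro CollectI exI[of _ "%j. c*r j"]) auto
  qed
 qed
 have mn: "r*m^n:N" if r: "r:R" for r
 proof -
  have "0 = (SUM i<=n. coeff p i*m^i)" using p(3) by(simp add: poly_altdef n_def)
  also have "... = (SUM i<n. coeff p i*m^i) + m^n" using p(1) by(simp add: n_def lessThan_Suc_atMost[symmetric])
  finally have "m^n = - (SUM i<n. coeff p i*m^i)" by(simp add: eq_neg_iff_add_eq_0 add.commute)
  hence "r*m^n = (SUM i<n. (- r*coeff p i)*m^i)" by(simp add: sum_distrib_left sum_negf mult.assoc)
  moreover have "- r*coeff p i:R" for i using subring_mult[OF R(1) subring_neg[OF R(1) r]] p(2) R(2) by blast
  ultimately show ?thesis unfolding N_def by(intro CollectI exI[of _ "%i. - r*coeff p i"]) auto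
 qed
 have mN: "m*a:N" if "a:N" for a
 proof -
  obtain r where a: "a = (SUM j<n. r j*m^j)" "ALL j<n. r j:R" using `a : N` unfolding N_def by blast
  have "m*a = (SUM j<n. r j*m^Suc j)" unfolding a by(simp add: sum_distrib_left mult_ac)
  moreover have "r j*m^Suc j:N" if "j < n" for j
   using a(2) that mn[of "r j"] Nj[of "r j" "Suc j"] by(cases "Suc j = n") auto
  ultimately show ?thesis using submod_sum[OF Ns, of "{..<n}" "%j. r j*m^Suc j"] by simp
 qed
 obtain e where e: "e:P" "e ~= 0" "ALL b:(%j. m^j) ` {..<n}. e*b:P"
  using frac_field_common_denominator[OF P fr, of "(%j. m^j) ` {..<n}"] by blast
 have dN: "d*e*a:P" if "a:N" for a
 proof -
  obtain r where a: "a = (SUM j<n. r j*m^j)" "ALL j<n. r j:R" using `a : N` unfolding N_def by blast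
  have "d*e*a = (SUM j<n. (d*r j)*(e*m^j))" unfolding a by(simp add: sum_distrib_left mult_ac)
  also have "... : P" by(rule submod_sum[OF submod_self[OF P]]) (use a(2) d(3) e(3) subring_mult[OF P] in auto)
  finally show ?thesis .
 qed
 define R' where "R' = {z. ALL a:N. z*a:N}"
 have "is_subring R'" unfolding is_subring_def R'_def using submod_diff[OF R(1) Ns] by(auto simp: left_diff_distrib mult.assoc)
 moreover have "R <= R'" unfolding R'_def using submod_scale[OF Ns] by blast
 moreover have "m:R'" unfolding R'_def using mN by blast
 moreover have "1*m^0:N" using Nj[OF subring_1[OF R(1)] n] .
 hence "R' <= N" unfolding R'_def by force
 moreover have "d*e:P" "d*e ~= 0" using subring_mult[OF P d(1) e(1)] d e by auto
 ultimately show ?thesis using dN by blast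
qed

lemma adjoin_integral_set:
 assumes P: "is_subring P" and fr: "frac_field P = UNIV"
 shows "finite S ==> S <= integral_closure P ==> EX R d. is_subring R & P <= R & S <= R & d:P & d ~= 0 & (ALL r:R. d*r:P)"
proof(induction S rule: finite_induct)
 case empty
 thus ?case using P subring_1[OF P] by(intro exI[of _ P] exI[of _ 1]) auto
next
 case (insert m S)
 then obtain R d where R: "is_subring R" "P <= R" "S <= R" "d:P" "d ~= 0" "ALL r:R. d*r:P" by blast
 obtain R' d' where "is_subring R'" "R <= R'" "m:R'" "d':P" "d' ~= 0" "ALL r:R'. d'*r:P"
  using adjoin_integral[OF P fr R(1,2,4,5) _, of m] R(6) insert.prems by blast
 thus ?case using R by(intro exI[of _ R'] exI[of _ d']) auto
qed

end

context dcurve begin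

text \<open>A w is needed that divides \<omega> P at every place over P at once. If w does so for some generators,
  then \<open>separating_denominator\<close> gives a scalar a for which y - a w divides both w and a further generator
  y.\<close>
lemma fibre_generator:
 assumes P: "P:cpts C"
 obtains w where "w:\<omega> P" "w ~= 0" "!!x. x:\<omega> P ==> x/w:integral_closure P"
proof -
 let ?B = "integral_closure P"
 note PC = closed_pt[OF P, THEN conjunct1]
 note B = closure_facts(1)[OF PC] and M = lat_submod[OF lat_omega P]
 obtain S s0 where S: "finite S" "s0:S" "s0 ~= 0" "\<omega> P = lspan P S" by(rule omega_gen[OF P])
 have S\<omega>: "S <= \<omega> P" using lin_span_base[OF closed_ring[OF P]] S(4) by blast
 have "finite T ==> T <= S ==> EX w. w:\<omega> P & w ~= 0 & (ALL s:insert s0 T. s/w:?B)" for T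
 proof(induction T rule: finite_induct)
  case empty
  thus ?case using S(2,3) S\<omega> subring_1[OF B] by(intro exI[of _ s0]) auto
 next
  case (insert y T)
  then obtain w where w: "w:\<omega> P" "w ~= 0" "!!s. s:insert s0 T ==> s/w:?B" by blast
  obtain a where a: "y/w - em a ~= 0" "inverse (y/w - em a):?B" "y/w*inverse (y/w - em a):?B"
   by(rule separating_denominator[OF PC])
  define w' where "w' = y - em a*w"
  have w': "w' = w*(y/w - em a)" using w(2) by(simp add: w'_def field_simps)
  have "y:\<omega> P" using insert.prems S\<omega> by blast
  hence "w':\<omega> P" unfolding w'_def by(rule submod_diff[OF closed_ring[OF P] M _ submod_scale[OF M _ w(1)]]) (use closed_range[OF P] in blast)
  moreover have "s/w' = s/w*inverse (y/w - em a)" for s unfolding w' by(simp add: divide_inverse mult.assoc)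
  hence "s/w':?B" if "s:insert s0 (insert y T)" for s
   using that a(2,3) subring_mult[OF B w(3) a(2)] by auto
  ultimately show ?case using w(2) a(1) w' by(intro exI[of _ w']) auto
 qed
 from this[OF S(1) order_refl] obtain w where w: "w:\<omega> P" "w ~= 0" "!!s. s:S ==> s/w:?B" by blast
 have "S <= w ** ?B"
 proof
  fix s assume "s:S"
  thus "s:w ** ?B" using w(2,3) by(intro image_eqI[of _ _ "s/w"]) auto
 qed
 moreover have "P <= ?B" unfolding integral_closure_eq[OF closed_ring[OF P]] by blast
 ultimately have "\<omega> P <= w ** ?B" unfolding S(4)
  by(intro lin_span_submod[OF submod_image[OF submod_mono[OF submod_self[OF B]]]])
 hence "x/w:?B" if "x:\<omega> P" for x using that w(2) by auto
 thus thesis by(rule that[OF w(1,2)])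
qed

lemma finite_blowup:
 assumes P: "P:cpts C"
 obtains w B y where "w:\<omega> P" "w ~= 0" "is_subring B" "P <= B" "\<omega> P <= w ** B" "B <= y ** P"
proof -
 obtain w where w: "w:\<omega> P" "w ~= 0" "!!x. x:\<omega> P ==> x/w:integral_closure P" using fibre_generator[OF P] by blast
 obtain S where S: "finite S" "\<omega> P = lspan P S" by(rule omega_gen[OF P])
 have "(%x. x/w) ` S <= integral_closure P" using w(3) lin_span_base[OF closed_ring[OF P]] S(2) by blast
 then obtain B d where B: "is_subring B" "P <= B" "(%x. x/w) ` S <= B" "d:P" "d ~= 0" "ALL r:B. d*r:P"
  using adjoin_integral_set[OF closed_ring[OF P] P_facts(3), of "(%x. x/w) ` S"] S(1) closed_pt[OF P] by blast
 have "S <= w ** B"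
 proof
  fix s assume "s:S"
  thus "s:w ** B" using B(3) w(2) by(intro image_eqI[of _ _ "s/w"]) auto
 qed
 hence 1: "\<omega> P <= w ** B" unfolding S(2)
  by(rule lin_span_submod[OF submod_image[OF submod_mono[OF submod_self[OF B(1)] B(2)]]])
 have "B <= inverse d ** P"
 proof
  fix r assume "r:B"
  thus "r:inverse d ** P" using B(5,6) by(intro image_eqI[of _ _ "d*r"]) auto
 qed
 thus thesis using that w(1,2) B(1,2) 1 by blast
qed

lemma invertibleI:
 assumes loc: "!!P. P:cpts C ==> EX w. w ~= 0 & \<omega> P = w ** P"
 shows "gorenstein C \<omega>"
 unfolding gorenstein_def invertible_def
proof
 fix P assume P: "P:C"
 have "EX w. w ~= 0 & (P:cpts C --> \<omega> P = w ** P)"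
  using loc[of P] zero_neq_one[where 'a='K] by metis
 then obtain w where w: "w ~= 0" "P:cpts C ==> \<omega> P = w ** P" by blast
 define Bd where "Bd = {Q:cpts C. \<omega> Q ~= w ** Q}"
 have fin: "finite Bd" unfolding Bd_def by(rule lat_ae[OF lat_omega lat_scale[OF lat_O w(1)]])
 have "EX T. finite T & T <= P & (ALL Q:Bd. ~ T <= Q)"
  by(rule avoid_points[OF P fin]) (use w(2) in "auto simp: Bd_def")
 then obtain T where T: "finite T" "T <= P" "!!Q. Q:Bd ==> ~ T <= Q" by blast
 have "\<omega> Q = (%x. x*w) ` Q" if Q: "Q:C" "T <= Q" for Q
 proof(cases "Q = UNIV")
  case True
  have "x:(%x. x*w) ` UNIV" for x using w(1) by(intro image_eqI[of _ _ "x/w"]) auto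
  thus ?thesis using lat_omega True unfolding lat_def by blast
 next
  case False
  hence "\<omega> Q = w ** Q" using T(3) Q closed_points_iff unfolding Bd_def by blast
  thus ?thesis by(simp add: mult.commute)
 qed
 thus "EX T w. finite T & T <= P & w ~= 0 & (ALL Q:C. T <= Q --> \<omega> Q = (%x. x*w) ` Q)"
  using T w(1) by blast
qed

text \<open>At each point P write \<omega> P \<subseteq> w B with w \<in> \<omega> P and a finite extension ring B of
  P, and put x = v/w. Then V^n \<subseteq> w^n B, so the Hilbert function grows at most like n times the sum of the
  numbers e = dim B/xB. As B/P is finite-dimensional, dim \<omega> P/vP = e + dim \<omega> P/wP, and the sum of the
  left sides is 2 g - 2. The last term is positive where \<omega> is not principal.\<close>
lemma degree_not_gorenstein:
 assumes ng: "~ gorenstein C \<omega>" shows "ls.deg + 3 <= 2*gC"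
proof -
 obtain v where v: "v:VV" "v ~= 0" by(rule V_ne)
 define vO where "vO = (%P. v ** P)"
 have lvO: "lat vO" unfolding vO_def by(rule lat_scale[OF lat_O v(2)])
 have vO\<omega>: "vO P <= \<omega> P" if P: "P:cpts C" for P
  unfolding vO_def using v(1) P submod_scale[OF lat_submod[OF lat_omega P]] unfolding V_iff by(auto simp: mult.commute)
 \<comment> \<open>Outside S the choices w = v and B = P are made, so that all sums below are finite.\<close>
 define S where "S = {P:cpts C. vO P ~= \<omega> P}"
 have Sf: "finite S" "S <= cpts C" unfolding S_def using lat_ae[OF lvO lat_omega] by auto
 define ok where "ok = (%P (w, B, y). w:\<omega> P & w ~= 0 & is_subring B & P <= B & \<omega> P <= w ** B & B <= y ** P & (P ~: S --> w = v & B = P))"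
 have "EX t. ok P t" if P: "P:cpts C" for P
 proof(cases "P:S")
  case True
  obtain w B y where "w:\<omega> P" "w ~= 0" "is_subring B" "P <= B" "\<omega> P <= w ** B" "B <= y ** P" by(rule finite_blowup[OF P])
  hence "ok P (w, B, y)" unfolding ok_def using True by simp
  thus ?thesis by blast
 next
  case False
  hence "\<omega> P = vO P" using P by(simp add: S_def)
  moreover have "v:v ** P" using subring_1[OF closed_ring[OF P]] by(intro image_eqI[of _ _ 1]) auto
  ultimately have "ok P (v, P, 1)" unfolding ok_def vO_def using v(2) closed_ring[OF P] by simp
  thus ?thesis by blast
 qed
 then obtain t where t: "!!P. P:cpts C ==> ok P (t P)" by metis
 define w B y where "w = (%P. fst (t P))" and "B = (%P. fst (snd (t P)))" and "y = (%P. snd (snd (t P)))"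
 have ok: "w P:\<omega> P" "w P ~= 0" "is_subring (B P)" "P <= B P" "\<omega> P <= w P ** B P" "B P <= y P ** P"
  "P ~: S ==> w P = v & B P = P" if "P:cpts C" for P
  using t[OF that] by(auto simp: ok_def w_def B_def y_def split: prod.splits)
 define x where "x = (%P. v/w P)"
 have wx: "w P*x P = v" "x P ~= 0" if "P:cpts C" for P using ok(2)[OF that] v by(simp_all add: x_def)
 have xB: "x P:B P" if P: "P:cpts C" for P
 proof -
  have "v:\<omega> P" using v(1) P by(simp add: V_iff)
  then obtain r where "v = w P*r" "r:B P" using ok(5)[OF P] by blast
  thus ?thesis using ok(2)[OF P] by(simp add: x_def)
 qed
 have Bk: "range em <= B P" if "P:cpts C" for P using closed_range[OF that] ok(4)[OF that] by blast
 have sB: "ksub (B P)" "ksub P" if P: "P:cpts C" for P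
  using subring_subspace ok(3)[OF P] Bk[OF P] closed_ring[OF P] closed_range[OF P] by auto
 \<comment> \<open>Compare the chains xP \<subseteq> xB \<subseteq> B and xP \<subseteq> M \<subseteq> B for M = \<omega>/w, which contains P.\<close>
 have loc: "EX e b c. qdK (B P) (x P ** B P) = enat e & qdK (B P) P = enat b & qdK (\<omega> P) (w P ** P) = enat c & qdK (\<omega> P) (vO P) = enat (e + c)"
  if P: "P:cpts C" for P
 proof -
  let ?i = "%N. (inverse (w P)) ** N"
  define M where "M = ?i (\<omega> P)"
  have iw: "inverse (w P) ~= 0" using ok(2)[OF P] by simp
  have iwM: "?i (w P ** N) = N" for N unfolding image_mult_assoc using ok(2)[OF P] by simp
  have so: "submod P (\<omega> P)" by(rule lat_submod[OF lat_omega P])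
  have sM: "ksub M" unfolding M_def by(rule ksub_image[OF submod_subspace[OF so closed_range[OF P]]])
  have wo: "w P ** P <= \<omega> P" using ok(1)[OF P] submod_scale[OF so] by(auto simp: mult.commute)
  have PM: "P <= M" using image_mono[OF wo, of "%r. inverse (w P)*r"] unfolding M_def iwM .
  have MB: "M <= B P" using image_mono[OF ok(5)[OF P], of "%r. inverse (w P)*r"] unfolding M_def iwM .
  let ?xP = "x P ** P" and ?xB = "x P ** B P"
  have vx: "?i (vO P) = ?xP" unfolding vO_def image_mult_assoc x_def by(simp add: field_simps)
  have xM: "?xP <= M" using image_mono[OF vO\<omega>[OF P], of "%r. inverse (w P)*r"] unfolding M_def vx .
  have xPB: "?xP <= ?xB" using ok(4)[OF P] by blast
  have xBB: "?xB <= B P" using subring_mult[OF ok(3)[OF P] xB[OF P]] by blast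
  note s = sB[OF P] ksub_image[OF sB(1)[OF P], of "x P"] ksub_image[OF sB(2)[OF P], of "x P"]
  have q1: "qdK (B P) ?xP = qdK (B P) ?xB + qdK ?xB ?xP" by(rule kv.qd_add[OF s(4) s(3) s(1) xPB xBB])
  have q2: "qdK ?xB ?xP = qdK (B P) P" by(rule qd_mult[OF wx(2)[OF P] s(2)])
  have q3: "qdK (B P) ?xP = qdK (B P) M + qdK M ?xP" by(rule kv.qd_add[OF s(4) sM s(1) xM MB])
  have q4: "qdK (B P) P = qdK (B P) M + qdK M P" by(rule kv.qd_add[OF s(2) sM s(1) PM MB])
  have sv: "ksub (vO P)" unfolding vO_def by(rule ksub_image[OF s(2)])
  have q5: "qdK M ?xP = qdK (\<omega> P) (vO P)" unfolding vx[symmetric] M_def by(rule qd_mult[OF iw sv])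
  have "qdK M P = qdK M (?i (w P ** P))" unfolding iwM ..
  also have "... = qdK (\<omega> P) (w P ** P)" unfolding M_def by(rule qd_mult[OF iw ksub_image[OF s(2)]])
  finally have q6: "qdK M P = qdK (\<omega> P) (w P ** P)" .
  have f: "qdK (B P) ?xP < \<infinity>" by(rule sandwich_finite[OF P wx(2)[OF P] _ ok(6)[OF P]]) (use xPB xBB in blast)
  obtain e where e: "qdK (B P) ?xB = enat e" using f q1 by(cases "qdK (B P) ?xB") auto
  obtain b where b: "qdK (B P) P = enat b" using f q1 q2 by(cases "qdK (B P) P") auto
  obtain c where c: "qdK M P = enat c" using b q4 by(cases "qdK M P") auto
  obtain k where k: "qdK (B P) M = enat k" using b q4 by(cases "qdK (B P) M") auto
  obtain l where l: "qdK M ?xP = enat l" using f q3 by(cases "qdK M ?xP") auto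
  have "l = e + c" using q1 q2 q3 q4 unfolding e b c k l by simp
  thus ?thesis using e b c l q5 q6 by auto
 qed
 then obtain e b c where ebc: "!!P. P:cpts C ==> qdK (B P) (x P ** B P) = enat (e P) & qdK (B P) P = enat (b P) & qdK (\<omega> P) (w P ** P) = enat (c P) & qdK (\<omega> P) (vO P) = enat (e P + c P)"
  by metis
 have bound: "ls.D n <= 1 + n*sum e S + sum b S" for n
 proof -
  define G where "G = (%P. if P:cpts C then (w P^n) ** B P else UNIV)"
  define F where "F = (%P. (v^n) ** P)"
  have vn: "v^n ~= 0" using v by simp
  have lF: "lat F" unfolding F_def by(rule lat_scale[OF lat_O vn])
  have wn: "w P^n*x P^n = v^n" if "P:cpts C" for P using wx(1)[OF that] by(simp add: power_mult_distrib[symmetric])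
  have out: "F P = G P" if "P:cpts C" "P ~: S" for P using ok(7)[OF that] that by(simp add: F_def G_def)
  have lG: "lat G"
  proof(rule lat_intro)
   show "G UNIV = UNIV" using closed_pt by(auto simp: G_def)
   have "{P:cpts C. G P ~= P} <= S Un {P:cpts C. F P ~= P}" using out by blast
   thus "finite {P:cpts C. G P ~= P}" using Sf(1) lF finite_subset unfolding lat_def by blast
   fix P assume P: "P:cpts C"
   have GP: "G P = (w P^n) ** B P" using P by(simp add: G_def)
   show "submod P (G P)" unfolding GP by(rule submod_image[OF submod_mono[OF submod_self[OF ok(3)[OF P]] ok(4)[OF P]]])
   have "(w P^n) ** P <= G P" "G P <= (w P^n*y P) ** P"
    unfolding GP image_mult_assoc[symmetric] using ok(4,6)[OF P] by blast+
   thus "EX z y. z ~= 0 & z ** P <= G P & G P <= y ** P" using ok(2)[OF P]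
    by(intro exI[of _ "w P^n"] exI[of _ "w P^n*y P"]) auto
  qed
  have FG: "F P <= G P" if P: "P:cpts C" for P
  proof -
   have "v^n*r = w P^n*(x P^n*r)" for r using wn[OF P] by(simp add: mult.assoc[symmetric])
   moreover have "x P^n*r:B P" if "r:P" for r using subring_mult[OF ok(3)[OF P] subring_power[OF ok(3)[OF P] xB[OF P]]] ok(4)[OF P] that by blast
   ultimately have "(v^n) ** P <= (w P^n) ** B P" by blast
   thus ?thesis unfolding F_def G_def using P by simp
  qed
  interpret p: fam_pair em C UNIV F G by(rule lat_pair[OF lF lG FG])
  have lc: "qdK (G P) (F P) = enat (n*e P + b P)" if P: "P:cpts C" for P
  proof -
   have w0: "w P^n ~= 0" using ok(2)[OF P] by simp
   let ?xn = "%N. (x P^n) ** N"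
   note sp = ksub_image[OF sB(2)[OF P], of "x P^n"] ksub_image[OF sB(1)[OF P], of "x P^n"]
   have "F P = (w P^n) ** ?xn P" unfolding F_def image_mult_assoc wn[OF P] ..
   hence "qdK (G P) (F P) = qdK (B P) (?xn P)" using qd_mult[OF w0 sp(1), of "B P"] P by(simp add: G_def)
   also have "... = qdK (B P) (?xn (B P)) + qdK (?xn (B P)) (?xn P)"
    by(rule kv.qd_add[OF sp sB(1)[OF P]]) (use ok(4)[OF P] subring_mult[OF ok(3)[OF P] subring_power[OF ok(3)[OF P] xB[OF P]]] in auto)
   also have "qdK (?xn (B P)) (?xn P) = enat (b P)" using qd_mult[OF _ sB(2)[OF P], of "x P^n" "B P"] wx(2)[OF P] ebc[OF P] by simp
   also have "qdK (B P) (?xn (B P)) = enat (n*e P)" by(rule qd_power_ideal[OF ok(3)[OF P] Bk[OF P] xB[OF P] wx(2)[OF P]]) (use ebc[OF P] in blast)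
   finally show ?thesis by simp
  qed
  have "power_products VV n <= H0 C G" unfolding cc.H0_eq[OF p.G]
  proof(intro subsetI CollectI conjI ballI UNIV_I)
   fix q P assume q: "q:power_products VV n" and P: "P:cpts C"
   have "q:(w P^n) ** B P" using q
   proof(induction n arbitrary: q)
    case 0 thus ?case using subring_1[OF ok(3)[OF P]] by(auto simp: power_products_0)
   next
    case (Suc n)
    then obtain a u where au: "q = a*u" "a:power_products VV n" "u:VV" unfolding power_products_Suc by blast
    obtain r where r: "a = w P^n*r" "r:B P" using Suc.IH[OF au(2)] by blast
    have "u:\<omega> P" using au(3) P by(simp add: V_iff)
    then obtain s where s: "u = w P*s" "s:B P" using ok(5)[OF P] by blast
    have "q = w P^Suc n*(r*s)" unfolding au(1) r(1) s(1) by(simp add: mult_ac)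
    thus ?case using subring_mult[OF ok(3)[OF P] r(2) s(2)] by blast
   qed
   thus "q:G P" using P by(simp add: G_def)
  qed
  hence "coord_ring_part em VV n <= H0 C G" unfolding coord_span by(rule kv.span_minimal[OF _ cc.H0_subspace[OF p.G]])
  hence "enat (ls.D n) <= h0 em C G" unfolding ls.D[symmetric] h0_def by(rule kv.qd_mono) simp
  also have "... <= h0 em C F + qdA (Lam C G) (Lam C F)" by(rule p.h0_le)
  also have "h0 em C F = 1" unfolding F_def using cc.h0_scale[OF lat_fam[OF lat_O] vn] h0_O by simp
  also have "qdA (Lam C G) (Lam C F) = (SUM P:S. qdK (G P) (F P))"
   by(rule cc.Lam_sum[OF p.F p.G FG Sf out])
  also have "... = (SUM P:S. enat (n*e P + b P))" using lc Sf(2) by(intro sum.cong) auto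
  also have "... = enat (SUM P:S. n*e P + b P)" by(induction S rule: infinite_finite_induct) (auto simp: zero_enat_def)
  also have "(SUM P:S. n*e P + b P) = n*sum e S + sum b S" by(simp add: sum.distrib sum_distrib_left)
  finally show ?thesis by(simp add: one_enat_def)
 qed
 define E b' where "E = sum e S" and "b' = sum b S"
 have "ls.deg <= E"
 proof(rule ccontr)
  assume "~ ?thesis"
  hence d: "int E + 1 <= int ls.deg" by linarith
  obtain k :: int and N where k: "ALL n>=N. int (ls.D n) = int ls.deg*int n + k" using ls.D_linear by blast
  \<comment> \<open>From this n on, slope E + 1 exceeds the bound.\<close>
  define n where "n = max N (2 + b' + nat (- k))"
  have "(int E + 1)*int n <= int ls.deg*int n" using d by(rule mult_right_mono) simp
  moreover have "int (ls.D n) = int ls.deg*int n + k" using k by(simp add: n_def)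
  moreover have "int (ls.D n) <= int (1 + n*E + b')" using bound[of n] unfolding E_def b'_def by(rule of_nat_mono)
  hence "int (ls.D n) <= 1 + int n*int E + int b'" by simp
  moreover have "int n >= 2 + int b' - k" unfolding n_def by auto
  ultimately show False by(simp add: algebra_simps)
 qed
 hence "ls.deg <= sum e S" by(simp only: E_def)
 moreover have "sum e S + sum c S = 2*gC - 2"
 proof -
  have "enat (2*gC - 2) = qdA (Lam C \<omega>) (Lam C vO)" unfolding vO_def by(rule omega_degree[OF v, symmetric])
  also have "... = (SUM P:S. qdK (\<omega> P) (vO P))" by(rule cc.Lam_sum[OF lat_fam[OF lvO] lat_fam[OF lat_omega] vO\<omega> Sf]) (auto simp: S_def)
  also have "... = (SUM P:S. enat (e P + c P))" using ebc Sf(2) by(intro sum.cong) auto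
  also have "... = enat (SUM P:S. e P + c P)" by(induction S rule: infinite_finite_induct) (auto simp: zero_enat_def)
  finally show ?thesis by(simp add: sum.distrib)
 qed
 moreover have "0 < sum c S"
 proof -
  obtain P where P: "P:cpts C" "!!w. w ~= 0 ==> \<omega> P ~= w ** P" using invertibleI ng by blast
  have "P:S" using P v(2) by(auto simp: S_def vO_def)
  moreover have "0 < c P"
  proof(rule ccontr)
   assume "~ 0 < c P"
   hence "qdK (\<omega> P) (w P ** P) = 0" using ebc[OF P(1)] by(simp add: zero_enat_def)
   hence "\<omega> P <= w P ** P" using kv.qd_eq_0[OF ksub_image[OF sB(2)[OF P(1)]]] by blast
   moreover have "w P ** P <= \<omega> P" using ok(1)[OF P(1)] submod_scale[OF lat_submod[OF lat_omega P(1)]] by(auto simp: mult.commute)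
   ultimately show False using P(2) ok(2)[OF P(1)] by blast
  qed
  ultimately show ?thesis using Sf(1) by(metis bot_nat_0.not_eq_extremum sum_eq_0_iff)
 qed
 ultimately show ?thesis using gC(3) by linarith
qed

lemma lin_normal_iff: "linearly_normal em C \<omega> \<longleftrightarrow> H0 ls.CX (ls.tw 1) = VV"
proof -
 have sub: "VV <= H0 ls.CX (ls.tw 1)" using ls.coord_H0[of 1] coord_1[OF V_subspace] by simp
 have "h0 em ls.CX (ls.tw 1) = enat gC \<longleftrightarrow> H0 ls.CX (ls.tw 1) = VV"
 proof
  assume h: "h0 em ls.CX (ls.tw 1) = enat gC"
  show "H0 ls.CX (ls.tw 1) = VV"
   by(rule kv.subspace_eq_of_qd[OF V_subspace ls.cx.H0_subspace[OF ls.fam_tw] sub, symmetric]) (use h gC(1) in "auto simp: h0_def")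
 qed (simp add: h0_def gC(1))
 thus ?thesis unfolding linearly_normal_def canonical_model_eq gC(2) .
qed

lemma proj_normal_iff: "projectively_normal em C \<omega> \<longleftrightarrow> (ALL n>=1. coord_ring_part em VV n = H0 ls.CX (ls.tw n))"
 unfolding projectively_normal_def canonical_model_eq ..

lemma proj_lin: "projectively_normal em C \<omega> ==> linearly_normal em C \<omega>"
 unfolding proj_normal_iff lin_normal_iff using coord_1[OF V_subspace] by(metis order_refl)

lemma not_gorenstein:
 assumes ng: "~ gorenstein C \<omega>"
 shows "h1 em ls.CX (ls.tw 1) = 0" "linearly_normal em C \<omega> \<longleftrightarrow> ls.deg + 1 = gC + ls.g'" "linearly_normal em C \<omega> ==> projectively_normal em C \<omega>"
proof -
 obtain v where v: "v:VV" "v ~= 0" by(rule V_ne)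
 note rr = ls.riemann_roch[of 1]
 have gle: "enat gC <= h0 em ls.CX (ls.tw 1)" using ls.coord_le_h0[of 1] coord_1[OF V_subspace] gC(1) by simp
 obtain k where k: "h1 em ls.CX (ls.tw 1) = enat k" using ls.h1_tw_le[of 1] by(cases "h1 em ls.CX (ls.tw 1)") auto
 obtain h where h: "h0 em ls.CX (ls.tw 1) = enat h" using rr k by(cases "h0 em ls.CX (ls.tw 1)") auto
 have hr: "h + ls.g' = 1 + ls.deg + k" using rr unfolding h k by simp
 have gh: "gC <= h" using gle h by simp
 note d = degree_not_gorenstein[OF ng]
 show h1z: "h1 em ls.CX (ls.tw 1) = 0"
 proof(rule ccontr)
  assume nz: "h1 em ls.CX (ls.tw 1) ~= 0"
  have vR: "v ** R <= ls.tw 1 R" if R: "R:cpts ls.CX" for R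
   using ls.tw_mult[OF ls.closed_in[OF R] ls.V_coord[OF v(1)], of _ 0] ls.tw_0[OF ls.closed_in[OF R]] by auto
  have "h0 em ls.CX (ls.tw 1) + h1 em ls.CX (ls.tw 1) <= enat (ls.g' + 1)"
   by(rule ls.clifford_scaled[OF v ls.fam_tw ls.tw_submod[OF ls.closed_in] vR _ nz]) (use ls.tw_not_Z[OF _ _ v, of _ 1] in auto)
  hence "h + k <= ls.g' + 1" unfolding h k by simp
  thus False using hr gh d by linarith
 qed
 hence "k = 0" using k by(simp add: zero_enat_def)
 have e: "linearly_normal em C \<omega> \<longleftrightarrow> h = gC" unfolding linearly_normal_def canonical_model_eq gC(2) h by simp
 show l: "linearly_normal em C \<omega> \<longleftrightarrow> ls.deg + 1 = gC + ls.g'" unfolding e using hr `k = 0` by linarith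
 assume ln: "linearly_normal em C \<omega>"
 hence "ls.g' + 2 <= gC" using l d by linarith
 hence "coord_ring_part em VV n = H0 ls.CX (ls.tw n)" if "1 <= n" for n
  using ls.normal_generation[OF _ h1z _ that] ln gC(1) unfolding lin_normal_iff by simp
 thus "projectively_normal em C \<omega>" unfolding proj_normal_iff by blast
qed

end

section \<open>Pencils from multiplication by an adele\<close>

context ground begin

lemma pw_mult: "prods (pw x a (Suc p)) (pw x b (Suc q)) = pw x (a*b) (Suc (p + q))"
proof
 show "prods (pw x a (Suc p)) (pw x b (Suc q)) <= pw x (a*b) (Suc (p + q))"
 proof(rule prods_least[OF pw_subspace])
  fix u t assume u: "u:pw x a (Suc p)" and t: "t:pw x b (Suc q)"
  have "a*x^i*t:pw x (a*b) (Suc (p + q))" if i: "i < Suc p" for i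
  proof -
   have "pw x b (Suc q) <= {t. a*x^i*t:pw x (a*b) (Suc (p + q))}"
   proof(rule pw_least[OF subspace_preimage_mult(1)[OF pw_subspace]], rule CollectI)
    fix j assume j: "j < Suc q"
    have e: "a*x^i*(b*x^j) = a*b*x^(i + j)" by(simp add: power_add mult_ac)
    show "a*x^i*(b*x^j):pw x (a*b) (Suc (p + q))" unfolding e by(rule pw_base) (use i j in simp)
   qed
   thus ?thesis using t by blast
  qed
  hence "pw x a (Suc p) <= {u. u*t:pw x (a*b) (Suc (p + q))}" by(intro pw_least[OF subspace_preimage_mult(2)[OF pw_subspace]]) blast
  thus "u*t:pw x (a*b) (Suc (p + q))" using u by blast
 qed
 show "pw x (a*b) (Suc (p + q)) <= prods (pw x a (Suc p)) (pw x b (Suc q))"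
 proof(rule pw_least[OF prods_subspace])
  fix i assume i: "i < Suc (p + q)"
  have e: "a*b*x^i = (a*x^min i p)*(b*x^(i - min i p))" by(simp add: mult_ac power_add[symmetric])
  show "a*b*x^i:prods (pw x a (Suc p)) (pw x b (Suc q))"
   unfolding e by(intro prods_base pw_base) (use i in auto)
 qed
qed

lemma pw_scale: "c ** pw x b n = pw x (c*b) n" if c: "c ~= 0"
proof
 have "pw x b n <= {y. c*y:pw x (c*b) n}"
  by(rule pw_least[OF subspace_preimage_mult(1)[OF pw_subspace]]) (simp add: pw_base mult.assoc[symmetric])
 thus "c ** pw x b n <= pw x (c*b) n" by blast
 show "pw x (c*b) n <= c ** pw x b n"
  by(rule pw_least[OF ksub_image[OF pw_subspace]]) (auto simp: mult.assoc intro: pw_base)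
qed

lemma pw_1: "pw x b (Suc 0) = b ** range em"
proof
 show "pw x b (Suc 0) <= b ** range em"
  by(rule pw_least[OF ksub_image[OF subring_subspace[OF range_subring order_refl]]]) (use subring_1[OF range_subring] in auto)
 show "b ** range em <= pw x b (Suc 0)"
  using ksub_scale[OF pw_subspace pw_base[of 0 "Suc 0" b x]] by(auto simp: mult.commute)
qed

end

context linsys begin

text \<open>The Hilbert function 1 + n d' attains the general upper bound for h0(O(n)).\<close>
lemma rational_normal:
 assumes V: "V = pw x w (Suc m)" and x: "x ~: range em" and w: "w ~= 0"
 shows "H0 CX (tw n) = Vn n"
proof -
 have Vn: "Vn n = pw x (w^n) (Suc (n*m))" for n
 proof(induction n)
  case 0 show ?case by(simp add: coord_0 pw_1)
 next
  case (Suc n)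
  show ?case unfolding coord_Suc Suc unfolding V pw_mult by(simp add: add.commute mult.commute)
 qed
 hence Dn: "D n = Suc (n*m)" for n using D[of n] pw_dim[OF x, of "w^n"] w by simp
 have "deg = m"
 proof -
  obtain c :: int and N where c: "ALL n>=N. int (D n) = int deg*int n + c" using D_linear by blast
  have "ALL n>=0. int (D n) = int m*int n + 1" by(simp add: Dn)
  from linear_slope_unique[OF c this] show ?thesis .
 qed
 obtain v where v: "v:V" "v ~= 0" by(rule nonzero_elem)
 have "h0 em CX (tw n) <= enat (D n)" using h0_tw_bound[OF v degree_eq[OF v], of n] `deg = m` by(simp add: Dn)
 thus ?thesis unfolding h0_def
  by(intro kv.subspace_eq_of_qd[OF coord_subspace cx.H0_subspace[OF fam_tw] coord_H0, symmetric]) (simp_all add: D)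
qed

end

context dcurve begin

lemma killed_coboundary:
 assumes F: "lat F" and u: "u:AC" and z: "!!c. c:Hm F ==> tr (cc.ascale c u) = 0"
 shows "u:cob C F"
proof(rule ccontr)
 assume "u ~: cob C F"
 then obtain f where f: "ka.lin_on UNIV f" "!!w. w:cob C F ==> f w = 0" "f u = 1"
  using ka.functional_separate[OF cc.cob_subspace[OF lat_fam[OF F]]] by metis
 have "ka.lin_on AC f" using f(1) unfolding ka.lin_on_def by blast
 from ex1_implies_ex[OF duality[OF F this f(2)]] obtain c where "c:Hm F" "ALL r:AC. f r = tr (cc.ascale c r)" by blast
 thus False using z u f(3) by simp
qed

abbreviation kl :: "'K => 'K set" where "kl v == v ** range em"

lemma kl_subspace: "ksub (kl v)" by(rule ksub_image[OF subring_subspace[OF range_subring order_refl]])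
lemma kl_dim: "v ~= 0 ==> qdK (kl v) {0} = 1" using qd_mult[OF _ kv.subspace_single_0, of v "range em"] qd_range_k by simp

lemma kl_proper:
 assumes A: "ksub A" "kl v <= A" "A ~= kl v" and v: "v ~= 0" and f: "qdK A {0} < \<infinity>"
 shows "EX p. qdK A {0} = enat (Suc (Suc p))"
proof -
 obtain a where a: "qdK A {0} = enat a" using f by auto
 have "~ qdK A {0} <= 1" using kv.subspace_eq_of_qd[OF kl_subspace A(1,2)] A(3) kl_dim[OF v] by(auto simp: one_enat_def)
 hence "2 <= a" unfolding a by(simp add: one_enat_def)
 thus ?thesis using a by(metis Suc_le_D numeral_2_eq_2 Suc_le_mono)
qed

lemma local_sections: "(!!P. P:cpts C ==> c:v ** P) ==> c:kl v"
proof -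
 assume c: "!!P. P:cpts C ==> c:v ** P"
 obtain P0 where P0: "P0:cpts C" using closed_ne by blast
 show "c:kl v"
 proof(cases "v = 0")
  case True thus ?thesis using c[OF P0] by(auto intro!: image_eqI[of _ _ "em 0"])
 next
  case False
  have "c/v:P" if P: "P:cpts C" for P using c[OF P] False by auto
  hence "c/v:range em" unfolding H0_O[symmetric] cc.H0_eq[OF lat_fam[OF lat_O]] by blast
  moreover have "c = v*(c/v)" using False by simp
  ultimately show ?thesis by blast
 qed
qed

text \<open>Multiplication by \<beta> acts on the space V modulo v. An annihilating polynomial of minimal degree for a
  vector s0 has a root because k is algebraically closed, and the complementary factor sends s0 to an
  eigenvector.\<close>
lemma adele_eigenvector:
 assumes v: "v:VV" "v ~= 0" and \<beta>: "!!P. P:cpts C ==> \<beta> P:P"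
  and T: "!!s. s:VV ==> EX z:VV. ALL P:cpts C. s*\<beta> P - z:v ** P"
 shows "EX a. EX s:VV. s ~: kl v & (ALL P:cpts C. (\<beta> P - em a)*s:v ** P)"
proof -
 let ?J = "%P. v ** P"
 have J: "submod P (?J P)" if "P:cpts C" for P by(rule submod_image[OF submod_self[OF closed_ring[OF that]]])
 have Jd: "x - y:?J P" if "P:cpts C" "x:?J P" "y:?J P" for P x y by(rule submod_diff[OF closed_ring[OF that(1)] J[OF that(1)] that(2,3)])
 have klJ: "x:?J P" if "x:kl v" "P:cpts C" for x P using that closed_range by blast
 have klV: "kl v <= VV" using ksub_scale[OF V_subspace v(1)] by(auto simp: mult.commute)
 have "VV ~= kl v"
 proof
  assume "VV = kl v"
  hence "enat gC = 1" using kl_dim[OF v(2)] gC(1) by simp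
  thus False using gC(3) by(simp add: one_enat_def)
 qed
 then obtain s0 where s0: "s0:VV" "s0 ~: kl v" using klV by blast
 have evz: "EX z:VV. ALL P:cpts C. ev q (\<beta> P)*s0 - z:?J P" for q
 proof(induction q)
  case 0
  have "0:?J P" if "P:cpts C" for P using submod_0[OF J[OF that]] .
  thus ?case using ksub_0[OF V_subspace] by(intro bexI[of _ 0]) auto
 next
  case (pCons a q)
  then obtain z where z: "z:VV" "!!P. P:cpts C ==> ev q (\<beta> P)*s0 - z:?J P" by blast
  obtain z' where z': "z':VV" "!!P. P:cpts C ==> z*\<beta> P - z':?J P" using T[OF z(1)] by blast
  have "ev (pCons a q) (\<beta> P)*s0 - (em a*s0 + z'):?J P" if P: "P:cpts C" for P
  proof -
   have e: "ev (pCons a q) (\<beta> P)*s0 - (em a*s0 + z') = \<beta> P*(ev q (\<beta> P)*s0 - z) + (z*\<beta> P - z')" by(simp add: ev_pCons algebra_simps)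
   show ?thesis unfolding e by(rule submod_add[OF J[OF P] submod_scale[OF J[OF P] \<beta>[OF P] z(2)[OF P]] z'(2)[OF P]])
  qed
  moreover have "em a*s0 + z':VV" by(rule ksub_add[OF V_subspace ksub_scale[OF V_subspace s0(1)] z'(1)])
  ultimately show ?case by blast
 qed
 define Q where "Q = (%q. q ~= 0 & (ALL P:cpts C. ev q (\<beta> P)*s0:?J P))"
 have "EX q. Q q"
 proof -
  have "EX z. z:VV & (ALL P:cpts C. ev (monom 1 i) (\<beta> P)*s0 - z:?J P)" for i :: nat using evz[of "monom 1 i"] by blast
  then obtain z where z: "!!i :: nat. z i:VV & (ALL P:cpts C. ev (monom 1 i) (\<beta> P)*s0 - z i:?J P)" by metis
  have "EX a. (EX i<=gC. a i ~= 0) & (SUM i<=gC. em (a i)*z i):{0}" by(rule kv.qd_dependent_seq[OF gC(1)]) (use z in auto)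
  then obtain a where a: "EX i<=gC. a i ~= 0" "(SUM i<=gC. em (a i)*z i) = 0" by blast
  \<comment> \<open>The relation among the g + 1 vectors that represent the powers of \<beta> applied to s0.\<close>
  define q where "q = (SUM i<=gC. monom (a i) i)"
  have co: "coeff q i = a i" if "i <= gC" for i unfolding q_def coeff_sum coeff_monom using that by simp
  have "q ~= 0" using a(1) co by(metis coeff_0)
  moreover have "ev q (\<beta> P)*s0:?J P" if P: "P:cpts C" for P
  proof -
   have "ev q (\<beta> P)*s0 = (SUM i<=gC. em (a i)*(ev (monom 1 i) (\<beta> P)*s0 - z i)) + (SUM i<=gC. em (a i)*z i)"
    unfolding q_def ev_sum_monom ev_monom by(simp add: sum_distrib_right right_diff_distrib sum_subtractf mult.assoc)
   also have "... = (SUM i<=gC. em (a i)*(ev (monom 1 i) (\<beta> P)*s0 - z i))" using a(2) by simp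
   also have "... : ?J P" by(rule submod_sum[OF J[OF P]], rule submod_scale[OF J[OF P]]) (use closed_range[OF P] z P in blast)+
   finally show ?thesis .
  qed
  ultimately show ?thesis unfolding Q_def by blast
 qed
 then obtain q where q: "Q q" "!!q'. Q q' ==> degree q <= degree q'" using ex_has_least_nat[of Q _ degree] by blast
 have "degree q ~= 0"
 proof
  assume "degree q = 0"
  then obtain a where a: "q = [:a:]" using degree_eq_zeroE by blast
  hence "a ~= 0" using q(1) by(simp add: Q_def)
  have "em a*s0:kl v" by(rule local_sections) (use q(1) a in "simp add: Q_def ev_pCons")
  hence "em (inverse a)*(em a*s0):kl v" by(rule ksub_scale[OF kl_subspace])
  thus False using s0(2) `a ~= 0` by(simp add: i_inverse mult.assoc[symmetric])
 qed
 then obtain a where "poly q a = 0" using alg_closed_imp_poly_has_root[of q] by auto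
 then obtain q' where q': "q = [:- a, 1:]*q'" unfolding poly_eq_0_iff_dvd by(elim dvdE)
 have "q' ~= 0" using q(1) q' by(auto simp: Q_def)
 hence "degree q = Suc (degree q')" unfolding q' by(subst degree_mult_eq) auto
 hence "~ Q q'" using q(2)[of q'] by linarith
 obtain s where s: "s:VV" "!!P. P:cpts C ==> ev q' (\<beta> P)*s0 - s:?J P" using evz[of q'] by blast
 have "s ~: kl v"
 proof
  assume k: "s:kl v"
  have "ev q' (\<beta> P)*s0:?J P" if P: "P:cpts C" for P
   using submod_add[OF J[OF P] s(2)[OF P] klJ[OF k P]] by simp
  thus False using `~ Q q'` `q' ~= 0` unfolding Q_def by blast
 qed
 moreover have "(\<beta> P - em a)*s:?J P" if P: "P:cpts C" for P
 proof -
  have h: "ev q (\<beta> P) = (\<beta> P - em a)*ev q' (\<beta> P)" unfolding q' ev_mult by(simp add: ev_pCons i_neg)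
  have e: "(\<beta> P - em a)*s = ev q (\<beta> P)*s0 - (\<beta> P - em a)*(ev q' (\<beta> P)*s0 - s)" unfolding h by(simp add: algebra_simps)
  have bP: "\<beta> P - em a:P" using subring_diff[OF closed_ring[OF P] \<beta>[OF P]] closed_range[OF P] by blast
  show ?thesis unfolding e by(rule Jd[OF P _ submod_scale[OF J[OF P] bP s(2)[OF P]]]) (use q(1) P in "simp add: Q_def")
 qed
 ultimately show ?thesis using s(1) by blast
qed

text \<open>The kernel A and the image I of b on V modulo v, both taken to contain v, satisfy A I \<subseteq> v V, and
  dim A + dim I - 1 = dim V. So Hopf's inequality is an equality.\<close>
lemma multiplication_pencil:
 assumes v: "v:VV" "v ~= 0" and b: "!!P. P:cpts C ==> b P:P"
  and T: "!!s. s:VV ==> EX z:VV. ALL P:cpts C. b P*s - z:v ** P"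
  and s1: "s1:VV" "s1 ~: kl v" "!!P. P:cpts C ==> b P*s1:v ** P"
  and s2: "s2:VV" "EX P:cpts C. b P*s2 ~: v ** P"
 shows "EX x w. x ~: range em & w ~= 0 & VV = pw x w gC"
proof -
 define J' where "J' P = v ** P" for P
 note T = T[folded J'_def] and s1 = s1(1,2) s1(3)[folded J'_def] and s2 = s2[folded J'_def]
 have J: "submod P (J' P)" if "P:cpts C" for P unfolding J'_def by(rule submod_image[OF submod_self[OF closed_ring[OF that]]])
 have Js: "ksub (J' P)" if "P:cpts C" for P by(rule submod_subspace[OF J[OF that] closed_range[OF that]])
 have klJ: "x:J' P" if "x:kl v" "P:cpts C" for x P using that closed_range unfolding J'_def by blast
 have klV: "kl v <= VV" using ksub_scale[OF V_subspace v(1)] by(auto simp: mult.commute)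
 define A where "A = {s:VV. ALL P:cpts C. b P*s:J' P}"
 define I where "I = {z:VV. EX s:VV. ALL P:cpts C. b P*s - z:J' P}"
 have As: "ksub A"
 proof(rule kv.subspaceI)
  show "0:A" unfolding A_def using ksub_0[OF V_subspace] ksub_0[OF Js] by simp
  show "x + y:A" if "x:A" "y:A" for x y
   using that ksub_add[OF V_subspace] ksub_add[OF Js] unfolding A_def by(simp add: distrib_left)
  show "em c*x:A" if x: "x:A" for c x
  proof -
   have e: "b P*(em c*x) = em c*(b P*x)" for P by(simp add: mult_ac)
   have "b P*(em c*x):J' P" if P: "P:cpts C" for P
    unfolding e by(rule ksub_scale[OF Js[OF P]]) (use x P in "simp add: A_def")
   moreover have "em c*x:VV" by(rule ksub_scale[OF V_subspace]) (use x in "simp add: A_def")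
   ultimately show ?thesis unfolding A_def by blast
  qed
 qed
 have Is: "ksub I"
 proof(rule kv.subspaceI)
  show "0:I" unfolding I_def using ksub_0[OF V_subspace] ksub_0[OF Js] by(intro CollectI conjI bexI[of _ 0] ballI) simp_all
  show "x + y:I" if xy: "x:I" "y:I" for x y
  proof -
   obtain s t where st: "s:VV" "t:VV" "!!P. P:cpts C ==> b P*s - x:J' P" "!!P. P:cpts C ==> b P*t - y:J' P"
    using xy unfolding I_def by blast
   have e: "b P*(s + t) - (x + y) = (b P*s - x) + (b P*t - y)" for P by(simp add: algebra_simps)
   have "b P*(s + t) - (x + y):J' P" if "P:cpts C" for P
    unfolding e by(rule ksub_add[OF Js[OF that] st(3,4)[OF that]])
   moreover have "s + t:VV" "x + y:VV" using ksub_add[OF V_subspace] st(1,2) xy by(simp_all add: I_def)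
   ultimately show ?thesis unfolding I_def by blast
  qed
  show "em c*x:I" if x: "x:I" for c x
  proof -
   obtain s where st: "s:VV" "!!P. P:cpts C ==> b P*s - x:J' P" using x unfolding I_def by blast
   have e: "b P*(em c*s) - em c*x = em c*(b P*s - x)" for P by(simp add: algebra_simps)
   have "b P*(em c*s) - em c*x:J' P" if "P:cpts C" for P
    unfolding e by(rule ksub_scale[OF Js[OF that] st(2)[OF that]])
   moreover have "em c*s:VV" "em c*x:VV" using ksub_scale[OF V_subspace] st(1) x by(simp_all add: I_def)
   ultimately show ?thesis unfolding I_def by blast
  qed
 qed
 have AV: "A <= VV" and IV: "I <= VV" by(auto simp: A_def I_def)
 have klA: "kl v <= A" unfolding A_def using klV submod_scale[OF J b klJ] by blast
 have klI: "kl v <= I"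
 proof
  fix z assume z: "z:kl v"
  have "b P*0 - z:J' P" if P: "P:cpts C" for P using kv.subspace_neg[OF Js[OF P] klJ[OF z P]] by simp
  thus "z:I" unfolding I_def using z klV ksub_0[OF V_subspace] by blast
 qed
 have "s1:A" using s1 by(simp add: A_def)
 hence Ane: "A ~= kl v" using s1(2) by blast
 have Ine: "I ~= kl v"
 proof
  assume I: "I = kl v"
  obtain z where z: "z:VV" "!!P. P:cpts C ==> b P*s2 - z:J' P" using T[OF s2(1)] by blast
  hence "z:kl v" using s2(1) I unfolding I_def by blast
  hence "(b P*s2 - z) + z:J' P" if P: "P:cpts C" for P
   using ksub_add[OF Js[OF P] z(2)[OF P] klJ] P by blast
  thus False using s2(2) by simp
 qed
 have finA: "qdK A {0} < \<infinity>" "qdK I {0} < \<infinity>"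
  using kv.qd_mono[OF AV order_refl] kv.qd_mono[OF IV order_refl] V_finite by(metis order.strict_trans1)+
 obtain p where p: "qdK A {0} = enat (Suc (Suc p))" using kl_proper[OF As klA Ane v(2) finA(1)] by blast
 obtain q where q: "qdK I {0} = enat (Suc (Suc q))" using kl_proper[OF Is klI Ine v(2) finA(2)] by blast
 obtain f where f: "!!s. s:VV ==> f s:VV & (ALL P:cpts C. b P*s - f s:J' P)" using T by metis
 have VA: "qdK VV A <= qdK I (kl v)"
 proof(rule qd_le_relation[OF vspK vspK, where f=f])
  show "f x:I" if "x:VV" for x using f[OF that] that unfolding I_def by blast
  show "0:kl v" by(rule ksub_0[OF kl_subspace])
  fix B a assume B: "finite B" "B <= VV" "(SUM s:B. em (a s)*f s):kl v"
  have "b P*(SUM s:B. em (a s)*s):J' P" if P: "P:cpts C" for P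
  proof -
   have e: "b P*(SUM s:B. em (a s)*s) = (SUM s:B. em (a s)*(b P*s - f s)) + (SUM s:B. em (a s)*f s)"
    by(simp add: sum_distrib_left right_diff_distrib sum_subtractf mult_ac)
   show ?thesis unfolding e
    by(intro ksub_add[OF Js[OF P] ksub_sum[OF Js[OF P]] klJ[OF B(3) P]] ksub_scale[OF Js[OF P]]) (use f B(2) P in blast)
  qed
  moreover have "(SUM s:B. em (a s)*s):VV" by(intro ksub_sum[OF V_subspace] ksub_scale[OF V_subspace]) (use B(2) in blast)
  ultimately show "(SUM s:B. em (a s)*s):A" unfolding A_def by blast
 qed
 have "qdK I {0} = qdK I (kl v) + qdK (kl v) {0}" by(rule kv.qd_add) (use Is kl_subspace klI ksub_0[OF kl_subspace] in auto)
 hence ikl: "qdK I (kl v) = enat (Suc q)" unfolding q kl_dim[OF v(2)] by(cases "qdK I (kl v)") (auto simp: one_enat_def)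
 have "qdK VV {0} = qdK VV A + qdK A {0}" by(rule kv.qd_add) (use As V_subspace AV ksub_0[OF As] in auto)
 hence gle: "gC <= p + q + 3" using VA unfolding gC(1) p ikl by(cases "qdK VV A") auto
 have prod: "prods A I <= v ** VV"
 proof(rule prods_least[OF ksub_image[OF V_subspace]])
  fix a z assume a: "a:A" and z: "z:I"
  obtain s where s: "s:VV" "!!P. P:cpts C ==> b P*s - z:J' P" using z unfolding I_def by blast
  have "a*z/v:\<omega> P" if P: "P:cpts C" for P
  proof -
   have M: "submod P (\<omega> P)" by(rule lat_submod[OF lat_omega P])
   have "b P*a:J' P" using a P unfolding A_def by blast
   then obtain t where t: "b P*a = v*t" "t:P" unfolding J'_def by blast
   obtain r where r: "b P*s - z = v*r" "r:P" using s(2)[OF P] unfolding J'_def by blast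
   have "a*z = a*(b P*s) - a*(b P*s - z)" by(simp add: algebra_simps)
   also have "... = v*(t*s - r*a)" unfolding r(1) using t(1) by(simp add: algebra_simps)
   finally have e: "a*z/v = t*s - r*a" using v(2) by simp
   have sa: "s:\<omega> P" "a:\<omega> P" using s(1) a AV P unfolding V_iff by(auto simp: V_iff)
   show ?thesis unfolding e
    by(rule submod_diff[OF closed_ring[OF P] M submod_scale[OF M t(2) sa(1)] submod_scale[OF M r(2) sa(2)]])
  qed
  hence "a*z/v:VV" unfolding V_iff by blast
  moreover have "a*z = v*(a*z/v)" using v(2) by simp
  ultimately show "a*z:v ** VV" by blast
 qed
 have dv: "qdK (v ** VV) {0} = enat gC" using qd_mult[OF v(2) kv.subspace_single_0, of VV] gC(1) by simp
 have pl: "qdK (prods A I) {0} <= enat gC" unfolding dv[symmetric] by(rule kv.qd_mono[OF prod order_refl])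
 hence "qdK (prods A I) {0} <= enat (p + q + 3)" using gle by(meson enat_ord_simps(1) order.trans)
 from equality_in_hopf[OF As p Is q this] obtain w x where wx: "w ~= 0" "x ~: range em" "prods A I = pw x w (p + q + 3)" by blast
 hence g: "gC = p + q + 3" using pl gle pw_dim[OF wx(2,1), of "p + q + 3"] by simp
 have "prods A I = v ** VV"
  by(rule kv.subspace_eq_of_qd[OF prods_subspace ksub_image[OF V_subspace] prod]) (use wx(3) pw_dim[OF wx(2,1)] g dv in auto)
 hence "inverse v ** v ** VV = inverse v ** pw x w gC" using wx(3) g by simp
 hence "VV = pw x (inverse v*w) gC" unfolding image_mult_assoc using v(2) pw_scale[of "inverse v"] by simp
 thus ?thesis using wx v(2) by(intro exI[of _ x] exI[of _ "inverse v*w"]) simp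
qed

end

section \<open>Gorenstein curves\<close>

locale dgor = dcurve em C \<omega> for em :: "'k::alg_closed_field => 'K::field" and C :: "'K set set" and \<omega> :: "'K set => 'K set" +
 assumes gor: "gorenstein C \<omega>"
begin

lemma local_generator:
 assumes P: "P:cpts C"
 shows "EX w. w:VV & w ~= 0 & \<omega> P = w ** P"
proof -
 have PC: "P:C" "P ~= UNIV" using closed_pt[OF P] by auto
 note R = closed_ring[OF P]
 obtain T u where u: "u ~= 0" "T <= P" "ALL Q:C. T <= Q --> \<omega> Q = (%x. x*u) ` Q"
  using bspec[OF gor[unfolded gorenstein_def invertible_def] PC(1)] by(elim exE conjE) (rule that)
 have uP: "\<omega> P = u ** P" using bspec[OF u(3) PC(1)] u(2) by(simp add: mult.commute)
 have "~ VV <= u ** nu P"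
 proof
  assume "VV <= u ** nu P"
  hence "\<omega> P <= u ** nu P" unfolding omega_generated[OF P, symmetric]
   by(rule lin_span_submod[OF submod_image[OF rat_nonunits_submod[OF point_rat_ring[OF PC]]]])
  moreover have "u*1:\<omega> P" unfolding uP using subring_1[OF R] by blast
  ultimately have "1:nu P" using u(1) by auto
  thus False using subring_1[OF R] by(simp add: nonunits_def)
 qed
 then obtain v where v: "v:VV" "v ~: u ** nu P" by blast
 hence "v:\<omega> P" using P by(simp add: V_iff)
 then obtain p where p: "v = u*p" "p:P" unfolding uP by blast
 have "p ~: nu P" using v(2) p(1) by blast
 hence ip: "p ~= 0" "inverse p:P" using p(2) by(auto simp: nonunits_def)
 have "u*x = v*(inverse p*x)" for x unfolding p(1) using ip(1) by simp
 hence "u ** P <= v ** P" using subring_mult[OF R ip(2)] by blast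
 moreover have "v ** P <= u ** P" unfolding p(1) using subring_mult[OF R p(2)] by(auto simp: mult.assoc)
 ultimately show ?thesis using v(1) p(1) ip(1) u(1) uP by(intro exI[of _ v]) auto
qed

text \<open>A generator of \<omega> at P; it may be taken from V because V generates \<omega>.\<close>
definition wp :: "'K set => 'K" where "wp P = (SOME w. w:VV & w ~= 0 & \<omega> P = w ** P)"

lemma wp: assumes "P:cpts C" shows "wp P:VV" "wp P ~= 0" "\<omega> P = wp P ** P"
 using someI_ex[OF local_generator[OF assms], folded wp_def] by auto

text \<open>The power \<omega>^n, also for negative n.\<close>
definition Om :: "int => 'K set => 'K set" where
 "Om n P = (if P:cpts C then {x. x*wp P powi (- n):P} else UNIV)"

lemma Om_iff: "P:cpts C ==> x:Om n P \<longleftrightarrow> x*wp P powi (- n):P" by(simp add: Om_def)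

lemma powi_cancel: "P:cpts C ==> wp P powi n*wp P powi (- n) = 1"
 using wp(2) by(simp add: power_int_minus)

lemma Om_mult: assumes P: "P:cpts C" and x: "x:Om m P" and y: "y:Om n P" shows "x*y:Om (m + n) P"
proof -
 have "wp P powi (- (m + n)) = wp P powi (- m)*wp P powi (- n)" using power_int_add[of "wp P" "- m" "- n"] wp(2)[OF P] by simp
 hence e: "x*y*wp P powi (- (m + n)) = (x*wp P powi (- m))*(y*wp P powi (- n))" by(simp add: mult_ac)
 show ?thesis using x y subring_mult[OF closed_ring[OF P]] unfolding Om_iff[OF P] e by blast
qed

lemma Om_0: "P:cpts C ==> Om 0 P = P" by(auto simp: Om_def)

lemma Om_1: assumes P: "P:cpts C" shows "Om 1 P = \<omega> P"
proof -
 have "x*inverse (wp P):P \<longleftrightarrow> x:wp P ** P" for x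
  using wp(2)[OF P] by(auto simp: image_iff field_simps intro!: bexI[of _ "x*inverse (wp P)"])
 thus ?thesis using P wp(3)[OF P] by(auto simp: Om_def power_int_minus)
qed

lemma Om_submod: assumes P: "P:cpts C" shows "submod P (Om n P)"
 unfolding submod_def using subring_add[OF closed_ring[OF P]] subring_mult[OF closed_ring[OF P]] subring_0[OF closed_ring[OF P]]
 by(auto simp: Om_iff[OF P] distrib_right mult.assoc)

lemma Om_diff: "P:cpts C ==> x:Om n P ==> y:Om n P ==> x - y:Om n P"
 using submod_diff[OF closed_ring Om_submod] by blast

lemma lat_Om: "lat (Om n)"
proof(rule lat_intro)
 show "Om n UNIV = UNIV" using closed_pt by(auto simp: Om_def)
 have "Om n P = P" if P: "P:cpts C" and e: "\<omega> P = P" for P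
 proof -
  note R = closed_ring[OF P]
  have w: "wp P:P" using wp(1)[OF P] P e V_iff by blast
  have "1:wp P ** P" using wp(3)[OF P] e subring_1[OF R] by simp
  then obtain p where p: "1 = wp P*p" "p:P" by blast
  have iw: "inverse (wp P):P" using p by(metis inverse_unique)
  have pw: "wp P powi k:P" for k unfolding power_int_def using subring_power[OF R w] subring_power[OF R iw] by simp
  have "x = (x*wp P powi (- n))*wp P powi n" for x using powi_cancel[OF P, of n] by(simp add: mult_ac)
  thus ?thesis using subring_mult[OF R] pw unfolding set_eq_iff Om_iff[OF P] by metis
 qed
 hence "{P:cpts C. Om n P ~= P} <= {P:cpts C. \<omega> P ~= P}" by blast
 thus "finite {P:cpts C. Om n P ~= P}" using lat_omega finite_subset unfolding lat_def by blast
 fix P assume P: "P:cpts C"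
 show "submod P (Om n P)" by(rule Om_submod[OF P])
 have c: "wp P powi n*wp P powi (- n) = 1" by(rule powi_cancel[OF P])
 have "x = wp P powi n*(x*wp P powi (- n))" "wp P powi n*x*wp P powi (- n) = x" for x using c by(simp_all add: mult_ac)
 hence "(wp P powi n) ** P = Om n P" unfolding set_eq_iff image_iff Om_iff[OF P] by metis
 thus "EX z y. z ~= 0 & z ** P <= Om n P & Om n P <= y ** P"
  using wp(2)[OF P] by(intro exI[of _ "wp P powi n"]) auto
qed

abbreviation "HOm n == H0 C (Om n)"

lemma HOm_iff: "x:HOm n \<longleftrightarrow> (ALL P:cpts C. x:Om n P)" using cc.H0_eq[OF lat_fam[OF lat_Om]] by simp

lemma HOm_0: "HOm 0 = range em" unfolding H0_O[symmetric] cc.H0_eq[OF lat_fam[OF lat_Om]] cc.H0_eq[OF lat_fam[OF lat_O]] using Om_0 by auto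
lemma HOm_1: "HOm 1 = VV" unfolding set_eq_iff HOm_iff V_iff using Om_1 by simp
lemma HOm_mult: "x:HOm m ==> y:HOm n ==> x*y:HOm (m + n)" unfolding HOm_iff using Om_mult by blast
lemma V_Om: "s:VV ==> P:cpts C ==> s:Om 1 P" using Om_1 V_iff by blast

lemma Hm_Om: "Hm (Om n) = HOm (1 - n)"
proof
 show "Hm (Om n) <= HOm (1 - n)"
 proof(intro subsetI, unfold HOm_iff, intro ballI)
  fix c P assume c: "c:Hm (Om n)" and P: "P:cpts C"
  have "wp P powi n:Om n P" unfolding Om_iff[OF P] powi_cancel[OF P] by(rule subring_1[OF closed_ring[OF P]])
  hence "c*wp P powi n:Om 1 P" using c P Om_1[OF P] unfolding Hm_def by blast
  moreover have "wp P powi (- n):Om (- n) P" using powi_cancel[OF P, of "- n"] subring_1[OF closed_ring[OF P]] by(simp add: Om_iff[OF P])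
  ultimately have "c*wp P powi n*wp P powi (- n):Om (1 + - n) P" by(rule Om_mult[OF P])
  thus "c:Om (1 - n) P" using powi_cancel[OF P, of n] by(simp add: mult.assoc)
 qed
 show "HOm (1 - n) <= Hm (Om n)"
 proof
  fix c assume c: "c:HOm (1 - n)"
  have "c*x:\<omega> P" if "P:cpts C" "x:Om n P" for P x
   using Om_mult[OF that(1), of c "1 - n" x n] c that Om_1[OF that(1)] unfolding HOm_iff by simp
  thus "c:Hm (Om n)" unfolding Hm_def by blast
 qed
qed

lemma HOm_negative:
 assumes n: "n < 0" and c: "c:HOm n" shows "c = 0"
proof(rule ccontr)
 assume c0: "c ~= 0"
 define k where "k = nat (- n) - 1"
 have k: "n + int (Suc k) = 0" using n by(simp add: k_def)
 obtain v u where uv: "u:VV" "v:VV" "v ~= 0" "u/v ~: range em" using ls.Vt by blast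
 have pow: "v^j:HOm (int j)" for j
 proof(induction j)
  case 0 show ?case using HOm_0 subring_1[OF range_subring] by simp
 next
  case (Suc j) show ?case using HOm_mult[of v 1 "v^j" "int j"] Suc uv(2) HOm_1 by simp
 qed
 have "c*(v^k*x):range em" if "x:VV" for x
  using HOm_mult[OF c HOm_mult[OF pow[of k], of x 1]] that k unfolding HOm_1 HOm_0[symmetric] by(simp add: algebra_simps)
 from this[OF uv(1)] this[OF uv(2)] obtain a b where ab: "c*(v^k*u) = em a" "c*(v^k*v) = em b" by blast
 hence "u/v = em (a/b)" unfolding i_divide using c0 uv(3) by(simp add: ab[symmetric])
 thus False using uv(4) by blast
qed

text \<open>At a closed point P the generator of \<omega> also generates O(1) at the point of the model below
  P.\<close>
lemma sections_of_model: "H0 ls.CX (ls.tw n) <= HOm (int n)"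
proof(intro subsetI, unfold HOm_iff, intro ballI)
 fix z P assume z: "z:H0 ls.CX (ls.tw n)" and P: "P:cpts C"
 have PC: "P:C" "P ~= UNIV" using closed_pt[OF P] by auto
 obtain W where W: "VR W" "W ~= UNIV" "P <= W" "dominates W P" by(rule dominating_place[OF PC])
 have q: "v/wp P:P" if v: "v:VV" for v
 proof -
  have "v:\<omega> P" using v P V_iff by blast
  thus ?thesis unfolding wp(3)[OF P] using wp(2)[OF P] by auto
 qed
 have g: "ls.gen W (wp P)" unfolding ls.gen_def using wp(1,2)[OF P] q W(3) by blast
 have A: "ls.Av (wp P) <= P" unfolding ls.Av_def by(rule alg_gen_least[OF closed_ring[OF P] closed_range[OF P]]) (use q in blast)
 have RP: "ls.RW W <= P"
 proof
  fix x assume "x:ls.RW W"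
  then obtain a b where ab: "x = a/b" "a:ls.Av (wp P)" "b:ls.Av (wp P)" "b ~: nu W"
   unfolding ls.RW_eq_loc[OF W(1) g] loc_iff by blast
  have b: "b:P" "b ~: nu P" using ab A W(4) unfolding dominates_def by blast+
  hence "inverse b:P" by(auto simp: nonunits_def)
  thus "x:P" unfolding ab(1) divide_inverse using subring_mult[OF closed_ring[OF P]] ab(2) A by blast
 qed
 have "ls.RW W:cpts ls.CX" unfolding ls.CX_closed using W by blast
 hence "z:ls.tw n (ls.RW W)" using z unfolding ls.cx.H0_eq[OF ls.fam_tw] by blast
 then obtain r where r: "z = wp P^n*r" "r:P" unfolding ls.tw_gen[OF W(1) g] using RP by blast
 have "z*wp P powi (- int n) = r*(wp P powi int n*wp P powi (- int n))" unfolding r(1) by(simp add: mult_ac)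
 thus "z:Om (int n) P" unfolding Om_iff[OF P] powi_cancel[OF P] using r(2) by simp
qed

text \<open>Duality for \<omega>^{-n}: its dual H0(\<omega>^{n+1}) has V H0(\<omega>^n) as a proper subspace, so some
  adele \<xi> is no coboundary although V \<xi> pairs to zero with H0(\<omega>^n). The shift \<eta> of \<xi> by a
  constant adele is integral after multiplication with v.\<close>
lemma noether_obstruction:
 assumes n: "~ HOm (n + 1) <= prods (HOm n) VV" and v: "v:VV" "v ~= 0"
 obtains \<eta> where "!!s. s:VV ==> EX f. ALL P:cpts C. s*\<eta> P - f:Om (1 - n) P"
  "!!P. P:cpts C ==> v*\<eta> P:Om (1 - n) P"
  "!!m. EX s:VV. EX P:cpts C. s*(\<eta> P - m) ~: Om (1 - n) P"
proof -
 let ?F = "Om (- n)"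
 have hm: "Hm ?F = HOm (n + 1)" using Hm_Om[of "- n"] by(simp add: add.commute)
 interpret pr: pairing "%c x. em c*x" "%c r P. em c*r P" "Hm ?F" AC "cob C ?F" "%c r. tr (cc.ascale c r)"
  by(rule Hm_pairing[OF lat_Om])
 have sub: "prods (HOm n) VV <= Hm ?F" unfolding hm
  by(rule prods_least[OF cc.H0_subspace[OF lat_fam[OF lat_Om]]]) (use HOm_mult[of _ n _ 1] HOm_1 in blast)
 have "EX u:AC. u ~: cob C ?F & (ALL s:prods (HOm n) VV. tr (cc.ascale s u) = 0)"
  by(rule pr.proper_annihilated[OF _ prods_subspace sub]) (use n hm h0_finite[OF lat_Om, of "n + 1"] in "auto simp: h0_def")
 then obtain \<xi> where \<xi>: "\<xi> : AC" "\<xi> ~: cob C ?F" "!!s. s:prods (HOm n) VV ==> tr (cc.ascale s \<xi>) = 0" by blast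
 have cob: "EX f. ALL P:cpts C. s*\<xi> P - f:Om (1 - n) P" if s: "s:VV" for s
 proof -
  have "cc.ascale s \<xi> : cob C (Om (1 - n))"
  proof(rule killed_coboundary[OF lat_Om AC_scale[OF \<xi>(1)]])
   fix c assume "c:Hm (Om (1 - n))"
   hence "c:HOm n" using Hm_Om[of "1 - n"] by simp
   thus "tr (cc.ascale c (cc.ascale s \<xi>)) = 0" unfolding cc.ascale_ascale using \<xi>(3) prods_base s by blast
  qed
  thus ?thesis unfolding coboundaries_def cc.ascale_def by blast
 qed
 obtain m0 where m0: "!!P. P:cpts C ==> v*\<xi> P - m0:Om (1 - n) P" using cob[OF v(1)] by blast
 define \<eta> where "\<eta> = (%P. \<xi> P - m0/v)"
 show thesis
 proof(rule that[of \<eta>])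
  fix s assume "s:VV"
  then obtain f where f: "!!P. P:cpts C ==> s*\<xi> P - f:Om (1 - n) P" using cob by blast
  have "s*\<eta> P - (f - s*m0/v) = s*\<xi> P - f" for P by(simp add: \<eta>_def algebra_simps)
  thus "EX f. ALL P:cpts C. s*\<eta> P - f:Om (1 - n) P" using f by metis
 next
  have "v*\<eta> P = v*\<xi> P - m0" for P using v(2) by(simp add: \<eta>_def algebra_simps)
  thus "v*\<eta> P:Om (1 - n) P" if "P:cpts C" for P using m0[OF that] by simp
 next
  fix m
  show "EX s:VV. EX P:cpts C. s*(\<eta> P - m) ~: Om (1 - n) P"
  proof(rule ccontr)
   assume "~ ?thesis"
   hence z: "s*(\<eta> P - m):Om (1 - n) P" if "s:VV" "P:cpts C" for s P using that by blast
   have "\<xi> P - (m + m0/v):Om (- n) P" if P: "P:cpts C" for P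
   proof -
    have "inverse (wp P):Om (- 1) P" using wp(2)[OF P] subring_1[OF closed_ring[OF P]] by(simp add: Om_iff[OF P])
    from Om_mult[OF P this z[OF wp(1)[OF P] P]] have "inverse (wp P)*(wp P*(\<eta> P - m)):Om (- n) P" by simp
    moreover have "inverse (wp P)*(wp P*(\<eta> P - m)) = \<eta> P - m" using wp(2)[OF P] by(simp add: mult.assoc[symmetric])
    moreover have "\<eta> P - m = \<xi> P - (m + m0/v)" by(simp add: \<eta>_def)
    ultimately show ?thesis by(simp only:)
   qed
   hence "\<xi> : cob C ?F" unfolding coboundaries_def generic_point lat_adeles[OF lat_Om]
    using \<xi>(1) lat_Om[of "- n"] by(auto simp: lat_def)
   thus False using \<xi>(2) by blast
  qed
 qed
qed

text \<open>Each s \<in> V has a function f with s \<eta> - f integral, and if s1 \<eta> is itself integral then s1 f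
  \<in> H0(\<omega>^{2-n}). For n \<ge> 3 this group is zero. For n = 2 it is k, which leaves only dim V = 2. For n =
  1 it is V, so \<beta> = v \<eta> acts on V modulo v, and the shift of \<beta> by an eigenvalue has a kernel.\<close>
lemma noether_step:
 assumes nH: "~ (EX x w. x ~: range em & w ~= 0 & VV = pw x w gC)" and n: "1 <= n"
 shows "HOm (n + 1) <= prods (HOm n) VV"
proof(rule ccontr)
 assume not: "~ ?thesis"
 obtain v where v: "v:VV" "v ~= 0" by(rule V_ne)
 obtain \<eta> where \<eta>: "!!s. s:VV ==> EX f. ALL P:cpts C. s*\<eta> P - f:Om (1 - n) P"
  "!!P. P:cpts C ==> v*\<eta> P:Om (1 - n) P"
  "!!m. EX s:VV. EX P:cpts C. s*(\<eta> P - m) ~: Om (1 - n) P" using noether_obstruction[OF not v] by blast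
 define kil where "kil s \<longleftrightarrow> (ALL P:cpts C. s*\<eta> P:Om (1 - n) P)" for s
 define rep where "rep s f \<longleftrightarrow> (ALL P:cpts C. s*\<eta> P - f:Om (1 - n) P)" for s f
 have cross: "s'*f:HOm (2 - n)" if s': "s':VV" "kil s'" and s: "s:VV" "rep s f" for s' s f
 proof(unfold HOm_iff, intro ballI)
  fix P assume P: "P:cpts C"
  have e: "s'*f = s*(s'*\<eta> P) - s'*(s*\<eta> P - f)" by(simp add: algebra_simps)
  have "1 + (1 - n) = 2 - n" by simp
  thus "s'*f:Om (2 - n) P" unfolding e
   using Om_diff[OF P Om_mult[OF P V_Om[OF s(1) P], of _ "1 - n"] Om_mult[OF P V_Om[OF s'(1) P], of _ "1 - n"]] s' s P
   unfolding kil_def rep_def by metis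
 qed
 have kv: "kil v" using \<eta>(2) by(simp add: kil_def)
 have ex: "EX f. rep s f" if "s:VV" for s using \<eta>(1)[OF that] by(simp add: rep_def)
 have rep0: "kil s" if "rep s 0" for s using that by(simp add: kil_def rep_def)
 obtain s1 where s1: "s1:VV" "~ kil s1" using \<eta>(3)[of 0] by(auto simp: kil_def)
 obtain f1 where f1: "rep s1 f1" using ex[OF s1(1)] by blast
 have f1n: "f1 ~= 0" using s1 f1 rep0 by blast
 consider "3 <= n" | "n = 2" | "n = 1" using n by linarith
 thus False
 proof cases
  case 1
  hence "v*f1 = 0" using HOm_negative[OF _ cross[OF v(1) kv s1(1) f1]] by simp
  thus False using v(2) f1n by simp
 next
  case 2
  have cr: "EX c. s'*f = em c" if "s':VV" "kil s'" "s:VV" "rep s f" for s' s f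
   using cross[OF that] HOm_0 2 by auto
  obtain d where d: "v*f1 = em d" using cr[OF v(1) kv s1(1) f1] by blast
  have d0: "d ~= 0" using d v(2) f1n by auto
  have x: "s1/v ~: range em"
  proof
   assume "s1/v:range em"
   then obtain c where "s1 = em c*v" using v(2) by(auto simp: field_simps)
   moreover have "em c*v*\<eta> P:Om (1 - n) P" if P: "P:cpts C" for P
    using submod_scale[OF Om_submod[OF P] _ \<eta>(2)[OF P], of "em c"] closed_range[OF P] by(auto simp: mult.assoc)
   ultimately show False using s1(2) by(simp add: kil_def)
  qed
  have Vp: "VV = pw (s1/v) v 2"
  proof
   show "pw (s1/v) v 2 <= VV"
    by(rule pw_least[OF V_subspace]) (use v s1(1) in "auto simp: less_2_cases_iff")
   show "VV <= pw (s1/v) v 2"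
   proof
    fix s assume s: "s:VV"
    obtain f where f: "rep s f" using ex[OF s] by blast
    obtain c where c: "v*f = em c" using cr[OF v(1) kv s f] by blast
    \<comment> \<open>The constants v f = c and v f1 = d show that f = (c/d) f1, so s - (c/d) s1 is killed.\<close>
    define e where "e = c/d"
    define s' where "s' = s - em e*s1"
    have s'V: "s':VV" unfolding s'_def by(rule ksub_diff[OF V_subspace s ksub_scale[OF V_subspace s1(1)]])
    have "v*f = v*(em e*f1)" using c d d0 unfolding e_def i_divide by(simp add: field_simps)
    hence fe: "f = em e*f1" using v(2) by simp
    have "s'*\<eta> P:Om (1 - n) P" if P: "P:cpts C" for P
    proof -
     have ee: "s'*\<eta> P = (s*\<eta> P - f) - em e*(s1*\<eta> P - f1)" unfolding s'_def fe by(simp add: algebra_simps)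
     show ?thesis unfolding ee
      by(rule Om_diff[OF P _ submod_scale[OF Om_submod[OF P]]]) (use f f1 P closed_range[OF P] in "auto simp: rep_def")
    qed
    hence "kil s'" by(simp add: kil_def)
    then obtain b where b: "s'*f1 = em b" using cr[OF s'V _ s1(1) f1] by blast
    have "s'*(v*f1) = em b*v" using b by(simp add: mult_ac)
    hence "s' = em (b/d)*v" unfolding d i_divide using d0 by(simp add: field_simps)
    hence se: "s = em (b/d)*(v*(s1/v)^0) + em e*(v*(s1/v)^1)" using v(2) by(simp add: s'_def algebra_simps)
    show "s:pw (s1/v) v 2" unfolding se by(intro ksub_add[OF pw_subspace] ksub_scale[OF pw_subspace] pw_base) simp_all
   qed
  qed
  have "enat gC = enat 2" unfolding gC(1)[symmetric] Vp by(rule pw_dim[OF x v(2)])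
  hence "VV = pw (s1/v) v gC" using Vp by simp
  with x v(2) have "EX x w. x ~: range em & w ~= 0 & VV = pw x w gC" by(intro exI conjI)
  thus False using nH by simp
 next
  case 3
  define \<beta> where "\<beta> P = v*\<eta> P" for P
  have O: "Om (1 - n) P = P" if "P:cpts C" for P using Om_0[OF that] 3 by simp
  have \<beta>P: "\<beta> P:P" if P: "P:cpts C" for P using \<eta>(2)[OF P] O[OF P] by(simp add: \<beta>_def)
  have T: "EX z:VV. ALL P:cpts C. s*\<beta> P - z:v ** P" if s: "s:VV" for s
  proof -
   obtain f where f: "rep s f" using ex[OF s] by blast
   have "v*f:VV" using cross[OF v(1) kv s f] 3 HOm_1 by simp
   moreover have "s*\<beta> P - v*f:v ** P" if P: "P:cpts C" for P
   proof -
    have "s*\<eta> P - f:Om (1 - n) P" using f P by(simp add: rep_def)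
    hence "s*\<eta> P - f:P" unfolding O[OF P] .
    thus ?thesis by(intro image_eqI[of _ _ "s*\<eta> P - f"]) (simp_all add: \<beta>_def algebra_simps)
   qed
   ultimately show ?thesis by blast
  qed
  obtain a s where s: "s:VV" "s ~: kl v" "!!P. P:cpts C ==> (\<beta> P - em a)*s:v ** P"
   using adele_eigenvector[OF v \<beta>P T] by blast
  have b: "\<beta> P - em a:P" if P: "P:cpts C" for P using subring_diff[OF closed_ring[OF P] \<beta>P[OF P]] closed_range[OF P] by blast
  have Tb: "EX z:VV. ALL P:cpts C. (\<beta> P - em a)*s - z:v ** P" if s: "s:VV" for s
  proof -
   obtain z where z: "z:VV" "!!P. P:cpts C ==> s*\<beta> P - z:v ** P" using T[OF s] by blast
   have e: "(\<beta> P - em a)*s - (z - em a*s) = s*\<beta> P - z" for P by(simp add: algebra_simps)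
   have "ALL P:cpts C. (\<beta> P - em a)*s - (z - em a*s):v ** P" unfolding e using z(2) by blast
   moreover have "z - em a*s:VV" by(rule ksub_diff[OF V_subspace z(1) ksub_scale[OF V_subspace s]])
   ultimately show ?thesis by(rule bexI)
  qed
  obtain s2 P2 where s2: "s2:VV" "P2:cpts C" "s2*(\<eta> P2 - em a/v) ~: P2" using \<eta>(3)[of "em a/v"] O by metis
  have "(\<beta> P2 - em a)*s2 ~: v ** P2"
  proof
   assume "(\<beta> P2 - em a)*s2:v ** P2"
   then obtain r where r: "(\<beta> P2 - em a)*s2 = v*r" "r:P2" by blast
   have "v*(s2*(\<eta> P2 - em a/v)) = (\<beta> P2 - em a)*s2" using v(2) by(simp add: \<beta>_def algebra_simps)
   hence "s2*(\<eta> P2 - em a/v) = r" using r(1) v(2) by simp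
   thus False using s2(3) r(2) by simp
  qed
  hence nk: "EX P:cpts C. (\<beta> P - em a)*s2 ~: v ** P" by(rule bexI[OF _ s2(2)])
  have "EX x w. x ~: range em & w ~= 0 & VV = pw x w gC"
   by(rule multiplication_pencil[OF v b Tb s s2(1) nk])
  thus False using nH by blast
 qed
qed

lemma gorenstein_normal: "H0 ls.CX (ls.tw n) = coord_ring_part em VV n"
proof(cases "EX x w. x ~: range em & w ~= 0 & VV = pw x w gC")
 case True
 then obtain x w where xw: "x ~: range em" "w ~= 0" "VV = pw x w gC" by blast
 have "gC = Suc (gC - 1)" using gC(3) by simp
 thus ?thesis using ls.rational_normal[OF _ xw(1,2)] xw(3) by metis
next
 case False
 have "HOm (int n) <= coord_ring_part em VV n"
 proof(induction n)
  case 0 show ?case by(simp add: HOm_0 coord_0)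
 next
  case (Suc n)
  show ?case
  proof(cases "n = 0")
   case True thus ?thesis using HOm_1 coord_1[OF V_subspace] by simp
  next
   case n: False
   have "HOm (int n + 1) <= prods (HOm (int n)) VV" by(rule noether_step[OF False]) (use n in simp)
   also have "... <= prods (coord_ring_part em VV n) VV"
    by(rule prods_least[OF prods_subspace]) (use Suc prods_base in blast)
   finally show ?thesis unfolding coord_Suc by(simp add: add.commute)
  qed
 qed
 thus ?thesis using sections_of_model ls.coord_H0 by blast
qed

end

theorem lemma5p4:
  fixes \<iota> :: "'k::alg_closed_field \<Rightarrow> 'K::field"
    and C C' :: "'K set set"
    and \<omega> :: "'K set \<Rightarrow> 'K set"
    and g g' :: enat and d' :: nat
  assumes "field_embedding \<iota>"
    and "complete_integral_curve \<iota> C"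
    and "dualizing_sheaf \<iota> C \<omega>"
    and "g = arithmetic_genus \<iota> C" and "g \<ge> 2"
    and "C' = canonical_model \<iota> C \<omega>"
    and "d' = projective_degree \<iota> (H0 C \<omega>)"
    and "g' = arithmetic_genus \<iota> C'"
  shows "(linearly_normal \<iota> C \<omega> \<longleftrightarrow> projectively_normal \<iota> C \<omega>) \<and>
    (gorenstein C \<omega> \<longrightarrow> linearly_normal \<iota> C \<omega>) \<and>
    (\<not> gorenstein C \<omega> \<longrightarrow>
       (\<forall>l\<ge>1. h1 \<iota> C' (twisting_sheaf (H0 C \<omega>) l) = 0) \<and>
       (linearly_normal \<iota> C \<omega> \<longleftrightarrow> enat d' = g + g' - 1))"
proof -
 interpret dcurve \<iota> C \<omega> by unfold_locales (use assms in auto)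
 have C': "C' = ls.CX" using assms(6) canonical_model_eq by simp
 have d': "d' = ls.deg" using assms(7) by(simp add: ls.deg_def)
 have g': "g' = enat ls.g'" using assms(8) C' ls.arithmetic_genus_CX by simp
 have g: "g = enat gC" using assms(4) gC(2) by simp
 show ?thesis
 proof(cases "gorenstein C \<omega>")
  case True
  interpret dgor \<iota> C \<omega> by unfold_locales (rule True)
  have "projectively_normal \<iota> C \<omega>" unfolding proj_normal_iff using gorenstein_normal by simp
  thus ?thesis using True proj_lin by blast
 next
  case False
  note ng = not_gorenstein[OF False]
  have "h1 \<iota> C' (twisting_sheaf VV l) = 0" if "1 <= l" for l unfolding C' by(rule ls.h1_tw_0_later[OF ng(1) that])
  moreover have "linearly_normal \<iota> C \<omega> \<longleftrightarrow> enat d' = g + g' - 1"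
   unfolding ng(2) d' g g' using gC(3) by(auto simp: one_enat_def)
  ultimately show ?thesis using False ng(3) proj_lin by blast
 qed
qed

end
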